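(* Let $X$ be a compact subset of a Riemannian manifold $M$ and $\mu$ a Borel probability measure. Let $f\in\mathrm{Diff}^1_{\mathrm{loc},\mathbb P}(X,\mu)$ be such that $\mu$ is quasi-irreducible for $f$. Then the map $$\lambda_1(\mu,\cdot):\big(\mathrm{Diff}^1_{\mathrm{loc},\mathbb P}(X,\mu),d_{C^1}\big)\to\mathbb R,\qquad g\mapsto\lambda_1(\mu,g):=\lim_{n\to\infty}\frac1n\int\log\|Dg^n_\omega(x)\|\,d\mathbb P\,d\mu$$ is continuous at $f$. Moreover, if $f\in\mathrm{Diff}^1_{\mathrm{loc},\mathbb P}(X)$ is maximal quasi-irreducible, then the map $$\lambda_1:\big(\mathrm{Diff}^1_{\mathrm{loc},\mathbb P}(X),d_{C^1}\big)\to\mathbb R,\qquad g\mapsto\lambda_1(g):=\sup\{\lambda_1(\eta,g):\eta\in\mathcal I(g)\}$$ is continuous at $f$.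
   Context: Setting. $M$ is a Riemannian manifold of dimension $m$. $(T,\mathscr A,p)$ is a probability space and $(\Omega,\mathscr F,\mathbb P)=(T^{\mathbb N},\mathscr A^{\mathbb N},p^{\mathbb N})$. A $C^1$ random map is a measurable map $f:\Omega\times M\to M$ such that $f_\omega:=f(\omega,\cdot)=f_{\omega_0}$ depends only on the coordinate $\omega_0$ of $\omega$ and is a $C^1$ local diffeomorphism for $\mathbb P$-a.e. $\omega$. Put $f^0_\omega=\mathrm{id}$, $f^n_\omega=f_{\omega_{n-1}}\circ\dots\circ f_{\omega_0}$. For compact $X\subset M$, $\|Df_\omega\|_\infty=\sup_{x\in X}\|Df_\omega(x)\|$, $\|(Df_\omega)^{-1}\|_\infty=\sup_{x\in X}\|Df_\omega(x)^{-1}\|$. $\mathrm{Diff}^1_{\mathrm{loc},\mathbb P}(X)$ is the set of $C^1$ random maps $f$ with $f_\omega(X)\subset X$ for $\mathbb P$-a.e. $\omega$ and $\int(\log^+\|Df_\omega\|_\infty+\log^+\|(Df_\omega)^{-1}\|_\infty)\,d\mathbb P<\infty$; maps are regarded as restricted to $X$. $\mathcal I(f)$ is the set of Borel probability measures $\mu$ on $X$ with $\mu=\int(f_\omega)_*\mu\,d\mathbb P$ ($f$-stationary). $\mathrm{Diff}^1_{\mathrm{loc},\mathbb P}(X,\mu)=\{f\in\mathrm{Diff}^1_{\mathrm{loc},\mathbb P}(X):\mu\in\mathcal I(f)\}$. The average $C^1$ distance (possibly infinite) is $$d_{C^1}(f,g)=\int\big(d_{C^0}(f_\omega,g_\omega)+\|Df_\omega-Dg_\omega\|_\infty+\|(Df_\omega)^{-1}-(Dg_\omega)^{-1}\|_\infty\big)\,d\mathbb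 P,$$ all suprema over $X$. To compare linear maps between different fibres one fixes a continuous fibrewise isometric embedding $\iota:T_XM\hookrightarrow X\times\mathbb R^N$, with $P_x:\mathbb R^N\to\iota_x(T_xM)$ the orthogonal projection, and sets $\|Df_\omega-Dg_\omega\|_\infty=\sup_{x\in X}\|\iota_{f_\omega(x)}Df_\omega(x)\iota_x^{-1}P_x-\iota_{g_\omega(x)}Dg_\omega(x)\iota_x^{-1}P_x\|$ and $\|(Df_\omega)^{-1}-(Dg_\omega)^{-1}\|_\infty=\sup_{x\in X}\|\iota_xDf_\omega(x)^{-1}\iota_{f_\omega(x)}^{-1}P_{f_\omega(x)}-\iota_xDg_\omega(x)^{-1}\iota_{g_\omega(x)}^{-1}P_{g_\omega(x)}\|$. Write $\lambda_1(\mu)=\lambda_1(\mu,f)$ for the top Lyapunov exponent and $\lambda_1(f)=\sup_{\eta\in\mathcal I(f)}\lambda_1(\eta,f)$. $\hat X=P(T_XM)$ is the projectivized tangent bundle over $X$ with points $(x,\hat v)$, $v\in T_xM$ unit; $\hat f_\omega(x,\hat v)=(f_\omega(x),Df_\omega(x)\hat v)$; $\mathcal I_\mu(\hat f)$ is the set of $\hat f$-stationary probability measures on $\hat X$ projecting to $\mu$; $\phi_f(x,\hat v)=\int\log\|Df_\omega(x)v\|\,d\mathbb P$. $\mu\in\mathcal I(f)$ is quasi-irreducible for $f$ if $\int\phi_f\,d\nu=\lambda_1(\mu)$ for every $\nu\in\mathcal I_\mu(\hat f)$. $f$ is maximal quasi-irreducible if every $\mu\in\mathcal I(f)$ is quasi-irreducible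 and $\lambda_1(\mu)=\lambda_1(f)$ for all $\mu\in\mathcal I(f)$. *)

theory Defs
  imports "HOL-Probability.Probability"
begin

section \<open>Smooth and Riemannian manifolds\<close>

text \<open>\<open>Ck_on k S f\<close> is meant for open \<open>S\<close>; all directional derivatives of order at most \<open>k\<close>
  exist and are continuous.\<close>

primrec Ck_on ::
  "nat \<Rightarrow> 'a::euclidean_space set \<Rightarrow> ('a \<Rightarrow> 'b::real_normed_vector) \<Rightarrow> bool" where
  "Ck_on 0 S f = continuous_on S f"
| "Ck_on (Suc k) S f = ((\<forall>y\<in>S. f differentiable (at y)) \<and>
     (\<forall>v. Ck_on k S (\<lambda>y. frechet_derivative f (at y) v)))"

definition smooth_on :: "'a::euclidean_space set \<Rightarrow> ('a \<Rightarrow> 'b::real_normed_vector) \<Rightarrow> bool" where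
  "smooth_on S f \<longleftrightarrow> (\<forall>k. Ck_on k S f)"

type_synonym ('m, 'e) chart = "'m set \<times> ('m \<Rightarrow> 'e)"

abbreviation chart_dom :: "('m, 'e) chart \<Rightarrow> 'm set" where
  "chart_dom c \<equiv> fst c"

abbreviation chart_map :: "('m, 'e) chart \<Rightarrow> 'm \<Rightarrow> 'e" where
  "chart_map c \<equiv> snd c"

definition chart_inv :: "('m, 'e) chart \<Rightarrow> 'e \<Rightarrow> 'm" where
  "chart_inv c = inv_into (chart_dom c) (chart_map c)"

definition transition_map :: "('m, 'e) chart \<Rightarrow> ('m, 'e) chart \<Rightarrow> 'e \<Rightarrow> 'e" where
  "transition_map c c' = chart_map c' \<circ> chart_inv c"

definition smooth_atlas ::
  "('m::{t2_space,second_countable_topology}, 'e::euclidean_space) chart set \<Rightarrow> bool" where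
  "smooth_atlas A \<longleftrightarrow>
     (\<Union>c\<in>A. chart_dom c) = UNIV \<and>
     (\<forall>c\<in>A. open (chart_dom c) \<and> open (chart_map c ` chart_dom c) \<and>
        homeomorphism (chart_dom c) (chart_map c ` chart_dom c) (chart_map c) (chart_inv c)) \<and>
     (\<forall>c\<in>A. \<forall>c'\<in>A.
        smooth_on (chart_map c ` (chart_dom c \<inter> chart_dom c')) (transition_map c c'))"

text \<open>A tangent vector at \<open>x\<close> is the family of its coordinate vectors in all charts of the atlas
  around \<open>x\<close>; these are related by the derivatives of the transition maps. The family is \<open>0\<close> at
  all other indices, and the vector operations are pointwise.\<close>

type_synonym ('m, 'e) tvec = "('m, 'e) chart \<Rightarrow> 'e"

text \<open>The manifold itself is the whole type \<open>'m\<close>, the dimension is \<open>DIM('e)\<close>.\<close>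

record ('m, 'e) riemannian =
  charts :: "('m, 'e) chart set"
  metric :: "'m \<Rightarrow> ('m, 'e) tvec \<Rightarrow> ('m, 'e) tvec \<Rightarrow> real"

definition charts_at :: "('m, 'e) riemannian \<Rightarrow> 'm \<Rightarrow> ('m, 'e) chart set" where
  "charts_at M x = {c \<in> charts M. x \<in> chart_dom c}"

definition some_chart_at :: "('m, 'e) riemannian \<Rightarrow> 'm \<Rightarrow> ('m, 'e) chart" where
  "some_chart_at M x = (SOME c. c \<in> charts_at M x)"

definition tangent_space ::
  "('m, 'e::euclidean_space) riemannian \<Rightarrow> 'm \<Rightarrow> ('m, 'e) tvec set" where
  "tangent_space M x = {v.
     (\<forall>c\<in>charts_at M x. \<forall>c'\<in>charts_at M x.
        v c' = frechet_derivative (transition_map c c') (at (chart_map c x)) (v c)) \<and>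
     (\<forall>c. c \<notin> charts_at M x \<longrightarrow> v c = 0)}"

text \<open>The tangent vector at \<open>x\<close> with coordinate vector \<open>a\<close> in the chart \<open>c\<close>.\<close>

definition coord_tvec ::
  "('m, 'e::euclidean_space) riemannian \<Rightarrow> ('m, 'e) chart \<Rightarrow> 'm \<Rightarrow> 'e \<Rightarrow> ('m, 'e) tvec" where
  "coord_tvec M c x a = (\<lambda>c'. if c' \<in> charts_at M x
     then frechet_derivative (transition_map c c') (at (chart_map c x)) a else 0)"

definition riemannian_manifold ::
  "('m::{t2_space,second_countable_topology}, 'e::euclidean_space) riemannian \<Rightarrow> bool" where
  "riemannian_manifold M \<longleftrightarrow>
     smooth_atlas (charts M) \<and>
     (\<forall>x. \<forall>u\<in>tangent_space M x. \<forall>v\<in>tangent_space M x. \<forall>w\<in>tangent_space M x. \<forall>r s.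
        metric M x (\<lambda>c. r *\<^sub>R u c + s *\<^sub>R v c) w = r * metric M x u w + s * metric M x v w) \<and>
     (\<forall>x. \<forall>u\<in>tangent_space M x. \<forall>v\<in>tangent_space M x. metric M x u v = metric M x v u) \<and>
     (\<forall>x. \<forall>v\<in>tangent_space M x. v \<noteq> (\<lambda>_. 0) \<longrightarrow> metric M x v v > 0) \<and>
     (\<forall>c\<in>charts M. \<forall>a b. smooth_on (chart_map c ` chart_dom c)
        (\<lambda>y. metric M (chart_inv c y)
               (coord_tvec M c (chart_inv c y) a) (coord_tvec M c (chart_inv c y) b)))"

definition tnorm :: "('m, 'e) riemannian \<Rightarrow> 'm \<Rightarrow> ('m, 'e) tvec \<Rightarrow> real" where
  "tnorm M x v = sqrt (metric M x v v)"

text \<open>Riemannian distance: infimum of the lengths of piecewise \<open>C\<^sup>1\<close> curves; it is infinite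
  between different connected components.\<close>

definition piecewise_C1_path :: "('m::topological_space, 'e::euclidean_space) riemannian \<Rightarrow>
    (real \<Rightarrow> 'm) \<Rightarrow> bool" where
  "piecewise_C1_path M \<gamma> \<longleftrightarrow> continuous_on {0..1} \<gamma> \<and>
     (\<exists>K. finite K \<and> (\<forall>c\<in>charts M.
        (chart_map c \<circ> \<gamma>) C1_differentiable_on ({0<..<1} \<inter> \<gamma> -` chart_dom c - K)))"

definition velocity :: "('m, 'e::euclidean_space) riemannian \<Rightarrow>
    (real \<Rightarrow> 'm) \<Rightarrow> real \<Rightarrow> ('m, 'e) tvec" where
  "velocity M \<gamma> t = (let c = some_chart_at M (\<gamma> t) in
     coord_tvec M c (\<gamma> t) (vector_derivative (chart_map c \<circ> \<gamma>) (at t)))"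

definition path_len :: "('m, 'e::euclidean_space) riemannian \<Rightarrow> (real \<Rightarrow> 'm) \<Rightarrow> ennreal" where
  "path_len M \<gamma> = (\<integral>\<^sup>+t\<in>{0<..<1}. ennreal (tnorm M (\<gamma> t) (velocity M \<gamma> t)) \<partial>lborel)"

definition riem_dist :: "('m::topological_space, 'e::euclidean_space) riemannian \<Rightarrow>
    'm \<Rightarrow> 'm \<Rightarrow> ennreal" where
  "riem_dist M x y = (INF \<gamma>\<in>{\<gamma>. piecewise_C1_path M \<gamma> \<and> \<gamma> 0 = x \<and> \<gamma> 1 = y}. path_len M \<gamma>)"

section \<open>Differentiable maps\<close>

definition C1_map_on :: "('m::topological_space, 'e::euclidean_space) riemannian \<Rightarrow>
    'm set \<Rightarrow> ('m \<Rightarrow> 'm) \<Rightarrow> bool" where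
  "C1_map_on M V h \<longleftrightarrow> continuous_on V h \<and>
     (\<forall>c\<in>charts M. \<forall>c'\<in>charts M.
        Ck_on 1 (chart_map c ` (chart_dom c \<inter> V \<inter> h -` chart_dom c'))
          (chart_map c' \<circ> h \<circ> chart_inv c))"

definition C1_local_diffeo :: "('m::topological_space, 'e::euclidean_space) riemannian \<Rightarrow>
    ('m \<Rightarrow> 'm) \<Rightarrow> bool" where
  "C1_local_diffeo M h \<longleftrightarrow>
     (\<forall>x. \<exists>V. open V \<and> x \<in> V \<and> open (h ` V) \<and> inj_on h V \<and>
        C1_map_on M V h \<and> C1_map_on M (h ` V) (inv_into V h))"

text \<open>By the chain rule the value does not depend on the chart chosen at \<open>x\<close>.\<close>

definition differential :: "('m, 'e::euclidean_space) riemannian \<Rightarrow>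
    ('m \<Rightarrow> 'm) \<Rightarrow> 'm \<Rightarrow> ('m, 'e) tvec \<Rightarrow> ('m, 'e) tvec" where
  "differential M h x v = (let c = some_chart_at M x in
     (\<lambda>c'. if c' \<in> charts_at M (h x)
       then frechet_derivative (chart_map c' \<circ> h \<circ> chart_inv c) (at (chart_map c x)) (v c)
       else 0))"

definition differential_inv :: "('m, 'e::euclidean_space) riemannian \<Rightarrow>
    ('m \<Rightarrow> 'm) \<Rightarrow> 'm \<Rightarrow> ('m, 'e) tvec \<Rightarrow> ('m, 'e) tvec" where
  "differential_inv M h x = inv_into (tangent_space M x) (differential M h x)"

text \<open>Operator norm of a linear map \<open>L\<close> from the tangent space at \<open>x\<close> to that at \<open>y\<close>.\<close>

definition tangent_onorm :: "('m, 'e::euclidean_space) riemannian \<Rightarrow> 'm \<Rightarrow> 'm \<Rightarrow>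
    (('m, 'e) tvec \<Rightarrow> ('m, 'e) tvec) \<Rightarrow> real" where
  "tangent_onorm M x y L = (SUP v\<in>{v \<in> tangent_space M x. tnorm M x v \<le> 1}. tnorm M y (L v))"

definition sup_norm_D :: "('m, 'e::euclidean_space) riemannian \<Rightarrow>
    'm set \<Rightarrow> ('m \<Rightarrow> 'm) \<Rightarrow> ennreal" where
  "sup_norm_D M X h = (SUP x\<in>X. ennreal (tangent_onorm M x (h x) (differential M h x)))"

definition sup_norm_Dinv :: "('m, 'e::euclidean_space) riemannian \<Rightarrow>
    'm set \<Rightarrow> ('m \<Rightarrow> 'm) \<Rightarrow> ennreal" where
  "sup_norm_Dinv M X h = (SUP x\<in>X. ennreal (tangent_onorm M (h x) x (differential_inv M h x)))"

definition log_plus :: "ennreal \<Rightarrow> ennreal" where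
  "log_plus a = (if a = \<infinity> then \<infinity> else ennreal (max 0 (ln (enn2real a))))"

section \<open>Random maps\<close>

abbreviation path_space :: "'t measure \<Rightarrow> (nat \<Rightarrow> 't) measure" where
  "path_space p \<equiv> Pi\<^sub>M UNIV (\<lambda>_::nat. p)"

definition C1_random_map ::
  "('m::topological_space, 'e::euclidean_space) riemannian \<Rightarrow> 't measure \<Rightarrow>
    ((nat \<Rightarrow> 't) \<Rightarrow> 'm \<Rightarrow> 'm) \<Rightarrow> bool" where
  "C1_random_map M p f \<longleftrightarrow>
     case_prod f \<in> measurable (path_space p \<Otimes>\<^sub>M borel) borel \<and>
     (\<forall>\<omega>\<in>space (path_space p). \<forall>\<omega>'\<in>space (path_space p). \<omega> 0 = \<omega>' 0 \<longrightarrow> f \<omega> = f \<omega>') \<and>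
     (AE \<omega> in path_space p. C1_local_diffeo M (f \<omega>))"

text \<open>Since \<open>f \<omega>\<close> depends only on \<open>\<omega> 0\<close>, the map attached to the coordinate \<open>\<omega> n\<close> is \<open>f\<close> at the
  \<open>n\<close>-fold shift of \<open>\<omega>\<close>.\<close>

primrec random_iterate :: "((nat \<Rightarrow> 't) \<Rightarrow> 'm \<Rightarrow> 'm) \<Rightarrow> nat \<Rightarrow> (nat \<Rightarrow> 't) \<Rightarrow> 'm \<Rightarrow> 'm" where
  "random_iterate f 0 \<omega> = id"
| "random_iterate f (Suc n) \<omega> = f (\<lambda>k. \<omega> (k + n)) \<circ> random_iterate f n \<omega>"

definition Diff1_loc ::
  "('m::topological_space, 'e::euclidean_space) riemannian \<Rightarrow> 't measure \<Rightarrow> 'm set \<Rightarrow>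
    ((nat \<Rightarrow> 't) \<Rightarrow> 'm \<Rightarrow> 'm) set" where
  "Diff1_loc M p X = {f. C1_random_map M p f \<and>
     (AE \<omega> in path_space p. f \<omega> ` X \<subseteq> X) \<and>
     (\<integral>\<^sup>+\<omega>. log_plus (sup_norm_D M X (f \<omega>)) + log_plus (sup_norm_Dinv M X (f \<omega>))
        \<partial>path_space p) < \<infinity>}"

definition borel_prob_on :: "'m::topological_space set \<Rightarrow> 'm measure set" where
  "borel_prob_on X = {\<mu>. prob_space \<mu> \<and> sets \<mu> = sets (restrict_space borel X)}"

definition stationary :: "'w measure \<Rightarrow> ('w \<Rightarrow> 'a \<Rightarrow> 'a) \<Rightarrow> 'a measure \<Rightarrow> bool" where
  "stationary P F \<mu> \<longleftrightarrow>
     (\<forall>A\<in>sets \<mu>. emeasure \<mu> A = (\<integral>\<^sup>+\<omega>. emeasure (distr \<mu> \<mu> (F \<omega>)) A \<partial>P))"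

definition stationary_measures ::
  "'t measure \<Rightarrow> 'm::topological_space set \<Rightarrow> ((nat \<Rightarrow> 't) \<Rightarrow> 'm \<Rightarrow> 'm) \<Rightarrow> 'm measure set" where
  "stationary_measures p X f = {\<mu> \<in> borel_prob_on X. stationary (path_space p) f \<mu>}"

definition Diff1_loc_stat ::
  "('m::topological_space, 'e::euclidean_space) riemannian \<Rightarrow> 't measure \<Rightarrow> 'm set \<Rightarrow>
    'm measure \<Rightarrow> ((nat \<Rightarrow> 't) \<Rightarrow> 'm \<Rightarrow> 'm) set" where
  "Diff1_loc_stat M p X \<mu> = {f \<in> Diff1_loc M p X. \<mu> \<in> stationary_measures p X f}"

section \<open>Average distance\<close>

definition tangent_embedding ::
  "('m::topological_space, 'e::euclidean_space) riemannian \<Rightarrow> 'm set \<Rightarrow>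
    ('m \<Rightarrow> ('m, 'e) tvec \<Rightarrow> 'r::euclidean_space) \<Rightarrow> bool" where
  "tangent_embedding M X \<iota> \<longleftrightarrow>
     (\<forall>x\<in>X. \<forall>u\<in>tangent_space M x. \<forall>v\<in>tangent_space M x. \<forall>r s.
        \<iota> x (\<lambda>c. r *\<^sub>R u c + s *\<^sub>R v c) = r *\<^sub>R \<iota> x u + s *\<^sub>R \<iota> x v) \<and>
     (\<forall>x\<in>X. \<forall>v\<in>tangent_space M x. norm (\<iota> x v) = tnorm M x v) \<and>
     (\<forall>c\<in>charts M.
        continuous_on ((chart_dom c \<inter> X) \<times> UNIV) (\<lambda>(x, a). \<iota> x (coord_tvec M c x a)))"

definition orth_proj :: "'r::euclidean_space set \<Rightarrow> 'r \<Rightarrow> 'r" where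
  "orth_proj S w = (THE q. q \<in> S \<and> (\<forall>s\<in>S. orthogonal (w - q) s))"

text \<open>The linear map \<open>L\<close> from the tangent space at \<open>x\<close> to that at \<open>y\<close>, transported to the ambient
  space: \<open>\<iota>\<^sub>y \<circ> L \<circ> \<iota>\<^sub>x\<^sup>-\<^sup>1 \<circ> P\<^sub>x\<close>.\<close>

definition ambient :: "('m, 'e::euclidean_space) riemannian \<Rightarrow>
    ('m \<Rightarrow> ('m, 'e) tvec \<Rightarrow> 'r::euclidean_space) \<Rightarrow> 'm \<Rightarrow> 'm \<Rightarrow>
    (('m, 'e) tvec \<Rightarrow> ('m, 'e) tvec) \<Rightarrow> 'r \<Rightarrow> 'r" where
  "ambient M \<iota> x y L w =
     \<iota> y (L (inv_into (tangent_space M x) (\<iota> x) (orth_proj (\<iota> x ` tangent_space M x) w)))"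

definition dC0 :: "('m::topological_space, 'e::euclidean_space) riemannian \<Rightarrow> 'm set \<Rightarrow>
    ('m \<Rightarrow> 'm) \<Rightarrow> ('m \<Rightarrow> 'm) \<Rightarrow> ennreal" where
  "dC0 M X h k = (SUP x\<in>X. riem_dist M (h x) (k x))"

definition sup_diff_D :: "('m, 'e::euclidean_space) riemannian \<Rightarrow> 'm set \<Rightarrow>
    ('m \<Rightarrow> ('m, 'e) tvec \<Rightarrow> 'r::euclidean_space) \<Rightarrow> ('m \<Rightarrow> 'm) \<Rightarrow> ('m \<Rightarrow> 'm) \<Rightarrow> ennreal" where
  "sup_diff_D M X \<iota> h k = (SUP x\<in>X. ennreal (onorm (\<lambda>w.
     ambient M \<iota> x (h x) (differential M h x) w - ambient M \<iota> x (k x) (differential M k x) w)))"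

definition sup_diff_Dinv :: "('m, 'e::euclidean_space) riemannian \<Rightarrow> 'm set \<Rightarrow>
    ('m \<Rightarrow> ('m, 'e) tvec \<Rightarrow> 'r::euclidean_space) \<Rightarrow> ('m \<Rightarrow> 'm) \<Rightarrow> ('m \<Rightarrow> 'm) \<Rightarrow> ennreal" where
  "sup_diff_Dinv M X \<iota> h k = (SUP x\<in>X. ennreal (onorm (\<lambda>w.
     ambient M \<iota> (h x) x (differential_inv M h x) w -
     ambient M \<iota> (k x) x (differential_inv M k x) w)))"

definition dC1 :: "('m::topological_space, 'e::euclidean_space) riemannian \<Rightarrow> 't measure \<Rightarrow>
    'm set \<Rightarrow> ('m \<Rightarrow> ('m, 'e) tvec \<Rightarrow> 'r::euclidean_space) \<Rightarrow>
    ((nat \<Rightarrow> 't) \<Rightarrow> 'm \<Rightarrow> 'm) \<Rightarrow> ((nat \<Rightarrow> 't) \<Rightarrow> 'm \<Rightarrow> 'm) \<Rightarrow> ennreal" where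
  "dC1 M p X \<iota> f g = (\<integral>\<^sup>+\<omega>. dC0 M X (f \<omega>) (g \<omega>) + sup_diff_D M X \<iota> (f \<omega>) (g \<omega>) +
     sup_diff_Dinv M X \<iota> (f \<omega>) (g \<omega>) \<partial>path_space p)"

text \<open>Continuity at \<open>f\<close> of a real function on \<open>S\<close> with a possibly infinite distance \<open>d\<close>.\<close>

definition continuous_at_wrt ::
  "('f \<Rightarrow> 'f \<Rightarrow> ennreal) \<Rightarrow> 'f set \<Rightarrow> ('f \<Rightarrow> real) \<Rightarrow> 'f \<Rightarrow> bool" where
  "continuous_at_wrt d S \<Phi> f \<longleftrightarrow>
     (\<forall>\<epsilon>>0. \<exists>\<delta>>0. \<forall>g\<in>S. d f g < ennreal \<delta> \<longrightarrow> \<bar>\<Phi> g - \<Phi> f\<bar> < \<epsilon>)"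

section \<open>Lyapunov exponents and quasi-irreducibility\<close>

text \<open>A random map is differentiable only for almost every \<open>\<omega>\<close>, so integrands involving its
  differential are measurable only up to a null set. As the Bochner integral of a non-measurable
  function is \<open>0\<close> by convention, these integrals are taken over the completed measure; for
  nonnegative integrals the completion makes no difference.\<close>

definition lyapunov :: "('m, 'e::euclidean_space) riemannian \<Rightarrow> 't measure \<Rightarrow>
    'm measure \<Rightarrow> ((nat \<Rightarrow> 't) \<Rightarrow> 'm \<Rightarrow> 'm) \<Rightarrow> real" where
  "lyapunov M p \<mu> g = lim (\<lambda>n. 1 / real n *
     (\<integral>x. (\<integral>\<omega>. ln (tangent_onorm M x (random_iterate g n \<omega> x)
                     (differential M (random_iterate g n \<omega>) x))
        \<partial>completion (path_space p)) \<partial>\<mu>))"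

definition top_lyapunov ::
  "('m::topological_space, 'e::euclidean_space) riemannian \<Rightarrow> 't measure \<Rightarrow>
    'm set \<Rightarrow> ((nat \<Rightarrow> 't) \<Rightarrow> 'm \<Rightarrow> 'm) \<Rightarrow> real" where
  "top_lyapunov M p X g = (SUP \<eta>\<in>stationary_measures p X g. lyapunov M p \<eta> g)"

text \<open>The projective class of a vector is the line spanned by it.\<close>

definition proj_class :: "('m, 'e::real_vector) tvec \<Rightarrow> ('m, 'e) tvec set" where
  "proj_class v = range (\<lambda>r::real. \<lambda>c. r *\<^sub>R v c)"

definition proj_bundle :: "('m, 'e::euclidean_space) riemannian \<Rightarrow> 'm set \<Rightarrow>
    ('m \<times> ('m, 'e) tvec set) set" where
  "proj_bundle M X = {(x, proj_class v) | x v. x \<in> X \<and> v \<in> tangent_space M x \<and> tnorm M x v = 1}"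

text \<open>The quotient topology: a set is open iff its preimages under all the maps
  \<open>(x, a) \<mapsto> (x, [a])\<close>, with \<open>a \<noteq> 0\<close> a coordinate vector in a chart, are.\<close>

definition proj_bundle_open :: "('m::topological_space, 'e::euclidean_space) riemannian \<Rightarrow>
    'm set \<Rightarrow> ('m \<times> ('m, 'e) tvec set) set \<Rightarrow> bool" where
  "proj_bundle_open M X W \<longleftrightarrow> W \<subseteq> proj_bundle M X \<and>
     (\<forall>c\<in>charts M. openin (top_of_set ((chart_dom c \<inter> X) \<times> (- {0})))
        {(x, a). x \<in> chart_dom c \<inter> X \<and> a \<noteq> 0 \<and> (x, proj_class (coord_tvec M c x a)) \<in> W})"

definition proj_bundle_borel :: "('m::topological_space, 'e::euclidean_space) riemannian \<Rightarrow>
    'm set \<Rightarrow> ('m \<times> ('m, 'e) tvec set) measure" where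
  "proj_bundle_borel M X = sigma (proj_bundle M X) {W. proj_bundle_open M X W}"

definition proj_map :: "('m, 'e::euclidean_space) riemannian \<Rightarrow> ('m \<Rightarrow> 'm) \<Rightarrow>
    'm \<times> ('m, 'e) tvec set \<Rightarrow> 'm \<times> ('m, 'e) tvec set" where
  "proj_map M h = (\<lambda>(x, l). (h x, differential M h x ` l))"

definition stationary_lifts ::
  "('m::topological_space, 'e::euclidean_space) riemannian \<Rightarrow> 't measure \<Rightarrow> 'm set \<Rightarrow>
    'm measure \<Rightarrow> ((nat \<Rightarrow> 't) \<Rightarrow> 'm \<Rightarrow> 'm) \<Rightarrow> ('m \<times> ('m, 'e) tvec set) measure set" where
  "stationary_lifts M p X \<mu> f = {\<nu>. prob_space \<nu> \<and> sets \<nu> = sets (proj_bundle_borel M X) \<and>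
     stationary (path_space p) (\<lambda>\<omega>. proj_map M (f \<omega>)) \<nu> \<and> distr \<nu> \<mu> fst = \<mu>}"

text \<open>The two unit vectors of a line differ by a sign, so the choice does not matter.\<close>

definition phi :: "('m, 'e::euclidean_space) riemannian \<Rightarrow> 't measure \<Rightarrow>
    ((nat \<Rightarrow> 't) \<Rightarrow> 'm \<Rightarrow> 'm) \<Rightarrow> 'm \<times> ('m, 'e) tvec set \<Rightarrow> real" where
  "phi M p f = (\<lambda>(x, l). let v = (SOME v. v \<in> l \<and> tnorm M x v = 1) in
     (\<integral>\<omega>. ln (tnorm M (f \<omega> x) (differential M (f \<omega>) x v)) \<partial>completion (path_space p)))"

definition quasi_irreducible ::
  "('m::topological_space, 'e::euclidean_space) riemannian \<Rightarrow> 't measure \<Rightarrow> 'm set \<Rightarrow>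
    ((nat \<Rightarrow> 't) \<Rightarrow> 'm \<Rightarrow> 'm) \<Rightarrow> 'm measure \<Rightarrow> bool" where
  "quasi_irreducible M p X f \<mu> \<longleftrightarrow>
     \<mu> \<in> stationary_measures p X f \<and>
     (\<forall>\<nu>\<in>stationary_lifts M p X \<mu> f. (\<integral>z. phi M p f z \<partial>\<nu>) = lyapunov M p \<mu> f)"

definition maximal_quasi_irreducible ::
  "('m::topological_space, 'e::euclidean_space) riemannian \<Rightarrow> 't measure \<Rightarrow> 'm set \<Rightarrow>
    ((nat \<Rightarrow> 't) \<Rightarrow> 'm \<Rightarrow> 'm) \<Rightarrow> bool" where
  "maximal_quasi_irreducible M p X f \<longleftrightarrow>
     (\<forall>\<mu>\<in>stationary_measures p X f.
        quasi_irreducible M p X f \<mu> \<and> lyapunov M p \<mu> f = top_lyapunov M p X f)"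

end

theory Submission imports Defs begin

text \<open>The embedding \<open>\<iota>\<close> turns the unit tangent bundle over \<open>X\<close> into a compact subset \<open>S\<close> of \<open>M \<times> \<real>\<^sup>N\<close>, on which
  \<open>f\<close> acts by random continuous maps. For a stationary \<open>\<mu>\<close> the exponent \<open>\<lambda>\<^sub>1(\<mu>, g)\<close> is the supremum of \<open>\<integral>\<phi>\<^sub>g\<close>
  over the stationary lifts of \<open>\<mu>\<close> to \<open>S\<close>. The upper bound is \<open>\<parallel>Dg v\<parallel> \<le> \<parallel>Dg\<parallel>\<close>. For the lower bound, average
  Dirac masses at many vector fields, take Cesaro limits, and use that most of these vectors detect the
  norm of a linear map up to a constant factor; this replaces subadditivity. If \<open>g\<^sub>k \<rightarrow> f\<close> in the average \<open>C\<^sup>1\<close> distance,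
  the transfer operators and the functions \<open>\<phi>\<close> converge uniformly, so weak limits of almost optimal
  stationary lifts for \<open>g\<^sub>k\<close> are stationary lifts for \<open>f\<close>, and there quasi-irreducibility fixes \<open>\<integral>\<phi>\<^sub>f\<close>.\<close>

section \<open>Probability measures on compact second countable spaces\<close>

text \<open>Measures live on the sphere bundle and not on the bundle of lines because the former is
  a compact subset of a second countable Hausdorff type; lines enter at the end, when a stationary
  measure is pushed forward so that quasi-irreducibility applies. The points carry no metric, so
  separation, measurability and weak compactness are derived from compactness and a countable base.
  The perturbation step is shaped by integrability: the moment condition controls only log
  ||(Df)^{-1}||, so a product like ||Df - Dg|| ||(Df)^{-1}|| need not be integrable. Parameters with
  ||(Df)^{-1}|| > R are therefore split off. There the estimates involve the weight 1 + ln (1 +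
  ||(Df)^{-1}||), whose tail integral is small; elsewhere the one-step distance suffices, with
  constants depending on R. The distance between the inverse derivatives keeps ||(Dg)^{-1}|| under
  control, hence the logarithm away from its singularity. The vectors averaged in the lower bound
  form a lattice box, read in piecewise chosen charts, since a continuous unit vector field need not
  exist.\<close>

lemma univ_countable_basis_seq:
  obtains B :: "nat \<Rightarrow> 'a::second_countable_topology set"
  where "\<And>i. open (B i)" "\<And>U x. open U \<Longrightarrow> x \<in> U \<Longrightarrow> \<exists>i. x \<in> B i \<and> B i \<subseteq> U"
proof -
  obtain \<B> :: "'a set set" where B: "countable \<B>" "topological_basis \<B>"
    using ex_countable_basis by blast
  \<comment> \<open>Adding the empty set makes the family visibly nonempty, as the enumeration
    \<open>from_nat_into\<close> requires, and keeps all its members open.\<close>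
  have "range (from_nat_into (insert {} \<B>)) = insert {} \<B>"
    using B by (intro range_from_nat_into) auto
  then have r: "range (from_nat_into (insert {} \<B>)) = insert {} \<B>" .
  show ?thesis
  proof
    show "open (from_nat_into (insert {} \<B>) i)" for i
      using B(2) r topological_basis_open[OF B(2)] by (metis insertE open_empty rangeI)
    fix U :: "'a set" and x assume "open U" "x \<in> U"
    then obtain b where "b \<in> \<B>" "x \<in> b" "b \<subseteq> U"
      using topological_basisE[OF B(2)] by metis
    then show "\<exists>i. x \<in> from_nat_into (insert {} \<B>) i \<and> from_nat_into (insert {} \<B>) i \<subseteq> U"
      using r by (metis UnCI image_iff insert_is_Un)
  qed
qed

text \<open>Urysohn's lemma is applied inside \<open>S\<close>: the ambient type is only Hausdorff,
  while a compact Hausdorff subspace is normal.\<close>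

lemma continuous_point_separation:
  fixes S :: "'a::t2_space set"
  assumes "compact S" "open U" "s \<in> S" "s \<in> U"
  obtains h :: "'a \<Rightarrow> real" where "continuous_on S h" "\<And>x. x \<in> S \<Longrightarrow> 0 \<le> h x \<and> h x \<le> 1"
    "h s = 1" "\<And>x. x \<in> S - U \<Longrightarrow> h x = 0"
proof -
  have "compact_space (top_of_set S)" using assms(1) by (simp add: compact_space_subtopology)
  moreover have "Hausdorff_space (top_of_set S)"
    by (intro Hausdorff_space_subtopology) (auto simp: Hausdorff_space_def disjnt_def dest!: hausdorff)
  ultimately have n: "normal_space (top_of_set S)"
    using compact_Hausdorff_or_regular_imp_normal_space by blast
  have c1: "closedin (top_of_set S) (S - U)"
    using closedin_closed_Int[of "- U" S] assms(2) by (simp add: Diff_eq closed_Compl)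
  have c2: "closedin (top_of_set S) {s}"
    using closedin_closed_Int[of "{s}" S] assms(3) by simp
  obtain f where f: "continuous_map (top_of_set S) (top_of_set {0..1::real}) f"
     "f ` (S - U) \<subseteq> {0}" "f ` {s} \<subseteq> {1}"
    using Urysohn_lemma[OF n c1 c2, of 0 1] assms by (auto simp: disjnt_def)
  show ?thesis
  proof
    show "continuous_on S f" using f(1) by (simp add: continuous_map_in_subtopology)
    show "0 \<le> f x \<and> f x \<le> 1" if "x \<in> S" for x using f(1) that
      by (auto simp: continuous_map_in_subtopology image_subset_iff Pi_iff)
  qed (use f in auto)
qed

text \<open>Replaces the distance to the complement of \<open>U\<close>, which is missing without a
  metric. By Lindelof, countably many positivity sets of Urysohn functions cover the trace of
  \<open>U\<close> on \<open>S\<close>, and the sum of these functions with geometric weights is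
  positive exactly there.\<close>

lemma cozero_open:
  fixes S :: "'a::{t2_space,second_countable_topology} set"
  assumes S: "compact S" and U: "open U"
  obtains h :: "'a \<Rightarrow> real" where "continuous_on S h" "\<And>x. x \<in> S \<Longrightarrow> 0 \<le> h x"
    "\<And>x. x \<in> S \<Longrightarrow> 0 < h x \<longleftrightarrow> x \<in> U"
proof -
  define P where "P s h \<longleftrightarrow> continuous_on S h \<and> (\<forall>x\<in>S. 0 \<le> h x \<and> h x \<le> 1) \<and> h s = 1 \<and>
    (\<forall>x\<in>S-U. h x = 0)" for s and h :: "'a \<Rightarrow> real"
  have "\<exists>h. P s h" if s: "s \<in> S \<inter> U" for s
  proof -
    obtain h :: "'a \<Rightarrow> real" where "continuous_on S h" "\<And>x. x \<in> S \<Longrightarrow> 0 \<le> h x \<and> h x \<le> 1"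
      "h s = 1" "\<And>x. x \<in> S - U \<Longrightarrow> h x = 0"
      using continuous_point_separation[OF S U, of s] s by blast
    then show ?thesis unfolding P_def by blast
  qed
  then have "\<forall>s\<in>S \<inter> U. \<exists>h. P s h" by blast
  from bchoice[OF this] obtain h where h0: "\<forall>s\<in>S \<inter> U. P s (h s)" by blast
  then have h: "\<And>s. s \<in> S \<inter> U \<Longrightarrow> continuous_on S (h s)"
     "\<And>s x. s \<in> S \<inter> U \<Longrightarrow> x \<in> S \<Longrightarrow> 0 \<le> h s x \<and> h s x \<le> 1"
     "\<And>s. s \<in> S \<inter> U \<Longrightarrow> h s s = 1" "\<And>s x. s \<in> S \<inter> U \<Longrightarrow> x \<in> S - U \<Longrightarrow> h s x = 0"
    unfolding P_def by blast+
  \<comment> \<open>Lindelof speaks of open sets of the type, so the relatively open positivity sets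
    are first written as traces.\<close>
  have "\<exists>W. open W \<and> (\<forall>x\<in>S. x \<in> W \<longleftrightarrow> h s x > 0)" if "s \<in> S \<inter> U" for s
  proof -
    have "openin (top_of_set S) (S \<inter> h s -` {0<..})"
      using h(1)[OF that] by (simp add: continuous_openin_preimage_gen)
    then show ?thesis unfolding openin_open by blast
  qed
  then have "\<forall>s\<in>S \<inter> U. \<exists>W. open W \<and> (\<forall>x\<in>S. x \<in> W \<longleftrightarrow> h s x > 0)" by blast
  from bchoice[OF this] obtain W where W: "\<And>s. s \<in> S \<inter> U \<Longrightarrow> open (W s)"
     "\<And>s x. s \<in> S \<inter> U \<Longrightarrow> x \<in> S \<Longrightarrow> x \<in> W s \<longleftrightarrow> h s x > 0"
    by blast
  obtain F where F: "F \<subseteq> W ` (S \<inter> U)" "countable F" "\<Union>F = \<Union>(W ` (S \<inter> U))"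
    using Lindelof[of "W ` (S \<inter> U)"] W(1) by blast
  show ?thesis
  proof (cases "F = {}")
    case True
    then have "S \<inter> U = {}" using F W(2) h(3) by fastforce
    then show ?thesis by (intro that[of "\<lambda>_. 0"]) auto
  next
    case False
    then have "\<exists>s. s \<in> S \<inter> U \<and> from_nat_into F i = W s" for i
      using F(1) from_nat_into[OF False, of i] by auto
    then have "\<forall>i. \<exists>s. s \<in> S \<inter> U \<and> from_nat_into F i = W s" by blast
    from choice[OF this] obtain s where s: "\<And>i. s i \<in> S \<inter> U" "\<And>i. from_nat_into F i = W (s i)"
      by blast
    define H where "H x = (\<Sum>i. (1/2)^i * h (s i) x)" for x
    have le: "norm ((1/2)^i * h (s i) x) \<le> (1/2::real)^i" if "x \<in> S" for i x
    proof -
      have "(1/2)^i * h (s i) x \<le> (1/2)^i * 1"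
        using h(2)[OF s(1) that] by (intro mult_left_mono) auto
      then show ?thesis using h(2)[OF s(1) that, of i] by (simp add: abs_mult)
    qed
    have geo: "summable (\<lambda>i. (1/2::real)^i)" by (rule summable_geometric) simp
    have sm: "summable (\<lambda>i. (1/2)^i * h (s i) x)" if "x \<in> S" for x
      using summable_comparison_test'[OF geo le[OF that]] .
    have "uniform_limit S (\<lambda>n x. \<Sum>i<n. (1/2)^i * h (s i) x) H sequentially"
      unfolding H_def by (rule Weierstrass_m_test[OF le geo])
    then have cH: "continuous_on S H"
      by (rule uniform_limit_theorem[rotated]) (auto intro!: always_eventually continuous_intros h(1)[OF s(1)])
    have nn: "0 \<le> H x" if "x \<in> S" for x unfolding H_def using sm[OF that] h(2)[OF s(1) that]
      by (intro suminf_nonneg) auto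
    have pos: "0 < H x \<longleftrightarrow> x \<in> U" if x: "x \<in> S" for x
    proof
      assume "x \<in> U"
      then have "x \<in> \<Union>F" using F(3) W(2) h(3) x by fastforce
      then obtain i where "x \<in> W (s i)"
        using from_nat_into_surj[OF F(2)] s by (metis UnionE)
      then have "h (s i) x > 0" using W(2)[OF s(1) x] by auto
      then show "0 < H x" unfolding H_def using sm[OF x] h(2)[OF s(1) x]
        by (subst suminf_pos_iff) (auto intro!: exI[of _ i])
    next
      assume "0 < H x" show "x \<in> U"
      proof (rule ccontr)
        assume "x \<notin> U" then have "\<And>i. h (s i) x = 0" using h(4)[OF s(1)] x by auto
        then have "H x = 0" unfolding H_def by simp
        then show False using \<open>0 < H x\<close> by simp
      qed
    qed
    show ?thesis by (rule that[OF cH nn pos])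
  qed
qed

lemma borel_prob_onD:
  assumes "\<mu> \<in> borel_prob_on S"
  shows "prob_space \<mu>" "sets \<mu> = sets (restrict_space borel S)" "space \<mu> = S"
  using assms sets_eq_imp_space_eq[of \<mu> "restrict_space borel S"]
  by (auto simp: borel_prob_on_def space_restrict_space)

lemma continuous_on_compact_bdd:
  fixes h :: "'a::topological_space \<Rightarrow> real"
  assumes "compact S" "continuous_on S h"
  obtains B where "0 \<le> B" "\<And>x. x \<in> S \<Longrightarrow> \<bar>h x\<bar> \<le> B"
proof -
  have "bounded (h ` S)" using assms compact_continuous_image compact_imp_bounded by blast
  then obtain B where "\<And>x. x \<in> S \<Longrightarrow> \<bar>h x\<bar> \<le> B" unfolding bounded_iff by auto
  then show ?thesis by (intro that[of "max 0 B"]) (auto simp: le_max_iff_disj)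
qed

lemma borel_prob_on_measurable:
  fixes h :: "'a::topological_space \<Rightarrow> 'b::topological_space"
  assumes "\<mu> \<in> borel_prob_on S" "continuous_on S h"
  shows "h \<in> borel_measurable \<mu>"
  using borel_measurable_continuous_on_restrict[OF assms(2)] borel_prob_onD(2)[OF assms(1)]
  by (simp cong: measurable_cong_sets)

lemma borel_prob_on_integrable:
  fixes h :: "'a::topological_space \<Rightarrow> real"
  assumes "compact S" "\<mu> \<in> borel_prob_on S" "continuous_on S h"
  shows "integrable \<mu> h"
proof -
  interpret prob_space \<mu> using borel_prob_onD[OF assms(2)] by simp
  obtain B where "\<And>x. x \<in> S \<Longrightarrow> \<bar>h x\<bar> \<le> B" using continuous_on_compact_bdd[OF assms(1,3)] by metis
  then show ?thesis using borel_prob_onD(3)[OF assms(2)] borel_prob_on_measurable[OF assms(2,3)]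
    by (intro integrable_const_bound[of _ B]) auto
qed

text \<open>With \<open>a = h x\<close> this approximates the indicator of a cozero set by bounded
  continuous functions.\<close>

lemma tendsto_min_one_cozero:
  fixes a :: real assumes "0 \<le> a"
  shows "(\<lambda>n. min 1 (real n * a)) \<longlonglongrightarrow> (if 0 < a then 1 else 0)"
proof (cases "0 < a")
  case True
  obtain N where N: "1 < real N * a" using reals_Archimedean3[OF True] by auto
  have "eventually (\<lambda>n. min 1 (real n * a) = 1) sequentially"
    using eventually_ge_at_top[of N]
  proof eventually_elim
    case (elim n)
    have "real N * a \<le> real n * a" using elim True by (intro mult_right_mono) auto
    then show ?case using N by simp
  qed
  then show ?thesis using True by (simp add: tendsto_eventually)
next
  case False then show ?thesis using assms by simp
qed

text \<open>Every relatively open set is the cozero set of a continuous \<open>h\<close>, so its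
  measure is the limit of the integrals of \<open>min 1 (n * h)\<close>. Relatively open sets are
  stable under intersection and generate the sigma-algebra.\<close>

lemma borel_prob_eqI:
  fixes S :: "'a::{t2_space,second_countable_topology} set"
  assumes S: "compact S" and \<mu>: "\<mu> \<in> borel_prob_on S" and \<nu>: "\<nu> \<in> borel_prob_on S"
    and eq: "\<And>h::'a \<Rightarrow> real. continuous_on S h \<Longrightarrow> (\<integral>x. h x \<partial>\<mu>) = (\<integral>x. h x \<partial>\<nu>)"
  shows "\<mu> = \<nu>"
proof (rule measure_eqI_generator_eq[where E="{S \<inter> U | U. open U}" and \<Omega>=S and A="\<lambda>_. S"])
  interpret m: prob_space \<mu> using borel_prob_onD[OF \<mu>] by simp
  interpret n: prob_space \<nu> using borel_prob_onD[OF \<nu>] by simp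
  have lim: "(\<lambda>n. \<integral>x. min 1 (real n * h x) \<partial>\<xi>) \<longlonglongrightarrow> measure \<xi> (S \<inter> U)"
    if \<xi>: "\<xi> \<in> borel_prob_on S" and h: "continuous_on S h" "\<And>x. x \<in> S \<Longrightarrow> 0 \<le> h x"
    "\<And>x. x \<in> S \<Longrightarrow> 0 < h x \<longleftrightarrow> x \<in> U" and U: "open U" for \<xi> and h :: "'a \<Rightarrow> real" and U
  proof -
    interpret x: prob_space \<xi> using borel_prob_onD[OF \<xi>] by simp
    have SU: "S \<inter> U \<in> sets \<xi>" using borel_prob_onD[OF \<xi>] U by (auto simp: sets_restrict_space)
    have "(\<lambda>n. \<integral>x. min 1 (real n * h x) \<partial>\<xi>) \<longlonglongrightarrow> (\<integral>x. indicator (S \<inter> U) x \<partial>\<xi>)"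
    proof (rule integral_dominated_convergence[where w="\<lambda>_. 1"])
      show "(\<lambda>x. min 1 (real n * h x)) \<in> borel_measurable \<xi>" for n
        using borel_prob_on_measurable[OF \<xi> h(1)] by measurable
      show "AE x in \<xi>. (\<lambda>n. min 1 (real n * h x)) \<longlonglongrightarrow> indicat_real (S \<inter> U) x"
      proof (rule AE_I2)
        fix x assume "x \<in> space \<xi>" then have x: "x \<in> S" using borel_prob_onD[OF \<xi>] by simp
        show "(\<lambda>n. min 1 (real n * h x)) \<longlonglongrightarrow> indicat_real (S \<inter> U) x"
          using tendsto_min_one_cozero[OF h(2)[OF x]] h(3)[OF x] x by (auto simp: indicator_def)
      qed
      show "AE x in \<xi>. norm (min 1 (real n * h x)) \<le> 1" for n
        using h(2) borel_prob_onD[OF \<xi>] by (intro AE_I2) auto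
    qed (use SU in auto)
    then show ?thesis using SU by simp
  qed
  show "emeasure \<mu> V = emeasure \<nu> V" if V: "V \<in> {S \<inter> U | U. open U}" for V
  proof -
    obtain U where U: "open U" "V = S \<inter> U" using V by blast
    obtain h :: "'a \<Rightarrow> real" where h: "continuous_on S h" "\<And>x. x \<in> S \<Longrightarrow> 0 \<le> h x"
    "\<And>x. x \<in> S \<Longrightarrow> 0 < h x \<longleftrightarrow> x \<in> U" using cozero_open[OF S U(1)] by metis
    have "(\<lambda>n. \<integral>x. min 1 (real n * h x) \<partial>\<mu>) = (\<lambda>n. \<integral>x. min 1 (real n * h x) \<partial>\<nu>)"
      by (intro ext eq continuous_intros h)
    then have "measure \<mu> V = measure \<nu> V"
      using lim[OF \<mu> h U(1)] lim[OF \<nu> h U(1)] LIMSEQ_unique U(2) by metis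
    then show ?thesis by (simp add: m.emeasure_eq_measure n.emeasure_eq_measure)
  qed
  show "Int_stable {S \<inter> U | U. open U}"
  proof (rule Int_stableI)
    fix a b assume "a \<in> {S \<inter> U | U. open U}" "b \<in> {S \<inter> U | U. open U}"
    then obtain U V where "open U" "open V" "a = S \<inter> U" "b = S \<inter> V" by auto
    then show "a \<inter> b \<in> {S \<inter> U | U. open U}" by (intro CollectI exI[of _ "U \<inter> V"]) auto
  qed
  have Sb: "sets (restrict_space borel S) = sigma_sets S {S \<inter> U | U. open U}"
  proof -
    have "sets (restrict_space borel S) = (\<inter>) S ` sigma_sets UNIV (Collect open)"
      by (simp add: sets_restrict_space borel_def)
    also have "\<dots> = sigma_sets S ((\<inter>) S ` Collect open)"
      using borel_closed[OF compact_imp_closed[OF S]]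
      by (intro sigma_sets_Int) (auto simp: borel_def)
    also have "(\<inter>) S ` Collect open = {S \<inter> U | U. open U}" by auto
    finally show ?thesis .
  qed
  show "sets \<mu> = sigma_sets S {S \<inter> U | U. open U}" "sets \<nu> = sigma_sets S {S \<inter> U | U. open U}"
    using Sb borel_prob_onD[OF \<mu>] borel_prob_onD[OF \<nu>] by auto
  have "S \<in> {S \<inter> U | U. open U}" using open_UNIV by blast
  then show "range (\<lambda>_::nat. S) \<subseteq> {S \<inter> U | U. open U}" by simp
  show "{S \<inter> U | U. open U} \<subseteq> Pow S" by blast
  show "(\<Union>i::nat. S) = S" by (intro UN_constant_eq) auto
  show "emeasure \<mu> S \<noteq> \<infinity>" for i :: nat using m.emeasure_finite[of S] by simp
qed

section \<open>Ternary codes and weak sequential compactness\<close>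

definition cantor_code :: "(nat \<Rightarrow> bool) \<Rightarrow> real" where
  "cantor_code b = (\<Sum>i. if b i then 2 / 3 ^ Suc i else 0)"

lemma cantor_code_summable: "summable (\<lambda>i. if b i then 2 / 3 ^ Suc i else (0::real))"
proof (rule summable_comparison_test')
  show "summable (\<lambda>i. 2/3 * (1/3::real)^i)" by (intro summable_mult summable_geometric) simp
  show "norm (if b n then 2 / 3 ^ Suc n else (0::real)) \<le> 2/3 * (1/3)^n" if "n \<ge> 0" for n
    by (simp add: power_divide)
qed

lemma cantor_code_unfold:
  "cantor_code b = (if b 0 then 2/3 else 0) + cantor_code (\<lambda>i. b (Suc i)) / 3"
proof -
  have "cantor_code b = (if b 0 then 2/3 else 0) + (\<Sum>i. if b (Suc i) then 2 / 3 ^ Suc (Suc i) else 0)"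
    unfolding cantor_code_def using suminf_split_head[OF cantor_code_summable[of b]] by simp
  also have "(\<Sum>i. if b (Suc i) then 2 / 3 ^ Suc (Suc i) else (0::real)) =
     (\<Sum>i. (if b (Suc i) then 2 / 3 ^ Suc i else 0) / 3)"
    by (intro suminf_cong) simp
  also have "\<dots> = cantor_code (\<lambda>i. b (Suc i)) / 3"
    unfolding cantor_code_def by (intro suminf_divide cantor_code_summable)
  finally show ?thesis .
qed

lemma cantor_code_bounds: "0 \<le> cantor_code b" "cantor_code b \<le> 1"
proof -
  show "0 \<le> cantor_code b" unfolding cantor_code_def
    by (intro suminf_nonneg cantor_code_summable) simp
  have "(\<lambda>i. 2/3 * (1/3::real)^i) sums (2/3 * (1 / (1 - 1/3)))"
    by (intro sums_mult geometric_sums) simp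
  then have s: "(\<lambda>i. 2/3 * (1/3::real)^i) sums 1" by simp
  have "cantor_code b \<le> (\<Sum>i. 2/3 * (1/3::real)^i)"
    unfolding cantor_code_def using s
    by (intro suminf_le cantor_code_summable) (auto simp: sums_iff power_divide)
  then show "cantor_code b \<le> 1" using s by (simp add: sums_iff)
qed

text \<open>This is why the code is ternary with digits 0 and 2: different first digits put the
  codes into [0, 1/3] and [2/3, 1], and removing a common first digit multiplies the distance by 3.
  With binary digits, close codes could have different digits.\<close>

lemma cantor_code_digits:
  assumes "\<bar>cantor_code b - cantor_code b'\<bar> < 1 / 3 ^ N" "i < N"
  shows "b i = b' i"
  using assms
proof (induction N arbitrary: b b' i)
  case (Suc N)
  let ?b = "\<lambda>i. b (Suc i)" and ?b' = "\<lambda>i. b' (Suc i)"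
  note u = cantor_code_unfold[of b] cantor_code_unfold[of b']
  note bd = cantor_code_bounds[of ?b] cantor_code_bounds[of ?b']
  have "(1::real) / 3 ^ Suc N \<le> 1 / 3" by (simp add: field_simps)
  then have lt: "\<bar>cantor_code b - cantor_code b'\<bar> < 1/3" using Suc.prems by linarith
  have z: "b 0 = b' 0"
  proof (rule ccontr)
    assume "b 0 \<noteq> b' 0" then show False using u bd lt by (auto split: if_splits)
  qed
  then have "\<bar>cantor_code ?b - cantor_code ?b'\<bar> / 3 < 1 / 3 ^ Suc N"
    using Suc.prems u by (auto simp: abs_if split: if_splits)
  then have "\<bar>cantor_code ?b - cantor_code ?b'\<bar> < 1 / 3 ^ N" by (simp add: field_simps)
  then show ?case using Suc.IH[of ?b ?b' "i - 1"] z Suc.prems(2) by (cases i) auto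
qed simp

text \<open>A compact second countable Hausdorff space is coded by the membership digits of its points in a
  countable base. The inverse of the code extends continuously to the closure of its image, which
  transfers weak compactness from the real line, where it is Helly's selection theorem.\<close>

lemma compact_cantor_coding:
  fixes S :: "'a::{t2_space,second_countable_topology} set"
  assumes S: "compact S"
  obtains \<sigma> :: "'a \<Rightarrow> real" and K \<pi> where "\<sigma> \<in> borel_measurable borel" "compact K"
    "\<And>s. s \<in> S \<Longrightarrow> \<sigma> s \<in> K" "continuous_on K \<pi>" "\<And>t. t \<in> K \<Longrightarrow> \<pi> t \<in> S" "\<And>s. s \<in> S \<Longrightarrow> \<pi> (\<sigma> s) = s"
proof -
  obtain B :: "nat \<Rightarrow> 'a set" where B: "\<And>i. open (B i)"
    "\<And>U x. open U \<Longrightarrow> x \<in> U \<Longrightarrow> \<exists>i. x \<in> B i \<and> B i \<subseteq> U"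
    using univ_countable_basis_seq by blast
  define \<sigma> where "\<sigma> s = cantor_code (\<lambda>i. s \<in> B i)" for s
  define K where "K = closure (\<sigma> ` S)"
  \<comment> \<open>\<open>s\<close> is the limit of the points whose codes tend to
    \<open>t\<close>. The code is not continuous, so \<open>t\<close> in the closure
    \<open>K\<close> need not itself be a code.\<close>
  define L where "L t s \<longleftrightarrow> (\<forall>U. open U \<longrightarrow> s \<in> U \<longrightarrow> (\<exists>\<delta>>0. \<forall>s'\<in>S. \<bar>\<sigma> s' - t\<bar> < \<delta> \<longrightarrow> s' \<in> U))" for t s
  have ms: "\<sigma> \<in> borel_measurable borel" unfolding \<sigma>_def cantor_code_def
    using B(1) by (intro borel_measurable_suminf measurable_If) (auto simp: pred_def)
  have near: "\<exists>s'\<in>S. \<bar>\<sigma> s' - t\<bar> < \<delta>" if "t \<in> K" "\<delta> > 0" for t \<delta>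
    using that unfolding K_def closure_approachable by (auto simp: dist_real_def)
  \<comment> \<open>Otherwise each \<open>s\<close> has a basic neighbourhood \<open>B (I s)\<close>
    missed by points with codes arbitrarily close to \<open>t\<close>. Finitely many of these sets
    cover \<open>S\<close>, and their indices are below some \<open>N\<close>. Points whose codes
    are within half of \<open>1 / 3 ^ N\<close> of \<open>t\<close> share their first
    \<open>N\<close> digits, so they lie in the same sets of the cover, although one of them lies in
    some \<open>B (I s)\<close> that another misses.\<close>
  have ex: "\<exists>s\<in>S. L t s" if t: "t \<in> K" for t
  proof (rule ccontr)
    assume "\<not> (\<exists>s\<in>S. L t s)"
    then have "\<forall>s\<in>S. \<exists>i. s \<in> B i \<and> (\<forall>\<delta>>0. \<exists>s'\<in>S. \<bar>\<sigma> s' - t\<bar> < \<delta> \<and> s' \<notin> B i)"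
    proof (intro ballI)
      fix s assume "s \<in> S"
      then have "\<not> L t s" using \<open>\<not> (\<exists>s\<in>S. L t s)\<close> by blast
      then obtain U where U: "open U" "s \<in> U" "\<And>\<delta>. \<delta> > 0 \<Longrightarrow> \<exists>s'\<in>S. \<bar>\<sigma> s' - t\<bar> < \<delta> \<and> s' \<notin> U"
        unfolding L_def by blast
      obtain i where "s \<in> B i" "B i \<subseteq> U" using B(2)[OF U(1,2)] by blast
      then show "\<exists>i. s \<in> B i \<and> (\<forall>\<delta>>0. \<exists>s'\<in>S. \<bar>\<sigma> s' - t\<bar> < \<delta> \<and> s' \<notin> B i)"
        using U(3) by blast
    qed
    from bchoice[OF this] obtain I where I: "\<And>s. s \<in> S \<Longrightarrow> s \<in> B (I s)"
      "\<And>s \<delta>. s \<in> S \<Longrightarrow> \<delta> > 0 \<Longrightarrow> \<exists>s'\<in>S. \<bar>\<sigma> s' - t\<bar> < \<delta> \<and> s' \<notin> B (I s)" by blast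
    have cov: "S \<subseteq> (\<Union>s\<in>S. B (I s))" using I(1) by blast
    obtain C where C: "C \<subseteq> S" "finite C" "S \<subseteq> (\<Union>s\<in>C. B (I s))"
      by (rule compactE_image[OF S _ cov], rule B(1), rule that)
    define N where "N = Suc (Max (insert 0 (I ` C)))"
    have IN: "I s < N" if "s \<in> C" for s
      using C(2) that unfolding N_def by (simp add: less_Suc_eq_le)
    define e :: real where "e = 1 / 3 ^ N"
    define \<delta> where "\<delta> = e / 2"
    have dp: "\<delta> > 0" unfolding \<delta>_def e_def by simp
    obtain s0 where s0: "s0 \<in> S" "\<bar>\<sigma> s0 - t\<bar> < \<delta>" using near[OF t dp] by blast
    obtain s where s: "s \<in> C" "s0 \<in> B (I s)" using C(3) s0(1) by blast
    obtain s' where s': "s' \<in> S" "\<bar>\<sigma> s' - t\<bar> < \<delta>" "s' \<notin> B (I s)" using I(2)[of s \<delta>] s(1) C(1) dp by blast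
    have "\<bar>\<sigma> s0 - \<sigma> s'\<bar> < 1 / 3 ^ N"
      using s0(2) s'(2) unfolding \<delta>_def e_def[symmetric] by linarith
    then have "(s0 \<in> B (I s)) = (s' \<in> B (I s))"
      unfolding \<sigma>_def using cantor_code_digits[where N=N and i="I s"] IN[OF s(1)] by blast
    then show False using s s' by blast
  qed
  define \<pi> where "\<pi> t = (SOME s. s \<in> S \<and> L t s)" for t
  have \<pi>: "\<pi> t \<in> S" "L t (\<pi> t)" if "t \<in> K" for t
    using someI_ex[of "\<lambda>s. s \<in> S \<and> L t s"] ex[OF that] unfolding \<pi>_def by blast+
  have \<sigma>K: "\<sigma> s \<in> K" if "s \<in> S" for s unfolding K_def
    using subsetD[OF closure_subset imageI[OF that]] .
  have inv: "\<pi> (\<sigma> s) = s" if s: "s \<in> S" for s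
  proof (rule ccontr)
    assume "\<pi> (\<sigma> s) \<noteq> s"
    from t1_space[OF this] obtain U where U: "open U" "\<pi> (\<sigma> s) \<in> U" "s \<notin> U" by blast
    then obtain \<delta> where "\<delta> > 0" "\<forall>s'\<in>S. \<bar>\<sigma> s' - \<sigma> s\<bar> < \<delta> \<longrightarrow> s' \<in> U"
      using \<pi>(2)[OF \<sigma>K[OF s]] unfolding L_def by blast
    then show False using s U(3) by fastforce
  qed
  have cont: "continuous_on K \<pi>"
    unfolding continuous_on_topological
  proof (intro ballI allI impI)
    fix t U assume t: "t \<in> K" and U: "open U" "\<pi> t \<in> U"
    \<comment> \<open>Continuity by separation: the compact set \<open>S - U\<close> is covered by
      finitely many basic sets, each disjoint from a neighbourhood of \<open>\<pi> t\<close>. If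
      \<open>\<pi> t'\<close> lay in one of them for \<open>t'\<close> close to \<open>t\<close>, a
      point with code close to \<open>t'\<close>, hence also to \<open>t\<close>, would lie in both
      disjoint sets.\<close>
    have "\<forall>s\<in>S - U. \<exists>i V. s \<in> B i \<and> open V \<and> \<pi> t \<in> V \<and> B i \<inter> V = {}"
    proof
      fix s assume "s \<in> S - U" then have ne: "s \<noteq> \<pi> t" using U by blast
      from hausdorff[OF ne] obtain W V where WV: "open W" "open V" "s \<in> W" "\<pi> t \<in> V" "W \<inter> V = {}" by blast
      obtain i where "s \<in> B i" "B i \<subseteq> W" using B(2)[OF WV(1,3)] by blast
      then show "\<exists>i V. s \<in> B i \<and> open V \<and> \<pi> t \<in> V \<and> B i \<inter> V = {}" using WV by blast
    qed
    from bchoice[OF this] obtain I where I: "\<forall>s\<in>S - U. \<exists>V. s \<in> B (I s) \<and> open V \<and> \<pi> t \<in> V \<and> B (I s) \<inter> V = {}"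
      by blast
    from bchoice[OF I] obtain V where V: "\<And>s. s \<in> S - U \<Longrightarrow> s \<in> B (I s)" "\<And>s. s \<in> S - U \<Longrightarrow> open (V s)"
      "\<And>s. s \<in> S - U \<Longrightarrow> \<pi> t \<in> V s" "\<And>s. s \<in> S - U \<Longrightarrow> B (I s) \<inter> V s = {}" by blast
    have comp: "compact (S - U)" using S U(1) by (rule compact_diff)
    have cov: "S - U \<subseteq> (\<Union>s\<in>S - U. B (I s))" using V(1) by blast
    obtain C where C: "C \<subseteq> S - U" "finite C" "S - U \<subseteq> (\<Union>s\<in>C. B (I s))"
      by (rule compactE_image[OF comp _ cov], rule B(1), rule that)
    define W where "W = (\<Inter>s\<in>C. V s)"
    have W: "open W" "\<pi> t \<in> W" unfolding W_def using C V by (auto intro!: open_INT)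
    from \<pi>(2)[OF t, unfolded L_def, rule_format, OF W]
    obtain \<delta> where \<delta>: "\<delta> > 0" "\<And>s'. s'\<in>S \<Longrightarrow> \<bar>\<sigma> s' - t\<bar> < \<delta> \<Longrightarrow> s' \<in> W"
      by auto
    have "\<pi> t' \<in> U" if t': "t' \<in> K" "t' \<in> ball t (\<delta>/2)" for t'
    proof (rule ccontr)
      assume "\<pi> t' \<notin> U"
      then obtain s where s: "s \<in> C" "\<pi> t' \<in> B (I s)" using C(3) \<pi>(1)[OF t'(1)] by blast
      from \<pi>(2)[OF t'(1), unfolded L_def, rule_format, OF B(1) s(2)]
      obtain \<delta>' where d': "\<delta>' > 0" "\<And>s'. s'\<in>S \<Longrightarrow> \<bar>\<sigma> s' - t'\<bar> < \<delta>' \<Longrightarrow> s' \<in> B (I s)"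
        by auto
      obtain s' where s': "s' \<in> S" "\<bar>\<sigma> s' - t'\<bar> < min \<delta>' (\<delta>/2)" using near[OF t'(1), of "min \<delta>' (\<delta>/2)"] d' \<delta> by auto
      have "s' \<in> B (I s)" using d'(2) s' by simp
      moreover have "\<bar>t - t'\<bar> < \<delta>/2" using t'(2) by (simp add: dist_real_def)
      then have "\<bar>\<sigma> s' - t\<bar> < \<delta>" using s'(2) by linarith
      then have "s' \<in> V s" using \<delta>(2) s' s(1) unfolding W_def by blast
      ultimately show False using V(4) s(1) C(1) by blast
    qed
    then show "\<exists>A. open A \<and> t \<in> A \<and> (\<forall>y\<in>K. y \<in> A \<longrightarrow> \<pi> y \<in> U)"
      using \<delta>(1) by (intro exI[of _ "ball t (\<delta>/2)"]) auto
  qed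
  have "bounded (\<sigma> ` S)" unfolding bounded_iff \<sigma>_def using cantor_code_bounds
    by (intro exI[of _ 1]) auto
  then have "compact K" unfolding K_def by simp
  then show ?thesis using that ms \<sigma>K cont \<pi>(1) inv by blast
qed

text \<open>The images of the measures under the code are carried by one bounded interval, hence
  tight, and Helly's theorem gives a limit on the line. That limit is carried by the compact set
  \<open>K\<close> and is brought back by the continuous inverse \<open>\<pi>\<close>.\<close>

lemma weak_seq_compact:
  fixes S :: "'a::{t2_space,second_countable_topology} set"
  assumes S: "compact S" and \<nu>: "\<And>k::nat. \<nu> k \<in> borel_prob_on S"
  obtains r \<xi> where "strict_mono (r :: nat \<Rightarrow> nat)" "\<xi> \<in> borel_prob_on S"
    "\<And>h::'a \<Rightarrow> real. continuous_on S h \<Longrightarrow> (\<lambda>k. \<integral>x. h x \<partial>\<nu> (r k)) \<longlonglongrightarrow> (\<integral>x. h x \<partial>\<xi>)"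
proof -
  obtain \<sigma> :: "'a \<Rightarrow> real" and K \<pi> where c: "\<sigma> \<in> borel_measurable borel" "compact K"
    "\<And>s. s \<in> S \<Longrightarrow> \<sigma> s \<in> K" "continuous_on K \<pi>" "\<And>t. t \<in> K \<Longrightarrow> \<pi> t \<in> S" "\<And>s. s \<in> S \<Longrightarrow> \<pi> (\<sigma> s) = s"
    by (rule compact_cantor_coding[OF S], rule that)
  have pr: "prob_space (\<nu> k)" "sets (\<nu> k) = sets (restrict_space borel S)" "space (\<nu> k) = S" for k
    using borel_prob_onD[OF \<nu>] by auto
  have S0: "S \<noteq> {}" using prob_space.not_empty[OF pr(1)[of 0]] pr(3) by simp
  then obtain s0 where s0: "s0 \<in> S" by blast
  have m\<sigma>: "\<sigma> \<in> borel_measurable (\<nu> k)" for k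
    using measurable_restrict_space1[OF c(1), of S] pr(2) by (simp cong: measurable_cong_sets)
  define \<kappa> where "\<kappa> k = distr (\<nu> k) borel \<sigma>" for k
  have rd: "real_distribution (\<kappa> k)" for k
    unfolding \<kappa>_def using prob_space.real_distribution_distr[OF pr(1) m\<sigma>] .
  interpret kp: real_distribution "\<kappa> k" for k by (rule rd)
  obtain M where M: "\<And>t. t \<in> K \<Longrightarrow> \<bar>t\<bar> \<le> M" using compact_imp_bounded[OF c(2)] unfolding bounded_iff by auto
  have one: "measure (\<kappa> k) {-\<bar>M\<bar>-1<..\<bar>M\<bar>+1} = 1" for k
  proof -
    interpret n: prob_space "\<nu> k" by (rule pr)
    have "\<sigma> -` {-\<bar>M\<bar>-1<..\<bar>M\<bar>+1} \<inter> space (\<nu> k) = space (\<nu> k)"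
      using M c(3) pr(3) by force
    then show ?thesis unfolding \<kappa>_def using n.prob_space by (subst measure_distr[OF m\<sigma>]) auto
  qed
  have "\<exists>a b. a < b \<and> (\<forall>k. measure (\<kappa> k) {a<..b} > 1 - e)" if "e > 0" for e :: real
    using one that by (intro exI[of _ "-\<bar>M\<bar>-1"] exI[of _ "\<bar>M\<bar>+1"]) auto
  then have tight: "tight \<kappa>" unfolding tight_def using rd by blast
  obtain r N where r: "strict_mono (r::nat \<Rightarrow> nat)" "real_distribution N" "weak_conv_m (\<kappa> \<circ> id \<circ> r) N"
    using tight_imp_convergent_subsubsequence[OF tight, of id] strict_mono_id by blast
  interpret N: real_distribution N by (rule r)
  have conv: "(\<lambda>k. \<integral>t. H t \<partial>\<kappa> (r k)) \<longlonglongrightarrow> (\<integral>t. H t \<partial>N)"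
    if "continuous_on UNIV H" "\<And>t. \<bar>H t\<bar> \<le> B" for H :: "real \<Rightarrow> real" and B
    using weak_conv_imp_integral_bdd_continuous_conv[of "\<kappa> \<circ> id \<circ> r" N H B] r(3) rd r(2) that
    by (auto simp: continuous_on_eq_continuous_at comp_def)
  have Kne: "K \<noteq> {}" using c(3) s0 by blast
  have Kcl: "closed K" using c(2) by (rule compact_imp_closed)
  \<comment> \<open>The truncated distance to \<open>K\<close> is bounded and continuous and has
    integral 0 for every \<open>\<kappa> k\<close>, so its integral against the limit is 0
    too.\<close>
  have AEK: "AE t in N. t \<in> K"
  proof -
    let ?H = "\<lambda>t. min 1 (infdist t K)"
    have z: "(\<integral>t. ?H t \<partial>\<kappa> k) = 0" for k
    proof -
      have "(\<integral>t. ?H t \<partial>\<kappa> k) = (\<integral>s. ?H (\<sigma> s) \<partial>\<nu> k)" unfolding \<kappa>_def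
        by (rule integral_distr[OF m\<sigma>]) (auto intro!: borel_measurable_continuous_onI continuous_intros)
      also have "\<dots> = (\<integral>s. 0 \<partial>\<nu> k)" using c(3) pr(3) by (intro Bochner_Integration.integral_cong) auto
      finally show ?thesis by simp
    qed
    have "(\<integral>t. ?H t \<partial>N) = 0"
      using conv[of ?H 1] z continuous_on_min[OF continuous_on_const continuous_on_infdist[OF continuous_on_id]]
      by (auto simp: infdist_nonneg LIMSEQ_const_iff)
    moreover have "?H \<in> borel_measurable borel"
      by (intro borel_measurable_continuous_onI continuous_on_min continuous_on_const continuous_on_infdist continuous_on_id)
    then have "integrable N ?H"
      by (intro N.integrable_const_bound[of _ 1]) (auto simp: infdist_nonneg)
    ultimately have "AE t in N. ?H t = 0"
      by (subst (asm) integral_nonneg_eq_0_iff_AE) (auto simp: infdist_nonneg)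
    then show ?thesis
    proof (rule AE_mp, intro AE_I2 impI)
      fix t assume "min 1 (infdist t K) = 0"
      then have "infdist t K = 0" by (auto simp: min_def split: if_splits)
      then show "t \<in> K" using in_closed_iff_infdist_zero[OF Kcl Kne] by blast
    qed
  qed
  \<comment> \<open>The value \<open>s0\<close> off \<open>K\<close> affects only an
    \<open>N\<close>-null set; it makes the map total and \<open>S\<close>-valued.\<close>
  define p' where "p' t = (if t \<in> K then \<pi> t else s0)" for t
  have mp: "p' \<in> N \<rightarrow>\<^sub>M restrict_space borel S"
  proof -
    have "p' \<in> borel \<rightarrow>\<^sub>M borel" unfolding p'_def
      by (rule borel_measurable_continuous_on_if[OF borel_closed[OF Kcl] c(4)]) auto
    then have "p' \<in> borel \<rightarrow>\<^sub>M restrict_space borel S"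
      using c(5) s0 by (intro measurable_restrict_space2) (auto simp: p'_def)
    then show ?thesis by (simp cong: measurable_cong_sets)
  qed
  define \<xi> where "\<xi> = distr N (restrict_space borel S) p'"
  have \<xi>: "\<xi> \<in> borel_prob_on S" unfolding borel_prob_on_def \<xi>_def
    using N.prob_space_distr[OF mp] by simp
  have "(\<lambda>k. \<integral>x. h x \<partial>\<nu> (r k)) \<longlonglongrightarrow> (\<integral>x. h x \<partial>\<xi>)" if h: "continuous_on S h" for h :: "'a \<Rightarrow> real"
  proof -
    obtain B where B: "0 \<le> B" "\<And>x. x \<in> S \<Longrightarrow> \<bar>h x\<bar> \<le> B" using continuous_on_compact_bdd[OF S h] by metis
    have hp: "continuous_on K (h \<circ> \<pi>)" using h c(4,5) by (intro continuous_on_compose continuous_on_subset[OF h]) auto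
    \<comment> \<open>Weak convergence tests functions that are bounded and continuous on the whole
      line, hence the Tietze extension with the same bound.\<close>
    obtain H where H: "continuous_on UNIV H" "\<And>t. t \<in> K \<Longrightarrow> H t = (h \<circ> \<pi>) t" "\<And>t. norm (H t) \<le> B"
      using Tietze[OF hp, of UNIV B] Kcl B c(5) by auto
    have Hm: "H \<in> borel_measurable borel" using H(1) by (rule borel_measurable_continuous_onI)
    have "(\<integral>x. h x \<partial>\<nu> k) = (\<integral>t. H t \<partial>\<kappa> k)" for k
    proof -
      have "(\<integral>t. H t \<partial>\<kappa> k) = (\<integral>s. H (\<sigma> s) \<partial>\<nu> k)" unfolding \<kappa>_def by (rule integral_distr[OF m\<sigma> Hm])
      also have "\<dots> = (\<integral>x. h x \<partial>\<nu> k)" using H(2) c(3,6) pr(3) by (intro Bochner_Integration.integral_cong) auto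
      finally show ?thesis by simp
    qed
    moreover have "(\<integral>t. H t \<partial>N) = (\<integral>x. h x \<partial>\<xi>)"
    proof -
      have "(\<integral>x. h x \<partial>\<xi>) = (\<integral>t. h (p' t) \<partial>N)" unfolding \<xi>_def
        by (rule integral_distr[OF mp]) (rule borel_measurable_continuous_on_restrict[OF h])
      also have "\<dots> = (\<integral>t. H t \<partial>N)"
      proof (rule integral_cong_AE)
        show "(\<lambda>t. h (p' t)) \<in> borel_measurable N"
          using measurable_compose[OF mp borel_measurable_continuous_on_restrict[OF h]] .
        show "H \<in> borel_measurable N" using Hm by simp
        show "AE x in N. h (p' x) = H x" using AEK by eventually_elim (simp add: p'_def H(2))
      qed
      finally show ?thesis by simp
    qed
    ultimately show ?thesis using conv[OF H(1), of B] H(3) by simp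
  qed
  then show ?thesis using that r(1) \<xi> by blast
qed

section \<open>Random continuous maps and stationary measures\<close>

lemma countable_dense_subset:
  fixes S :: "'a::second_countable_topology set"
  obtains D where "countable D" "D \<subseteq> S" "\<And>U. open U \<Longrightarrow> U \<inter> S \<noteq> {} \<Longrightarrow> U \<inter> D \<noteq> {}"
proof -
  obtain B :: "nat \<Rightarrow> 'a set" where B: "\<And>i. open (B i)"
    "\<And>U x. open U \<Longrightarrow> x \<in> U \<Longrightarrow> \<exists>i. x \<in> B i \<and> B i \<subseteq> U"
    using univ_countable_basis_seq by blast
  define d where "d i = (SOME x. x \<in> B i \<inter> S)" for i
  have d: "d i \<in> B i \<inter> S" if "B i \<inter> S \<noteq> {}" for i
  proof -
    have "\<exists>x. x \<in> B i \<inter> S" using that by blast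
    from someI_ex[OF this] show ?thesis unfolding d_def .
  qed
  show ?thesis
  proof
    show "countable (d ` {i. B i \<inter> S \<noteq> {}})" by simp
    show "d ` {i. B i \<inter> S \<noteq> {}} \<subseteq> S" using d by blast
    fix U :: "'a set" assume U: "open U" "U \<inter> S \<noteq> {}"
    then obtain x where x: "x \<in> U" "x \<in> S" by blast
    obtain i where "x \<in> B i" "B i \<subseteq> U" using B(2)[OF U(1) x(1)] by blast
    then show "U \<inter> d ` {i. B i \<inter> S \<noteq> {}} \<noteq> {}" using d[of i] x by blast
  qed
qed

text \<open>By continuity in \<open>s\<close>, \<open>u t s > y\<close> holds iff for some rational
  \<open>r > y\<close> and some basic set around \<open>s\<close> all values of \<open>u t\<close>
  on a countable dense subset there are at least \<open>r\<close>. The superlevel set is thus a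
  countable union of measurable rectangles.\<close>

lemma caratheodory_measurable:
  fixes S :: "'a::second_countable_topology set" and u :: "'t \<Rightarrow> 'a \<Rightarrow> real"
  assumes c: "\<And>t. t \<in> space p \<Longrightarrow> continuous_on S (u t)"
    and m: "\<And>s. s \<in> S \<Longrightarrow> (\<lambda>t. u t s) \<in> borel_measurable p"
  shows "(\<lambda>(t, s). u t s) \<in> borel_measurable (p \<Otimes>\<^sub>M restrict_space borel S)"
proof (rule borel_measurableI_greater)
  fix y :: real
  obtain B :: "nat \<Rightarrow> 'a set" where B: "\<And>i. open (B i)"
    "\<And>U x. open U \<Longrightarrow> x \<in> U \<Longrightarrow> \<exists>i. x \<in> B i \<and> B i \<subseteq> U"
    using univ_countable_basis_seq by blast
  obtain D where D: "countable D" "D \<subseteq> S" "\<And>U. open U \<Longrightarrow> U \<inter> S \<noteq> {} \<Longrightarrow> U \<inter> D \<noteq> {}"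
    by (rule countable_dense_subset[of S], rule that)
  define E where "E r i = {t \<in> space p. \<forall>d\<in>D \<inter> B i. r \<le> u t d} \<times> (S \<inter> B i)" for r i
  have Em: "E r i \<in> sets (p \<Otimes>\<^sub>M restrict_space borel S)" for r i
  proof -
    have "{t \<in> space p. \<forall>d\<in>D \<inter> B i. r \<le> u t d} \<in> sets p"
    proof -
      have "{t \<in> space p. \<forall>d\<in>D \<inter> B i. r \<le> u t d} = space p - (\<Union>d\<in>D \<inter> B i. {t \<in> space p. u t d < r})"
        unfolding not_le[symmetric] by blast
      moreover have "(\<Union>d\<in>D \<inter> B i. {t \<in> space p. u t d < r}) \<in> sets p"
      proof (rule sets.countable_UN'')
        show "countable (D \<inter> B i)" using D(1) by (rule countable_subset[rotated]) simp
        fix d assume "d \<in> D \<inter> B i"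
        then have [measurable]: "(\<lambda>t. u t d) \<in> borel_measurable p" using m D(2) by blast
        show "{t \<in> space p. u t d < r} \<in> sets p" by measurable
      qed
      ultimately show ?thesis by simp
    qed
    moreover have "S \<inter> B i \<in> sets (restrict_space borel S)"
      using B(1) by (auto simp: sets_restrict_space)
    ultimately show ?thesis unfolding E_def by (rule pair_measureI)
  qed
  have eq: "{x \<in> space (p \<Otimes>\<^sub>M restrict_space borel S). y < (case x of (t, s) \<Rightarrow> u t s)} = (\<Union>r\<in>{r\<in>\<rat>. y < r}. \<Union>i. E r i)"
  proof (intro equalityI subsetI)
    fix x assume "x \<in> {x \<in> space (p \<Otimes>\<^sub>M restrict_space borel S). y < (case x of (t, s) \<Rightarrow> u t s)}"
    then obtain t s where x: "x = (t, s)" "t \<in> space p" "s \<in> S" "y < u t s"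
      by (auto simp: space_pair_measure space_restrict_space)
    obtain r where r: "r \<in> \<rat>" "y < r" "r < u t s" using Rats_dense_in_real[OF x(4)] by blast
    have "\<exists>A. open A \<and> s \<in> A \<and> (\<forall>y\<in>S. y \<in> A \<longrightarrow> u t y \<in> {r<..})"
      using c[OF x(2), unfolded continuous_on_topological, rule_format, OF x(3), of "{r<..}"] r(3) by simp
    then obtain A where A: "open A" "s \<in> A" "\<And>y. y \<in> S \<Longrightarrow> y \<in> A \<Longrightarrow> r < u t y" by auto
    obtain i where i: "s \<in> B i" "B i \<subseteq> A" using B(2)[OF A(1,2)] by blast
    have "\<And>d. d \<in> D \<inter> B i \<Longrightarrow> r \<le> u t d" using A(3) i D(2) by (meson IntE less_imp_le subsetD)
    then have "x \<in> E r i" unfolding E_def using x i by simp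
    then show "x \<in> (\<Union>r\<in>{r\<in>\<rat>. y < r}. \<Union>i. E r i)" using r(1,2) by blast
  next
    fix x assume "x \<in> (\<Union>r\<in>{r\<in>\<rat>. y < r}. \<Union>i. E r i)"
    then obtain r i where r: "r \<in> \<rat>" "y < r" "x \<in> E r i" by blast
    then obtain t s where x: "x = (t, s)" "t \<in> space p" "s \<in> S" "s \<in> B i" "\<And>d. d \<in> D \<inter> B i \<Longrightarrow> r \<le> u t d"
      unfolding E_def by blast
    have "r \<le> u t s"
    proof (rule ccontr)
      assume "\<not> r \<le> u t s"
      then have "\<exists>A. open A \<and> s \<in> A \<and> (\<forall>y\<in>S. y \<in> A \<longrightarrow> u t y \<in> {..<r})"
        using c[OF x(2), unfolded continuous_on_topological, rule_format, OF x(3), of "{..<r}"] by simp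
      then obtain A where A: "open A" "s \<in> A" "\<And>y. y \<in> S \<Longrightarrow> y \<in> A \<Longrightarrow> u t y < r" by auto
      have "A \<inter> B i \<inter> D \<noteq> {}" using D(3)[of "A \<inter> B i"] A(1,2) B(1) x(3,4) by blast
      then obtain d where "d \<in> D \<inter> B i" "d \<in> A" by blast
      then show False using x(5) A(3) D(2) by (metis IntD1 linorder_not_less subsetD)
    qed
    then show "x \<in> {x \<in> space (p \<Otimes>\<^sub>M restrict_space borel S). y < (case x of (t, s) \<Rightarrow> u t s)}"
      using x r by (simp add: space_pair_measure space_restrict_space)
  qed
  have "countable {r \<in> \<rat>. y < r}" using countable_rat by (rule countable_subset[rotated]) auto
  then show "{x \<in> space (p \<Otimes>\<^sub>M restrict_space borel S). y < (case x of (t, s) \<Rightarrow> u t s)} \<in> sets (p \<Otimes>\<^sub>M restrict_space borel S)"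
    unfolding eq using Em by (intro sets.countable_UN' sets.countable_UN) auto
qed

text \<open>Reduction to real functions: an open set of the compact target is the cozero set of a
  continuous \<open>h\<close>, and \<open>h\<close> composed with \<open>F\<close> is of
  Caratheodory type.\<close>

lemma caratheodory_measurable_map:
  fixes S :: "'a::second_countable_topology set" and R :: "'b::{t2_space,second_countable_topology} set"
  assumes R: "compact R"
    and i: "\<And>t s. t \<in> space p \<Longrightarrow> s \<in> S \<Longrightarrow> F t s \<in> R"
    and c: "\<And>t. t \<in> space p \<Longrightarrow> continuous_on S (F t)"
    and m: "\<And>s. s \<in> S \<Longrightarrow> (\<lambda>t. F t s) \<in> borel_measurable p"
  shows "(\<lambda>(t, s). F t s) \<in> p \<Otimes>\<^sub>M restrict_space borel S \<rightarrow>\<^sub>M restrict_space borel R"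
proof (rule measurable_restrict_space2)
  let ?P = "p \<Otimes>\<^sub>M restrict_space borel S"
  have sp: "space ?P = space p \<times> S" by (simp add: space_pair_measure space_restrict_space)
  show "(\<lambda>(t, s). F t s) \<in> space ?P \<rightarrow> R" using i sp by auto
  show "(\<lambda>(t, s). F t s) \<in> borel_measurable ?P"
  proof (rule borel_measurableI)
    fix U :: "'b set" assume U: "open U"
    obtain h :: "'b \<Rightarrow> real" where h: "continuous_on R h" "\<And>x. x \<in> R \<Longrightarrow> 0 \<le> h x"
      "\<And>x. x \<in> R \<Longrightarrow> 0 < h x \<longleftrightarrow> x \<in> U" by (rule cozero_open[OF R U], rule that)
    have "(\<lambda>(t, s). h (F t s)) \<in> borel_measurable ?P"
    proof (rule caratheodory_measurable)
      fix t assume t: "t \<in> space p"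
      show "continuous_on S (\<lambda>s. h (F t s))"
        by (rule continuous_on_compose2[OF h(1) c[OF t]]) (use i t in auto)
    next
      fix s assume s: "s \<in> S"
      have "(\<lambda>t. F t s) \<in> p \<rightarrow>\<^sub>M restrict_space borel R"
        using m[OF s] i s by (intro measurable_restrict_space2) auto
      then show "(\<lambda>t. h (F t s)) \<in> borel_measurable p"
        using measurable_compose borel_measurable_continuous_on_restrict[OF h(1)] by blast
    qed
    then have "{x \<in> space ?P. 0 < (case x of (t, s) \<Rightarrow> h (F t s))} \<in> sets ?P" by measurable
    also have "{x \<in> space ?P. 0 < (case x of (t, s) \<Rightarrow> h (F t s))} = (\<lambda>(t, s). F t s) -` U \<inter> space ?P"
      using h(3) i sp by auto
    finally show "(\<lambda>(t, s). F t s) -` U \<inter> space ?P \<in> sets ?P" .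
  qed
qed

text \<open>Dominated convergence along sequences, which detect continuity on a first countable
  space.\<close>

lemma continuous_on_parametric_integral:
  fixes S :: "'a::{t2_space,first_countable_topology} set" and u :: "'t \<Rightarrow> 'a \<Rightarrow> real"
  assumes c: "\<And>t. t \<in> space p \<Longrightarrow> continuous_on S (u t)"
    and m: "\<And>s. s \<in> S \<Longrightarrow> (\<lambda>t. u t s) \<in> borel_measurable p"
    and b: "integrable p b" "\<And>t s. t \<in> space p \<Longrightarrow> s \<in> S \<Longrightarrow> \<bar>u t s\<bar> \<le> b t"
  shows "continuous_on S (\<lambda>s. \<integral>t. u t s \<partial>p)"
proof (rule continuous_on_sequentiallyI)
  fix s :: "nat \<Rightarrow> 'a" and a assume s: "\<forall>n. s n \<in> S" "a \<in> S" "s \<longlonglongrightarrow> a"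
  show "(\<lambda>n. \<integral>t. u t (s n) \<partial>p) \<longlonglongrightarrow> (\<integral>t. u t a \<partial>p)"
  proof (rule integral_dominated_convergence[where w=b])
    show "AE t in p. (\<lambda>n. u t (s n)) \<longlonglongrightarrow> u t a"
    proof (rule AE_I2)
      fix t assume "t \<in> space p"
      then show "(\<lambda>n. u t (s n)) \<longlonglongrightarrow> u t a"
        using c[unfolded continuous_on_sequentially, rule_format, of t a s] s by (simp add: comp_def)
    qed
  qed (use s m b in auto)
qed

section \<open>Orbits, the Markov operator and stationary measures\<close>

primrec orbit :: "('t \<Rightarrow> 'a \<Rightarrow> 'a) \<Rightarrow> nat \<Rightarrow> (nat \<Rightarrow> 't) \<Rightarrow> 'a \<Rightarrow> 'a" where
  "orbit F 0 \<omega> s = s"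
| "orbit F (Suc n) \<omega> s = F (\<omega> n) (orbit F n \<omega> s)"

text \<open>The recursion of \<open>orbit\<close> splits off the last step; this form splits off the
  first one, which matches the decomposition of path space in
  \<open>integral_path_split\<close>.\<close>

lemma orbit_case_nat: "orbit F (Suc n) (case_nat t \<omega>) s = orbit F n \<omega> (F t s)"
  by (induction n) auto

definition birkhoff_sum :: "('t \<Rightarrow> 'a \<Rightarrow> 'a) \<Rightarrow> ('t \<Rightarrow> 'a \<Rightarrow> real) \<Rightarrow> nat \<Rightarrow> (nat \<Rightarrow> 't) \<Rightarrow> 'a \<Rightarrow> real" where
  "birkhoff_sum F l n \<omega> s = (\<Sum>j<n. l (\<omega> j) (orbit F j \<omega> s))"

text \<open>The Markov operator on functions, dual to the averaged pushforward of measures.\<close>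

definition transfer_op :: "'t measure \<Rightarrow> ('t \<Rightarrow> 'a \<Rightarrow> 'a) \<Rightarrow> ('a \<Rightarrow> real) \<Rightarrow> 'a \<Rightarrow> real" where
  "transfer_op p F h s = (\<integral>t. h (F t s) \<partial>p)"

text \<open>Stationarity tested on continuous functions, the form that passes to weak limits;
  \<open>stationary_iff_emeasure\<close> identifies it with the form on sets.\<close>

definition fun_stationary :: "'t measure \<Rightarrow> 'a::topological_space set \<Rightarrow> ('t \<Rightarrow> 'a \<Rightarrow> 'a) \<Rightarrow> 'a measure \<Rightarrow> bool" where
  "fun_stationary p S F \<nu> \<longleftrightarrow> \<nu> \<in> borel_prob_on S \<and>
     (\<forall>h. continuous_on S h \<longrightarrow> (\<integral>s. transfer_op p F h s \<partial>\<nu>) = (\<integral>s. h s \<partial>\<nu>))"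

text \<open>The measure is the law of \<open>Z i x\<close> for \<open>i\<close> uniform in
  \<open>I\<close> and \<open>x\<close> independent with law \<open>N\<close>. It serves both for
  averages over time and for averages over several vector fields.\<close>

lemma average_of_images:
  fixes S :: "'a::topological_space set"
  assumes "prob_space N" "finite I" "I \<noteq> {}" "compact S"
    and Z: "\<And>i. i \<in> I \<Longrightarrow> Z i \<in> N \<rightarrow>\<^sub>M restrict_space borel S"
  obtains \<nu> where "\<nu> \<in> borel_prob_on S"
    "\<And>h::'a \<Rightarrow> real. continuous_on S h \<Longrightarrow> (\<integral>s. h s \<partial>\<nu>) = (\<Sum>i\<in>I. \<integral>x. h (Z i x) \<partial>N) / card I"
proof -
  interpret N: prob_space N by fact
  obtain i0 where i0: "i0 \<in> I" using assms(3) by blast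
  define q where "q = measure_pmf (pmf_of_set I)"
  \<comment> \<open>Indices outside \<open>I\<close> have probability 0; sending them to
    \<open>i0\<close> makes \<open>Y\<close> measurable on the full index type.\<close>
  define Y where "Y = (\<lambda>(i, x). Z (if i \<in> I then i else i0) x)"
  interpret q: prob_space q unfolding q_def by (rule prob_space_measure_pmf)
  interpret pair_prob_space q N by unfold_locales
  have "Y \<in> count_space UNIV \<Otimes>\<^sub>M N \<rightarrow>\<^sub>M restrict_space borel S"
  proof -
    have "(\<lambda>w. Z (if fst w \<in> I then fst w else i0) (snd w)) \<in> count_space UNIV \<Otimes>\<^sub>M N \<rightarrow>\<^sub>M restrict_space borel S"
    proof (rule measurable_compose_countable'[where I=I and g="\<lambda>w. if fst w \<in> I then fst w else i0" and f="\<lambda>i w. Z i (snd w)"])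
      show "countable I" using assms(2) by (rule countable_finite)
      show "(\<lambda>w. if fst w \<in> I then fst w else i0) \<in> count_space UNIV \<Otimes>\<^sub>M N \<rightarrow>\<^sub>M count_space I"
        using i0 by (intro measurable_compose[OF measurable_fst]) auto
      show "\<And>i. i \<in> I \<Longrightarrow> (\<lambda>w. Z i (snd w)) \<in> count_space UNIV \<Otimes>\<^sub>M N \<rightarrow>\<^sub>M restrict_space borel S"
        using measurable_compose[OF measurable_snd Z] .
    qed
    then show ?thesis unfolding Y_def by (simp add: case_prod_beta)
  qed
  moreover have "sets (q \<Otimes>\<^sub>M N) = sets (count_space UNIV \<Otimes>\<^sub>M N)"
    unfolding q_def by (intro sets_pair_measure_cong) auto
  ultimately have Y: "Y \<in> q \<Otimes>\<^sub>M N \<rightarrow>\<^sub>M restrict_space borel S"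
    by (simp cong: measurable_cong_sets)
  define \<nu> where "\<nu> = distr (q \<Otimes>\<^sub>M N) (restrict_space borel S) Y"
  have b: "\<nu> \<in> borel_prob_on S" unfolding borel_prob_on_def \<nu>_def using prob_space_distr[OF Y] by simp
  have "(\<integral>s. h s \<partial>\<nu>) = (\<Sum>i\<in>I. \<integral>x. h (Z i x) \<partial>N) / card I" if h: "continuous_on S h" for h :: "'a \<Rightarrow> real"
  proof -
    have hm: "h \<in> borel_measurable (restrict_space borel S)" using borel_measurable_continuous_on_restrict[OF h] .
    obtain B where B: "\<And>s. s \<in> S \<Longrightarrow> \<bar>h s\<bar> \<le> B" using continuous_on_compact_bdd[OF assms(4) h] by metis
    have YS: "Y w \<in> S" if "w \<in> space (q \<Otimes>\<^sub>M N)" for w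
      using measurable_space[OF Y that] by (simp add: space_restrict_space)
    have int: "integrable (q \<Otimes>\<^sub>M N) (\<lambda>w. h (Y w))"
      using measurable_compose[OF Y hm] B YS by (intro P.integrable_const_bound[of _ B]) auto
    have "(\<integral>s. h s \<partial>\<nu>) = (\<integral>w. h (Y w) \<partial>(q \<Otimes>\<^sub>M N))"
      unfolding \<nu>_def by (rule integral_distr[OF Y hm])
    also have "\<dots> = (\<integral>i. (\<integral>x. h (Y (i, x)) \<partial>N) \<partial>q)" using integral_fst'[OF int] by simp
    also have "\<dots> = (\<Sum>i\<in>I. \<integral>x. h (Y (i, x)) \<partial>N) / card I" unfolding q_def using assms by (simp add: integral_pmf_of_set)
    also have "(\<Sum>i\<in>I. \<integral>x. h (Y (i, x)) \<partial>N) = (\<Sum>i\<in>I. \<integral>x. h (Z i x) \<partial>N)" by (rule sum.cong) (auto simp: Y_def)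
    finally show ?thesis .
  qed
  then show ?thesis using that b by blast
qed

text \<open>Integrands and measures vary together: uniform convergence handles the integrands for
  probability measures of any kind, the assumed limit for the fixed \<open>v\<close> handles the
  measures.\<close>

lemma integral_uniform_limit:
  fixes S :: "'a::topological_space set" and u :: "nat \<Rightarrow> 'a \<Rightarrow> real"
  assumes S: "compact S" and \<nu>: "\<And>k. \<nu> k \<in> borel_prob_on S"
    and c: "\<And>k. continuous_on S (u k)" "continuous_on S v"
    and e: "\<And>e. e > 0 \<Longrightarrow> eventually (\<lambda>k. \<forall>s\<in>S. \<bar>u k s - v s\<bar> \<le> e) sequentially"
    and l: "(\<lambda>k. \<integral>s. v s \<partial>\<nu> k) \<longlonglongrightarrow> a"
  shows "(\<lambda>k. \<integral>s. u k s \<partial>\<nu> k) \<longlonglongrightarrow> a"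
proof -
  have "(\<lambda>k. (\<integral>s. u k s \<partial>\<nu> k) - (\<integral>s. v s \<partial>\<nu> k)) \<longlonglongrightarrow> 0"
  proof (rule LIMSEQ_I)
    fix r :: real assume r: "0 < r"
    have "eventually (\<lambda>k. norm ((\<integral>s. u k s \<partial>\<nu> k) - (\<integral>s. v s \<partial>\<nu> k) - 0) < r) sequentially"
    proof (rule eventually_mono[OF e[of "r/2"]])
      show "0 < r/2" using r by simp
      fix k assume k: "\<forall>s\<in>S. \<bar>u k s - v s\<bar> \<le> r / 2"
      interpret n: prob_space "\<nu> k" using borel_prob_onD(1)[OF \<nu>] .
      have i: "integrable (\<nu> k) (u k)" "integrable (\<nu> k) v" using borel_prob_on_integrable[OF S \<nu>] c by auto
      have "\<bar>(\<integral>s. u k s \<partial>\<nu> k) - (\<integral>s. v s \<partial>\<nu> k)\<bar> = \<bar>\<integral>s. u k s - v s \<partial>\<nu> k\<bar>" using i by simp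
      also have "\<dots> \<le> (\<integral>s. \<bar>u k s - v s\<bar> \<partial>\<nu> k)" by (rule integral_abs_bound)
      also have "\<dots> \<le> (\<integral>s. r/2 \<partial>\<nu> k)" using i k borel_prob_onD(3)[OF \<nu>] by (intro integral_mono) auto
      also have "\<dots> < r" using r by (simp add: n.prob_space)
      finally show "norm ((\<integral>s. u k s \<partial>\<nu> k) - (\<integral>s. v s \<partial>\<nu> k) - 0) < r" by simp
    qed
    then show "\<exists>no. \<forall>n\<ge>no. norm ((\<integral>s. u n s \<partial>\<nu> n) - (\<integral>s. v s \<partial>\<nu> n) - 0) < r"
      unfolding eventually_sequentially .
  qed
  from tendsto_add[OF this l] show ?thesis by simp
qed

text \<open>Stationarity is closed under perturbation: in the identity for \<open>F' k\<close> and
  \<open>\<nu> k\<close> both sides converge along a weakly convergent subsequence, the left one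
  because the operators converge uniformly on continuous functions.\<close>

lemma fun_stationary_limit:
  fixes S :: "'a::{t2_space,second_countable_topology} set"
  assumes S: "compact S" and st: "\<And>k. fun_stationary p S (F' k) (\<nu> k)"
    and c: "\<And>k h. continuous_on S h \<Longrightarrow> continuous_on S (transfer_op p (F' k) h)"
      "\<And>h. continuous_on S h \<Longrightarrow> continuous_on S (transfer_op p F h)"
    and u: "\<And>h e. continuous_on S h \<Longrightarrow> e > 0 \<Longrightarrow>
       eventually (\<lambda>k. \<forall>s\<in>S. \<bar>transfer_op p (F' k) h s - transfer_op p F h s\<bar> \<le> e) sequentially"
  obtains r \<xi> where "strict_mono (r::nat \<Rightarrow> nat)" "fun_stationary p S F \<xi>"
    "\<And>h::'a \<Rightarrow> real. continuous_on S h \<Longrightarrow> (\<lambda>k. \<integral>x. h x \<partial>\<nu> (r k)) \<longlonglongrightarrow> (\<integral>x. h x \<partial>\<xi>)"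
proof -
  have \<nu>: "\<nu> k \<in> borel_prob_on S" for k using st unfolding fun_stationary_def by blast
  obtain r \<xi> where r: "strict_mono (r :: nat \<Rightarrow> nat)" "\<xi> \<in> borel_prob_on S"
    "\<And>h::'a \<Rightarrow> real. continuous_on S h \<Longrightarrow> (\<lambda>k. \<integral>x. h x \<partial>\<nu> (r k)) \<longlonglongrightarrow> (\<integral>x. h x \<partial>\<xi>)"
    by (rule weak_seq_compact[OF S \<nu>], rule that)
  have "(\<integral>s. transfer_op p F h s \<partial>\<xi>) = (\<integral>s. h s \<partial>\<xi>)" if h: "continuous_on S h" for h
  proof -
    have "(\<lambda>k. \<integral>s. transfer_op p (F' (r k)) h s \<partial>\<nu> (r k)) \<longlonglongrightarrow> (\<integral>s. transfer_op p F h s \<partial>\<xi>)"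
    proof (rule integral_uniform_limit[OF S \<nu> c(1)[OF h] c(2)[OF h] _ r(3)[OF c(2)[OF h]]])
      fix e :: real assume "e > 0"
      from u[OF h this] show "eventually (\<lambda>k. \<forall>s\<in>S. \<bar>transfer_op p (F' (r k)) h s - transfer_op p F h s\<bar> \<le> e) sequentially"
        by (rule eventually_subseq[OF r(1)])
    qed
    moreover have "(\<lambda>k. \<integral>s. transfer_op p (F' (r k)) h s \<partial>\<nu> (r k)) = (\<lambda>k. \<integral>s. h s \<partial>\<nu> (r k))"
      using st h unfolding fun_stationary_def by auto
    ultimately show ?thesis using r(3)[OF h] LIMSEQ_unique by metis
  qed
  then have "fun_stationary p S F \<xi>" unfolding fun_stationary_def using r(2) by blast
  then show ?thesis using that r by blast
qed

text \<open>All conditions are imposed for every parameter, not almost every one; instances arrange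
  this by altering their maps on a null set. \<open>l\<close> plays the logarithmic expansion of one
  step and \<open>b\<close> an integrable bound for it. With \<open>l = 0\<close> the locale also
  describes the base dynamics.\<close>

locale random_cocycle = prob_space p for p :: "'t measure" +
  fixes S :: "'a::{t2_space,second_countable_topology} set"
    and F :: "'t \<Rightarrow> 'a \<Rightarrow> 'a" and l :: "'t \<Rightarrow> 'a \<Rightarrow> real" and b :: "'t \<Rightarrow> real"
  assumes compact_S: "compact S"
    and F_in: "\<And>t s. t \<in> space p \<Longrightarrow> s \<in> S \<Longrightarrow> F t s \<in> S"
    and F_cont: "\<And>t. t \<in> space p \<Longrightarrow> continuous_on S (F t)"
    and F_meas: "\<And>s. s \<in> S \<Longrightarrow> (\<lambda>t. F t s) \<in> borel_measurable p"
    and l_cont: "\<And>t. t \<in> space p \<Longrightarrow> continuous_on S (l t)"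
    and l_meas: "\<And>s. s \<in> S \<Longrightarrow> (\<lambda>t. l t s) \<in> borel_measurable p"
    and b_int: "integrable p b"
    and l_bound: "\<And>t s. t \<in> space p \<Longrightarrow> s \<in> S \<Longrightarrow> \<bar>l t s\<bar> \<le> b t"
begin

abbreviation "RS \<equiv> restrict_space borel S"

sublocale seq: sequence_space p by unfold_locales

abbreviation "Top \<equiv> transfer_op p F"

definition mean_log :: "'a \<Rightarrow> real" where "mean_log s = (\<integral>t. l t s \<partial>p)"

lemma F_joint: "(\<lambda>(t, s). F t s) \<in> p \<Otimes>\<^sub>M RS \<rightarrow>\<^sub>M RS"
  by (rule caratheodory_measurable_map[OF compact_S F_in F_cont F_meas])

lemma l_joint: "(\<lambda>(t, s). l t s) \<in> borel_measurable (p \<Otimes>\<^sub>M RS)"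
  by (rule caratheodory_measurable[OF l_cont l_meas])

lemma F_section: "s \<in> S \<Longrightarrow> (\<lambda>t. F t s) \<in> p \<rightarrow>\<^sub>M RS"
  using F_meas F_in by (intro measurable_restrict_space2) auto

lemma compose_cont_meas:
  fixes h :: "'a \<Rightarrow> real"
  assumes "continuous_on S h" "s \<in> S"
  shows "(\<lambda>t. h (F t s)) \<in> borel_measurable p"
  using measurable_compose[OF F_section[OF assms(2)] borel_measurable_continuous_on_restrict[OF assms(1)]] .

lemma Top_cont:
  assumes h: "continuous_on S h" shows "continuous_on S (Top h)"
proof -
  obtain B where B: "\<And>s. s \<in> S \<Longrightarrow> \<bar>h s\<bar> \<le> B" using continuous_on_compact_bdd[OF compact_S h] by metis
  show ?thesis unfolding transfer_op_def
  proof (rule continuous_on_parametric_integral[where b="\<lambda>_. B"])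
    fix t assume t: "t \<in> space p"
    show "continuous_on S (\<lambda>s. h (F t s))"
      by (rule continuous_on_compose2[OF h F_cont[OF t]]) (use F_in[OF t] in auto)
  qed (use compose_cont_meas[OF h] B F_in in auto)
qed

lemma mean_log_cont: "continuous_on S mean_log"
  unfolding mean_log_def by (rule continuous_on_parametric_integral[OF l_cont l_meas b_int l_bound])

lemma Top_pow_cont: "continuous_on S h \<Longrightarrow> continuous_on S ((Top ^^ n) h)"
  by (induction n) (auto intro: Top_cont)

lemma Top_Suc: "(Top ^^ Suc n) h s = (\<integral>t. (Top ^^ n) h (F t s) \<partial>p)"
  by (simp add: transfer_op_def[of p F "(Top ^^ n) h"])

lemma Top_pow_bound:
  assumes h: "continuous_on S h" and B: "\<And>s. s \<in> S \<Longrightarrow> \<bar>h s\<bar> \<le> B" and s: "s \<in> S"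
  shows "\<bar>(Top ^^ n) h s\<bar> \<le> B"
  using s
proof (induction n arbitrary: s)
  case (Suc n)
  have c: "continuous_on S ((Top ^^ n) h)" using Top_pow_cont[OF h] .
  have B0: "0 \<le> B" using B[OF Suc.prems] by linarith
  have le: "\<bar>(Top ^^ n) h (F t s)\<bar> \<le> B" if "t \<in> space p" for t using Suc that F_in by blast
  have "\<bar>(Top ^^ Suc n) h s\<bar> = \<bar>\<integral>t. (Top ^^ n) h (F t s) \<partial>p\<bar>" by (simp only: Top_Suc)
  also have "\<dots> \<le> (\<integral>t. \<bar>(Top ^^ n) h (F t s)\<bar> \<partial>p)" by (rule integral_abs_bound)
  also have "\<dots> \<le> (\<integral>t. B \<partial>p)"
    using compose_cont_meas[OF c Suc.prems] le B0
    by (intro integral_mono integrable_abs integrable_const_bound[of _ B]) auto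
  also have "\<dots> = B" by (simp add: prob_space)
  finally show ?case .
qed (use B in auto)

lemma path_space_prob: "prob_space (path_space p)"
  by (rule seq.prob_space_axioms)

text \<open>Independence of the coordinates: prefixing an independent first coordinate to a path
  reproduces the law of the path.\<close>

lemma integral_path_split:
  fixes G :: "(nat \<Rightarrow> 't) \<Rightarrow> real"
  assumes G: "integrable (path_space p) G"
  shows "(\<integral>\<omega>. G \<omega> \<partial>path_space p) = (\<integral>t. (\<integral>\<omega>. G (case_nat t \<omega>) \<partial>path_space p) \<partial>p)"
proof -
  interpret Q: pair_prob_space p "path_space p" by unfold_locales
  have m: "(\<lambda>(t, \<omega>). case_nat t \<omega>) \<in> p \<Otimes>\<^sub>M path_space p \<rightarrow>\<^sub>M path_space p"
    by measurable
  have gi: "integrable (distr (p \<Otimes>\<^sub>M path_space p) (path_space p) (\<lambda>(t, \<omega>). case_nat t \<omega>)) G"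
    unfolding seq.PiM_iter by (rule G)
  then have i: "integrable (p \<Otimes>\<^sub>M path_space p) (\<lambda>z. G (case z of (t, \<omega>) \<Rightarrow> case_nat t \<omega>))"
    by (rule integrable_distr[OF m])
  have "(\<integral>\<omega>. G \<omega> \<partial>path_space p) = (\<integral>z. G (case z of (t, \<omega>) \<Rightarrow> case_nat t \<omega>) \<partial>(p \<Otimes>\<^sub>M path_space p))"
    by (subst seq.PiM_iter[symmetric]) (rule integral_distr[OF m borel_measurable_integrable[OF G]])
  also have "\<dots> = (\<integral>t. (\<integral>\<omega>. G (case_nat t \<omega>) \<partial>path_space p) \<partial>p)"
    using Q.integral_fst'[OF i] by simp
  finally show ?thesis .
qed

lemma path_in: "\<omega> \<in> space (path_space p) \<Longrightarrow> \<omega> n \<in> space p"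
  by (auto simp: space_PiM PiE_def)

lemma orbit_in: "\<omega> \<in> space (path_space p) \<Longrightarrow> s \<in> S \<Longrightarrow> orbit F n \<omega> s \<in> S"
  by (induction n) (auto intro: F_in path_in)

lemma orbit_meas: "(\<lambda>(\<omega>, s). orbit F n \<omega> s) \<in> path_space p \<Otimes>\<^sub>M RS \<rightarrow>\<^sub>M RS"
proof (induction n)
  case (Suc n)
  have "(\<lambda>z. (fst z n, (\<lambda>(\<omega>, s). orbit F n \<omega> s) z)) \<in> path_space p \<Otimes>\<^sub>M RS \<rightarrow>\<^sub>M p \<Otimes>\<^sub>M RS"
    using Suc by (intro measurable_Pair measurable_compose[OF measurable_fst] measurable_component_singleton) auto
  from measurable_compose[OF this F_joint] show ?case by (simp add: case_prod_beta)
qed (simp add: case_prod_beta)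

lemma birkhoff_meas: "(\<lambda>(\<omega>, s). birkhoff_sum F l n \<omega> s) \<in> borel_measurable (path_space p \<Otimes>\<^sub>M RS)"
proof -
  have "(\<lambda>z. l (fst z j) (orbit F j (fst z) (snd z))) \<in> borel_measurable (path_space p \<Otimes>\<^sub>M RS)" for j
  proof -
    have "(\<lambda>z. (fst z j, (\<lambda>(\<omega>, s). orbit F j \<omega> s) z)) \<in> path_space p \<Otimes>\<^sub>M RS \<rightarrow>\<^sub>M p \<Otimes>\<^sub>M RS"
      using orbit_meas by (intro measurable_Pair measurable_compose[OF measurable_fst] measurable_component_singleton) auto
    from measurable_compose[OF this l_joint] show ?thesis by (simp add: case_prod_beta)
  qed
  then show ?thesis unfolding birkhoff_sum_def case_prod_beta by (intro borel_measurable_sum) auto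
qed

lemma section_meas:
  assumes "s \<in> S" "g \<in> path_space p \<Otimes>\<^sub>M RS \<rightarrow>\<^sub>M N"
  shows "(\<lambda>\<omega>. g (\<omega>, s)) \<in> path_space p \<rightarrow>\<^sub>M N"
  using assms by (intro measurable_compose[OF measurable_Pair2' assms(2)]) (auto simp: space_restrict_space)

lemma coord_integrable: "integrable (path_space p) (\<lambda>\<omega>. b (\<omega> j))"
  "(\<integral>\<omega>. b (\<omega> j) \<partial>path_space p) = (\<integral>t. b t \<partial>p)"
proof -
  have d: "distr (path_space p) p (\<lambda>\<omega>. \<omega> j) = p" by (rule distr_PiM_component) (auto intro: prob_space_axioms)
  have m: "(\<lambda>\<omega>. \<omega> j) \<in> path_space p \<rightarrow>\<^sub>M p" by measurable
  show "integrable (path_space p) (\<lambda>\<omega>. b (\<omega> j))" using integrable_distr[OF m] d b_int by metis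
  show "(\<integral>\<omega>. b (\<omega> j) \<partial>path_space p) = (\<integral>t. b t \<partial>p)"
    using integral_distr[OF m borel_measurable_integrable[OF b_int]] d by simp
qed

text \<open>The Markov property, by induction on \<open>n\<close> for all starting points at once,
  since splitting off the first step moves the starting point to \<open>F t s\<close>.\<close>

lemma integral_orbit:
  assumes h: "continuous_on S h" and s: "s \<in> S"
  shows "(\<integral>\<omega>. h (orbit F n \<omega> s) \<partial>path_space p) = (Top ^^ n) h s"
  using s
proof (induction n arbitrary: s)
  case 0 show ?case using prob_space.prob_space[OF path_space_prob] by simp
next
  case (Suc n)
  obtain B where B: "\<And>s. s \<in> S \<Longrightarrow> \<bar>h s\<bar> \<le> B" using continuous_on_compact_bdd[OF compact_S h] by metis
  have "(\<lambda>\<omega>. (\<lambda>(\<omega>, s). orbit F (Suc n) \<omega> s) (\<omega>, s)) \<in> path_space p \<rightarrow>\<^sub>M RS"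
    by (rule section_meas[OF Suc.prems orbit_meas])
  from measurable_compose[OF this borel_measurable_continuous_on_restrict[OF h]]
  have "integrable (path_space p) (\<lambda>\<omega>. h (orbit F (Suc n) \<omega> s))"
    using B orbit_in[OF _ Suc.prems, of _ "Suc n"]
    by (intro seq.integrable_const_bound[of _ B]) (auto simp del: orbit.simps)
  from integral_path_split[OF this]
  have "(\<integral>\<omega>. h (orbit F (Suc n) \<omega> s) \<partial>path_space p) = (\<integral>t. (\<integral>\<omega>. h (orbit F n \<omega> (F t s)) \<partial>path_space p) \<partial>p)"
    by (simp add: orbit_case_nat del: orbit.simps)
  also have "\<dots> = (\<integral>t. (Top ^^ n) h (F t s) \<partial>p)"
    using Suc F_in by (intro Bochner_Integration.integral_cong) auto
  finally show ?case by (simp only: Top_Suc)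
qed

lemma log_orbit_integrable:
  assumes s: "s \<in> S"
  shows "integrable (path_space p) (\<lambda>\<omega>. l (\<omega> n) (orbit F n \<omega> s))"
proof (rule Bochner_Integration.integrable_bound[OF coord_integrable(1)[of n]])
  have "(\<lambda>z. (fst z n, (\<lambda>(\<omega>, s). orbit F n \<omega> s) z)) \<in> path_space p \<Otimes>\<^sub>M RS \<rightarrow>\<^sub>M p \<Otimes>\<^sub>M RS"
    using orbit_meas by (intro measurable_Pair measurable_compose[OF measurable_fst] measurable_component_singleton) auto
  from section_meas[OF s measurable_compose[OF this l_joint]]
  show "(\<lambda>\<omega>. l (\<omega> n) (orbit F n \<omega> s)) \<in> borel_measurable (path_space p)" by simp
  show "AE \<omega> in path_space p. norm (l (\<omega> n) (orbit F n \<omega> s)) \<le> norm (b (\<omega> n))"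
    using l_bound path_in orbit_in s by (intro AE_I2) (simp, meson abs_ge_self order_trans)
qed

lemma integral_log_orbit:
  assumes s: "s \<in> S"
  shows "(\<integral>\<omega>. l (\<omega> n) (orbit F n \<omega> s) \<partial>path_space p) = (Top ^^ n) mean_log s"
  using s
proof (induction n arbitrary: s)
  case 0
  have d: "distr (path_space p) p (\<lambda>\<omega>. \<omega> 0) = p" by (rule distr_PiM_component) (auto intro: prob_space_axioms)
  have m: "(\<lambda>\<omega>. \<omega> 0) \<in> path_space p \<rightarrow>\<^sub>M p" by measurable
  show ?case using integral_distr[OF m l_meas[OF 0]] d by (simp add: mean_log_def)
next
  case (Suc n)
  from integral_path_split[OF log_orbit_integrable[OF Suc.prems, of "Suc n"]]
  have "(\<integral>\<omega>. l (\<omega> (Suc n)) (orbit F (Suc n) \<omega> s) \<partial>path_space p) = (\<integral>t. (\<integral>\<omega>. l (\<omega> n) (orbit F n \<omega> (F t s)) \<partial>path_space p) \<partial>p)"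
    by (simp add: orbit_case_nat del: orbit.simps)
  also have "\<dots> = (\<integral>t. (Top ^^ n) mean_log (F t s) \<partial>p)"
    using Suc F_in by (intro Bochner_Integration.integral_cong) auto
  finally show ?case by (simp only: Top_Suc)
qed

lemma birkhoff_integrable: "s \<in> S \<Longrightarrow> integrable (path_space p) (\<lambda>\<omega>. birkhoff_sum F l n \<omega> s)"
  unfolding birkhoff_sum_def using log_orbit_integrable by auto

lemma integral_birkhoff:
  "s \<in> S \<Longrightarrow> (\<integral>\<omega>. birkhoff_sum F l n \<omega> s \<partial>path_space p) = (\<Sum>j<n. (Top ^^ j) mean_log s)"
  unfolding birkhoff_sum_def using log_orbit_integrable integral_log_orbit by simp

lemma birkhoff_bound:
  "\<omega> \<in> space (path_space p) \<Longrightarrow> s \<in> S \<Longrightarrow> \<bar>birkhoff_sum F l n \<omega> s\<bar> \<le> (\<Sum>j<n. b (\<omega> j))"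
  unfolding birkhoff_sum_def using path_in orbit_in l_bound
  by (intro order.trans[OF sum_abs] sum_mono) auto

lemma stationary_pow:
  assumes "fun_stationary p S F \<nu>" "continuous_on S h"
  shows "(\<integral>s. (Top ^^ n) h s \<partial>\<nu>) = (\<integral>s. h s \<partial>\<nu>)"
  using assms Top_pow_cont by (induction n) (auto simp: fun_stationary_def)

lemma emeasure_pushforward:
  assumes \<nu>: "\<nu> \<in> borel_prob_on S" and A: "A \<in> sets \<nu>"
  shows "emeasure (distr (p \<Otimes>\<^sub>M \<nu>) \<nu> (\<lambda>(t, s). F t s)) A = (\<integral>\<^sup>+t. emeasure \<nu> (F t -` A \<inter> S) \<partial>p)"
    "(\<lambda>(t, s). F t s) \<in> p \<Otimes>\<^sub>M \<nu> \<rightarrow>\<^sub>M \<nu>"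
proof -
  interpret n: prob_space \<nu> using borel_prob_onD(1)[OF \<nu>] .
  have e: "sets \<nu> = sets RS" "space \<nu> = S" using borel_prob_onD[OF \<nu>] by auto
  have s: "sets (p \<Otimes>\<^sub>M \<nu>) = sets (p \<Otimes>\<^sub>M RS)" using e by (intro sets_pair_measure_cong) auto
  show m: "(\<lambda>(t, s). F t s) \<in> p \<Otimes>\<^sub>M \<nu> \<rightarrow>\<^sub>M \<nu>"
    using F_joint measurable_cong_sets[OF s e(1)] by auto
  show "emeasure (distr (p \<Otimes>\<^sub>M \<nu>) \<nu> (\<lambda>(t, s). F t s)) A = (\<integral>\<^sup>+t. emeasure \<nu> (F t -` A \<inter> S) \<partial>p)"
    unfolding emeasure_distr[OF m A] using measurable_sets[OF m A]
    by (subst n.emeasure_pair_measure_alt)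
      (auto intro!: nn_integral_cong arg_cong[where f="emeasure \<nu>"] simp: space_pair_measure e)
qed

lemma integral_pushforward:
  fixes h :: "'a \<Rightarrow> real"
  assumes \<nu>: "\<nu> \<in> borel_prob_on S" and h: "continuous_on S h"
  shows "(\<integral>s. h s \<partial>distr (p \<Otimes>\<^sub>M \<nu>) \<nu> (\<lambda>(t, s). F t s)) = (\<integral>s. Top h s \<partial>\<nu>)"
proof -
  interpret n: prob_space \<nu> using borel_prob_onD(1)[OF \<nu>] .
  interpret Q: pair_prob_space p \<nu> by unfold_locales
  have e: "sets \<nu> = sets RS" "space \<nu> = S" using borel_prob_onD[OF \<nu>] by auto
  have m: "(\<lambda>(t, s). F t s) \<in> p \<Otimes>\<^sub>M \<nu> \<rightarrow>\<^sub>M \<nu>" using emeasure_pushforward(2)[OF \<nu> sets.top] .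
  have hm: "h \<in> borel_measurable \<nu>" using borel_prob_on_measurable[OF \<nu> h] .
  obtain B where B: "\<And>s. s \<in> S \<Longrightarrow> \<bar>h s\<bar> \<le> B" using continuous_on_compact_bdd[OF compact_S h] by metis
  have i: "integrable (p \<Otimes>\<^sub>M \<nu>) (\<lambda>z. h (case z of (t, s) \<Rightarrow> F t s))"
    using measurable_compose[OF m hm] B F_in by (intro Q.P.integrable_const_bound[of _ B]) (auto simp: space_pair_measure e)
  have "(\<integral>s. h s \<partial>distr (p \<Otimes>\<^sub>M \<nu>) \<nu> (\<lambda>(t, s). F t s)) = (\<integral>z. h (case z of (t, s) \<Rightarrow> F t s) \<partial>(p \<Otimes>\<^sub>M \<nu>))"
    by (rule integral_distr[OF m hm])
  also have "\<dots> = (\<integral>s. (\<integral>t. h (F t s) \<partial>p) \<partial>\<nu>)"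
    using Q.integral_snd[of "\<lambda>t s. h (F t s)"] i unfolding case_prod_beta by simp
  finally show ?thesis by (simp add: transfer_op_def)
qed

lemma pushforward_prob:
  assumes \<nu>: "\<nu> \<in> borel_prob_on S"
  shows "distr (p \<Otimes>\<^sub>M \<nu>) \<nu> (\<lambda>(t, s). F t s) \<in> borel_prob_on S"
proof -
  interpret n: prob_space \<nu> using borel_prob_onD(1)[OF \<nu>] .
  interpret Q: pair_prob_space p \<nu> by unfold_locales
  have m: "(\<lambda>(t, s). F t s) \<in> p \<Otimes>\<^sub>M \<nu> \<rightarrow>\<^sub>M \<nu>" using emeasure_pushforward(2)[OF \<nu> sets.top] .
  show ?thesis using Q.P.prob_space_distr[OF m] borel_prob_onD[OF \<nu>] by (simp add: borel_prob_on_def)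
qed

text \<open>Both conditions say that the image of \<open>p \<Otimes>\<^sub>M \<nu>\<close> under
  \<open>F\<close> is \<open>\<nu>\<close>: one tests this on sets, the other on continuous
  functions, which determine the measure by \<open>borel_prob_eqI\<close>.\<close>

lemma stationary_iff_emeasure:
  assumes \<nu>: "\<nu> \<in> borel_prob_on S"
  shows "fun_stationary p S F \<nu> \<longleftrightarrow> (\<forall>A\<in>sets \<nu>. emeasure \<nu> A = (\<integral>\<^sup>+t. emeasure \<nu> (F t -` A \<inter> S) \<partial>p))"
proof
  assume "fun_stationary p S F \<nu>"
  then have "distr (p \<Otimes>\<^sub>M \<nu>) \<nu> (\<lambda>(t, s). F t s) = \<nu>"
    using integral_pushforward[OF \<nu>] unfolding fun_stationary_def
    by (intro borel_prob_eqI[OF compact_S pushforward_prob[OF \<nu>] \<nu>]) auto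
  then show "\<forall>A\<in>sets \<nu>. emeasure \<nu> A = (\<integral>\<^sup>+t. emeasure \<nu> (F t -` A \<inter> S) \<partial>p)"
    using emeasure_pushforward(1)[OF \<nu>] by metis
next
  assume "\<forall>A\<in>sets \<nu>. emeasure \<nu> A = (\<integral>\<^sup>+t. emeasure \<nu> (F t -` A \<inter> S) \<partial>p)"
  then have "distr (p \<Otimes>\<^sub>M \<nu>) \<nu> (\<lambda>(t, s). F t s) = \<nu>"
    by (intro measure_eqI) (auto simp: emeasure_pushforward(1)[OF \<nu>])
  then show "fun_stationary p S F \<nu>"
    using integral_pushforward[OF \<nu>] \<nu> unfolding fun_stationary_def by metis
qed

text \<open>The Krylov-Bogolyubov argument. The times \<open>N\<close> are prescribed by the caller
  because the lower bound for the exponent has to be read along a given subsequence of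
  times.\<close>

lemma cesaro_limit_stationary:
  assumes m: "m \<in> borel_prob_on S" and N: "strict_mono N" "\<And>k. N k > (0::nat)"
  obtains r \<xi> where "strict_mono (r::nat \<Rightarrow> nat)" "fun_stationary p S F \<xi>"
    "\<And>h. continuous_on S h \<Longrightarrow>
      (\<lambda>k. (\<Sum>j<N (r k). \<integral>s. (Top ^^ j) h s \<partial>m) / real (N (r k))) \<longlonglongrightarrow> (\<integral>s. h s \<partial>\<xi>)"
proof -
  interpret m: prob_space m using borel_prob_onD(1)[OF m] .
  interpret Q: pair_prob_space "path_space p" m by unfold_locales
  have e: "sets m = sets RS" "space m = S" using borel_prob_onD[OF m] by auto
  have s: "sets (path_space p \<Otimes>\<^sub>M m) = sets (path_space p \<Otimes>\<^sub>M RS)" using e by (intro sets_pair_measure_cong) auto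
  have om: "(\<lambda>(\<omega>, s). orbit F j \<omega> s) \<in> path_space p \<Otimes>\<^sub>M m \<rightarrow>\<^sub>M RS" for j
    using orbit_meas measurable_cong_sets[OF s refl] by auto
  have oi: "(\<integral>z. h (case z of (\<omega>, s) \<Rightarrow> orbit F j \<omega> s) \<partial>(path_space p \<Otimes>\<^sub>M m)) = (\<integral>s. (Top ^^ j) h s \<partial>m)"
    if h: "continuous_on S h" for j h
  proof -
    have hm: "h \<in> borel_measurable RS" using borel_measurable_continuous_on_restrict[OF h] .
    obtain B where B: "\<And>s. s \<in> S \<Longrightarrow> \<bar>h s\<bar> \<le> B" using continuous_on_compact_bdd[OF compact_S h] by metis
    have i: "integrable (path_space p \<Otimes>\<^sub>M m) (\<lambda>z. h (case z of (\<omega>, s) \<Rightarrow> orbit F j \<omega> s))"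
      using measurable_compose[OF om hm] B orbit_in
      by (intro Q.P.integrable_const_bound[of _ B]) (auto simp: space_pair_measure e)
    have "(\<integral>z. h (case z of (\<omega>, s) \<Rightarrow> orbit F j \<omega> s) \<partial>(path_space p \<Otimes>\<^sub>M m)) = (\<integral>s. (\<integral>\<omega>. h (orbit F j \<omega> s) \<partial>path_space p) \<partial>m)"
      using Q.integral_snd[of "\<lambda>\<omega> s. h (orbit F j \<omega> s)"] i unfolding case_prod_beta by simp
    also have "\<dots> = (\<integral>s. (Top ^^ j) h s \<partial>m)"
      using integral_orbit[OF h] e by (intro Bochner_Integration.integral_cong) auto
    finally show ?thesis .
  qed
  have "\<exists>\<nu>. \<nu> \<in> borel_prob_on S \<and> (\<forall>h. continuous_on S h \<longrightarrow>
     (\<integral>s. h s \<partial>\<nu>) = (\<Sum>j<N k. \<integral>s. (Top ^^ j) h s \<partial>m) / real (N k))" for k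
  proof -
    have ne: "{..<N k} \<noteq> {}" using N(2)[of k] by auto
    obtain \<nu> where n: "\<nu> \<in> borel_prob_on S" "\<And>h::'a \<Rightarrow> real. continuous_on S h \<Longrightarrow> (\<integral>s. h s \<partial>\<nu>) =
        (\<Sum>j\<in>{..<N k}. \<integral>z. h (case z of (\<omega>, s) \<Rightarrow> orbit F j \<omega> s) \<partial>(path_space p \<Otimes>\<^sub>M m)) / card {..<N k}"
      by (rule average_of_images[OF Q.P.prob_space_axioms finite_lessThan ne compact_S om], rule that)
    then show ?thesis using oi by (intro exI[of _ \<nu>]) simp
  qed
  then have "\<forall>k. \<exists>\<nu>. \<nu> \<in> borel_prob_on S \<and> (\<forall>h. continuous_on S h \<longrightarrow>
     (\<integral>s. h s \<partial>\<nu>) = (\<Sum>j<N k. \<integral>s. (Top ^^ j) h s \<partial>m) / real (N k))" by blast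
  from choice[OF this] obtain \<nu> where "\<forall>k. \<nu> k \<in> borel_prob_on S \<and> (\<forall>h. continuous_on S h \<longrightarrow>
     (\<integral>s. h s \<partial>\<nu> k) = (\<Sum>j<N k. \<integral>s. (Top ^^ j) h s \<partial>m) / real (N k))" ..
  then have \<nu>: "\<And>k. \<nu> k \<in> borel_prob_on S"
     "\<And>k h. continuous_on S h \<Longrightarrow> (\<integral>s. h s \<partial>\<nu> k) = (\<Sum>j<N k. \<integral>s. (Top ^^ j) h s \<partial>m) / real (N k)" by auto
  obtain r \<xi> where r: "strict_mono (r :: nat \<Rightarrow> nat)" "\<xi> \<in> borel_prob_on S"
    "\<And>h::'a \<Rightarrow> real. continuous_on S h \<Longrightarrow> (\<lambda>k. \<integral>x. h x \<partial>\<nu> (r k)) \<longlonglongrightarrow> (\<integral>x. h x \<partial>\<xi>)"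
    by (rule weak_seq_compact[OF compact_S \<nu>(1)], rule that)
  have Ninf: "filterlim (\<lambda>k. real (N (r k))) at_top sequentially"
    using filterlim_compose[OF filterlim_real_sequentially filterlim_subseq[OF strict_mono_o[OF N(1) r(1)]]]
    by (simp add: comp_def)
  have "(\<integral>s. Top h s \<partial>\<xi>) = (\<integral>s. h s \<partial>\<xi>)" if h: "continuous_on S h" for h
  proof -
    obtain B where B: "\<And>s. s \<in> S \<Longrightarrow> \<bar>h s\<bar> \<le> B" using continuous_on_compact_bdd[OF compact_S h] by metis
    let ?a = "\<lambda>j. \<integral>s. (Top ^^ j) h s \<partial>m"
    have ab: "\<bar>?a j\<bar> \<le> B" for j
    proof -
      have "\<bar>?a j\<bar> \<le> (\<integral>s. \<bar>(Top ^^ j) h s\<bar> \<partial>m)" by (rule integral_abs_bound)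
      also have "\<dots> \<le> (\<integral>s. B \<partial>m)"
        using Top_pow_bound[OF h B] borel_prob_on_integrable[OF compact_S m Top_pow_cont[OF h]] e
        by (intro integral_mono integrable_abs) auto
      finally show ?thesis by (simp add: m.prob_space)
    qed
    \<comment> \<open>Telescoping: applying the operator to a Cesaro average over \<open>n\<close>
      times changes it by two boundary terms, at most \<open>2 * B / n\<close>.\<close>
    have shift: "(\<Sum>j<n. ?a (Suc j)) = (\<Sum>j<n. ?a j) + (?a n - ?a 0)" for n
      by (induction n) auto
    have eq: "(\<integral>s. Top h s \<partial>\<nu> k) = (\<integral>s. h s \<partial>\<nu> k) + (?a (N k) - ?a 0) / real (N k)" for k
      unfolding \<nu>(2)[OF Top_cont[OF h]] \<nu>(2)[OF h] add_divide_distrib[symmetric] shift[symmetric]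
      by (simp only: funpow_Suc_right comp_apply)
    have "(\<lambda>k. (?a (N (r k)) - ?a 0) / real (N (r k))) \<longlonglongrightarrow> 0"
    proof (rule Lim_null_comparison)
      show "eventually (\<lambda>k. norm ((?a (N (r k)) - ?a 0) / real (N (r k))) \<le> (2 * B) / real (N (r k))) sequentially"
      proof (rule always_eventually, rule allI)
        fix k
        have "\<bar>?a (N (r k)) - ?a 0\<bar> \<le> 2 * B" using ab[of "N (r k)"] ab[of 0] by linarith
        then show "norm ((?a (N (r k)) - ?a 0) / real (N (r k))) \<le> (2 * B) / real (N (r k))"
          by (simp add: divide_right_mono)
      qed
      show "(\<lambda>k. (2 * B) / real (N (r k))) \<longlonglongrightarrow> 0" by (rule real_tendsto_divide_at_top[OF tendsto_const Ninf])
    qed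
    from tendsto_add[OF r(3)[OF h] this] have "(\<lambda>k. \<integral>s. Top h s \<partial>\<nu> (r k)) \<longlonglongrightarrow> (\<integral>s. h s \<partial>\<xi>)"
      unfolding eq by simp
    then show ?thesis using r(3)[OF Top_cont[OF h]] LIMSEQ_unique by blast
  qed
  then have "fun_stationary p S F \<xi>" unfolding fun_stationary_def using r(2) by blast
  moreover have "(\<lambda>k. (\<Sum>j<N (r k). \<integral>s. (Top ^^ j) h s \<partial>m) / real (N (r k))) \<longlonglongrightarrow> (\<integral>s. h s \<partial>\<xi>)"
    if h: "continuous_on S h" for h using r(3)[OF h] unfolding \<nu>(2)[OF h] .
  ultimately show ?thesis using that r(1) by blast
qed

end

section \<open>Derivatives in charts\<close>

definition local_rep :: "('m, 'e) chart \<Rightarrow> ('m, 'e) chart \<Rightarrow> ('m \<Rightarrow> 'm) \<Rightarrow> 'e \<Rightarrow> 'e" where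
  "local_rep c c' h = chart_map c' \<circ> h \<circ> chart_inv c"

abbreviation local_deriv :: "('m, 'e::euclidean_space) chart \<Rightarrow> ('m, 'e) chart \<Rightarrow> ('m \<Rightarrow> 'm) \<Rightarrow> 'm \<Rightarrow> 'e \<Rightarrow> 'e" where
  "local_deriv c c' h x \<equiv> frechet_derivative (local_rep c c' h) (at (chart_map c x))"

text \<open>A pointwise notion, so that the chain rule alone covers the iterates. Continuity at
  \<open>x\<close> is included because it keeps the values in the target chart near
  \<open>x\<close>, without which the local representation says nothing.\<close>

definition diff_at :: "('m::t2_space, 'e::euclidean_space) riemannian \<Rightarrow> ('m \<Rightarrow> 'm) \<Rightarrow> 'm \<Rightarrow> bool" where
  "diff_at M h x \<longleftrightarrow> isCont h x \<and> (\<forall>c\<in>charts_at M x. \<forall>c'\<in>charts_at M (h x).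
     local_rep c c' h differentiable (at (chart_map c x)))"

lemma isCont_open_preimage:
  assumes "isCont (h :: 'a::t2_space \<Rightarrow> 'b::topological_space) x" "open U" "h x \<in> U"
  obtains W where "open W" "x \<in> W" "\<And>y. y \<in> W \<Longrightarrow> h y \<in> U"
proof -
  have "\<exists>S. open S \<and> x \<in> S \<and> (\<forall>x'\<in>S. h x' \<in> U)"
    using assms unfolding continuous_at_open by blast
  then show ?thesis using that by blast
qed

locale atlas_manifold =
  fixes M :: "('m::{t2_space,second_countable_topology}, 'e::euclidean_space) riemannian"
  assumes atlas: "smooth_atlas (charts M)"
begin

lemma chart_at: "c \<in> charts_at M x \<longleftrightarrow> c \<in> charts M \<and> x \<in> chart_dom c"
  by (simp add: charts_at_def)

lemma charts_at_ne: "charts_at M x \<noteq> {}"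
proof -
  have "x \<in> (\<Union>c\<in>charts M. chart_dom c)" using atlas unfolding smooth_atlas_def by simp
  then show ?thesis by (auto simp: charts_at_def)
qed

lemma some_chart_at: "some_chart_at M x \<in> charts_at M x"
  unfolding some_chart_at_def using charts_at_ne some_in_eq by blast

lemma chart_props:
  assumes "c \<in> charts M"
  shows "open (chart_dom c)" "open (chart_map c ` chart_dom c)"
    "homeomorphism (chart_dom c) (chart_map c ` chart_dom c) (chart_map c) (chart_inv c)"
  using atlas assms unfolding smooth_atlas_def by auto

lemma chart_inv_map: "c \<in> charts M \<Longrightarrow> x \<in> chart_dom c \<Longrightarrow> chart_inv c (chart_map c x) = x"
  using chart_props(3) homeomorphism_apply1 by blast

lemma chart_map_inv:
  "c \<in> charts M \<Longrightarrow> y \<in> chart_map c ` chart_dom c \<Longrightarrow> chart_map c (chart_inv c y) = y"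
  "c \<in> charts M \<Longrightarrow> y \<in> chart_map c ` chart_dom c \<Longrightarrow> chart_inv c y \<in> chart_dom c"
  by (metis chart_inv_map imageE)+

lemma chart_cont: "c \<in> charts M \<Longrightarrow> continuous_on (chart_dom c) (chart_map c)"
  "c \<in> charts M \<Longrightarrow> continuous_on (chart_map c ` chart_dom c) (chart_inv c)"
  using chart_props(3) unfolding homeomorphism_def by auto

lemma chart_image_open:
  assumes c: "c \<in> charts M" and U: "open U" "U \<subseteq> chart_dom c"
  shows "open (chart_map c ` U)"
proof -
  have "openin (top_of_set (chart_map c ` chart_dom c)) (chart_map c ` U)"
    using homeomorphism_imp_open_map[OF chart_props(3)[OF c]] U by (simp add: openin_open_eq chart_props(1)[OF c])
  then show ?thesis using chart_props(2)[OF c] openin_open_trans by blast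
qed

lemma chart_inv_cont_at: "c \<in> charts M \<Longrightarrow> x \<in> chart_dom c \<Longrightarrow> isCont (chart_inv c) (chart_map c x)"
  using chart_cont(2) chart_props(2) continuous_on_eq_continuous_at by blast

lemma local_rep_id: "local_rep c c' id = transition_map c c'"
  by (simp add: local_rep_def transition_map_def)

lemma diff_at_id: "diff_at M id x"
  unfolding diff_at_def
proof (intro conjI ballI)
  fix c c' assume c: "c \<in> charts_at M x" "c' \<in> charts_at M (id x)"
  have "smooth_on (chart_map c ` (chart_dom c \<inter> chart_dom c')) (transition_map c c')"
    using atlas c unfolding smooth_atlas_def by (auto simp: chart_at)
  then have "Ck_on (Suc 0) (chart_map c ` (chart_dom c \<inter> chart_dom c')) (transition_map c c')"
    unfolding smooth_on_def by blast
  then show "local_rep c c' id differentiable (at (chart_map c x))"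
    using c by (auto simp: local_rep_id chart_at)
qed (simp add: continuous_ident id_def)

lemma local_deriv_has:
  assumes "diff_at M h x" "c \<in> charts_at M x" "c' \<in> charts_at M (h x)"
  shows "(local_rep c c' h has_derivative local_deriv c c' h x) (at (chart_map c x))"
  using assms frechet_derivative_works unfolding diff_at_def by blast

lemma local_deriv_linear:
  assumes "diff_at M h x" "c \<in> charts_at M x" "c' \<in> charts_at M (h x)"
  shows "linear (local_deriv c c' h x)"
  using local_deriv_has[OF assms] has_derivative_linear by blast

lemma local_rep_at: "c \<in> charts_at M x \<Longrightarrow> local_rep c c' h (chart_map c x) = chart_map c' (h x)"
  by (simp add: local_rep_def chart_inv_map chart_at)

text \<open>The local representations compose only where \<open>h\<close> maps into the domain of
  the middle chart. Continuity of \<open>h\<close> provides such a neighbourhood, and the derivative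
  depends only on the germ.\<close>

lemma local_chain:
  assumes h: "diff_at M h x" and k: "diff_at M k (h x)"
    and c: "c \<in> charts_at M x" "c' \<in> charts_at M (h x)" "c'' \<in> charts_at M (k (h x))"
  shows "(local_rep c c'' (k \<circ> h) has_derivative (\<lambda>a. local_deriv c' c'' k (h x) (local_deriv c c' h x a))) (at (chart_map c x))"
proof -
  have cM: "c \<in> charts M" "x \<in> chart_dom c" "c' \<in> charts M" "h x \<in> chart_dom c'" using c by (auto simp: chart_at)
  have 1: "(local_rep c' c'' k has_derivative local_deriv c' c'' k (h x)) (at (local_rep c c' h (chart_map c x)))"
    using local_deriv_has[OF k c(2,3)] local_rep_at[OF c(1)] by simp
  have 2: "((local_rep c' c'' k \<circ> local_rep c c' h) has_derivative (local_deriv c' c'' k (h x) \<circ> local_deriv c c' h x)) (at (chart_map c x))"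
    by (rule diff_chain_at[OF local_deriv_has[OF h c(1,2)] 1])
  have hc: "isCont h x" using h unfolding diff_at_def by blast
  obtain W where W: "open W" "x \<in> W" "\<And>y. y \<in> W \<Longrightarrow> h y \<in> chart_dom c'"
    by (rule isCont_open_preimage[OF hc chart_props(1)[OF cM(3)] cM(4)], rule that)
  define W' where "W' = chart_map c ` (W \<inter> chart_dom c)"
  have oW: "open W'" unfolding W'_def using chart_image_open[OF cM(1)] W(1) chart_props(1)[OF cM(1)] by auto
  have "(local_rep c c'' (k \<circ> h) has_derivative (local_deriv c' c'' k (h x) \<circ> local_deriv c c' h x)) (at (chart_map c x))"
  proof (rule has_derivative_transform_within_open[OF 2 oW])
    show "chart_map c x \<in> W'" unfolding W'_def using W cM by blast
    fix y assume "y \<in> W'"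
    then obtain z where z: "z \<in> W" "z \<in> chart_dom c" "y = chart_map c z" unfolding W'_def by blast
    show "(local_rep c' c'' k \<circ> local_rep c c' h) y = local_rep c c'' (k \<circ> h) y"
      using z W(3)[OF z(1)] cM by (simp add: local_rep_def chart_inv_map)
  qed
  then show ?thesis by (simp add: comp_def)
qed

lemma diff_at_comp:
  assumes "diff_at M h x" "diff_at M k (h x)" shows "diff_at M (k \<circ> h) x"
  unfolding diff_at_def
proof (intro conjI ballI)
  show "isCont (k \<circ> h) x" using assms unfolding diff_at_def by (intro continuous_at_compose) auto
  fix c c'' assume c: "c \<in> charts_at M x" "c'' \<in> charts_at M ((k \<circ> h) x)"
  obtain c' where c': "c' \<in> charts_at M (h x)" using charts_at_ne by blast
  show "local_rep c c'' (k \<circ> h) differentiable (at (chart_map c x))"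
    using local_chain[OF assms c(1) c', of c''] c(2) unfolding differentiable_def comp_def by blast
qed

lemma local_deriv_comp:
  assumes "diff_at M h x" "diff_at M k (h x)"
    "c \<in> charts_at M x" "c' \<in> charts_at M (h x)" "c'' \<in> charts_at M (k (h x))"
  shows "local_deriv c c'' (k \<circ> h) x a = local_deriv c' c'' k (h x) (local_deriv c c' h x a)"
  using frechet_derivative_at[OF local_chain[OF assms]] by (metis (no_types))

lemma local_deriv_germ:
  assumes h: "diff_at M h x" and U: "open U" "x \<in> U" "\<And>y. y \<in> U \<Longrightarrow> h y = k y"
    and c: "c \<in> charts_at M x" "c' \<in> charts_at M (h x)"
  shows "local_deriv c c' k x = local_deriv c c' h x"
proof -
  have cM: "c \<in> charts M" "x \<in> chart_dom c" using c by (auto simp: chart_at)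
  have o: "open (chart_map c ` (U \<inter> chart_dom c))"
    using chart_image_open[OF cM(1)] U(1) chart_props(1)[OF cM(1)] by auto
  have "(local_rep c c' k has_derivative local_deriv c c' h x) (at (chart_map c x))"
    by (rule has_derivative_transform_within_open[OF local_deriv_has[OF h c] o])
      (use U cM in \<open>auto simp: local_rep_def chart_inv_map\<close>)
  then show ?thesis using frechet_derivative_at by metis
qed

lemma local_deriv_id: "c \<in> charts_at M x \<Longrightarrow> local_deriv c c id x a = a"
proof -
  assume c: "c \<in> charts_at M x"
  have cM: "c \<in> charts M" "x \<in> chart_dom c" using c by (auto simp: chart_at)
  have "(local_rep c c id has_derivative (\<lambda>a. a)) (at (chart_map c x))"
    by (rule has_derivative_transform_within_open[OF has_derivative_ident chart_props(2)[OF cM(1)]])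
      (use cM in \<open>auto simp: local_rep_def chart_inv_map\<close>)
  then show ?thesis using frechet_derivative_at by metis
qed

lemma coord_tvec_at: "c' \<in> charts_at M x \<Longrightarrow> coord_tvec M c x a c' = local_deriv c c' id x a"
  by (simp add: coord_tvec_def local_rep_id)

lemma coord_tvec_self: "c \<in> charts_at M x \<Longrightarrow> coord_tvec M c x a c = a"
  by (simp add: coord_tvec_at local_deriv_id)

lemma local_deriv_trans:
  assumes "c \<in> charts_at M x" "c' \<in> charts_at M x" "c'' \<in> charts_at M x"
  shows "local_deriv c' c'' id x (local_deriv c c' id x a) = local_deriv c c'' id x a"
  using local_deriv_comp[of id x id c c' c'' a] diff_at_id assms by simp

lemma coord_tvec_in:
  assumes c: "c \<in> charts_at M x" shows "coord_tvec M c x a \<in> tangent_space M x"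
  unfolding tangent_space_def
proof (intro CollectI conjI ballI allI impI)
  fix d e assume d: "d \<in> charts_at M x" "e \<in> charts_at M x"
  show "coord_tvec M c x a e = frechet_derivative (transition_map d e) (at (chart_map d x)) (coord_tvec M c x a d)"
    using local_deriv_trans[OF c d] d by (simp add: coord_tvec_at flip: local_rep_id)
qed (simp add: coord_tvec_def)

lemma tvec_eq_coord:
  assumes c: "c \<in> charts_at M x" and v: "v \<in> tangent_space M x"
  shows "v = coord_tvec M c x (v c)"
proof
  fix d show "v d = coord_tvec M c x (v c) d"
  proof (cases "d \<in> charts_at M x")
    case True
    then have "v d = frechet_derivative (transition_map c d) (at (chart_map c x)) (v c)"
      using v c unfolding tangent_space_def by blast
    then show ?thesis using True by (simp add: coord_tvec_def)
  next
    case False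
    then have "v d = 0" using v unfolding tangent_space_def by blast
    then show ?thesis using False by (simp add: coord_tvec_def)
  qed
qed

lemma tangent_space_eq: "c \<in> charts_at M x \<Longrightarrow> tangent_space M x = range (coord_tvec M c x)"
  using coord_tvec_in tvec_eq_coord by blast

lemma coord_tvec_lin:
  assumes c: "c \<in> charts_at M x"
  shows "coord_tvec M c x (r *\<^sub>R a + s *\<^sub>R b) = (\<lambda>d. r *\<^sub>R coord_tvec M c x a d + s *\<^sub>R coord_tvec M c x b d)"
proof
  fix d
  show "coord_tvec M c x (r *\<^sub>R a + s *\<^sub>R b) d = r *\<^sub>R coord_tvec M c x a d + s *\<^sub>R coord_tvec M c x b d"
  proof (cases "d \<in> charts_at M x")
    case True
    have "linear (local_deriv c d id x)" using local_deriv_linear[OF diff_at_id c] True by simp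
    then show ?thesis using True by (simp add: coord_tvec_at linear_add linear_scale)
  qed (simp add: coord_tvec_def)
qed

lemma tvec_lin_in:
  assumes "u \<in> tangent_space M x" "v \<in> tangent_space M x"
  shows "(\<lambda>d. r *\<^sub>R u d + s *\<^sub>R v d) \<in> tangent_space M x"
proof -
  obtain c where c: "c \<in> charts_at M x" using charts_at_ne by blast
  have "(\<lambda>d. r *\<^sub>R u d + s *\<^sub>R v d) = coord_tvec M c x (r *\<^sub>R u c + s *\<^sub>R v c)"
    by (simp only: coord_tvec_lin[OF c] tvec_eq_coord[OF c assms(1), symmetric] tvec_eq_coord[OF c assms(2), symmetric])
  then show ?thesis using coord_tvec_in[OF c] by simp
qed

text \<open>\<open>differential\<close> is defined through the chart picked by
  \<open>some_chart_at\<close>. Writing a change of chart as the local representation of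
  \<open>id\<close>, the chain rule for \<open>h \<circ> id\<close> and \<open>id \<circ> h\<close>
  frees both charts.\<close>

lemma differential_eq:
  assumes h: "diff_at M h x" and v: "v \<in> tangent_space M x"
    and c: "c \<in> charts_at M x" "c' \<in> charts_at M (h x)"
  shows "differential M h x v = coord_tvec M c' (h x) (local_deriv c c' h x (v c))"
proof
  fix d
  let ?c = "some_chart_at M x"
  show "differential M h x v d = coord_tvec M c' (h x) (local_deriv c c' h x (v c)) d"
  proof (cases "d \<in> charts_at M (h x)")
    case True
    have "differential M h x v d = local_deriv ?c d h x (v ?c)"
      using True by (simp add: differential_def Let_def local_rep_def)
    also have "v ?c = local_deriv c ?c id x (v c)"
      using fun_cong[OF tvec_eq_coord[OF c(1) v], of ?c] by (simp only: coord_tvec_at[OF some_chart_at])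
    also have "local_deriv ?c d h x (local_deriv c ?c id x (v c)) = local_deriv c d (h \<circ> id) x (v c)"
      using local_deriv_comp[of id x h c ?c d "v c"] diff_at_id h c some_chart_at True by simp
    also have "\<dots> = local_deriv c d (id \<circ> h) x (v c)" by simp
    also have "\<dots> = local_deriv c' d id (h x) (local_deriv c c' h x (v c))"
      using local_deriv_comp[of h x id c c' d "v c"] diff_at_id h c True by simp
    finally show ?thesis using True by (simp add: coord_tvec_at)
  qed (simp add: differential_def coord_tvec_def Let_def)
qed

lemma differential_in:
  assumes h: "diff_at M h x" and v: "v \<in> tangent_space M x"
  shows "differential M h x v \<in> tangent_space M (h x)"
  using differential_eq[OF assms] charts_at_ne coord_tvec_in by (metis all_not_in_conv)

lemma differential_comp:
  assumes h: "diff_at M h x" and k: "diff_at M k (h x)" and v: "v \<in> tangent_space M x"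
  shows "differential M (k \<circ> h) x v = differential M k (h x) (differential M h x v)"
proof -
  obtain c c' c'' where c: "c \<in> charts_at M x" "c' \<in> charts_at M (h x)" "c'' \<in> charts_at M (k (h x))"
    using charts_at_ne by blast
  have "differential M (k \<circ> h) x v = coord_tvec M c'' ((k \<circ> h) x) (local_deriv c c'' (k \<circ> h) x (v c))"
    by (rule differential_eq[OF diff_at_comp[OF h k] v c(1)]) (use c in simp)
  also have "\<dots> = coord_tvec M c'' (k (h x)) (local_deriv c' c'' k (h x) (local_deriv c c' h x (v c)))"
    using local_deriv_comp[OF h k c] by simp
  also have "\<dots> = differential M k (h x) (differential M h x v)"
    using differential_eq[OF k differential_in[OF h v] c(2,3)] differential_eq[OF h v c(1,2)] coord_tvec_self[OF c(2)] by simp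
  finally show ?thesis .
qed

lemma differential_id: "v \<in> tangent_space M x \<Longrightarrow> differential M id x v = v"
proof -
  assume v: "v \<in> tangent_space M x"
  obtain c where c: "c \<in> charts_at M x" using charts_at_ne by blast
  show ?thesis using differential_eq[OF diff_at_id v c, of c] c tvec_eq_coord[OF c v, symmetric] local_deriv_id[OF c] by simp
qed

lemma C1_map_on_diff_at:
  assumes V: "open V" "x \<in> V" and h: "C1_map_on M V h"
  shows "diff_at M h x"
  unfolding diff_at_def
proof (intro conjI ballI)
  show "isCont h x" using h V unfolding C1_map_on_def using continuous_on_eq_continuous_at by blast
  fix c c' assume c: "c \<in> charts_at M x" "c' \<in> charts_at M (h x)"
  then have "Ck_on 1 (chart_map c ` (chart_dom c \<inter> V \<inter> h -` chart_dom c')) (chart_map c' \<circ> h \<circ> chart_inv c)"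
    using h unfolding C1_map_on_def by (auto simp: chart_at)
  then show "local_rep c c' h differentiable (at (chart_map c x))"
    using c V(2) unfolding local_rep_def by (auto simp: chart_at)
qed

lemma C1_local_diffeo_diff_at:
  assumes "C1_local_diffeo M h" shows "diff_at M h x"
proof -
  obtain V where "open V" "x \<in> V" "C1_map_on M V h" using assms unfolding C1_local_diffeo_def by blast
  then show ?thesis by (rule C1_map_on_diff_at)
qed

text \<open>The inverse branch composed with \<open>h\<close> has the germ of the identity at
  \<open>x\<close>, so its derivative there is the identity; the chain rule splits it.\<close>

lemma C1_local_diffeo_left_inverse:
  assumes "C1_local_diffeo M h"
  obtains k where "diff_at M k (h x)" "k (h x) = x"
    "\<And>v. v \<in> tangent_space M x \<Longrightarrow> differential M k (h x) (differential M h x v) = v"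
proof -
  obtain V where V: "open V" "x \<in> V" "open (h ` V)" "inj_on h V" "C1_map_on M V h" "C1_map_on M (h ` V) (inv_into V h)"
    using assms unfolding C1_local_diffeo_def by blast
  let ?k = "inv_into V h"
  have d: "diff_at M h x" using C1_map_on_diff_at[OF V(1,2,5)] .
  have k: "diff_at M ?k (h x)" using C1_map_on_diff_at[OF V(3) imageI[OF V(2)] V(6)] .
  have kh: "?k (h y) = y" if "y \<in> V" for y using V(4) that by simp
  have "differential M ?k (h x) (differential M h x v) = v" if v: "v \<in> tangent_space M x" for v
  proof -
    obtain c where c: "c \<in> charts_at M x" using charts_at_ne by blast
    have "local_deriv c c (?k \<circ> h) x = local_deriv c c id x"
      by (rule local_deriv_germ[OF diff_at_id V(1,2)]) (use kh c in auto)
    moreover have "(?k \<circ> h) x = x" using kh V(2) by simp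
    ultimately have "differential M (?k \<circ> h) x v = v"
      using differential_eq[OF diff_at_comp[OF d k] v c, of c] c tvec_eq_coord[OF c v, symmetric] local_deriv_id[OF c] by simp
    then show ?thesis using differential_comp[OF d k v] by simp
  qed
  then show ?thesis using that k kh[OF V(2)] by blast
qed

lemma local_deriv_inj:
  assumes h: "C1_local_diffeo M h" and c: "c \<in> charts_at M x" "c' \<in> charts_at M (h x)"
  shows "inj (local_deriv c c' h x)" "surj (local_deriv c c' h x)"
proof -
  have d: "diff_at M h x" using C1_local_diffeo_diff_at[OF h] .
  obtain k where k: "diff_at M k (h x)" "k (h x) = x"
    "\<And>v. v \<in> tangent_space M x \<Longrightarrow> differential M k (h x) (differential M h x v) = v"
    by (rule C1_local_diffeo_left_inverse[OF h, of x], rule that)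
  show i: "inj (local_deriv c c' h x)"
  proof (rule injI)
    fix a b assume e: "local_deriv c c' h x a = local_deriv c c' h x b"
    have "differential M h x (coord_tvec M c x a) = differential M h x (coord_tvec M c x b)"
      using differential_eq[OF d coord_tvec_in[OF c(1)] c] e coord_tvec_self[OF c(1)] by simp
    then have "coord_tvec M c x a = coord_tvec M c x b" using k(3) coord_tvec_in[OF c(1)] by metis
    then show "a = b" using coord_tvec_self[OF c(1)] by metis
  qed
  then show "surj (local_deriv c c' h x)"
    using linear_injective_imp_surjective[OF local_deriv_linear[OF d c]] by blast
qed

lemma differential_bij:
  assumes h: "C1_local_diffeo M h"
  shows "bij_betw (differential M h x) (tangent_space M x) (tangent_space M (h x))"
proof -
  have d: "diff_at M h x" using C1_local_diffeo_diff_at[OF h] .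
  obtain k where k: "\<And>v. v \<in> tangent_space M x \<Longrightarrow> differential M k (h x) (differential M h x v) = v"
    by (rule C1_local_diffeo_left_inverse[OF h, of x], rule that)
  have i: "inj_on (differential M h x) (tangent_space M x)" by (rule inj_on_inverseI, rule k)
  obtain c c' where c: "c \<in> charts_at M x" "c' \<in> charts_at M (h x)" using charts_at_ne by blast
  have "tangent_space M (h x) \<subseteq> differential M h x ` tangent_space M x"
  proof
    fix u assume u: "u \<in> tangent_space M (h x)"
    obtain a where a: "u c' = local_deriv c c' h x a" using local_deriv_inj(2)[OF h c] by (metis surjD)
    have "differential M h x (coord_tvec M c x a) = u"
      using differential_eq[OF d coord_tvec_in[OF c(1)] c] a coord_tvec_self[OF c(1)] tvec_eq_coord[OF c(2) u, symmetric] by simp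
    then show "u \<in> differential M h x ` tangent_space M x" using coord_tvec_in[OF c(1)] by blast
  qed
  then show ?thesis unfolding bij_betw_def using i differential_in[OF d] by blast
qed

text \<open>Continuity of derivatives and of the metric is available for each fixed coordinate
  vector; expanding in the basis turns this into joint continuity.\<close>

lemma continuous_on_linear_family:
  fixes B :: "'x::topological_space \<Rightarrow> 'e \<Rightarrow> 'w::real_normed_vector"
  assumes c: "\<And>v. continuous_on W (\<lambda>x. B x v)" and l: "\<And>x. x \<in> W \<Longrightarrow> linear (B x)"
  shows "continuous_on (W \<times> UNIV) (\<lambda>(x, a). B x a)"
proof -
  have "continuous_on (W \<times> UNIV) (\<lambda>z. \<Sum>i\<in>Basis. (snd z \<bullet> i) *\<^sub>R B (fst z) i)"
    by (intro continuous_intros continuous_on_compose2[OF c continuous_on_fst]) auto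
  moreover have "(case z of (x, a) \<Rightarrow> B x a) = (\<Sum>i\<in>Basis. (snd z \<bullet> i) *\<^sub>R B (fst z) i)" if "z \<in> W \<times> UNIV" for z
  proof -
    have "B (fst z) (snd z) = B (fst z) (\<Sum>i\<in>Basis. (snd z \<bullet> i) *\<^sub>R i)" by (simp add: euclidean_representation)
    also have "\<dots> = (\<Sum>i\<in>Basis. (snd z \<bullet> i) *\<^sub>R B (fst z) i)"
      using l[of "fst z"] that by (subst linear_sum) (auto simp: linear_scale)
    finally show ?thesis by (simp add: case_prod_beta)
  qed
  ultimately show ?thesis by (subst continuous_on_cong[OF refl]) auto
qed

lemma local_deriv_cont:
  assumes h: "C1_local_diffeo M h" and c: "c \<in> charts_at M x0" "c' \<in> charts_at M (h x0)"
  obtains W where "open W" "x0 \<in> W" "W \<subseteq> chart_dom c" "\<And>x. x \<in> W \<Longrightarrow> h x \<in> chart_dom c'"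
    "continuous_on W h"
    "continuous_on (W \<times> UNIV) (\<lambda>(x, a). local_deriv c c' h x a)"
proof -
  obtain V where V: "open V" "x0 \<in> V" "C1_map_on M V h" using h unfolding C1_local_diffeo_def by blast
  have cM: "c \<in> charts M" "x0 \<in> chart_dom c" "c' \<in> charts M" "h x0 \<in> chart_dom c'" using c by (auto simp: chart_at)
  define W where "W = chart_dom c \<inter> V \<inter> h -` chart_dom c'"
  have hV: "continuous_on V h" using V(3) unfolding C1_map_on_def by blast
  have "open (V \<inter> h -` chart_dom c')" using hV V(1) chart_props(1)[OF cM(3)] by (rule continuous_open_preimage)
  then have oW: "open W" unfolding W_def using chart_props(1)[OF cM(1)] by (simp add: Int_assoc open_Int)
  have x0: "x0 \<in> W" unfolding W_def using V cM by blast
  have ck: "Ck_on 1 (chart_map c ` W) (local_rep c c' h)"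
    using V(3) cM unfolding C1_map_on_def W_def local_rep_def by blast
  then have d: "continuous_on (chart_map c ` W) (\<lambda>y. frechet_derivative (local_rep c c' h) (at y) v)" for v by simp
  have cc: "continuous_on W (chart_map c)" by (rule continuous_on_subset[OF chart_cont(1)[OF cM(1)]]) (auto simp: W_def)
  have "continuous_on (W \<times> UNIV) (\<lambda>(x, a). local_deriv c c' h x a)"
  proof (rule continuous_on_linear_family)
    show "continuous_on W (\<lambda>x. local_deriv c c' h x v)" for v
      by (rule continuous_on_compose2[OF d cc]) auto
    show "linear (local_deriv c c' h x)" if "x \<in> W" for x
      using local_deriv_linear[OF C1_local_diffeo_diff_at[OF h]] that cM unfolding W_def by (auto simp: chart_at)
  qed
  then show ?thesis using that[OF oW x0] hV unfolding W_def by (auto intro: continuous_on_subset)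
qed

lemma chart_compact_nbhd:
  assumes c: "c \<in> charts M" and x: "x \<in> chart_dom c"
  obtains V K where "open V" "x \<in> V" "V \<subseteq> K" "compact K" "K \<subseteq> chart_dom c"
proof -
  have "chart_map c x \<in> chart_map c ` chart_dom c" using x by blast
  then obtain e where e: "e > 0" "cball (chart_map c x) e \<subseteq> chart_map c ` chart_dom c"
    using chart_props(2)[OF c] open_contains_cball by blast
  define K where "K = chart_inv c ` cball (chart_map c x) e"
  define V where "V = chart_dom c \<inter> chart_map c -` ball (chart_map c x) e"
  have "continuous_on (cball (chart_map c x) e) (chart_inv c)"
    using chart_cont(2)[OF c] e(2) continuous_on_subset by blast
  then have "compact K" unfolding K_def by (intro compact_continuous_image) auto
  moreover have "open V" unfolding V_def using chart_cont(1)[OF c] chart_props(1)[OF c] open_ball by (rule continuous_open_preimage)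
  moreover have "x \<in> V" unfolding V_def using x e(1) by simp
  moreover have "V \<subseteq> K"
  proof
    fix y assume y: "y \<in> V"
    then have "y = chart_inv c (chart_map c y)" using chart_inv_map[OF c] unfolding V_def by simp
    then show "y \<in> K" using y unfolding V_def K_def by auto
  qed
  moreover have "K \<subseteq> chart_dom c" unfolding K_def using e(2) chart_map_inv(2)[OF c] by blast
  ultimately show ?thesis using that by blast
qed

end

section \<open>Riemannian distance and topology\<close>

text \<open>The fundamental theorem of calculus with finitely many exceptional times. The
  exceptional values of the derivative are set to 0, which changes neither integral.\<close>

lemma norm_increment_le_length:
  fixes \<phi> D :: "real \<Rightarrow> 'e::euclidean_space"
  assumes t: "0 \<le> t" and K: "finite K" and c: "continuous_on {0..t} \<phi>"
    and d: "\<And>s. s \<in> {0<..<t} - K \<Longrightarrow> (\<phi> has_vector_derivative D s) (at s)"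
    and Dc: "continuous_on ({0<..<t} - K) D"
  shows "ennreal (norm (\<phi> t - \<phi> 0)) \<le> (\<integral>\<^sup>+s. ennreal (norm (if s \<in> {0<..<t} - K then D s else 0)) \<partial>lborel)"
proof -
  define f' where "f' s = (if s \<in> {0<..<t} - K then D s else 0)" for s
  have o: "open ({0<..<t} - K)" using K by (intro open_Diff finite_imp_closed) auto
  have m: "f' \<in> borel_measurable lborel"
  proof -
    have "f' \<in> borel_measurable borel" unfolding f'_def
      by (rule borel_measurable_continuous_on_if[OF borel_open[OF o] Dc]) auto
    then show ?thesis by simp
  qed
  have I: "(f' has_integral (\<phi> t - \<phi> 0)) {0..t}"
    by (rule fundamental_theorem_of_calculus_interior_strong[OF K t _ c]) (use d in \<open>auto simp: f'_def\<close>)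
  have "((\<lambda>s. if s \<in> {0..t} then f' s else 0) has_integral (\<phi> t - \<phi> 0)) UNIV"
    unfolding has_integral_restrict_UNIV by (rule I)
  also have "(\<lambda>s. if s \<in> {0..t} then f' s else 0) = f'" by (auto simp: f'_def)
  finally have I': "(f' has_integral (\<phi> t - \<phi> 0)) UNIV" .
  show ?thesis
  proof (cases "(\<integral>\<^sup>+s. ennreal (norm (f' s)) \<partial>lborel) < \<infinity>")
    case True
    then have i: "integrable lborel f'" using m by (intro integrableI_bounded) auto
    have "\<phi> t - \<phi> 0 = integral\<^sup>L lborel f'"
      using has_integral_unique[OF I' has_integral_integral_lborel[OF i]] .
    then show ?thesis using integral_norm_bound_ennreal[OF i] unfolding f'_def by simp
  next
    \<comment> \<open>The theorem yields a gauge integral; absolute integrability is available only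
      when the right-hand side is finite, and otherwise the claim is trivial.\<close>
    case False
    then have "(\<integral>\<^sup>+s. ennreal (norm (f' s)) \<partial>lborel) = \<top>" using less_top by (simp add: less_top[symmetric])
    then show ?thesis unfolding f'_def by (simp only: top_greatest)
  qed
qed

lemma first_exit_time:
  fixes \<gamma> :: "real \<Rightarrow> 'a::topological_space"
  assumes c: "continuous_on {0..1} \<gamma>" and W: "open W" "\<gamma> 0 \<in> W" "\<gamma> 1 \<notin> W"
  obtains t where "0 < t" "t \<le> 1" "\<gamma> t \<notin> W" "\<And>s. 0 \<le> s \<Longrightarrow> s < t \<Longrightarrow> \<gamma> s \<in> W"
proof -
  define T where "T = {0..1} \<inter> \<gamma> -` (- W)"
  have cl: "closed T" unfolding T_def using c W(1) by (intro continuous_closed_preimage) auto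
  have "1 \<in> T" unfolding T_def using W(3) by simp
  then have ne: "T \<noteq> {}" by blast
  have "bdd_below T" unfolding T_def by (rule bdd_belowI[of _ 0]) simp
  note ne = ne this
  define t where "t = Inf T"
  have tT: "t \<in> T" unfolding t_def using closed_contains_Inf[OF ne cl] .
  have "t \<noteq> 0" using tT W(2) unfolding T_def by auto
  moreover have "\<gamma> s \<in> W" if "0 \<le> s" "s < t" for s
  proof (rule ccontr)
    assume "\<gamma> s \<notin> W"
    then have "s \<in> T" unfolding T_def using that tT by (auto simp: T_def)
    then have "t \<le> s" unfolding t_def using ne(2) by (rule cInf_lower)
    then show False using that by simp
  qed
  ultimately show ?thesis using tT that[of t] unfolding T_def by auto
qed

locale riemannian_mfd =
  fixes M :: "('m::{t2_space,second_countable_topology}, 'e::euclidean_space) riemannian"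
  assumes riem: "riemannian_manifold M"

sublocale riemannian_mfd \<subseteq> atlas_manifold
  using riem unfolding riemannian_manifold_def by unfold_locales blast

context riemannian_mfd
begin

definition gram :: "('m, 'e) chart \<Rightarrow> 'e \<Rightarrow> 'e \<Rightarrow> 'e \<Rightarrow> real" where
  "gram c y a b = metric M (chart_inv c y) (coord_tvec M c (chart_inv c y) a) (coord_tvec M c (chart_inv c y) b)"

lemma metric_lin: "u \<in> tangent_space M x \<Longrightarrow> v \<in> tangent_space M x \<Longrightarrow> w \<in> tangent_space M x \<Longrightarrow>
    metric M x (\<lambda>c. r *\<^sub>R u c + s *\<^sub>R v c) w = r * metric M x u w + s * metric M x v w"
  using riem unfolding riemannian_manifold_def by blast

lemma metric_sym: "u \<in> tangent_space M x \<Longrightarrow> v \<in> tangent_space M x \<Longrightarrow> metric M x u v = metric M x v u"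
  using riem unfolding riemannian_manifold_def by blast

lemma metric_pos: "v \<in> tangent_space M x \<Longrightarrow> v \<noteq> (\<lambda>_. 0) \<Longrightarrow> metric M x v v > 0"
  using riem unfolding riemannian_manifold_def by blast

lemma chart_inv_at: "c \<in> charts M \<Longrightarrow> y \<in> chart_map c ` chart_dom c \<Longrightarrow> c \<in> charts_at M (chart_inv c y)"
  using chart_map_inv(2) chart_at by blast

lemma gram_linear1:
  assumes "c \<in> charts M" "y \<in> chart_map c ` chart_dom c" shows "linear (\<lambda>a. gram c y a b)"
proof -
  note ca = chart_inv_at[OF assms]
  have *: "gram c y (r *\<^sub>R a + s *\<^sub>R a') b = r * gram c y a b + s * gram c y a' b" for r s a a'
    unfolding gram_def coord_tvec_lin[OF ca] using coord_tvec_in[OF ca] by (intro metric_lin) auto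
  show ?thesis
  proof (rule linearI)
    fix a a' show "gram c y (a + a') b = gram c y a b + gram c y a' b" using *[of 1 a 1 a'] by simp
    fix r show "gram c y (r *\<^sub>R a) b = r *\<^sub>R gram c y a b" using *[of r a 0 a] by simp
  qed
qed

lemma gram_sym: "c \<in> charts M \<Longrightarrow> y \<in> chart_map c ` chart_dom c \<Longrightarrow> gram c y a b = gram c y b a"
  unfolding gram_def by (intro metric_sym coord_tvec_in chart_inv_at)

lemma gram_linear2:
  assumes "c \<in> charts M" "y \<in> chart_map c ` chart_dom c" shows "linear (gram c y a)"
proof -
  have "gram c y a = (\<lambda>b. gram c y b a)" using gram_sym[OF assms] by auto
  then show ?thesis using gram_linear1[OF assms] by simp
qed

lemma gram_pos:
  assumes "c \<in> charts M" "y \<in> chart_map c ` chart_dom c" "a \<noteq> 0" shows "gram c y a a > 0"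
proof -
  note ca = chart_inv_at[OF assms(1,2)]
  have "coord_tvec M c (chart_inv c y) a \<noteq> (\<lambda>_. 0)" using coord_tvec_self[OF ca, of a] assms(3) by metis
  then show ?thesis unfolding gram_def using metric_pos coord_tvec_in[OF ca] by blast
qed

text \<open>Smoothness of the metric is given for two fixed coordinate vectors. Linearity is used
  once in each argument to get joint continuity, and the diagonal is taken last.\<close>

lemma gram_cont:
  assumes c: "c \<in> charts M"
  shows "continuous_on ((chart_map c ` chart_dom c) \<times> UNIV) (\<lambda>(y, a). gram c y a a)"
proof -
  let ?W = "chart_map c ` chart_dom c"
  have s: "smooth_on ?W (\<lambda>y. gram c y a b)" for a b
    using riem c unfolding riemannian_manifold_def gram_def by blast
  have c0: "continuous_on ?W (\<lambda>y. gram c y a b)" for a b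
  proof -
    have "Ck_on 0 ?W (\<lambda>y. gram c y a b)" using s unfolding smooth_on_def by blast
    then show ?thesis by simp
  qed
  have c1: "continuous_on (?W \<times> UNIV) (\<lambda>(y, a). gram c y a b)" for b
    by (rule continuous_on_linear_family[OF c0 gram_linear1[OF c]])
  have c2: "continuous_on ((?W \<times> UNIV) \<times> UNIV) (\<lambda>(z, b). (\<lambda>z b. gram c (fst z) (snd z) b) z b)"
    by (rule continuous_on_linear_family) (use c1 gram_linear2[OF c] in \<open>auto simp: case_prod_beta\<close>)
  have "continuous_on (?W \<times> UNIV) (\<lambda>z. (\<lambda>(z, b). (\<lambda>z b. gram c (fst z) (snd z) b) z b) (z, snd z))"
    by (rule continuous_on_compose2[OF c2]) (auto intro!: continuous_intros)
  then show ?thesis by (simp add: case_prod_beta)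
qed

text \<open>The minimum of the quadratic form over \<open>K\<close> times the unit sphere is
  positive by definiteness; homogeneity gives all other vectors.\<close>

lemma gram_lower:
  assumes c: "c \<in> charts M" and K: "compact K" "K \<subseteq> chart_map c ` chart_dom c"
  obtains \<kappa> where "\<kappa> > 0" "\<And>y a. y \<in> K \<Longrightarrow> \<kappa> * norm a \<le> sqrt (gram c y a a)"
proof (cases "K = {}")
  case False
  let ?S = "K \<times> sphere (0::'e) 1"
  have "compact ?S" using K by (intro compact_Times) auto
  moreover have "?S \<noteq> {}" using False by auto
  moreover have "continuous_on ?S (\<lambda>(y, a). gram c y a a)"
    by (rule continuous_on_subset[OF gram_cont[OF c]]) (use K in auto)
  ultimately obtain z where z: "z \<in> ?S" "\<And>w. w \<in> ?S \<Longrightarrow> (\<lambda>(y, a). gram c y a a) z \<le> (\<lambda>(y, a). gram c y a a) w"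
    using continuous_attains_inf[of ?S "\<lambda>(y, a). gram c y a a"] by blast
  define m where "m = (\<lambda>(y, a). gram c y a a) z"
  have m0: "m > 0" unfolding m_def
  proof (cases z)
    case (Pair y a)
    then have "y \<in> chart_map c ` chart_dom c" "a \<noteq> 0" using z(1) K(2) by auto
    then show "(\<lambda>(y, a). gram c y a a) z > 0" using gram_pos[OF c] Pair by simp
  qed
  have "sqrt m * norm a \<le> sqrt (gram c y a a)" if y: "y \<in> K" for y a
  proof (cases "a = 0")
    case True
    have "linear (gram c y 0)" using gram_linear2[OF c] y K(2) by blast
    then show ?thesis using True by (simp add: linear_0)
  next
    case False
    let ?u = "a /\<^sub>R norm a"
    have yW: "y \<in> chart_map c ` chart_dom c" using y K by blast
    have "m \<le> gram c y ?u ?u" unfolding m_def using z(2)[of "(y, ?u)"] y False by simp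
    also have "gram c y ?u ?u = gram c y a a / (norm a)\<^sup>2"
      using linear_scale[OF gram_linear1[OF c yW]] linear_scale[OF gram_linear2[OF c yW]]
      by (simp add: power2_eq_square field_simps)
    finally have "m * (norm a)\<^sup>2 \<le> gram c y a a" using False by (simp add: field_simps)
    then have "sqrt (m * (norm a)\<^sup>2) \<le> sqrt (gram c y a a)" by (rule real_sqrt_le_mono)
    then show ?thesis by (simp add: real_sqrt_mult)
  qed
  then show ?thesis using that[of "sqrt m"] m0 by simp
qed (use that[of 1] in auto)

lemma velocity_in_chart:
  assumes c: "c \<in> charts_at M (\<gamma> s)" and \<gamma>: "continuous_on {0..1} \<gamma>" and s: "s \<in> {0<..<1}"
    and d: "\<And>c. c \<in> charts_at M (\<gamma> s) \<Longrightarrow> (chart_map c \<circ> \<gamma>) differentiable (at s)"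
  shows "velocity M \<gamma> s = coord_tvec M c (\<gamma> s) (vector_derivative (chart_map c \<circ> \<gamma>) (at s))"
proof -
  let ?c = "some_chart_at M (\<gamma> s)"
  have c0: "?c \<in> charts_at M (\<gamma> s)" by (rule some_chart_at)
  let ?v = "vector_derivative (chart_map ?c \<circ> \<gamma>) (at s)"
  have 1: "((chart_map ?c \<circ> \<gamma>) has_derivative (\<lambda>h. h *\<^sub>R ?v)) (at s)"
    using d[OF c0] vector_derivative_works unfolding has_vector_derivative_def by blast
  have 2: "(local_rep ?c c id has_derivative local_deriv ?c c id (\<gamma> s)) (at ((chart_map ?c \<circ> \<gamma>) s))"
    using local_deriv_has[OF diff_at_id c0, of c] c by simp
  have L: "linear (local_deriv ?c c id (\<gamma> s))" using local_deriv_linear[OF diff_at_id c0, of c] c by simp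
  have "((local_rep ?c c id \<circ> (chart_map ?c \<circ> \<gamma>)) has_derivative (local_deriv ?c c id (\<gamma> s) \<circ> (\<lambda>h. h *\<^sub>R ?v))) (at s)"
    by (rule diff_chain_at[OF 1 2])
  then have 3: "((local_rep ?c c id \<circ> (chart_map ?c \<circ> \<gamma>)) has_vector_derivative local_deriv ?c c id (\<gamma> s) ?v) (at s)"
    unfolding has_vector_derivative_def by (simp add: comp_def linear_scale[OF L])
  define N where "N = {0<..<1} \<inter> \<gamma> -` chart_dom ?c"
  have oN: "open N" unfolding N_def
  proof (rule continuous_open_preimage)
    show "continuous_on {0<..<1} \<gamma>" by (rule continuous_on_subset[OF \<gamma>]) auto
  qed (use c0 chart_props(1) in \<open>auto simp: chart_at\<close>)
  have sN: "s \<in> N" unfolding N_def using s c0 by (auto simp: chart_at)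
  have "((chart_map c \<circ> \<gamma>) has_vector_derivative local_deriv ?c c id (\<gamma> s) ?v) (at s)"
  proof (rule has_vector_derivative_transform_within_open[OF 3 oN sN])
    fix r assume "r \<in> N"
    then show "(local_rep ?c c id \<circ> (chart_map ?c \<circ> \<gamma>)) r = (chart_map c \<circ> \<gamma>) r"
      using chart_inv_map[of ?c] c0 unfolding N_def by (simp add: local_rep_def chart_at)
  qed
  then have v: "vector_derivative (chart_map c \<circ> \<gamma>) (at s) = local_deriv ?c c id (\<gamma> s) ?v"
    by (rule vector_derivative_at)
  have "velocity M \<gamma> s = coord_tvec M ?c (\<gamma> s) ?v" by (simp add: velocity_def Let_def)
  also have "\<dots> = coord_tvec M c (\<gamma> s) (coord_tvec M ?c (\<gamma> s) ?v c)"
    by (rule tvec_eq_coord[OF c coord_tvec_in[OF c0]])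
  finally show ?thesis unfolding v coord_tvec_at[OF c] .
qed

text \<open>Only the piece of the path up to time \<open>t\<close> has to stay in the coordinate
  region; the length of the rest is bounded below by 0. There the chart derivative is dominated by
  the Riemannian speed.\<close>

lemma path_len_lower:
  assumes c: "c \<in> charts M" and \<gamma>: "piecewise_C1_path M \<gamma>" and t: "0 \<le> t" "t \<le> 1"
    and W: "\<And>s. s \<in> {0..t} \<Longrightarrow> \<gamma> s \<in> chart_dom c \<inter> chart_map c -` B"
    and \<kappa>: "\<kappa> > 0" "\<And>y a. y \<in> B \<Longrightarrow> \<kappa> * norm a \<le> sqrt (gram c y a a)"
  shows "ennreal (\<kappa> * norm (chart_map c (\<gamma> t) - chart_map c (\<gamma> 0))) \<le> path_len M \<gamma>"
proof -
  let ?\<phi> = "chart_map c \<circ> \<gamma>"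
  have cont: "continuous_on {0..1} \<gamma>" using \<gamma> unfolding piecewise_C1_path_def by blast
  obtain K where K: "finite K" "\<And>c. c \<in> charts M \<Longrightarrow> (chart_map c \<circ> \<gamma>) C1_differentiable_on ({0<..<1} \<inter> \<gamma> -` chart_dom c - K)"
    using \<gamma> unfolding piecewise_C1_path_def by blast
  obtain D where D: "\<And>s. s \<in> {0<..<1} \<inter> \<gamma> -` chart_dom c - K \<Longrightarrow> (?\<phi> has_vector_derivative D s) (at s)"
     "continuous_on ({0<..<1} \<inter> \<gamma> -` chart_dom c - K) D"
    using K(2)[OF c] unfolding C1_differentiable_on_def by blast
  have sub: "{0<..<t} - K \<subseteq> {0<..<1} \<inter> \<gamma> -` chart_dom c - K" using W t by auto
  have c\<phi>: "continuous_on {0..t} ?\<phi>"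
    unfolding comp_def
    by (rule continuous_on_compose2[OF chart_cont(1)[OF c] continuous_on_subset[OF cont]]) (use W t in auto)
  have pt: "ennreal \<kappa> * ennreal (norm (if s \<in> {0<..<t} - K then D s else 0))
    \<le> ennreal (tnorm M (\<gamma> s) (velocity M \<gamma> s)) * indicator {0<..<1} s" for s
  proof (cases "s \<in> {0<..<t} - K")
    case True
    then have s: "s \<in> {0<..<1}" "\<gamma> s \<in> chart_dom c" "chart_map c (\<gamma> s) \<in> B" using W t by auto
    have ca: "c \<in> charts_at M (\<gamma> s)" using c s by (simp add: chart_at)
    have "(chart_map c' \<circ> \<gamma>) differentiable (at s)" if "c' \<in> charts_at M (\<gamma> s)" for c'
      using K(2)[of c'] that True s unfolding C1_differentiable_on_eq by (auto simp: chart_at)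
    from velocity_in_chart[OF ca cont s(1) this]
    have v: "velocity M \<gamma> s = coord_tvec M c (\<gamma> s) (vector_derivative ?\<phi> (at s))" .
    have vd: "vector_derivative ?\<phi> (at s) = D s"
      by (rule vector_derivative_at, rule D(1)) (use True sub in blast)
    have "\<kappa> * norm (D s) \<le> sqrt (gram c (chart_map c (\<gamma> s)) (D s) (D s))" by (rule \<kappa>(2)[OF s(3)])
    also have "\<dots> = tnorm M (\<gamma> s) (velocity M \<gamma> s)"
      unfolding v vd tnorm_def gram_def using chart_inv_map[OF c s(2)] by simp
    finally show ?thesis using True s \<kappa>(1) by (simp add: ennreal_mult'[symmetric] ennreal_leI)
  qed auto
  have m: "(\<lambda>s. ennreal (norm (if s \<in> {0<..<t} - K then D s else 0))) \<in> borel_measurable lborel"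
  proof -
    have "open ({0<..<t} - K)" using K by (intro open_Diff finite_imp_closed) auto
    then have "(\<lambda>s. if s \<in> {0<..<t} - K then D s else 0) \<in> borel_measurable borel"
      using borel_measurable_continuous_on_if[OF borel_open continuous_on_subset[OF D(2) sub]] by auto
    then show ?thesis by simp
  qed
  have "ennreal (\<kappa> * norm (?\<phi> t - ?\<phi> 0)) = ennreal \<kappa> * ennreal (norm (?\<phi> t - ?\<phi> 0))"
    using \<kappa>(1) by (simp add: ennreal_mult')
  also have "\<dots> \<le> ennreal \<kappa> * (\<integral>\<^sup>+s. ennreal (norm (if s \<in> {0<..<t} - K then D s else 0)) \<partial>lborel)"
    by (intro mult_left_mono norm_increment_le_length[OF t(1) K(1) c\<phi>])
      (use D sub continuous_on_subset[OF D(2) sub] in auto)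
  also have "\<dots> = (\<integral>\<^sup>+s. ennreal \<kappa> * ennreal (norm (if s \<in> {0<..<t} - K then D s else 0)) \<partial>lborel)"
    using m by (rule nn_integral_cmult[symmetric])
  also have "\<dots> \<le> path_len M \<gamma>" unfolding path_len_def by (intro nn_integral_mono pt)
  finally show ?thesis by simp
qed

text \<open>Near \<open>x\<close> the metric dominates a multiple of the Euclidean metric of a chart, so a path that leaves a
  coordinate ball has length bounded below.\<close>

lemma riem_dist_nbhd:
  assumes U: "open U" "x \<in> U"
  obtains V \<delta> where "open V" "x \<in> V" "V \<subseteq> U" "\<delta> > 0"
    "\<And>a b. a \<in> V \<Longrightarrow> riem_dist M a b < ennreal \<delta> \<Longrightarrow> b \<in> U"
proof -
  obtain c where "c \<in> charts_at M x" using charts_at_ne by blast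
  then have c: "c \<in> charts M" "x \<in> chart_dom c" by (auto simp: chart_at)
  have "open (chart_map c ` (U \<inter> chart_dom c))" using chart_image_open[OF c(1)] U(1) chart_props(1)[OF c(1)] by auto
  then obtain e where e: "e > 0" "cball (chart_map c x) e \<subseteq> chart_map c ` (U \<inter> chart_dom c)"
    using open_contains_cball U c by blast
  have sub: "cball (chart_map c x) e \<subseteq> chart_map c ` chart_dom c" using e(2) by blast
  obtain \<kappa> where \<kappa>: "\<kappa> > 0" "\<And>y a. y \<in> cball (chart_map c x) e \<Longrightarrow> \<kappa> * norm a \<le> sqrt (gram c y a a)"
    by (rule gram_lower[OF c(1) compact_cball sub], rule that)
  define B where "B r = chart_dom c \<inter> chart_map c -` ball (chart_map c x) r" for r
  have oB: "open (B r)" for r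
    unfolding B_def using chart_cont(1)[OF c(1)] chart_props(1)[OF c(1)] open_ball by (rule continuous_open_preimage)
  have BU: "B e \<subseteq> U"
  proof
    fix y assume "y \<in> B e"
    then have y: "y \<in> chart_dom c" "chart_map c y \<in> cball (chart_map c x) e" unfolding B_def by auto
    then obtain z where "z \<in> U" "z \<in> chart_dom c" "chart_map c y = chart_map c z" using e(2) by blast
    then show "y \<in> U" using chart_inv_map[OF c(1)] y(1) by metis
  qed
  have xB: "x \<in> B (e/2)" unfolding B_def using c e(1) by simp
  have Be: "B (e/2) \<subseteq> B e" unfolding B_def using e(1) by auto
  have key: "b \<in> U" if a: "a \<in> B (e/2)" and lt: "riem_dist M a b < ennreal (\<kappa> * (e/2))" for a b
  proof (rule ccontr)
    assume b: "b \<notin> U"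
    obtain \<gamma> where \<gamma>: "piecewise_C1_path M \<gamma>" "\<gamma> 0 = a" "\<gamma> 1 = b" "path_len M \<gamma> < ennreal (\<kappa> * (e/2))"
      using lt unfolding riem_dist_def INF_less_iff by blast
    have cont: "continuous_on {0..1} \<gamma>" using \<gamma>(1) unfolding piecewise_C1_path_def by blast
    have g0: "\<gamma> 0 \<in> B e" "\<gamma> 1 \<notin> B e" using a \<gamma> b BU Be by auto
    obtain T where T: "0 < T" "T \<le> 1" "\<gamma> T \<notin> B e" "\<And>s. 0 \<le> s \<Longrightarrow> s < T \<Longrightarrow> \<gamma> s \<in> B e"
      by (rule first_exit_time[OF cont oB g0], rule that)
    \<comment> \<open>Chosen so that coordinate distance more than \<open>r\<close> from
      \<open>x\<close> forces coordinate distance more than \<open>e / 2\<close> from the starting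
      point \<open>a\<close>. It is below \<open>e\<close> because \<open>a\<close> lies in the
      half-size ball.\<close>
    define r where "r = e/2 + dist (chart_map c x) (chart_map c a)"
    have r: "r < e" using a unfolding r_def B_def by simp
    \<comment> \<open>The exit point itself may lie outside the chart, so a time before
      \<open>T\<close> is needed. If all earlier points stayed within \<open>r\<close>, they would
      lie in the compact, hence closed, image of a closed ball, and so would
      \<open>\<gamma> T\<close>, which would then not have left.\<close>
    have "\<exists>t. 0 \<le> t \<and> t < T \<and> r < dist (chart_map c x) (chart_map c (\<gamma> t))"
    proof (rule ccontr)
      assume "\<not> ?thesis"
      then have le: "\<And>t. 0 \<le> t \<Longrightarrow> t < T \<Longrightarrow> dist (chart_map c x) (chart_map c (\<gamma> t)) \<le> r" by (meson not_less)
      define Kr where "Kr = chart_inv c ` cball (chart_map c x) r"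
      have "cball (chart_map c x) r \<subseteq> cball (chart_map c x) e" using r by auto
      then have "continuous_on (cball (chart_map c x) r) (chart_inv c)"
        using chart_cont(2)[OF c(1)] sub by (meson continuous_on_subset order_trans)
      then have "compact Kr" unfolding Kr_def by (intro compact_continuous_image) auto
      then have clK: "closed Kr" by (rule compact_imp_closed)
      have "closed ({0..1} \<inter> \<gamma> -` Kr)" using cont clK by (intro continuous_closed_preimage) auto
      moreover have "{0..<T} \<subseteq> {0..1} \<inter> \<gamma> -` Kr"
      proof
        fix t assume t: "t \<in> {0..<T}"
        then have "\<gamma> t \<in> chart_dom c" using T(4)[of t] unfolding B_def by auto
        then have "\<gamma> t = chart_inv c (chart_map c (\<gamma> t))" using chart_inv_map[OF c(1)] by simp
        then show "t \<in> {0..1} \<inter> \<gamma> -` Kr" using le[of t] t T(2) unfolding Kr_def by auto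
      qed
      ultimately have "closure {0..<T} \<subseteq> {0..1} \<inter> \<gamma> -` Kr" by (rule closure_minimal[rotated])
      moreover have "T \<in> closure {0..<T}" using T(1) by simp
      ultimately have "\<gamma> T \<in> Kr" by blast
      then obtain y where y: "y \<in> cball (chart_map c x) r" "\<gamma> T = chart_inv c y" unfolding Kr_def by blast
      then have yW: "y \<in> chart_map c ` chart_dom c" using sub r by (auto simp: subset_iff)
      have "\<gamma> T \<in> B e" unfolding B_def using y chart_map_inv[OF c(1) yW] r by simp
      then show False using T(3) by blast
    qed
    then obtain t where t: "0 \<le> t" "t < T" "r < dist (chart_map c x) (chart_map c (\<gamma> t))" by blast
    have "ennreal (\<kappa> * norm (chart_map c (\<gamma> t) - chart_map c (\<gamma> 0))) \<le> path_len M \<gamma>"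
    proof (rule path_len_lower[OF c(1) \<gamma>(1) t(1) _ _ \<kappa>(1) \<kappa>(2)])
      show "t \<le> 1" using t T by simp
      show "\<gamma> s \<in> chart_dom c \<inter> chart_map c -` cball (chart_map c x) e" if "s \<in> {0..t}" for s
        using T(4)[of s] that t(2) unfolding B_def by auto
    qed auto
    also have "\<dots> < ennreal (\<kappa> * (e/2))" by (rule \<gamma>(4))
    finally have "\<kappa> * norm (chart_map c (\<gamma> t) - chart_map c a) < \<kappa> * (e/2)"
      using \<kappa>(1) e(1) \<gamma>(2) by (simp add: ennreal_less_iff)
    then have "norm (chart_map c (\<gamma> t) - chart_map c a) < e/2" using \<kappa>(1) by simp
    moreover have "dist (chart_map c x) (chart_map c (\<gamma> t)) \<le> dist (chart_map c x) (chart_map c a) + dist (chart_map c a) (chart_map c (\<gamma> t))"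
      by (rule dist_triangle)
    ultimately show False using t(3) unfolding r_def by (simp add: dist_norm norm_minus_commute)
  qed
  show ?thesis
  proof (rule that[OF oB xB _ _ key])
    show "B (e/2) \<subseteq> U" using Be BU by blast
    show "\<kappa> * (e/2) > 0" using \<kappa>(1) e(1) by simp
  qed
qed

end

section \<open>The unit sphere bundle\<close>

lemma continuous_on_locally:
  assumes "\<And>x. x \<in> S \<Longrightarrow> \<exists>U. open U \<and> x \<in> U \<and> continuous_on (S \<inter> U) f"
  shows "continuous_on S f"
  unfolding continuous_on_topological
proof (intro ballI allI impI)
  fix x B assume x: "x \<in> S" and B: "open B" "f x \<in> B"
  obtain U where U: "open U" "x \<in> U" "continuous_on (S \<inter> U) f" using assms[OF x] by blast
  have xS: "x \<in> S \<inter> U" using x U(2) by blast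
  from U(3)[unfolded continuous_on_topological, rule_format, OF xS B]
  obtain A where A: "open A" "x \<in> A" "\<forall>y\<in>S \<inter> U. y \<in> A \<longrightarrow> f y \<in> B" by blast
  then show "\<exists>A. open A \<and> x \<in> A \<and> (\<forall>y\<in>S. y \<in> A \<longrightarrow> f y \<in> B)"
    using U(1,2) by (intro exI[of _ "A \<inter> U"]) auto
qed

locale embedded_mfd = riemannian_mfd M for M :: "('m::{t2_space,second_countable_topology}, 'e::euclidean_space) riemannian" +
  fixes X :: "'m set" and \<iota> :: "'m \<Rightarrow> ('m, 'e) tvec \<Rightarrow> 'r::euclidean_space"
  assumes X_compact: "compact X" and X_ne: "X \<noteq> {}"
    and emb_ax: "tangent_embedding M X \<iota>"
begin

definition emb :: "('m, 'e) chart \<Rightarrow> 'm \<Rightarrow> 'e \<Rightarrow> 'r" where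
  "emb c x a = \<iota> x (coord_tvec M c x a)"

definition fibre :: "'m \<Rightarrow> 'r set" where "fibre x = \<iota> x ` tangent_space M x"

definition tbundle :: "('m \<times> 'r) set" where "tbundle = {(x, w). x \<in> X \<and> w \<in> fibre x}"

definition sph :: "('m \<times> 'r) set" where "sph = {(x, w). x \<in> X \<and> w \<in> fibre x \<and> norm w = 1}"

definition tvof :: "'m \<Rightarrow> 'r \<Rightarrow> ('m, 'e) tvec" where "tvof x w = inv_into (tangent_space M x) (\<iota> x) w"

definition push :: "('m \<Rightarrow> 'm) \<Rightarrow> 'm \<Rightarrow> 'r \<Rightarrow> 'r" where
  "push h x w = \<iota> (h x) (differential M h x (tvof x w))"

definition smap :: "('m \<Rightarrow> 'm) \<Rightarrow> 'm \<times> 'r \<Rightarrow> 'm \<times> 'r" where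
  "smap h = (\<lambda>(x, w). (h x, push h x w /\<^sub>R norm (push h x w)))"

definition slog :: "('m \<Rightarrow> 'm) \<Rightarrow> 'm \<times> 'r \<Rightarrow> real" where
  "slog h = (\<lambda>(x, w). ln (norm (push h x w)))"

text \<open>The deterministic properties shared by almost all maps of a random map in
  \<open>Diff1_loc\<close>; the estimates for single steps rest on these.\<close>

definition good :: "('m \<Rightarrow> 'm) \<Rightarrow> bool" where "good h \<longleftrightarrow> C1_local_diffeo M h \<and> h ` X \<subseteq> X"

lemma X_closed: "closed X" using X_compact by (rule compact_imp_closed)

lemma iota_lin: "x \<in> X \<Longrightarrow> u \<in> tangent_space M x \<Longrightarrow> v \<in> tangent_space M x \<Longrightarrow>
    \<iota> x (\<lambda>c. r *\<^sub>R u c + s *\<^sub>R v c) = r *\<^sub>R \<iota> x u + s *\<^sub>R \<iota> x v"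
  using emb_ax unfolding tangent_embedding_def by blast

lemma iota_norm: "x \<in> X \<Longrightarrow> v \<in> tangent_space M x \<Longrightarrow> norm (\<iota> x v) = tnorm M x v"
  using emb_ax unfolding tangent_embedding_def by blast

lemma emb_cont: "c \<in> charts M \<Longrightarrow> continuous_on ((chart_dom c \<inter> X) \<times> UNIV) (\<lambda>(x, a). emb c x a)"
  using emb_ax unfolding tangent_embedding_def emb_def by blast

lemma emb_linear:
  assumes x: "x \<in> X" and c: "c \<in> charts_at M x" shows "linear (emb c x)"
proof -
  have *: "emb c x (r *\<^sub>R a + s *\<^sub>R b) = r *\<^sub>R emb c x a + s *\<^sub>R emb c x b" for r s a b
    unfolding emb_def coord_tvec_lin[OF c] by (intro iota_lin x coord_tvec_in c)
  show ?thesis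
  proof (rule linearI)
    fix a b show "emb c x (a + b) = emb c x a + emb c x b" using *[of 1 a 1 b] by simp
    fix r show "emb c x (r *\<^sub>R a) = r *\<^sub>R emb c x a" using *[of r a 0 a] by simp
  qed
qed

lemma iota_inj:
  assumes x: "x \<in> X" shows "inj_on (\<iota> x) (tangent_space M x)"
proof (rule inj_onI)
  fix u v assume u: "u \<in> tangent_space M x" and v: "v \<in> tangent_space M x" and e: "\<iota> x u = \<iota> x v"
  define d where "d = (\<lambda>c. 1 *\<^sub>R u c + (-1) *\<^sub>R v c)"
  have d: "d \<in> tangent_space M x" unfolding d_def by (rule tvec_lin_in[OF u v])
  have "\<iota> x d = 0" unfolding d_def using iota_lin[OF x u v, of 1 "-1"] e by simp
  then have "metric M x d d = 0" using iota_norm[OF x d] unfolding tnorm_def by simp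
  then have z: "d = (\<lambda>_. 0)" using metric_pos[OF d] by fastforce
  show "u = v"
  proof
    fix c show "u c = v c" using fun_cong[OF z, of c] by (simp add: d_def)
  qed
qed

lemma tvof_props:
  assumes "w \<in> fibre x" shows "tvof x w \<in> tangent_space M x" "\<iota> x (tvof x w) = w"
  using inv_into_into[of w "\<iota> x" "tangent_space M x"] f_inv_into_f[of w "\<iota> x" "tangent_space M x"] assms
  unfolding tvof_def fibre_def by simp_all

lemma tvof_iota: "x \<in> X \<Longrightarrow> v \<in> tangent_space M x \<Longrightarrow> tvof x (\<iota> x v) = v"
  unfolding tvof_def by (rule inv_into_f_f[OF iota_inj])

lemma tvof_emb: "x \<in> X \<Longrightarrow> c \<in> charts_at M x \<Longrightarrow> tvof x (emb c x a) = coord_tvec M c x a"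
  unfolding emb_def by (rule tvof_iota[OF _ coord_tvec_in])

lemma emb_in: "c \<in> charts_at M x \<Longrightarrow> emb c x a \<in> fibre x"
  unfolding emb_def fibre_def using coord_tvec_in by blast

lemma fibre_eq: "c \<in> charts_at M x \<Longrightarrow> fibre x = range (emb c x)"
  unfolding fibre_def tangent_space_eq emb_def by (simp add: image_image)

lemma emb_coord:
  assumes "c \<in> charts_at M x" "w \<in> fibre x" shows "emb c x (tvof x w c) = w"
  unfolding emb_def using tvec_eq_coord[OF assms(1) tvof_props(1)[OF assms(2)]] tvof_props(2)[OF assms(2)] by simp

lemma coord_emb: "x \<in> X \<Longrightarrow> c \<in> charts_at M x \<Longrightarrow> tvof x (emb c x a) c = a"
  by (simp add: tvof_emb coord_tvec_self)

lemma emb_inj: "x \<in> X \<Longrightarrow> c \<in> charts_at M x \<Longrightarrow> inj (emb c x)"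
  by (metis coord_emb injI)

lemma emb_zero_iff: "x \<in> X \<Longrightarrow> c \<in> charts_at M x \<Longrightarrow> emb c x a = 0 \<longleftrightarrow> a = 0"
  using emb_inj emb_linear linear_injective_0 linear_0 by metis

lemma fibre_subspace:
  assumes "x \<in> X" shows "subspace (fibre x)"
proof -
  obtain c where c: "c \<in> charts_at M x" using charts_at_ne by blast
  show ?thesis unfolding fibre_eq[OF c] by (rule linear_subspace_image[OF emb_linear[OF assms c] subspace_UNIV])
qed

text \<open>The extremal values of the norm on \<open>K\<close> times the unit sphere; the smaller
  one is positive because the embedding is injective on fibres.\<close>

lemma emb_bounds:
  assumes c: "c \<in> charts M" and K: "compact K" "K \<subseteq> chart_dom c \<inter> X"
  obtains k1 k2 where "k1 > 0" "\<And>x a. x \<in> K \<Longrightarrow> k1 * norm a \<le> norm (emb c x a)"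
    "\<And>x a. x \<in> K \<Longrightarrow> norm (emb c x a) \<le> k2 * norm a"
proof (cases "K = {}")
  case False
  let ?S = "K \<times> sphere (0::'e) 1" and ?n = "\<lambda>(x, a). norm (emb c x a)"
  have S: "compact ?S" "?S \<noteq> {}" using K False by (auto intro: compact_Times)
  have cont: "continuous_on ?S ?n"
    using continuous_on_norm[OF continuous_on_subset[OF emb_cont[OF c], of ?S]] K by (auto simp: case_prod_beta)
  obtain z where z: "z \<in> ?S" "\<forall>w\<in>?S. ?n z \<le> ?n w"
    using continuous_attains_inf[OF S cont] by blast
  obtain y where y: "y \<in> ?S" "\<forall>w\<in>?S. ?n w \<le> ?n y"
    using continuous_attains_sup[OF S cont] by blast
  have zp: "?n z > 0"
  proof (cases z)
    case (Pair x a)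
    then have "x \<in> X" "c \<in> charts_at M x" "a \<noteq> 0" using z(1) K c by (auto simp: chart_at)
    then show ?thesis using Pair emb_zero_iff by simp
  qed
  have sc: "norm (emb c x a) = norm (emb c x (a /\<^sub>R norm a)) * norm a" "(x, a /\<^sub>R norm a) \<in> ?S"
    if x: "x \<in> K" and a: "a \<noteq> 0" for x a
  proof -
    have "x \<in> X" "c \<in> charts_at M x" using x K c by (auto simp: chart_at)
    then have "linear (emb c x)" by (rule emb_linear)
    then show "norm (emb c x a) = norm (emb c x (a /\<^sub>R norm a)) * norm a" using a by (simp add: linear_scale)
    show "(x, a /\<^sub>R norm a) \<in> ?S" using x a by simp
  qed
  have e0: "emb c x 0 = 0" if "x \<in> K" for x
  proof -
    have "x \<in> X" "c \<in> charts_at M x" using that K c by (auto simp: chart_at)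
    then show ?thesis using emb_zero_iff by blast
  qed
  have 1: "?n z * norm a \<le> norm (emb c x a)" if x: "x \<in> K" for x a
  proof (cases "a = 0")
    case False
    have "?n z \<le> norm (emb c x (a /\<^sub>R norm a))" using z(2) sc(2)[OF x False] by fastforce
    then show ?thesis unfolding sc(1)[OF x False] by (rule mult_right_mono) simp
  qed (use e0[OF x] in simp)
  have 2: "norm (emb c x a) \<le> ?n y * norm a" if x: "x \<in> K" for x a
  proof (cases "a = 0")
    case False
    have "norm (emb c x (a /\<^sub>R norm a)) \<le> ?n y" using y(2) sc(2)[OF x False] by fastforce
    then show ?thesis unfolding sc(1)[OF x False] by (rule mult_right_mono) simp
  qed (use e0[OF x] in simp)
  show ?thesis by (rule that[OF zp 1 2])
qed (use that[of 1] in auto)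

text \<open>The coordinates invert \<open>emb\<close>, and the lower bound \<open>k1\<close>,
  uniform on a compact neighbourhood of the base point, controls the error of the coordinates by the
  error of the embedded vectors.\<close>

lemma coord_cont:
  assumes c: "c \<in> charts M"
  shows "continuous_on {(x, w) \<in> tbundle. x \<in> chart_dom c} (\<lambda>(x, w). tvof x w c)"
proof (rule continuous_on_sequentiallyI)
  fix u :: "nat \<Rightarrow> 'm \<times> 'r" and z
  assume u: "\<forall>n. u n \<in> {(x, w) \<in> tbundle. x \<in> chart_dom c}" and z: "z \<in> {(x, w) \<in> tbundle. x \<in> chart_dom c}"
    and lim: "u \<longlonglongrightarrow> z"
  obtain x w where zx: "z = (x, w)" by (cases z)
  have x: "x \<in> X" "x \<in> chart_dom c" "w \<in> fibre x" using z zx unfolding tbundle_def by auto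
  define y where "y n = fst (u n)" for n
  define v where "v n = snd (u n)" for n
  have un: "u n = (y n, v n)" for n by (simp add: y_def v_def)
  have yn: "y n \<in> X" "y n \<in> chart_dom c" "v n \<in> fibre (y n)" for n
    using u[rule_format, of n] unfolding un tbundle_def by auto
  have yl: "y \<longlonglongrightarrow> x" "v \<longlonglongrightarrow> w" using tendsto_fst[OF lim] tendsto_snd[OF lim] unfolding y_def v_def zx by auto
  obtain V K where V: "open V" "x \<in> V" "V \<subseteq> K" "compact K" "K \<subseteq> chart_dom c"
    by (rule chart_compact_nbhd[OF c x(2)], rule that)
  have K: "compact (K \<inter> X)" "K \<inter> X \<subseteq> chart_dom c \<inter> X" using V X_closed by (auto intro: compact_Int_closed)
  obtain k1 k2 where k: "k1 > 0" "\<And>x a. x \<in> K \<inter> X \<Longrightarrow> k1 * norm a \<le> norm (emb c x a)"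
    "\<And>x a. x \<in> K \<inter> X \<Longrightarrow> norm (emb c x a) \<le> k2 * norm a"
    by (rule emb_bounds[OF c K], rule that)
  let ?a = "tvof x w c"
  have ex: "emb c x ?a = w" using emb_coord x c by (auto simp: chart_at)
  have el: "(\<lambda>n. emb c (y n) ?a) \<longlonglongrightarrow> w"
  proof -
    have cc: "continuous_on (chart_dom c \<inter> X) (\<lambda>x. (\<lambda>(x, a). emb c x a) (x, ?a))"
      by (rule continuous_on_compose2[OF emb_cont[OF c]]) (auto intro!: continuous_intros)
    have "((\<lambda>x. (\<lambda>(x, a). emb c x a) (x, ?a)) \<circ> y) \<longlonglongrightarrow> (\<lambda>(x, a). emb c x a) (x, ?a)"
      using cc[unfolded continuous_on_sequentially, rule_format, of x y] x yn yl by blast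
    then show ?thesis using ex by (simp add: comp_def)
  qed
  have "(\<lambda>n. tvof (y n) (v n) c - ?a) \<longlonglongrightarrow> 0"
  proof (rule Lim_null_comparison)
    show "eventually (\<lambda>n. norm (tvof (y n) (v n) c - ?a) \<le> norm (v n - emb c (y n) ?a) / k1) sequentially"
      using topological_tendstoD[OF yl(1) V(1,2)]
    proof eventually_elim
      case (elim n)
      have ca: "c \<in> charts_at M (y n)" using yn c by (simp add: chart_at)
      have "k1 * norm (tvof (y n) (v n) c - ?a) \<le> norm (emb c (y n) (tvof (y n) (v n) c - ?a))"
        using k(2) elim V(3) yn by blast
      also have "emb c (y n) (tvof (y n) (v n) c - ?a) = v n - emb c (y n) ?a"
        using linear_diff[OF emb_linear[OF yn(1) ca]] emb_coord[OF ca yn(3)] by simp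
      finally show ?case using k(1) by (simp add: field_simps)
    qed
    have "(\<lambda>n. norm (v n - emb c (y n) ?a) / k1) \<longlonglongrightarrow> norm (w - w) / k1"
      by (intro tendsto_intros yl el) (use k(1) in simp)
    then show "(\<lambda>n. norm (v n - emb c (y n) ?a) / k1) \<longlonglongrightarrow> 0" by simp
  qed
  then have "(\<lambda>n. tvof (y n) (v n) c) \<longlonglongrightarrow> ?a" by (simp add: LIM_zero_iff)
  then show "(\<lambda>n. case u n of (x, w) \<Rightarrow> tvof x w c) \<longlonglongrightarrow> (case z of (x, w) \<Rightarrow> tvof x w c)"
    unfolding un zx by simp
qed

lemma chart_cover:
  obtains C c K where "finite C" "C \<subseteq> X" "\<And>i. i \<in> C \<Longrightarrow> c i \<in> charts M" "\<And>i. i \<in> C \<Longrightarrow> compact (K i)"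
    "\<And>i. i \<in> C \<Longrightarrow> K i \<subseteq> chart_dom (c i) \<inter> X" "X = (\<Union>i\<in>C. K (i::'m))"
proof -
  have "\<exists>q. open (fst q) \<and> x \<in> fst q \<and> fst q \<subseteq> fst (snd q) \<and> compact (fst (snd q)) \<and> snd (snd q) \<in> charts M
     \<and> fst (snd q) \<subseteq> chart_dom (snd (snd q))" for x
  proof -
    obtain c where "c \<in> charts_at M x" using charts_at_ne by blast
    then have c: "c \<in> charts M" "x \<in> chart_dom c" by (auto simp: chart_at)
    obtain V K where "open V" "x \<in> V" "V \<subseteq> K" "compact K" "K \<subseteq> chart_dom c"
      by (rule chart_compact_nbhd[OF c], rule that)
    then show ?thesis using c by (intro exI[of _ "(V, K, c)"]) simp
  qed
  then have "\<forall>x. \<exists>q. open (fst q) \<and> x \<in> fst q \<and> fst q \<subseteq> fst (snd q) \<and> compact (fst (snd q)) \<and> snd (snd q) \<in> charts M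
     \<and> fst (snd q) \<subseteq> chart_dom (snd (snd q))" by blast
  from choice[OF this] obtain q where q: "\<forall>x. open (fst (q x)) \<and> x \<in> fst (q x) \<and> fst (q x) \<subseteq> fst (snd (q x)) \<and> compact (fst (snd (q x)))
     \<and> snd (snd (q x)) \<in> charts M \<and> fst (snd (q x)) \<subseteq> chart_dom (snd (snd (q x)))" ..
  have cov: "X \<subseteq> (\<Union>x\<in>X. fst (q x))" using q by blast
  obtain C where C: "C \<subseteq> X" "finite C" "X \<subseteq> (\<Union>x\<in>C. fst (q x))"
    by (rule compactE_image[OF X_compact _ cov], use q in blast, rule that)
  show ?thesis
  proof (rule that[of C "\<lambda>x. snd (snd (q x))" "\<lambda>x. fst (snd (q x)) \<inter> X"])
    show "X = (\<Union>i\<in>C. fst (snd (q i)) \<inter> X)"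
    proof
      show "X \<subseteq> (\<Union>i\<in>C. fst (snd (q i)) \<inter> X)"
      proof
        fix x assume x: "x \<in> X"
        then obtain i where "i \<in> C" "x \<in> fst (q i)" using C(3) by blast
        then show "x \<in> (\<Union>i\<in>C. fst (snd (q i)) \<inter> X)" using q x by blast
      qed
    qed blast
    show "\<And>i. i \<in> C \<Longrightarrow> compact (fst (snd (q i)) \<inter> X)" using q X_closed by (intro compact_Int_closed) auto
    show "\<And>i. i \<in> C \<Longrightarrow> fst (snd (q i)) \<inter> X \<subseteq> chart_dom (snd (snd (q i))) \<inter> X" using q by blast
  qed (use C q in auto)
qed

definition nemb :: "('m, 'e) chart \<Rightarrow> 'm \<Rightarrow> 'e \<Rightarrow> 'm \<times> 'r" where
  "nemb c x a = (x, emb c x a /\<^sub>R norm (emb c x a))"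

lemma nemb_in: "x \<in> X \<Longrightarrow> c \<in> charts_at M x \<Longrightarrow> a \<noteq> 0 \<Longrightarrow> nemb c x a \<in> sph"
  unfolding nemb_def sph_def using emb_in[of c x a] emb_zero_iff subspace_scale[OF fibre_subspace] by auto

lemma nemb_cont:
  assumes c: "c \<in> charts M"
  shows "continuous_on ((chart_dom c \<inter> X) \<times> (-{0})) (\<lambda>(x, a). nemb c x a)"
proof -
  let ?D = "(chart_dom c \<inter> X) \<times> (-{0::'e})"
  have e: "continuous_on ?D (\<lambda>z. emb c (fst z) (snd z))"
    using continuous_on_subset[OF emb_cont[OF c], of ?D] by (auto simp: case_prod_beta)
  have "continuous_on ?D (\<lambda>z. (fst z, emb c (fst z) (snd z) /\<^sub>R norm (emb c (fst z) (snd z))))"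
    using emb_zero_iff c by (intro continuous_intros e) (auto simp: chart_at)
  then show ?thesis by (simp add: nemb_def case_prod_beta)
qed

lemma sph_nemb:
  assumes s: "(x, w) \<in> sph" and c: "c \<in> charts_at M x"
  shows "(x, w) = nemb c x (tvof x w c)" "tvof x w c \<noteq> 0"
proof -
  have w: "w \<in> fibre x" "norm w = 1" "x \<in> X" using s unfolding sph_def by auto
  have e: "emb c x (tvof x w c) = w" by (rule emb_coord[OF c w(1)])
  show "(x, w) = nemb c x (tvof x w c)" unfolding nemb_def e using w by simp
  show "tvof x w c \<noteq> 0"
  proof
    assume "tvof x w c = 0"
    then have "w = 0" using e emb_zero_iff[OF w(3) c, of 0] by simp
    then show False using w(2) by simp
  qed
qed

text \<open>Finitely many continuous images of products of a compact piece of \<open>X\<close> with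
  the coordinate unit sphere. A coordinate vector may be normalized first because
  \<open>nemb\<close> is invariant under positive scaling.\<close>

lemma sph_compact: "compact sph"
proof -
  obtain C c K where C: "finite C" "C \<subseteq> X" "\<And>i. i \<in> C \<Longrightarrow> c i \<in> charts M" "\<And>i. i \<in> C \<Longrightarrow> compact (K i)"
    "\<And>i. i \<in> C \<Longrightarrow> K i \<subseteq> chart_dom (c i) \<inter> X" "X = (\<Union>i\<in>C. K (i::'m))"
    by (rule chart_cover, rule that)
  have "sph = (\<Union>i\<in>C. (\<lambda>(x, a). nemb (c i) x a) ` (K i \<times> sphere 0 1))"
  proof (intro equalityI subsetI)
    fix z assume z: "z \<in> sph"
    obtain x w where zx: "z = (x, w)" by (cases z)
    have x: "x \<in> X" using z zx unfolding sph_def by auto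
    then obtain i where i: "i \<in> C" "x \<in> K i" using C(6) by blast
    have ca: "c i \<in> charts_at M x" using C(3,5) i by (auto simp: chart_at)
    let ?a = "tvof x w (c i)"
    have s: "(x, w) = nemb (c i) x ?a" "?a \<noteq> 0" using sph_nemb[OF _ ca] z zx by auto
    have L: "linear (emb (c i) x)" by (rule emb_linear[OF x ca])
    have "nemb (c i) x (?a /\<^sub>R norm ?a) = nemb (c i) x ?a"
      using s(2) unfolding nemb_def by (simp add: linear_scale[OF L])
    then have "z = (\<lambda>(x, a). nemb (c i) x a) (x, ?a /\<^sub>R norm ?a)" using zx s by simp
    moreover have "(x, ?a /\<^sub>R norm ?a) \<in> K i \<times> sphere 0 1" using i s(2) by simp
    ultimately show "z \<in> (\<Union>i\<in>C. (\<lambda>(x, a). nemb (c i) x a) ` (K i \<times> sphere 0 1))" using i(1) by blast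
  next
    fix z assume "z \<in> (\<Union>i\<in>C. (\<lambda>(x, a). nemb (c i) x a) ` (K i \<times> sphere 0 1))"
    then obtain i x a where i: "i \<in> C" "x \<in> K i" "a \<in> sphere 0 1" "z = nemb (c i) x a" by auto
    then have "x \<in> X" "c i \<in> charts_at M x" "a \<noteq> 0" using C(3,5)[OF i(1)] by (auto simp: chart_at)
    then show "z \<in> sph" using i(4) nemb_in by simp
  qed
  moreover have "compact ((\<lambda>(x, a). nemb (c i) x a) ` (K i \<times> sphere 0 1))" if "i \<in> C" for i
    using C(3-5)[OF that] by (intro compact_continuous_image compact_Times continuous_on_subset[OF nemb_cont[OF C(3)[OF that]]]) auto
  ultimately show ?thesis using C(1) by (simp add: compact_UN)
qed

lemma sph_ne: "sph \<noteq> {}"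
proof -
  obtain x where x: "x \<in> X" using X_ne by blast
  obtain c where c: "c \<in> charts_at M x" using charts_at_ne by blast
  obtain a :: 'e where "a \<in> Basis" using nonempty_Basis by blast
  then have "a \<noteq> 0" by auto
  then show ?thesis using nemb_in[OF x c] by blast
qed

lemma sph_bundle: "sph \<subseteq> tbundle" unfolding sph_def tbundle_def by auto

lemma push_emb:
  assumes "diff_at M h x" "x \<in> X" "c \<in> charts_at M x" "c' \<in> charts_at M (h x)"
  shows "push h x (emb c x a) = emb c' (h x) (local_deriv c c' h x a)"
  unfolding push_def tvof_emb[OF assms(2,3)]
  using differential_eq[OF assms(1) coord_tvec_in[OF assms(3)] assms(3,4)] coord_tvec_self[OF assms(3)]
  by (simp add: emb_def)

lemma push_in: "diff_at M h x \<Longrightarrow> w \<in> fibre x \<Longrightarrow> push h x w \<in> fibre (h x)"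
  unfolding push_def fibre_def[of "h x"] using differential_in tvof_props(1) by blast

lemma push_scale:
  assumes h: "diff_at M h x" and x: "x \<in> X" "h x \<in> X" and w: "w \<in> fibre x"
  shows "push h x (r *\<^sub>R w) = r *\<^sub>R push h x w"
proof -
  obtain c c' where c: "c \<in> charts_at M x" "c' \<in> charts_at M (h x)" using charts_at_ne by blast
  obtain a where a: "w = emb c x a" using w fibre_eq[OF c(1)] by blast
  have "push h x (emb c x (r *\<^sub>R a)) = r *\<^sub>R push h x (emb c x a)"
    unfolding push_emb[OF h x(1) c] linear_scale[OF local_deriv_linear[OF h c]] linear_scale[OF emb_linear[OF x(2) c(2)]] ..
  then show ?thesis unfolding a linear_scale[OF emb_linear[OF x(1) c(1)]] .
qed

lemma push_comp:
  assumes "diff_at M h x" "diff_at M k (h x)" "h x \<in> X" "w \<in> fibre x"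
  shows "push (k \<circ> h) x w = push k (h x) (push h x w)"
  using differential_comp[OF assms(1,2) tvof_props(1)[OF assms(4)]] tvof_iota[OF assms(3) differential_in[OF assms(1) tvof_props(1)[OF assms(4)]]]
  by (simp add: push_def)

lemma good_diff: "good h \<Longrightarrow> diff_at M h x" unfolding good_def using C1_local_diffeo_diff_at by blast

lemma good_in: "good h \<Longrightarrow> x \<in> X \<Longrightarrow> h x \<in> X" unfolding good_def by blast

lemma push_nonzero:
  assumes h: "good h" and x: "x \<in> X" and w: "w \<in> fibre x" "w \<noteq> 0"
  shows "push h x w \<noteq> 0"
proof -
  obtain c c' where c: "c \<in> charts_at M x" "c' \<in> charts_at M (h x)" using charts_at_ne by blast
  obtain a where a: "w = emb c x a" using w fibre_eq[OF c(1)] by blast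
  have a0: "a \<noteq> 0" using a w(2) emb_zero_iff[OF x c(1)] by simp
  have "inj (local_deriv c c' h x)" using local_deriv_inj(1) h c unfolding good_def by blast
  then have "local_deriv c c' h x a \<noteq> 0"
    using a0 local_deriv_linear[OF good_diff[OF h] c] linear_injective_0 by blast
  then show ?thesis unfolding a push_emb[OF good_diff[OF h] x c] using emb_zero_iff[OF good_in[OF h x] c(2)] by simp
qed

lemma good_cont: "good h \<Longrightarrow> continuous_on X h"
  using good_diff unfolding diff_at_def by (auto intro: continuous_at_imp_continuous_on)

text \<open>Near a point \<open>push\<close> factors through coordinates, the derivative in charts
  and the embedding of the target fibre, each of them jointly continuous.\<close>

lemma push_cont:
  assumes h: "good h" shows "continuous_on tbundle (\<lambda>(x, w). push h x w)"
proof (rule continuous_on_locally)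
  fix z assume "z \<in> tbundle"
  then obtain x0 w0 where z: "z = (x0, w0)" "x0 \<in> X" "w0 \<in> fibre x0" unfolding tbundle_def by auto
  obtain c c' where c: "c \<in> charts_at M x0" "c' \<in> charts_at M (h x0)" using charts_at_ne by blast
  have cM: "c \<in> charts M" "c' \<in> charts M" using c by (auto simp: chart_at)
  have hd: "C1_local_diffeo M h" using h unfolding good_def by blast
  obtain W where W: "open W" "x0 \<in> W" "W \<subseteq> chart_dom c" "\<And>x. x \<in> W \<Longrightarrow> h x \<in> chart_dom c'"
    "continuous_on W h" "continuous_on (W \<times> UNIV) (\<lambda>(x, a). local_deriv c c' h x a)"
    by (rule local_deriv_cont[OF hd c], rule that)
  let ?B = "tbundle \<inter> W \<times> UNIV"
  have 1: "continuous_on ?B (\<lambda>z. tvof (fst z) (snd z) c)"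
    using continuous_on_subset[OF coord_cont[OF cM(1)], of ?B] W(3) by (auto simp: case_prod_beta)
  have 2: "continuous_on ?B (\<lambda>z. local_deriv c c' h (fst z) (tvof (fst z) (snd z) c))"
  proof -
    have "continuous_on ?B (\<lambda>z. (\<lambda>(x, a). local_deriv c c' h x a) (fst z, tvof (fst z) (snd z) c))"
      by (rule continuous_on_compose2[OF W(6)]) (use 1 in \<open>auto intro!: continuous_intros\<close>)
    then show ?thesis by simp
  qed
  have 3: "continuous_on ?B (\<lambda>z. h (fst z))"
    by (rule continuous_on_compose2[OF W(5)]) (auto intro!: continuous_intros)
  have XB: "fst z \<in> X" if "z \<in> ?B" for z using that unfolding tbundle_def by auto
  have 4: "continuous_on ?B (\<lambda>z. (\<lambda>(x, a). emb c' x a) (h (fst z), local_deriv c c' h (fst z) (tvof (fst z) (snd z) c)))"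
    by (rule continuous_on_compose2[OF emb_cont[OF cM(2)]]) (use 2 3 W(4) XB good_in[OF h] in \<open>auto intro!: continuous_intros\<close>)
  have "continuous_on ?B (\<lambda>(x, w). push h x w)"
  proof (subst continuous_on_cong[OF refl])
    fix y assume y: "y \<in> ?B"
    obtain x w where yx: "y = (x, w)" "x \<in> X" "w \<in> fibre x" "x \<in> W" using y unfolding tbundle_def by auto
    have ca: "c \<in> charts_at M x" "c' \<in> charts_at M (h x)" using cM W(3,4) yx by (auto simp: chart_at)
    have "push h x w = push h x (emb c x (tvof x w c))" using emb_coord[OF ca(1) yx(3)] by simp
    also have "\<dots> = emb c' (h x) (local_deriv c c' h x (tvof x w c))" by (rule push_emb[OF good_diff[OF h] yx(2) ca])
    finally show "(\<lambda>(x, w). push h x w) y = (\<lambda>(x, a). emb c' x a) (h (fst y), local_deriv c c' h (fst y) (tvof (fst y) (snd y) c))"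
      using yx by simp
  qed (rule 4)
  then show "\<exists>U. open U \<and> z \<in> U \<and> continuous_on (tbundle \<inter> U) (\<lambda>(x, w). push h x w)"
    using W z by (intro exI[of _ "W \<times> UNIV"]) (auto intro: open_Times)
qed

lemma sph_norm_push: "good h \<Longrightarrow> s \<in> sph \<Longrightarrow> norm (push h (fst s) (snd s)) > 0"
proof -
  assume h: "good h" and s: "s \<in> sph"
  have "fst s \<in> X" "snd s \<in> fibre (fst s)" "snd s \<noteq> 0" using s unfolding sph_def by auto
  then show ?thesis using push_nonzero[OF h] by simp
qed

lemma sph_push_cont: "good h \<Longrightarrow> continuous_on sph (\<lambda>s. push h (fst s) (snd s))"
  using continuous_on_subset[OF push_cont sph_bundle] by (simp add: case_prod_beta)

lemma smap_cont: "good h \<Longrightarrow> continuous_on sph (smap h)"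
proof -
  assume h: "good h"
  have "continuous_on sph (\<lambda>s. h (fst s))"
    by (rule continuous_on_compose2[OF good_cont[OF h]]) (auto simp: sph_def intro!: continuous_intros)
  moreover have "\<forall>s\<in>sph. norm (push h (fst s) (snd s)) \<noteq> 0" using sph_norm_push[OF h] by fastforce
  ultimately have "continuous_on sph (\<lambda>s. (h (fst s), push h (fst s) (snd s) /\<^sub>R norm (push h (fst s) (snd s))))"
    by (intro continuous_intros sph_push_cont[OF h]) auto
  then show ?thesis by (simp add: smap_def case_prod_beta)
qed

lemma slog_cont: "good h \<Longrightarrow> continuous_on sph (slog h)"
proof -
  assume h: "good h"
  have "\<forall>s\<in>sph. norm (push h (fst s) (snd s)) \<noteq> 0" using sph_norm_push[OF h] by fastforce
  then have "continuous_on sph (\<lambda>s. ln (norm (push h (fst s) (snd s))))"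
    by (intro continuous_intros sph_push_cont[OF h]) auto
  then show ?thesis by (simp add: slog_def case_prod_beta)
qed

lemma smap_in:
  assumes h: "good h" and s: "s \<in> sph" shows "smap h s \<in> sph"
proof -
  obtain x w where sx: "s = (x, w)" "x \<in> X" "w \<in> fibre x" "norm w = 1" using s unfolding sph_def by auto
  have "push h x w \<in> fibre (h x)" by (rule push_in[OF good_diff[OF h] sx(3)])
  moreover have "push h x w \<noteq> 0" using push_nonzero[OF h sx(2,3)] sx(4) norm_zero by fastforce
  moreover have "w \<noteq> 0" using sx(4) by auto
  ultimately show ?thesis unfolding sx smap_def sph_def
    using good_in[OF h sx(2)] subspace_scale[OF fibre_subspace[OF good_in[OF h sx(2)]]] by auto
qed

end

section \<open>Comparison with the sup norms and with the distances of derivatives\<close>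

lemma ennreal_cSUP_le:
  fixes f :: "'a \<Rightarrow> real"
  assumes "A \<noteq> {}" "\<And>s. s \<in> A \<Longrightarrow> ennreal (f s) \<le> B" "\<And>s. s \<in> A \<Longrightarrow> 0 \<le> f s"
  shows "ennreal (SUP s\<in>A. f s) \<le> B"
proof (cases B)
  case (real r)
  have "(SUP s\<in>A. f s) \<le> r"
    using assms real by (intro cSUP_least) (auto simp: ennreal_le_iff)
  then show ?thesis using real by (simp add: ennreal_leI)
qed simp

lemma log_plus_mono:
  assumes "a \<le> b" shows "log_plus a \<le> log_plus b"
proof (cases "b = \<infinity>")
  case False
  then have fin: "a \<noteq> \<infinity>" using assms by (auto simp: top_unique)
  have le: "enn2real a \<le> enn2real b" using assms False by (intro enn2real_mono) (auto simp: less_top)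
  have "max 0 (ln (enn2real a)) \<le> max 0 (ln (enn2real b))"
  proof (cases "enn2real a > 0")
    case True
    then have "ln (enn2real a) \<le> ln (enn2real b)" using le by simp
    then show ?thesis by simp
  next
    case False
    then have "enn2real a = 0" using enn2real_nonneg[of a] by linarith
    then show ?thesis by simp
  qed
  moreover have "log_plus a = ennreal (max 0 (ln (enn2real a)))" "log_plus b = ennreal (max 0 (ln (enn2real b)))"
    using False fin unfolding log_plus_def by (simp_all only: if_False)
  ultimately show ?thesis by (simp only: ennreal_leI)
qed (simp add: log_plus_def)

lemma log_plus_ennreal: "0 \<le> a \<Longrightarrow> log_plus (ennreal a) = ennreal (max 0 (ln a))"
  by (simp add: log_plus_def)

text \<open>Only \<open>norm a\<close> occurs in the denominator, so in the application the
  threshold depends on the inverse derivative of \<open>f\<close> and not on that of the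
  perturbation.\<close>

lemma norm_normalize_diff:
  fixes a b :: "'a::real_normed_vector"
  assumes "a \<noteq> 0" "b \<noteq> 0"
  shows "norm (a /\<^sub>R norm a - b /\<^sub>R norm b) \<le> 2 * norm (a - b) / norm a"
proof -
  have "a /\<^sub>R norm a - b /\<^sub>R norm b = (a - b) /\<^sub>R norm a + (1 / norm a - 1 / norm b) *\<^sub>R b"
    by (simp add: algebra_simps divide_inverse)
  also have "norm \<dots> \<le> norm ((a - b) /\<^sub>R norm a) + norm ((1 / norm a - 1 / norm b) *\<^sub>R b)"
    by (rule norm_triangle_ineq)
  also have "norm ((1 / norm a - 1 / norm b) *\<^sub>R b) = \<bar>norm b - norm a\<bar> / norm a"
  proof -
    have "(1 / norm a - 1 / norm b) * norm b = (norm b - norm a) / norm a" using assms by (simp add: field_simps)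
    then have "\<bar>(1 / norm a - 1 / norm b) * norm b\<bar> = \<bar>norm b - norm a\<bar> / norm a" by simp
    then show ?thesis by (simp add: abs_mult)
  qed
  also have "\<bar>norm b - norm a\<bar> / norm a \<le> norm (a - b) / norm a"
    using norm_triangle_ineq3[of b a] by (intro divide_right_mono) (auto simp: norm_minus_commute)
  finally have "norm (a /\<^sub>R norm a - b /\<^sub>R norm b) \<le> norm ((a - b) /\<^sub>R norm a) + norm (a - b) / norm a" by simp
  moreover have "norm ((a - b) /\<^sub>R norm a) = norm (a - b) / norm a" by (simp add: divide_inverse mult.commute)
  ultimately show ?thesis by simp
qed

lemma orth_proj_props:
  fixes S :: "'r::euclidean_space set"
  assumes S: "subspace S"
  shows "orth_proj S w \<in> S" "norm (orth_proj S w) \<le> norm w" "w \<in> S \<Longrightarrow> orth_proj S w = w"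
proof -
  obtain y z where yz: "y \<in> span S" "\<And>s. s \<in> span S \<Longrightarrow> orthogonal z s" "w = y + z"
    using orthogonal_subspace_decomp_exists[of S w] by metis
  have sp: "span S = S" using S by (simp add: span_eq_iff)
  have y: "y \<in> S" "\<forall>s\<in>S. orthogonal (w - y) s" using yz sp by auto
  have u: "q = y" if q: "q \<in> S" "\<forall>s\<in>S. orthogonal (w - q) s" for q
  proof -
    have d: "q - y \<in> S" using S q(1) y(1) by (rule subspace_diff)
    have "(w - y) \<bullet> (q - y) = 0" "(w - q) \<bullet> (q - y) = 0" using y(2) q(2) d unfolding orthogonal_def by blast+
    then have "(q - y) \<bullet> (q - y) = 0" by (simp add: inner_diff_left)
    then show ?thesis by simp
  qed
  have e: "orth_proj S w = y" unfolding orth_proj_def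
    by (rule the_equality) (use y u in blast)+
  show "orth_proj S w \<in> S" using e y by simp
  have "(w - y) \<bullet> y = 0" using y unfolding orthogonal_def by blast
  then have "(norm w)\<^sup>2 = (norm y)\<^sup>2 + (norm (w - y))\<^sup>2"
    by (simp add: power2_norm_eq_inner inner_diff_left inner_diff_right inner_commute algebra_simps)
  then have "(norm y)\<^sup>2 \<le> (norm w)\<^sup>2" by simp
  then show "norm (orth_proj S w) \<le> norm w" unfolding e using power2_le_imp_le norm_ge_zero by blast
  show "orth_proj S w = w" if "w \<in> S" unfolding e using u[OF that] by (simp add: orthogonal_def)
qed

text \<open>\<open>onorm\<close> is a real supremum, hence informative only when the quotients are
  bounded; the constant \<open>C\<close> provides this.\<close>

lemma le_onorm_point:
  fixes f :: "'a::real_normed_vector \<Rightarrow> 'b::real_normed_vector"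
  assumes C: "\<And>x. norm (f x) \<le> C * norm x" and x: "norm x = 1"
  shows "norm (f x) \<le> onorm f"
proof -
  have "bdd_above (range (\<lambda>x. norm (f x) / norm x))"
  proof (rule bdd_aboveI2)
    fix y show "norm (f y) / norm y \<le> max C 0"
    proof (cases "y = 0")
      case False then show ?thesis using C[of y] by (simp add: divide_le_eq le_max_iff_disj)
    qed simp
  qed
  from cSUP_upper[OF UNIV_I this, of x] show ?thesis using x by (simp add: onorm_def)
qed

context embedded_mfd
begin

abbreviation pnorm :: "('m \<Rightarrow> 'm) \<Rightarrow> 'm \<times> 'r \<Rightarrow> real" where
  "pnorm h s \<equiv> norm (push h (fst s) (snd s))"

definition Umax :: "('m \<Rightarrow> 'm) \<Rightarrow> real" where "Umax h = (SUP s\<in>sph. pnorm h s)"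

text \<open>The sup norm of the inverse derivative, expressed through the expansion of unit vectors.
  As the supremum of a continuous function on a compact set it is a real number, and later it is a
  measurable function of the parameter.\<close>

definition Linv :: "('m \<Rightarrow> 'm) \<Rightarrow> real" where "Linv h = (SUP s\<in>sph. 1 / pnorm h s)"

definition ediff :: "('m \<Rightarrow> 'm) \<Rightarrow> ('m \<Rightarrow> 'm) \<Rightarrow> real" where
  "ediff f g = (SUP s\<in>sph. norm (push f (fst s) (snd s) - push g (fst s) (snd s)))"

lemma bdd_sph: "continuous_on sph (f :: _ \<Rightarrow> real) \<Longrightarrow> bdd_above (f ` sph)"
  by (intro bounded_imp_bdd_above compact_imp_bounded compact_continuous_image sph_compact)

lemma pnorm_cont: "good h \<Longrightarrow> continuous_on sph (pnorm h)"
  by (intro continuous_on_norm sph_push_cont)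

lemma inv_pnorm_cont: "good h \<Longrightarrow> continuous_on sph (\<lambda>s. 1 / pnorm h s)"
  using sph_norm_push by (intro continuous_intros sph_push_cont) force+

lemma pdiff_cont: "good f \<Longrightarrow> good g \<Longrightarrow> continuous_on sph (\<lambda>s. norm (push f (fst s) (snd s) - push g (fst s) (snd s)))"
  by (intro continuous_intros sph_push_cont)

lemma pnorm_le_Umax: "good h \<Longrightarrow> s \<in> sph \<Longrightarrow> pnorm h s \<le> Umax h"
  unfolding Umax_def by (rule cSUP_upper[OF _ bdd_sph[OF pnorm_cont]])

lemma inv_le_Linv: "good h \<Longrightarrow> s \<in> sph \<Longrightarrow> 1 / pnorm h s \<le> Linv h"
  unfolding Linv_def by (rule cSUP_upper[OF _ bdd_sph[OF inv_pnorm_cont]])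

lemma pdiff_le: "good f \<Longrightarrow> good g \<Longrightarrow> s \<in> sph \<Longrightarrow> norm (push f (fst s) (snd s) - push g (fst s) (snd s)) \<le> ediff f g"
  unfolding ediff_def by (rule cSUP_upper[OF _ bdd_sph[OF pdiff_cont]])

lemma Umax_pos: "good h \<Longrightarrow> 0 < Umax h"
  using sph_ne sph_norm_push pnorm_le_Umax by (metis all_not_in_conv less_le_trans)

lemma Linv_pos: assumes "good h" shows "0 < Linv h"
proof -
  obtain s where s: "s \<in> sph" using sph_ne by blast
  have "0 < 1 / pnorm h s" using sph_norm_push[OF assms s] by simp
  then show ?thesis using inv_le_Linv[OF assms s] by linarith
qed

lemma ediff_nonneg: assumes "good f" "good g" shows "0 \<le> ediff f g"
proof -
  obtain s where s: "s \<in> sph" using sph_ne by blast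
  show ?thesis using pdiff_le[OF assms s] norm_ge_zero order_trans by blast
qed

lemma slog_bounds:
  assumes h: "good h" and s: "s \<in> sph"
  shows "slog h s \<le> ln (Umax h)" "- ln (Linv h) \<le> slog h s"
    "\<bar>slog h s\<bar> \<le> max 0 (ln (Umax h)) + max 0 (ln (Linv h))"
proof -
  have p: "0 < pnorm h s" by (rule sph_norm_push[OF h s])
  have e: "slog h s = ln (pnorm h s)" by (simp add: slog_def case_prod_beta)
  show 1: "slog h s \<le> ln (Umax h)" unfolding e
    using ln_le_cancel_iff[OF p Umax_pos[OF h]] pnorm_le_Umax[OF h s] by blast
  have "ln (1 / pnorm h s) \<le> ln (Linv h)" using p inv_le_Linv[OF h s] by (subst ln_le_cancel_iff) (auto intro: Linv_pos[OF h])
  then show 2: "- ln (Linv h) \<le> slog h s" unfolding e using p by (simp add: ln_div)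
  show "\<bar>slog h s\<bar> \<le> max 0 (ln (Umax h)) + max 0 (ln (Linv h))" using 1 2 by linarith
qed

text \<open>Stated for maps that are merely differentiable at the point, so that it makes the
  supremum in \<open>tangent_onorm\<close> bounded for iterates too.\<close>

lemma push_bound_ex:
  assumes h: "diff_at M h x" and x: "x \<in> X" "h x \<in> X"
  obtains C where "\<And>w. w \<in> fibre x \<Longrightarrow> norm (push h x w) \<le> C * norm w"
proof -
  obtain c c' where c: "c \<in> charts_at M x" "c' \<in> charts_at M (h x)" using charts_at_ne by blast
  have cM: "c \<in> charts M" "x \<in> chart_dom c" using c by (auto simp: chart_at)
  have L: "bounded_linear (\<lambda>a. emb c' (h x) (local_deriv c c' h x a))"
    using linear_compose[OF local_deriv_linear[OF h c] emb_linear[OF x(2) c(2)]]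
    by (simp add: comp_def linear_conv_bounded_linear)
  obtain B where B: "B > 0" "\<And>a. norm (emb c' (h x) (local_deriv c c' h x a)) \<le> norm a * B"
    using bounded_linear.pos_bounded[OF L] by blast
  have K: "compact {x}" "{x} \<subseteq> chart_dom c \<inter> X" using x cM by auto
  obtain k1 k2 where k: "k1 > 0" "\<And>y a. y \<in> {x} \<Longrightarrow> k1 * norm a \<le> norm (emb c y a)"
    "\<And>y a. y \<in> {x} \<Longrightarrow> norm (emb c y a) \<le> k2 * norm a"
    by (rule emb_bounds[OF cM(1) K], rule that)
  have "norm (push h x w) \<le> (B / k1) * norm w" if w: "w \<in> fibre x" for w
  proof -
    obtain a where a: "w = emb c x a" using w fibre_eq[OF c(1)] by blast
    have "norm (push h x w) \<le> norm a * B" unfolding a push_emb[OF h x(1) c] by (rule B(2))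
    also have "norm a \<le> norm w / k1" using k(2)[of x a] k(1) a by (simp add: field_simps)
    finally show ?thesis using B(1) by (simp add: mult_right_mono field_simps)
  qed
  then show ?thesis by (rule that)
qed

lemma tnorm_push:
  assumes h: "diff_at M h x" and x: "x \<in> X" "h x \<in> X" and w: "w \<in> fibre x"
  shows "tnorm M (h x) (differential M h x (tvof x w)) = norm (push h x w)" "tnorm M x (tvof x w) = norm w"
  using iota_norm[OF x(2) differential_in[OF h tvof_props(1)[OF w]]] iota_norm[OF x(1) tvof_props(1)[OF w]] tvof_props(2)[OF w]
  by (simp_all add: push_def)

lemma tvof_surj: "x \<in> X \<Longrightarrow> v \<in> tangent_space M x \<Longrightarrow> \<exists>w\<in>fibre x. v = tvof x w"
  using tvof_iota unfolding fibre_def by (metis imageI)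

lemma push_le_tangent_onorm:
  assumes h: "diff_at M h x" and x: "x \<in> X" "h x \<in> X" and w: "w \<in> fibre x" "norm w \<le> 1"
  shows "norm (push h x w) \<le> tangent_onorm M x (h x) (differential M h x)"
proof -
  obtain C where C: "\<And>w. w \<in> fibre x \<Longrightarrow> norm (push h x w) \<le> C * norm w"
    by (rule push_bound_ex[OF h x], rule that)
  let ?V = "{v \<in> tangent_space M x. tnorm M x v \<le> 1}"
  have "bdd_above ((\<lambda>v. tnorm M (h x) (differential M h x v)) ` ?V)"
  proof (rule bdd_aboveI2)
    fix v assume v: "v \<in> ?V"
    then obtain u where u: "u \<in> fibre x" "v = tvof x u" using tvof_surj[OF x(1)] by blast
    have "norm u \<le> 1" using tnorm_push(2)[OF h x u(1)] v u(2) by simp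
    have "norm (push h x u) \<le> C * norm u" by (rule C[OF u(1)])
    also have "\<dots> \<le> max C 0 * 1" using \<open>norm u \<le> 1\<close> by (intro mult_mono) auto
    finally show "tnorm M (h x) (differential M h x v) \<le> max C 0" using tnorm_push(1)[OF h x u(1)] u(2) by simp
  qed
  from cSUP_upper[OF _ this, of "tvof x w"] show ?thesis
    using tvof_props(1)[OF w(1)] tnorm_push[OF h x w(1)] w(2) unfolding tangent_onorm_def by simp
qed

lemma tangent_onorm_le:
  assumes h: "diff_at M h x" and x: "x \<in> X" "h x \<in> X"
    and C: "\<And>w. w \<in> fibre x \<Longrightarrow> norm w \<le> 1 \<Longrightarrow> norm (push h x w) \<le> C"
  shows "tangent_onorm M x (h x) (differential M h x) \<le> C"
  unfolding tangent_onorm_def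
proof (rule cSUP_least)
  have z: "0 \<in> fibre x" using subspace_0[OF fibre_subspace[OF x(1)]] .
  have "tvof x 0 \<in> {v \<in> tangent_space M x. tnorm M x v \<le> 1}"
    using tvof_props(1)[OF z] tnorm_push(2)[OF h x z] by simp
  then show "{v \<in> tangent_space M x. tnorm M x v \<le> 1} \<noteq> {}" by blast
  fix v assume v: "v \<in> {v \<in> tangent_space M x. tnorm M x v \<le> 1}"
  then obtain u where u: "u \<in> fibre x" "v = tvof x u" using tvof_surj[OF x(1)] by blast
  then show "tnorm M (h x) (differential M h x v) \<le> C" using C[OF u(1)] tnorm_push[OF h x u(1)] v by simp
qed

lemma Umax_le_sup_norm_D:
  assumes h: "good h" shows "ennreal (Umax h) \<le> sup_norm_D M X h"
  unfolding Umax_def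
proof (rule ennreal_cSUP_le[OF sph_ne])
  fix s assume s: "s \<in> sph"
  obtain x w where sx: "s = (x, w)" "x \<in> X" "w \<in> fibre x" "norm w = 1" using s unfolding sph_def by auto
  have "ennreal (norm (push h x w)) \<le> ennreal (tangent_onorm M x (h x) (differential M h x))"
    using push_le_tangent_onorm[OF good_diff[OF h] sx(2) good_in[OF h sx(2)] sx(3)] sx(4) by (intro ennreal_leI) simp
  also have "\<dots> \<le> sup_norm_D M X h" unfolding sup_norm_D_def using sx(2) by (intro SUP_upper) auto
  finally show "ennreal (pnorm h s) \<le> sup_norm_D M X h" using sx by simp
qed simp

definition pinv :: "('m \<Rightarrow> 'm) \<Rightarrow> 'm \<Rightarrow> 'r \<Rightarrow> 'r" where
  "pinv h x u = \<iota> x (differential_inv M h x (tvof (h x) u))"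

lemma pinv_push:
  assumes h: "good h" and x: "x \<in> X" and w: "w \<in> fibre x"
  shows "pinv h x (push h x w) = w" "differential_inv M h x (tvof (h x) (push h x w)) = tvof x w"
proof -
  have b: "bij_betw (differential M h x) (tangent_space M x) (tangent_space M (h x))"
    using differential_bij h unfolding good_def by blast
  have "tvof (h x) (push h x w) = differential M h x (tvof x w)"
    unfolding push_def by (rule tvof_iota[OF good_in[OF h x] differential_in[OF good_diff[OF h] tvof_props(1)[OF w]]])
  then show e: "differential_inv M h x (tvof (h x) (push h x w)) = tvof x w"
    unfolding differential_inv_def using b tvof_props(1)[OF w] by (simp add: bij_betw_def inv_into_f_f)
  show "pinv h x (push h x w) = w" unfolding pinv_def e by (rule tvof_props(2)[OF w])
qed

lemma push_surj:
  assumes h: "good h" and x: "x \<in> X" and u: "u \<in> fibre (h x)"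
  obtains w where "w \<in> fibre x" "u = push h x w"
proof -
  have b: "bij_betw (differential M h x) (tangent_space M x) (tangent_space M (h x))"
    using differential_bij h unfolding good_def by blast
  have "tvof (h x) u \<in> differential M h x ` tangent_space M x" using b tvof_props(1)[OF u] unfolding bij_betw_def by simp
  then obtain v where v: "v \<in> tangent_space M x" "tvof (h x) u = differential M h x v" by blast
  have "push h x (\<iota> x v) = u"
    unfolding push_def tvof_iota[OF x v(1)] v(2)[symmetric] by (rule tvof_props(2)[OF u])
  then show ?thesis using that[of "\<iota> x v"] v(1) unfolding fibre_def by blast
qed

lemma norm_pinv:
  assumes h: "good h" and x: "x \<in> X" and u: "u \<in> fibre (h x)"
  shows "norm (pinv h x u) \<le> Linv h * norm u"
proof -
  obtain w where w: "w \<in> fibre x" "u = push h x w" by (rule push_surj[OF h x u], rule that)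
  show ?thesis
  proof (cases "w = 0")
    case True
    then show ?thesis unfolding w(2) pinv_push(1)[OF h x w(1)] using Linv_pos[OF h] by simp
  next
    case False
    let ?w = "w /\<^sub>R norm w"
    have s: "(x, ?w) \<in> sph" unfolding sph_def using x w(1) False subspace_scale[OF fibre_subspace[OF x]] by auto
    have "push h x ?w = push h x w /\<^sub>R norm w" by (rule push_scale[OF good_diff[OF h] x good_in[OF h x] w(1)])
    then have "norm w / norm (push h x w) \<le> Linv h" using inv_le_Linv[OF h s] False by (simp add: field_simps)
    moreover have "norm (push h x w) > 0" using push_nonzero[OF h x w(1) False] by simp
    ultimately show ?thesis unfolding w(2) pinv_push(1)[OF h x w(1)] by (simp add: field_simps)
  qed
qed

lemma tnorm_pinv:
  assumes h: "good h" and x: "x \<in> X" and u: "u \<in> fibre (h x)"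
  shows "tnorm M x (differential_inv M h x (tvof (h x) u)) = norm (pinv h x u)"
proof -
  obtain w where w: "w \<in> fibre x" "u = push h x w" by (rule push_surj[OF h x u], rule that)
  show ?thesis unfolding w(2) pinv_push[OF h x w(1)] using iota_norm[OF x tvof_props(1)[OF w(1)]] tvof_props(2)[OF w(1)] by simp
qed

text \<open>The inverse derivative is tested on the normalized image of \<open>w\<close>, which it
  sends to \<open>w\<close> divided by the norm of that image.\<close>

lemma Linv_le_sup_norm_Dinv:
  assumes h: "good h" shows "ennreal (Linv h) \<le> sup_norm_Dinv M X h"
  unfolding Linv_def
proof (rule ennreal_cSUP_le[OF sph_ne])
  fix s assume s: "s \<in> sph"
  obtain x w where sx: "s = (x, w)" "x \<in> X" "w \<in> fibre x" "norm w = 1" using s unfolding sph_def by auto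
  have hx: "h x \<in> X" by (rule good_in[OF h sx(2)])
  let ?u = "push h x w"
  have uf: "?u \<in> fibre (h x)" by (rule push_in[OF good_diff[OF h] sx(3)])
  have un: "norm ?u > 0" using sph_norm_push[OF h s] sx by simp
  define u where "u = ?u /\<^sub>R norm ?u"
  have u: "u \<in> fibre (h x)" "norm u = 1" unfolding u_def using subspace_scale[OF fibre_subspace[OF hx] uf] un by auto
  have wn: "w /\<^sub>R norm ?u \<in> fibre x" by (rule subspace_scale[OF fibre_subspace[OF sx(2)] sx(3)])
  have "u = push h x (w /\<^sub>R norm ?u)" unfolding u_def by (rule push_scale[OF good_diff[OF h] sx(2) hx sx(3), symmetric])
  then have pu: "pinv h x u = w /\<^sub>R norm ?u" using pinv_push(1)[OF h sx(2) wn] by simp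
  let ?V = "{v \<in> tangent_space M (h x). tnorm M (h x) v \<le> 1}"
  have tn: "tnorm M (h x) (tvof (h x) z) = norm z" if "z \<in> fibre (h x)" for z
    using iota_norm[OF hx tvof_props(1)[OF that]] tvof_props(2)[OF that] by simp
  have bd: "bdd_above ((\<lambda>v. tnorm M x (differential_inv M h x v)) ` ?V)"
  proof (rule bdd_aboveI2)
    fix v assume v: "v \<in> ?V"
    then obtain z where z: "z \<in> fibre (h x)" "v = tvof (h x) z" using tvof_surj[OF hx] by blast
    have "norm z \<le> 1" using v z tn by simp
    then have "Linv h * norm z \<le> Linv h * 1" using Linv_pos[OF h] by (intro mult_left_mono) auto
    then show "tnorm M x (differential_inv M h x v) \<le> Linv h"
      using norm_pinv[OF h sx(2) z(1)] tnorm_pinv[OF h sx(2) z(1)] z(2) by simp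
  qed
  have "1 / norm ?u = norm (pinv h x u)" unfolding pu using sx(4) by (simp add: divide_inverse)
  also have "\<dots> \<le> tangent_onorm M (h x) x (differential_inv M h x)"
    unfolding tangent_onorm_def tnorm_pinv[OF h sx(2) u(1), symmetric]
    by (rule cSUP_upper[OF _ bd]) (use tvof_props(1)[OF u(1)] tn[OF u(1)] u(2) in simp)
  finally have "ennreal (1 / norm ?u) \<le> ennreal (tangent_onorm M (h x) x (differential_inv M h x))" by (rule ennreal_leI)
  also have "\<dots> \<le> sup_norm_Dinv M X h" unfolding sup_norm_Dinv_def using sx(2) by (intro SUP_upper) auto
  finally show "ennreal (1 / pnorm h s) \<le> sup_norm_Dinv M X h" using sx by simp
qed simp

definition dom_fun :: "('m \<Rightarrow> 'm) \<Rightarrow> real" where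
  "dom_fun h = max 0 (ln (Umax h)) + max 0 (ln (Linv h))"

lemma dom_fun_le:
  assumes h: "good h"
  shows "ennreal (dom_fun h) \<le> log_plus (sup_norm_D M X h) + log_plus (sup_norm_Dinv M X h)"
proof -
  have "ennreal (dom_fun h) = log_plus (ennreal (Umax h)) + log_plus (ennreal (Linv h))"
    unfolding dom_fun_def log_plus_ennreal[OF less_imp_le[OF Umax_pos[OF h]]] log_plus_ennreal[OF less_imp_le[OF Linv_pos[OF h]]]
    by (rule ennreal_plus) simp_all
  also have "\<dots> \<le> log_plus (sup_norm_D M X h) + log_plus (sup_norm_Dinv M X h)"
    by (intro add_mono log_plus_mono Umax_le_sup_norm_D Linv_le_sup_norm_Dinv h)
  finally show ?thesis .
qed

lemma ambient_D: "ambient M \<iota> x (h x) (differential M h x) w = push h x (orth_proj (fibre x) w)"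
  by (simp add: ambient_def push_def tvof_def fibre_def)

lemma ambient_Dinv: "ambient M \<iota> (h x) x (differential_inv M h x) w = pinv h x (orth_proj (fibre (h x)) w)"
  by (simp add: ambient_def pinv_def tvof_def fibre_def)

lemma push_le:
  assumes h: "good h" and x: "x \<in> X" and w: "w \<in> fibre x"
  shows "norm (push h x w) \<le> Umax h * norm w"
proof (cases "w = 0")
  case True
  then show ?thesis using push_scale[OF good_diff[OF h] x good_in[OF h x] w, of 0] by simp
next
  case False
  let ?w = "w /\<^sub>R norm w"
  have s: "(x, ?w) \<in> sph" unfolding sph_def using x w False subspace_scale[OF fibre_subspace[OF x]] by auto
  have "push h x ?w = push h x w /\<^sub>R norm w" by (rule push_scale[OF good_diff[OF h] x good_in[OF h x] w])
  then show ?thesis using pnorm_le_Umax[OF h s] False by (simp add: field_simps)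
qed

lemma ediff_le_sup_diff_D:
  assumes f: "good f" and g: "good g" shows "ennreal (ediff f g) \<le> sup_diff_D M X \<iota> f g"
  unfolding ediff_def
proof (rule ennreal_cSUP_le[OF sph_ne])
  fix s assume s: "s \<in> sph"
  obtain x w where sx: "s = (x, w)" "x \<in> X" "w \<in> fibre x" "norm w = 1" using s unfolding sph_def by auto
  note P = orth_proj_props[OF fibre_subspace[OF sx(2)]]
  let ?d = "\<lambda>w. ambient M \<iota> x (f x) (differential M f x) w - ambient M \<iota> x (g x) (differential M g x) w"
  have "norm (?d y) \<le> (Umax f + Umax g) * norm y" for y
  proof -
    have "norm (?d y) \<le> norm (push f x (orth_proj (fibre x) y)) + norm (push g x (orth_proj (fibre x) y))"
      unfolding ambient_D by (rule norm_triangle_ineq4)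
    also have "\<dots> \<le> Umax f * norm (orth_proj (fibre x) y) + Umax g * norm (orth_proj (fibre x) y)"
      by (intro add_mono push_le f g sx(2) P(1))
    also have "\<dots> \<le> Umax f * norm y + Umax g * norm y"
      using Umax_pos[OF f] Umax_pos[OF g] P(2) by (intro add_mono mult_left_mono) auto
    finally show ?thesis by (simp add: distrib_right)
  qed
  from le_onorm_point[OF this sx(4)] have "norm (push f x w - push g x w) \<le> onorm ?d"
    unfolding ambient_D P(3)[OF sx(3)] .
  then have "ennreal (norm (push f x w - push g x w)) \<le> ennreal (onorm ?d)" by (rule ennreal_leI)
  also have "\<dots> \<le> sup_diff_D M X \<iota> f g" unfolding sup_diff_D_def using sx(2) by (intro SUP_upper) auto
  finally show "ennreal (norm (push f (fst s) (snd s) - push g (fst s) (snd s))) \<le> sup_diff_D M X \<iota> f g" using sx by simp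
qed simp

text \<open>The inverses of \<open>Df\<close> and \<open>Dg\<close> act on different fibres. A unit
  vector \<open>u\<close> over \<open>g x\<close> is projected to the fibre over \<open>f x\<close>;
  the projection does not increase norms, so the inverse of \<open>Df\<close> maps it to norm at
  most \<open>Linv f\<close>, and the two images differ by at most the distance of the
  inverses.\<close>

lemma Linv_le_sup_diff_Dinv:
  assumes f: "good f" and g: "good g"
  shows "ennreal (max 0 (Linv g - Linv f)) \<le> sup_diff_Dinv M X \<iota> f g"
proof (cases "sup_diff_Dinv M X \<iota> f g")
  case (real r)
  have "Linv g \<le> Linv f + r" unfolding Linv_def[of g]
  proof (rule cSUP_least[OF sph_ne])
    fix s assume s: "s \<in> sph"
    obtain x w where sx: "s = (x, w)" "x \<in> X" "w \<in> fibre x" "norm w = 1" using s unfolding sph_def by auto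
    have gx: "g x \<in> X" "f x \<in> X" using good_in f g sx(2) by auto
    note Pg = orth_proj_props[OF fibre_subspace[OF gx(1)]] and Pf = orth_proj_props[OF fibre_subspace[OF gx(2)]]
    let ?u = "push g x w"
    have uf: "?u \<in> fibre (g x)" by (rule push_in[OF good_diff[OF g] sx(3)])
    have un: "norm ?u > 0" using sph_norm_push[OF g s] sx by simp
    define u where "u = ?u /\<^sub>R norm ?u"
    have u: "u \<in> fibre (g x)" "norm u = 1" unfolding u_def using subspace_scale[OF fibre_subspace[OF gx(1)] uf] un by auto
    have wn: "w /\<^sub>R norm ?u \<in> fibre x" by (rule subspace_scale[OF fibre_subspace[OF sx(2)] sx(3)])
    have "u = push g x (w /\<^sub>R norm ?u)" unfolding u_def by (rule push_scale[OF good_diff[OF g] sx(2) gx(1) sx(3), symmetric])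
    then have pu: "pinv g x u = w /\<^sub>R norm ?u" using pinv_push(1)[OF g sx(2) wn] by simp
    let ?d = "\<lambda>w. ambient M \<iota> (f x) x (differential_inv M f x) w - ambient M \<iota> (g x) x (differential_inv M g x) w"
    have "norm (?d y) \<le> (Linv f + Linv g) * norm y" for y
    proof -
      have "norm (?d y) \<le> norm (pinv f x (orth_proj (fibre (f x)) y)) + norm (pinv g x (orth_proj (fibre (g x)) y))"
        unfolding ambient_Dinv by (rule norm_triangle_ineq4)
      also have "\<dots> \<le> Linv f * norm (orth_proj (fibre (f x)) y) + Linv g * norm (orth_proj (fibre (g x)) y)"
        by (intro add_mono norm_pinv f g sx(2) Pf(1) Pg(1))
      also have "\<dots> \<le> Linv f * norm y + Linv g * norm y"
        using Linv_pos[OF f] Linv_pos[OF g] Pf(2) Pg(2) by (intro add_mono mult_left_mono) auto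
      finally show ?thesis by (simp add: distrib_right)
    qed
    from le_onorm_point[OF this u(2)]
    have d: "norm (pinv f x (orth_proj (fibre (f x)) u) - pinv g x u) \<le> onorm ?d"
      unfolding ambient_Dinv Pg(3)[OF u(1)] .
    have "ennreal (onorm ?d) \<le> ennreal r" unfolding real(2)[symmetric] sup_diff_Dinv_def using sx(2) by (intro SUP_upper) auto
    then have "onorm ?d \<le> r" using real(1) by (simp add: ennreal_le_iff)
    moreover have "norm (pinv f x (orth_proj (fibre (f x)) u)) \<le> Linv f * 1"
    proof (rule order_trans[OF norm_pinv[OF f sx(2) Pf(1)]])
      show "Linv f * norm (orth_proj (fibre (f x)) u) \<le> Linv f * 1"
        using Pf(2)[of u] u(2) Linv_pos[OF f] by (intro mult_left_mono) auto
    qed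
    moreover have "norm (pinv g x u) = 1 / pnorm g s" unfolding pu using sx by (simp add: divide_inverse)
    ultimately show "1 / pnorm g s \<le> Linv f + r"
      using d norm_triangle_ineq2[of "pinv g x u" "pinv f x (orth_proj (fibre (f x)) u)"] by (simp add: norm_minus_commute)
  qed
  then have "ennreal (max 0 (Linv g - Linv f)) \<le> ennreal r" using real(1) by (intro ennreal_leI) simp
  then show ?thesis using real by simp
qed simp

text \<open>The bound is arranged so that the only unbounded quantity, \<open>Linv f\<close>, stands
  inside a logarithm; this keeps it integrable. When \<open>norm (Dg v)\<close> is the smaller one,
  its reciprocal is replaced by \<open>Linv g\<close> and then by \<open>Linv f\<close> plus the
  distance of the inverses.\<close>

lemma slog_close:
  assumes f: "good f" and g: "good g" and s: "s \<in> sph"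
  shows "\<bar>slog g s - slog f s\<bar> \<le> ln (1 + ediff f g * Linv f) + ediff f g + max 0 (Linv g - Linv f)"
proof -
  let ?e = "ediff f g" and ?e' = "max 0 (Linv g - Linv f)" and ?a = "pnorm f s" and ?b = "pnorm g s"
  have a: "?a > 0" and b: "?b > 0" using sph_norm_push s f g by auto
  have e0: "0 \<le> ?e" by (rule ediff_nonneg[OF f g])
  have L: "Linv f > 0" "Linv g > 0" using Linv_pos f g by auto
  have d: "norm (push f (fst s) (snd s) - push g (fst s) (snd s)) \<le> ?e" by (rule pdiff_le[OF f g s])
  have ba: "?b \<le> ?a + ?e" "?a \<le> ?b + ?e"
    using d norm_triangle_ineq2[of "push f (fst s) (snd s)" "push g (fst s) (snd s)"]
      norm_triangle_ineq2[of "push g (fst s) (snd s)" "push f (fst s) (snd s)"] by (simp_all add: norm_minus_commute)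
  have ia: "1 / ?a \<le> Linv f" "1 / ?b \<le> Linv g" using inv_le_Linv f g s by auto
  have 1: "ln ?b - ln ?a \<le> ln (1 + ?e * Linv f)"
  proof -
    have "?b / ?a \<le> 1 + ?e * (1 / ?a)" using ba(1) a by (simp add: field_simps)
    also have "\<dots> \<le> 1 + ?e * Linv f" using ia e0 by (intro add_left_mono mult_left_mono) auto
    finally have "ln (?b / ?a) \<le> ln (1 + ?e * Linv f)"
      using a b e0 L by (subst ln_le_cancel_iff) (auto intro!: add_pos_nonneg)
    then show ?thesis using a b by (simp add: ln_div)
  qed
  have 2: "ln ?a - ln ?b \<le> ln (1 + ?e * Linv f) + ?e + ?e'"
  proof -
    have "?a / ?b \<le> 1 + ?e * (1 / ?b)" using ba(2) b by (simp add: field_simps)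
    also have "\<dots> \<le> 1 + ?e * (Linv f + ?e')" using ia e0 by (intro add_left_mono mult_left_mono) auto
    \<comment> \<open>A factored majorant, so that the logarithm becomes a sum. With
      \<open>A = ?e * Linv f\<close> the difference of the two sides is
      \<open>?e + ?e' + A * (?e + ?e' + ?e * ?e')\<close>.\<close>
    also have "\<dots> \<le> (1 + ?e * Linv f) * ((1 + ?e) * (1 + ?e'))"
    proof -
      have "0 \<le> ?e * Linv f" "0 \<le> ?e + ?e' + ?e * ?e'" using e0 L by auto
      then have "0 \<le> (?e * Linv f) * (?e + ?e' + ?e * ?e')" by (rule mult_nonneg_nonneg)
      then show ?thesis using e0 by (simp add: algebra_simps)
    qed
    finally have "ln (?a / ?b) \<le> ln ((1 + ?e * Linv f) * ((1 + ?e) * (1 + ?e')))"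
      using a b e0 L by (subst ln_le_cancel_iff) (auto intro!: mult_pos_pos add_pos_nonneg)
    also have "\<dots> = ln (1 + ?e * Linv f) + (ln (1 + ?e) + ln (1 + ?e'))"
      using e0 L by (subst ln_mult_pos, auto intro!: mult_pos_pos add_pos_nonneg)+
    also have "\<dots> \<le> ln (1 + ?e * Linv f) + (?e + ?e')"
      using e0 by (intro add_left_mono add_mono ln_add_one_self_le_self) auto
    finally show ?thesis using a b by (simp add: ln_div)
  qed
  have "0 \<le> ?e + ?e'" using e0 by simp
  then show ?thesis using 1 2 by (simp add: slog_def case_prod_beta abs_le_iff)
qed

text \<open>A Lebesgue number argument. \<open>riem_dist_nbhd\<close> gives, around every point, a
  neighbourhood and a radius valid for all its points; finitely many of them cover the sphere
  bundle, and the least radius works.\<close>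

lemma uniform_wrt_riem_dist:
  fixes h :: "'m \<times> 'r \<Rightarrow> real"
  assumes h: "continuous_on sph h" and e: "e > 0"
  obtains \<delta> where "\<delta> > 0" "\<And>x w y u. (x, w) \<in> sph \<Longrightarrow> (y, u) \<in> sph \<Longrightarrow> riem_dist M x y < ennreal \<delta> \<Longrightarrow>
     norm (w - u) < \<delta> \<Longrightarrow> \<bar>h (x, w) - h (y, u)\<bar> \<le> e"
proof -
  have "\<exists>q. open (fst q) \<and> fst s \<in> fst q \<and> (snd q :: real) > 0 \<and> (\<forall>x w y u. x \<in> fst q \<longrightarrow> w \<in> ball (snd s) (snd q) \<longrightarrow>
      (x, w) \<in> sph \<longrightarrow> (y, u) \<in> sph \<longrightarrow> riem_dist M x y < ennreal (snd q) \<longrightarrow> norm (w - u) < snd q \<longrightarrow> \<bar>h (x, w) - h (y, u)\<bar> \<le> e)"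
    if s: "s \<in> sph" for s
  proof -
    have "\<exists>A. open A \<and> s \<in> A \<and> (\<forall>y\<in>sph. y \<in> A \<longrightarrow> h y \<in> ball (h s) (e/2))"
      using h[unfolded continuous_on_topological, rule_format, OF s, of "ball (h s) (e/2)"] e by simp
    then obtain A where A: "open A" "s \<in> A" "\<And>y. y \<in> sph \<Longrightarrow> y \<in> A \<Longrightarrow> h y \<in> ball (h s) (e/2)" by blast
    from open_prod_elim[OF A(1,2)] obtain U V where UV: "open U" "open V" "s \<in> U \<times> V" "U \<times> V \<subseteq> A" by blast
    have sU: "fst s \<in> U" "snd s \<in> V" using UV(3) by auto
    obtain r where r: "r > 0" "ball (snd s) r \<subseteq> V" using UV(2) sU(2) open_contains_ball by blast
    obtain W \<delta> where W: "open W" "fst s \<in> W" "W \<subseteq> U" "\<delta> > 0"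
      "\<And>a b. a \<in> W \<Longrightarrow> riem_dist M a b < ennreal \<delta> \<Longrightarrow> b \<in> U"
      by (rule riem_dist_nbhd[OF UV(1) sU(1)], rule that)
    define d where "d = min \<delta> (r/2)"
    have d: "d > 0" "d \<le> \<delta>" "d \<le> r/2" unfolding d_def using W r by auto
    have "\<bar>h (x, w) - h (y, u)\<bar> \<le> e" if xy: "x \<in> W" "w \<in> ball (snd s) d" "(x, w) \<in> sph" "(y, u) \<in> sph"
      "riem_dist M x y < ennreal d" "norm (w - u) < d" for x w y u
    proof -
      have "riem_dist M x y < ennreal \<delta>" using xy(5) d(2) ennreal_leI less_le_trans by blast
      then have "y \<in> U" using W(5) xy(1) by blast
      moreover have "x \<in> U" using W(3) xy(1) by blast
      moreover have "w \<in> V" using r(2) xy(2) d by (auto simp: subset_iff)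
      moreover have "dist (snd s) u < r"
        using dist_triangle[of "snd s" u w] xy(2,6) d by (simp add: dist_norm)
      then have "u \<in> V" using r(2) by auto
      ultimately have "(x, w) \<in> A" "(y, u) \<in> A" using UV(4) by auto
      then have "dist (h s) (h (x, w)) < e/2" "dist (h s) (h (y, u)) < e/2" using A(3) xy(3,4) by auto
      then show ?thesis unfolding dist_real_def by linarith
    qed
    then show ?thesis using W(1,2) d(1) by (intro exI[of _ "(W, d)"]) simp
  qed
  then have "\<forall>s\<in>sph. \<exists>q. open (fst q) \<and> fst s \<in> fst q \<and> (snd q :: real) > 0 \<and> (\<forall>x w y u. x \<in> fst q \<longrightarrow> w \<in> ball (snd s) (snd q) \<longrightarrow>
      (x, w) \<in> sph \<longrightarrow> (y, u) \<in> sph \<longrightarrow> riem_dist M x y < ennreal (snd q) \<longrightarrow> norm (w - u) < snd q \<longrightarrow> \<bar>h (x, w) - h (y, u)\<bar> \<le> e)" by blast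
  from bchoice[OF this] obtain q where q: "\<forall>s\<in>sph. open (fst (q s)) \<and> fst s \<in> fst (q s) \<and> (snd (q s) :: real) > 0 \<and> (\<forall>x w y u. x \<in> fst (q s) \<longrightarrow> w \<in> ball (snd s) (snd (q s)) \<longrightarrow>
      (x, w) \<in> sph \<longrightarrow> (y, u) \<in> sph \<longrightarrow> riem_dist M x y < ennreal (snd (q s)) \<longrightarrow> norm (w - u) < snd (q s) \<longrightarrow> \<bar>h (x, w) - h (y, u)\<bar> \<le> e)" ..
  have cov: "sph \<subseteq> (\<Union>s\<in>sph. fst (q s) \<times> ball (snd s) (snd (q s)))"
  proof
    fix s assume s: "s \<in> sph"
    then have "s \<in> fst (q s) \<times> ball (snd s) (snd (q s))" using q by (simp add: mem_Times_iff)
    then show "s \<in> (\<Union>s\<in>sph. fst (q s) \<times> ball (snd s) (snd (q s)))" using s by blast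
  qed
  have op: "open (fst (q s) \<times> ball (snd s) (snd (q s)))" if "s \<in> sph" for s using q that by (intro open_Times) auto
  obtain C where C: "C \<subseteq> sph" "finite C" "sph \<subseteq> (\<Union>s\<in>C. fst (q s) \<times> ball (snd s) (snd (q s)))"
    by (rule compactE_image[OF sph_compact _ cov], rule op, assumption, rule that)
  have Cne: "C \<noteq> {}" using C(3) sph_ne by blast
  define \<delta> where "\<delta> = Min ((\<lambda>s. snd (q s)) ` C)"
  have dp: "\<delta> > 0" unfolding \<delta>_def using C Cne q by (subst Min_gr_iff) auto
  have dl: "\<delta> \<le> snd (q s)" if "s \<in> C" for s unfolding \<delta>_def using C(2) that by (intro Min_le) auto
  show ?thesis
  proof (rule that[OF dp])
    fix x w y u assume xy: "(x, w) \<in> sph" "(y, u) \<in> sph" "riem_dist M x y < ennreal \<delta>" "norm (w - u) < \<delta>"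
    obtain s where s: "s \<in> C" "(x, w) \<in> fst (q s) \<times> ball (snd s) (snd (q s))" using C(3) xy(1) by blast
    have ss: "s \<in> sph" using s(1) C(1) by blast
    have "riem_dist M x y < ennreal (snd (q s))" using xy(3) dl[OF s(1)] ennreal_leI less_le_trans by blast
    moreover have "norm (w - u) < snd (q s)" using xy(4) dl[OF s(1)] by linarith
    ultimately show "\<bar>h (x, w) - h (y, u)\<bar> \<le> e" using q[rule_format, OF ss] s(2) xy(1,2) by blast
  qed
qed

lemma smap_close:
  fixes h :: "'m \<times> 'r \<Rightarrow> real"
  assumes h: "continuous_on sph h" and e: "e > 0" and R: "R > 0"
  obtains \<delta> where "\<delta> > 0" "\<And>f g s. good f \<Longrightarrow> good g \<Longrightarrow> Linv f \<le> R \<Longrightarrow> dC0 M X f g < ennreal \<delta> \<Longrightarrow>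
     ediff f g < \<delta> \<Longrightarrow> s \<in> sph \<Longrightarrow> \<bar>h (smap f s) - h (smap g s)\<bar> \<le> e"
proof -
  obtain \<delta> where \<delta>: "\<delta> > 0" "\<And>x w y u. (x, w) \<in> sph \<Longrightarrow> (y, u) \<in> sph \<Longrightarrow> riem_dist M x y < ennreal \<delta> \<Longrightarrow>
     norm (w - u) < \<delta> \<Longrightarrow> \<bar>h (x, w) - h (y, u)\<bar> \<le> e"
    by (rule uniform_wrt_riem_dist[OF h e], rule that)
  \<comment> \<open>Normalizing the image vectors multiplies their difference by at most
    \<open>2 * R\<close>, by \<open>norm_normalize_diff\<close> and
    \<open>Linv f \<le> R\<close>.\<close>
  define d where "d = min \<delta> (\<delta> / (2 * R))"
  have dp: "d > 0" unfolding d_def using \<delta>(1) R by simp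
  have "\<bar>h (smap f s) - h (smap g s)\<bar> \<le> e" if f: "good f" and g: "good g" and L: "Linv f \<le> R"
    and d0: "dC0 M X f g < ennreal d" and ed: "ediff f g < d" and s: "s \<in> sph" for f g s
  proof -
    obtain x w where sx: "s = (x, w)" "x \<in> X" "w \<in> fibre x" "norm w = 1" using s unfolding sph_def by auto
    let ?a = "push f x w" and ?b = "push g x w"
    have ab: "norm ?a > 0" "norm ?b > 0" using sph_norm_push[OF f s] sph_norm_push[OF g s] sx by auto
    have "riem_dist M (f x) (g x) \<le> dC0 M X f g" unfolding dC0_def using sx(2) by (intro SUP_upper)
    also note d0
    also have "ennreal d \<le> ennreal \<delta>" unfolding d_def by (intro ennreal_leI) simp
    finally have 1: "riem_dist M (f x) (g x) < ennreal \<delta>" .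
    have "norm (?a /\<^sub>R norm ?a - ?b /\<^sub>R norm ?b) \<le> 2 * norm (?a - ?b) / norm ?a"
      using ab by (intro norm_normalize_diff) auto
    also have "\<dots> = 2 * norm (?a - ?b) * (1 / norm ?a)" by simp
    also have "\<dots> \<le> 2 * ediff f g * R"
    proof (rule mult_mono)
      show "2 * norm (?a - ?b) \<le> 2 * ediff f g" using pdiff_le[OF f g s] sx by simp
      show "1 / norm ?a \<le> R" using inv_le_Linv[OF f s] L sx by simp
    qed (use ediff_nonneg[OF f g] in auto)
    also have "\<dots> < 2 * (\<delta> / (2 * R)) * R"
      using ed R unfolding d_def by (intro mult_strict_right_mono mult_strict_left_mono) auto
    also have "\<dots> = \<delta>" using R by simp
    finally have 2: "norm (?a /\<^sub>R norm ?a - ?b /\<^sub>R norm ?b) < \<delta>" .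
    show ?thesis using \<delta>(2)[of "f x" "?a /\<^sub>R norm ?a" "g x" "?b /\<^sub>R norm ?b"] 1 2 smap_in[OF f s] smap_in[OF g s]
      unfolding sx smap_def by simp
  qed
  then show ?thesis using that dp by blast
qed

end

section \<open>The derivative cocycle\<close>

text \<open>The exponent and \<open>phi\<close> integrate over the completed measure. A function
  equal almost everywhere to a measurable one is measurable there, and the integral falls back to
  the original measure.\<close>

lemma integral_completion_AE_eq:
  fixes f g :: "'a \<Rightarrow> real"
  assumes g: "g \<in> borel_measurable M" and e: "AE x in M. f x = g x"
  shows "(\<integral>x. f x \<partial>completion M) = (\<integral>x. g x \<partial>M)"
proof -
  have gc: "g \<in> borel_measurable (completion M)" using g by (rule measurable_completion)
  have ec: "AE x in completion M. f x = g x" using e by (rule AE_completion)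
  have "f \<in> borel_measurable (completion M)"
  proof (rule measurableI)
    fix A :: "real set" assume A: "A \<in> sets borel"
    show "f -` A \<inter> space (completion M) \<in> sets (completion M)"
    proof (rule completion.in_sets_AE)
      show "AE x in completion M. x \<in> g -` A \<inter> space (completion M) \<longleftrightarrow> x \<in> f -` A \<inter> space (completion M)"
        using ec by eventually_elim auto
      show "g -` A \<inter> space (completion M) \<in> sets (completion M)" using measurable_sets[OF gc A] .
    qed auto
  qed simp
  then have "(\<integral>x. f x \<partial>completion M) = (\<integral>x. g x \<partial>completion M)" using gc ec by (rule integral_cong_AE)
  then show ?thesis using integral_completion[OF g] by simp
qed

text \<open>Each \<open>u t\<close> is continuous, so exceeding \<open>y\<close> somewhere on
  \<open>S\<close> means exceeding it at some point of a fixed countable dense set.\<close>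

lemma SUP_measurable:
  fixes S :: "'a::second_countable_topology set" and u :: "'t \<Rightarrow> 'a \<Rightarrow> real"
  assumes S: "compact S" "S \<noteq> {}"
    and c: "\<And>t. t \<in> space p \<Longrightarrow> continuous_on S (u t)"
    and m: "\<And>s. s \<in> S \<Longrightarrow> (\<lambda>t. u t s) \<in> borel_measurable p"
  shows "(\<lambda>t. SUP s\<in>S. u t s) \<in> borel_measurable p"
proof (rule borel_measurableI_greater)
  fix y :: real
  obtain D where D: "countable D" "D \<subseteq> S" "\<And>U. open U \<Longrightarrow> U \<inter> S \<noteq> {} \<Longrightarrow> U \<inter> D \<noteq> {}"
    by (rule countable_dense_subset[of S], rule that)
  have "{t \<in> space p. y < (SUP s\<in>S. u t s)} = (\<Union>d\<in>D. {t \<in> space p. y < u t d})"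
  proof (intro equalityI subsetI)
    fix t assume t: "t \<in> {t \<in> space p. y < (SUP s\<in>S. u t s)}"
    then have tp: "t \<in> space p" by simp
    have bd: "bdd_above (u t ` S)"
      by (intro bounded_imp_bdd_above compact_imp_bounded compact_continuous_image S c tp)
    obtain s where s: "s \<in> S" "y < u t s" using t less_cSUP_iff[OF S(2) bd, of y] by blast
    have "\<exists>A. open A \<and> s \<in> A \<and> (\<forall>z\<in>S. z \<in> A \<longrightarrow> u t z \<in> {y<..})"
      using c[OF tp, unfolded continuous_on_topological, rule_format, OF s(1), of "{y<..}"] s(2) by simp
    then obtain A where A: "open A" "s \<in> A" "\<And>z. z \<in> S \<Longrightarrow> z \<in> A \<Longrightarrow> y < u t z" by auto
    have "A \<inter> D \<noteq> {}" using D(3)[OF A(1)] A(2) s(1) by blast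
    then obtain d where "d \<in> A" "d \<in> D" by blast
    then show "t \<in> (\<Union>d\<in>D. {t \<in> space p. y < u t d})" using A(3) D(2) tp by blast
  next
    fix t assume "t \<in> (\<Union>d\<in>D. {t \<in> space p. y < u t d})"
    then obtain d where d: "d \<in> D" "t \<in> space p" "y < u t d" by blast
    have bd: "bdd_above (u t ` S)"
      by (intro bounded_imp_bdd_above compact_imp_bounded compact_continuous_image S c d(2))
    have "u t d \<le> (SUP s\<in>S. u t s)" using D(2) d(1) by (intro cSUP_upper bd) auto
    then show "t \<in> {t \<in> space p. y < (SUP s\<in>S. u t s)}" using d by simp
  qed
  moreover have "(\<Union>d\<in>D. {t \<in> space p. y < u t d}) \<in> sets p"
  proof (rule sets.countable_UN''[OF D(1)])
    fix d assume "d \<in> D"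
    then have [measurable]: "(\<lambda>t. u t d) \<in> borel_measurable p" using m D(2) by blast
    show "{t \<in> space p. y < u t d} \<in> sets p" by measurable
  qed
  ultimately show "{t \<in> space p. y < (SUP s\<in>S. u t s)} \<in> sets p" by simp
qed

text \<open>Writes a directional derivative as a limit of countably many difference quotients, which
  is what makes it measurable in the parameter.\<close>

lemma has_derivative_sequence:
  fixes F :: "'e::euclidean_space \<Rightarrow> 'e"
  assumes "(F has_derivative L) (at y)"
  shows "(\<lambda>n. real (Suc n) *\<^sub>R (F (y + (1 / real (Suc n)) *\<^sub>R a) - F y)) \<longlonglongrightarrow> L a"
proof -
  have lin: "linear L" using assms has_derivative_linear by blast
  have "((\<lambda>h. y + h *\<^sub>R a) has_derivative (\<lambda>h. h *\<^sub>R a)) (at (0::real))"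
    by (auto intro!: derivative_eq_intros)
  moreover have "(F has_derivative L) (at (y + 0 *\<^sub>R a))" using assms by simp
  ultimately have "((F \<circ> (\<lambda>h. y + h *\<^sub>R a)) has_derivative (L \<circ> (\<lambda>h. h *\<^sub>R a))) (at (0::real))"
    by (rule diff_chain_at)
  then have "((\<lambda>h. F (y + h *\<^sub>R a)) has_derivative (\<lambda>h. h *\<^sub>R L a)) (at (0::real))"
    by (simp add: comp_def linear_scale[OF lin])
  then have "((\<lambda>h. norm (F (y + h *\<^sub>R a) - F y - h *\<^sub>R L a) / norm h) \<longlongrightarrow> 0) (at (0::real))"
    unfolding has_derivative_at by simp
  moreover have "filterlim (\<lambda>n. 1 / real (Suc n)) (at 0) sequentially"
    using LIMSEQ_Suc[OF lim_1_over_n[where 'a=real]] by (auto simp: filterlim_at)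
  ultimately have lim: "(\<lambda>n. norm (F (y + (1 / real (Suc n)) *\<^sub>R a) - F y - (1 / real (Suc n)) *\<^sub>R L a) / norm (1 / real (Suc n))) \<longlonglongrightarrow> 0"
    by (rule filterlim_compose)
  have "norm (z - (1 / real (Suc n)) *\<^sub>R L a) / norm (1 / real (Suc n)) = norm (real (Suc n) *\<^sub>R z - L a)" for n z
  proof -
    have "real (Suc n) *\<^sub>R z - L a = real (Suc n) *\<^sub>R (z - (1 / real (Suc n)) *\<^sub>R L a)"
      by (simp add: scaleR_diff_right del: of_nat_Suc)
    then show ?thesis by (simp add: divide_inverse del: of_nat_Suc)
  qed
  then have "(\<lambda>n. norm (real (Suc n) *\<^sub>R (F (y + (1 / real (Suc n)) *\<^sub>R a) - F y) - L a)) \<longlonglongrightarrow> 0"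
    using lim by (simp only:)
  then show ?thesis by (simp only: tendsto_norm_zero_iff LIM_zero_iff)
qed

locale random_embedded = embedded_mfd M X \<iota> + prob_space p
  for M :: "('m::{t2_space,second_countable_topology}, 'e::euclidean_space) riemannian" and X :: "'m set"
    and \<iota> :: "'m \<Rightarrow> ('m, 'e) tvec \<Rightarrow> 'r::euclidean_space" and p :: "'t measure"
begin

sublocale seq: sequence_space p by unfold_locales

abbreviation "P \<equiv> path_space p"

text \<open>Since \<open>f \<omega>\<close> depends only on \<open>\<omega> 0\<close>, evaluation at
  a constant path recovers the map attached to one parameter.\<close>

definition one_step :: "((nat \<Rightarrow> 't) \<Rightarrow> 'm \<Rightarrow> 'm) \<Rightarrow> 't \<Rightarrow> 'm \<Rightarrow> 'm" where
  "one_step f t = f (\<lambda>_. t)"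

lemma P_prob: "prob_space P" by (rule seq.prob_space_axioms)

lemma path_at: "\<omega> \<in> space P \<Longrightarrow> \<omega> n \<in> space p"
  by (auto simp: space_PiM PiE_def)

lemma const_path: "t \<in> space p \<Longrightarrow> (\<lambda>_. t) \<in> space P"
  by (auto simp: space_PiM PiE_iff extensional_def)

lemma one_step_eq:
  assumes "C1_random_map M p f" "\<omega> \<in> space P" shows "f \<omega> = one_step f (\<omega> 0)"
  using assms(1)[unfolded C1_random_map_def, THEN conjunct2, THEN conjunct1, rule_format,
    OF assms(2) const_path[OF path_at[OF assms(2), of 0]]]
  by (simp add: one_step_def)

lemma AE_path_coord:
  assumes "AE t in p. Q t" shows "AE \<omega> in P. Q (\<omega> n)"
proof -
  have d: "distr P p (\<lambda>\<omega>. \<omega> n) = p" by (rule distr_PiM_component) (auto intro: prob_space_axioms)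
  have m: "(\<lambda>\<omega>. \<omega> n) \<in> P \<rightarrow>\<^sub>M p" by measurable
  have "AE t in distr P p (\<lambda>\<omega>. \<omega> n). Q t" unfolding d by (rule assms)
  then show ?thesis by (rule AE_distrD[OF m])
qed

text \<open>\<open>Q\<close> is not assumed measurable, so the law of the coordinate cannot simply
  be transported back. Path space is written as the image of a product with an independent first
  coordinate, and Fubini is applied to the null set.\<close>

lemma AE_coord_step:
  assumes "AE \<omega> in P. Q (\<omega> 0)" shows "AE t in p. Q t"
proof -
  interpret Q: pair_prob_space p P by unfold_locales
  have m: "(\<lambda>(t, \<omega>). case_nat t \<omega>) \<in> p \<Otimes>\<^sub>M P \<rightarrow>\<^sub>M P" by measurable
  have "AE \<omega> in distr (p \<Otimes>\<^sub>M P) P (\<lambda>(t, \<omega>). case_nat t \<omega>). Q (\<omega> 0)" unfolding seq.PiM_iter by (rule assms)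
  then have "AE z in p \<Otimes>\<^sub>M P. Q ((case z of (t, \<omega>) \<Rightarrow> case_nat t \<omega>) 0)" by (rule AE_distrD[OF m])
  then have "AE t in p. AE \<omega> in P. Q ((case (t, \<omega>) of (t, \<omega>) \<Rightarrow> case_nat t \<omega>) 0)" by (rule Q.AE_pair)
  then have "AE t in p. AE \<omega> in P. Q t" by simp
  then show ?thesis using prob_space.ae_filter_bot[OF P_prob] by simp
qed

lemma one_step_measurable:
  assumes "C1_random_map M p f"
  shows "(\<lambda>(t, x). one_step f t x) \<in> borel_measurable (p \<Otimes>\<^sub>M borel)"
proof -
  have m: "case_prod f \<in> borel_measurable (P \<Otimes>\<^sub>M borel)" using assms unfolding C1_random_map_def by blast
  have "(\<lambda>z. (\<lambda>_::nat. fst z, snd z)) \<in> p \<Otimes>\<^sub>M borel \<rightarrow>\<^sub>M P \<Otimes>\<^sub>M (borel :: 'm measure)"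
    by (intro measurable_Pair measurable_snd measurable_PiM_single') (auto simp: space_pair_measure)
  from measurable_compose[OF this m] show ?thesis by (simp add: one_step_def case_prod_beta)
qed

lemma one_step_point:
  assumes f: "C1_random_map M p f" shows "(\<lambda>t. one_step f t x) \<in> borel_measurable p"
  using measurable_compose[OF measurable_Pair2'[of x borel] one_step_measurable[OF f]] by simp

lemma one_step_good:
  assumes "f \<in> Diff1_loc M p X" shows "AE t in p. good (one_step f t)"
proof (rule AE_coord_step)
  have f: "C1_random_map M p f" "AE \<omega> in P. f \<omega> ` X \<subseteq> X"
    using assms unfolding Diff1_loc_def by blast+
  have f2: "AE \<omega> in P. C1_local_diffeo M (f \<omega>)" using f(1) unfolding C1_random_map_def by blast
  show "AE \<omega> in P. good (one_step f (\<omega> 0))"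
    using f(2) f2 AE_space
  proof eventually_elim
    case (elim \<omega>)
    then show ?case unfolding good_def one_step_eq[OF f(1) elim(3), symmetric] by blast
  qed
qed

text \<open>The null set \<open>bad f\<close> contains all exceptional parameters; replacing the maps by the identity there makes
  the hypotheses on a random cocycle hold for every parameter.\<close>

definition bad :: "((nat \<Rightarrow> 't) \<Rightarrow> 'm \<Rightarrow> 'm) \<Rightarrow> 't set" where
  "bad f = (SOME N. N \<in> null_sets p \<and> {t \<in> space p. \<not> good (one_step f t)} \<subseteq> N)"

lemma bad_props:
  assumes "f \<in> Diff1_loc M p X"
  shows "bad f \<in> null_sets p" "\<And>t. t \<in> space p \<Longrightarrow> t \<notin> bad f \<Longrightarrow> good (one_step f t)"
proof -
  have "\<exists>N. N \<in> null_sets p \<and> {t \<in> space p. \<not> good (one_step f t)} \<subseteq> N"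
    using one_step_good[OF assms] unfolding eventually_ae_filter by blast
  from someI_ex[OF this] show "bad f \<in> null_sets p" "\<And>t. t \<in> space p \<Longrightarrow> t \<notin> bad f \<Longrightarrow> good (one_step f t)"
    unfolding bad_def[symmetric] by blast+
qed

definition cpush :: "((nat \<Rightarrow> 't) \<Rightarrow> 'm \<Rightarrow> 'm) \<Rightarrow> 't \<Rightarrow> 'm \<times> 'r \<Rightarrow> 'r" where
  "cpush f t s = (if t \<in> bad f then snd s else push (one_step f t) (fst s) (snd s))"

definition cmap :: "((nat \<Rightarrow> 't) \<Rightarrow> 'm \<Rightarrow> 'm) \<Rightarrow> 't \<Rightarrow> 'm \<times> 'r \<Rightarrow> 'm \<times> 'r" where
  "cmap f t s = (if t \<in> bad f then s else smap (one_step f t) s)"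

definition clog :: "((nat \<Rightarrow> 't) \<Rightarrow> 'm \<Rightarrow> 'm) \<Rightarrow> 't \<Rightarrow> 'm \<times> 'r \<Rightarrow> real" where
  "clog f t s = (if t \<in> bad f then 0 else slog (one_step f t) s)"

definition cbound :: "((nat \<Rightarrow> 't) \<Rightarrow> 'm \<Rightarrow> 'm) \<Rightarrow> 't \<Rightarrow> real" where
  "cbound f t = (if t \<in> bad f then 0 else dom_fun (one_step f t))"

definition base_map :: "((nat \<Rightarrow> 't) \<Rightarrow> 'm \<Rightarrow> 'm) \<Rightarrow> 't \<Rightarrow> 'm \<Rightarrow> 'm" where
  "base_map f t x = (if t \<in> bad f then x else one_step f t x)"

context
  fixes f assumes f: "f \<in> Diff1_loc M p X"
begin

lemma f_random: "C1_random_map M p f" using f unfolding Diff1_loc_def by blast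

lemma bad_meas[measurable]: "bad f \<in> sets p" using bad_props(1)[OF f] by blast

lemma f_good: "t \<in> space p \<Longrightarrow> t \<notin> bad f \<Longrightarrow> good (one_step f t)" by (rule bad_props(2)[OF f])

lemma AE_not_bad: "AE t in p. t \<notin> bad f" using bad_props(1)[OF f] by (rule AE_not_in)

text \<open>For each fixed point of the manifold the one-step image is measurable in
  \<open>t\<close>, hence so are difference quotients read in a target chart, and their limit. The
  target chart must depend on \<open>t\<close>; a finite compact cover of \<open>X\<close> reduces
  this to finitely many cases.\<close>

lemma cpush_measurable:
  assumes s: "s \<in> sph"
  shows "(\<lambda>t. cpush f t s) \<in> borel_measurable p"
proof -
  obtain x w where sx: "s = (x, w)" "x \<in> X" "w \<in> fibre x" "norm w = 1" using s unfolding sph_def by auto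
  obtain c where c: "c \<in> charts_at M x" using charts_at_ne by blast
  define a where "a = tvof x w c"
  have wa: "w = emb c x a" unfolding a_def using emb_coord[OF c sx(3)] by simp
  obtain C ch K where C: "finite C" "C \<subseteq> X" "\<And>i. i \<in> C \<Longrightarrow> ch i \<in> charts M" "\<And>i. i \<in> C \<Longrightarrow> compact (K i)"
    "\<And>i. i \<in> C \<Longrightarrow> K i \<subseteq> chart_dom (ch i) \<inter> X" "X = (\<Union>i\<in>C. K (i::'m))"
    by (rule chart_cover, rule that)
  \<comment> \<open>The value 0 off the chart makes the function Borel on the whole manifold. It
    does not disturb the limit: the images of \<open>y n\<close> converge to an interior point of
    the chart domain.\<close>
  define cm where "cm i z = (if z \<in> chart_dom (ch i) then chart_map (ch i) z else 0)" for i z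
  have cmm[measurable]: "cm i \<in> borel_measurable borel" if "i \<in> C" for i
    unfolding cm_def using chart_props(1)[OF C(3)[OF that]] chart_cont(1)[OF C(3)[OF that]]
    by (intro borel_measurable_continuous_on_if) auto
  define y where "y n = chart_inv c (chart_map c x + (1 / real (Suc n)) *\<^sub>R a)" for n
  define g where "g i n t = real (Suc n) *\<^sub>R (cm i (one_step f t (y n)) - cm i (one_step f t x))" for i n t
  have om: "(\<lambda>t. one_step f t z) \<in> borel_measurable p" for z by (rule one_step_point[OF f_random])
  have gm: "g i n \<in> borel_measurable p" if i: "i \<in> C" for i n
    unfolding g_def using measurable_compose[OF om cmm[OF i]] by measurable
  define D where "D i t = lim (\<lambda>n. g i n t)" for i t
  \<comment> \<open>The pointwise \<open>lim\<close> of measurable functions is measurable even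
    where the sequence diverges, so no restriction on \<open>t\<close> is made here; convergence
    matters only in \<open>Dv\<close>.\<close>
  have Dm: "D i \<in> borel_measurable p" if i: "i \<in> C" for i
    unfolding D_def using gm[OF i] by measurable
  define E where "E i z = (if z \<in> K i \<times> UNIV then (\<lambda>(z, b). emb (ch i) z b) z else 0)" for i and z :: "'m \<times> 'e"
  have Em: "E i \<in> borel_measurable borel" if i: "i \<in> C" for i
    unfolding E_def
  proof (rule borel_measurable_continuous_on_if)
    have "closed (K i)" using C(4)[OF i] by (rule compact_imp_closed)
    then show "K i \<times> UNIV \<in> sets borel" by (intro borel_closed closed_Times) auto
    show "continuous_on (K i \<times> UNIV) (\<lambda>(z, b). emb (ch i) z b)"
      by (rule continuous_on_subset[OF emb_cont[OF C(3)[OF i]]]) (use C(5)[OF i] in auto)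
  qed auto
  have Dv: "push (one_step f t) x w = E i (one_step f t x, D i t)"
    if t: "t \<in> space p" "t \<notin> bad f" and i: "i \<in> C" "one_step f t x \<in> K i" for t i
  proof -
    let ?h = "one_step f t"
    have h: "good ?h" by (rule f_good[OF t])
    have ci: "ch i \<in> charts_at M (?h x)" using C(3,5)[OF i(1)] i(2) by (auto simp: chart_at)
    have cM: "c \<in> charts M" "x \<in> chart_dom c" using c by (auto simp: chart_at)
    have der: "(local_rep c (ch i) ?h has_derivative local_deriv c (ch i) ?h x) (at (chart_map c x))"
      by (rule local_deriv_has[OF good_diff[OF h] c ci])
    have "(\<lambda>n. chart_map c x + (1 / real (Suc n)) *\<^sub>R a) \<longlonglongrightarrow> chart_map c x + 0 *\<^sub>R a"
      by (intro tendsto_intros LIMSEQ_Suc[OF lim_1_over_n])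
    then have "y \<longlonglongrightarrow> chart_inv c (chart_map c x)"
      unfolding y_def using isCont_tendsto_compose[OF chart_inv_cont_at[OF cM]] by simp
    then have yl: "y \<longlonglongrightarrow> x" by (simp add: chart_inv_map[OF cM])
    have "isCont ?h x" using good_diff[OF h] unfolding diff_at_def by blast
    from isCont_tendsto_compose[OF this yl] have hl: "(\<lambda>n. ?h (y n)) \<longlonglongrightarrow> ?h x" .
    have ev: "eventually (\<lambda>n. ?h (y n) \<in> chart_dom (ch i)) sequentially"
      using topological_tendstoD[OF hl chart_props(1)[OF C(3)[OF i(1)]]] ci by (simp add: chart_at)
    have "(\<lambda>n. g i n t) \<longlonglongrightarrow> local_deriv c (ch i) ?h x a"
    proof (rule Lim_transform_eventually[OF has_derivative_sequence[OF der, of a]])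
      show "eventually (\<lambda>n. real (Suc n) *\<^sub>R (local_rep c (ch i) ?h (chart_map c x + (1 / real (Suc n)) *\<^sub>R a) - local_rep c (ch i) ?h (chart_map c x)) = g i n t) sequentially"
        using ev
      proof eventually_elim
        case (elim n)
        then show ?case unfolding g_def cm_def y_def using ci
          by (simp add: local_rep_def chart_inv_map[OF cM] chart_at)
      qed
    qed
    then have "D i t = local_deriv c (ch i) ?h x a" unfolding D_def by (rule limI)
    then show ?thesis unfolding wa push_emb[OF good_diff[OF h] sx(2) c ci] E_def using i by simp
  qed
  show ?thesis
  proof (rule borel_measurableI)
    fix U :: "'r set" assume U: "open U"
    define T where "T i = {t \<in> space p. t \<notin> bad f \<and> one_step f t x \<in> K i \<and> E i (one_step f t x, D i t) \<in> U}" for i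
    have Tm: "T i \<in> sets p" if i: "i \<in> C" for i
    proof -
      have [measurable]: "K i \<in> sets borel" using C(4)[OF i] by (intro borel_closed compact_imp_closed)
      have [measurable]: "(\<lambda>t. one_step f t x) \<in> borel_measurable p" by (rule om)
      have [measurable]: "(\<lambda>t. E i (one_step f t x, D i t)) \<in> borel_measurable p"
        using measurable_compose[OF borel_measurable_Pair[OF om Dm[OF i]] Em[OF i]] .
      have [measurable]: "U \<in> sets borel" using U by simp
      show ?thesis unfolding T_def by measurable
    qed
    have "(\<lambda>t. cpush f t s) -` U \<inter> space p = {t \<in> space p. t \<in> bad f \<and> w \<in> U} \<union> (\<Union>i\<in>C. T i)"
    proof (intro equalityI subsetI)
      fix t assume t: "t \<in> (\<lambda>t. cpush f t s) -` U \<inter> space p"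
      show "t \<in> {t \<in> space p. t \<in> bad f \<and> w \<in> U} \<union> (\<Union>i\<in>C. T i)"
      proof (cases "t \<in> bad f")
        case True then show ?thesis using t sx by (simp add: cpush_def)
      next
        case False
        have tp: "t \<in> space p" using t by simp
        obtain i where i: "i \<in> C" "one_step f t x \<in> K i"
          using good_in[OF f_good[OF tp False] sx(2)] C(6) by blast
        have "t \<in> T i" unfolding T_def using t False i Dv[OF tp False i] sx by (simp add: cpush_def)
        then show ?thesis using i(1) by blast
      qed
    next
      fix t assume "t \<in> {t \<in> space p. t \<in> bad f \<and> w \<in> U} \<union> (\<Union>i\<in>C. T i)"
      then show "t \<in> (\<lambda>t. cpush f t s) -` U \<inter> space p"
        using Dv sx unfolding T_def by (auto simp: cpush_def)
    qed
    moreover have "{t \<in> space p. t \<in> bad f \<and> w \<in> U} \<in> sets p" by measurable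
    moreover have "(\<Union>i\<in>C. T i) \<in> sets p" using C(1) Tm by (intro sets.finite_UN) auto
    ultimately show "(\<lambda>t. cpush f t s) -` U \<inter> space p \<in> sets p" by simp
  qed
qed

lemma cpush_cont: "t \<in> space p \<Longrightarrow> continuous_on sph (cpush f t)"
proof -
  assume t: "t \<in> space p"
  show ?thesis
  proof (cases "t \<in> bad f")
    case True
    then have "cpush f t = snd" by (auto simp: cpush_def)
    then show ?thesis by (simp add: continuous_on_snd continuous_on_id)
  next
    case False
    then have "cpush f t = (\<lambda>s. push (one_step f t) (fst s) (snd s))" by (auto simp: cpush_def)
    then show ?thesis using sph_push_cont[OF f_good[OF t False]] by simp
  qed
qed

lemma cpush_pos: "t \<in> space p \<Longrightarrow> s \<in> sph \<Longrightarrow> norm (cpush f t s) > 0"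
proof -
  assume t: "t \<in> space p" and s: "s \<in> sph"
  show ?thesis
  proof (cases "t \<in> bad f")
    case True
    have "norm (snd s) = 1" using s unfolding sph_def by auto
    then show ?thesis using True by (simp add: cpush_def)
  next
    case False
    then show ?thesis using sph_norm_push[OF f_good[OF t False] s] by (simp add: cpush_def)
  qed
qed

lemma base_map_measurable: "(\<lambda>t. base_map f t x) \<in> borel_measurable p"
proof -
  have [measurable]: "(\<lambda>t. one_step f t x) \<in> borel_measurable p" by (rule one_step_point[OF f_random])
  show ?thesis unfolding base_map_def by measurable
qed

lemma cmap_eq: "s \<in> sph \<Longrightarrow> cmap f t s = (base_map f t (fst s), cpush f t s /\<^sub>R norm (cpush f t s))"
  by (auto simp: cmap_def base_map_def cpush_def smap_def sph_def)

lemma clog_eq: "s \<in> sph \<Longrightarrow> clog f t s = ln (norm (cpush f t s))"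
  by (auto simp: clog_def cpush_def slog_def sph_def)

text \<open>A single formula for both branches: on the exceptional set \<open>cpush\<close> has norm
  1 on unit vectors, so both logarithms vanish. Measurability of \<open>cbound\<close> is read off
  from it.\<close>

lemma cbound_eq: "cbound f t = max 0 (ln (SUP s\<in>sph. norm (cpush f t s))) + max 0 (ln (SUP s\<in>sph. 1 / norm (cpush f t s)))"
proof (cases "t \<in> bad f")
  case True
  have "(SUP s\<in>sph. norm (cpush f t s)) = (SUP s\<in>sph. 1)" "(SUP s\<in>sph. 1 / norm (cpush f t s)) = (SUP s\<in>sph. 1)"
    using True by (intro SUP_cong refl, auto simp: cpush_def sph_def)+
  then show ?thesis using True sph_ne by (simp add: cbound_def)
next
  case False
  then show ?thesis by (simp add: cbound_def dom_fun_def Umax_def Linv_def cpush_def)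
qed

lemma cbound_measurable[measurable]: "cbound f \<in> borel_measurable p"
proof -
  have [measurable]: "(\<lambda>t. SUP s\<in>sph. norm (cpush f t s)) \<in> borel_measurable p"
    using cpush_measurable by (intro SUP_measurable[OF sph_compact sph_ne] continuous_on_norm cpush_cont) auto
  have [measurable]: "(\<lambda>t. SUP s\<in>sph. 1 / norm (cpush f t s)) \<in> borel_measurable p"
  proof (rule SUP_measurable[OF sph_compact sph_ne])
    fix t assume t: "t \<in> space p"
    show "continuous_on sph (\<lambda>s. 1 / norm (cpush f t s))"
      using cpush_pos[OF t] by (intro continuous_intros cpush_cont[OF t]) force+
  next
    fix s assume "s \<in> sph"
    then have [measurable]: "(\<lambda>t. cpush f t s) \<in> borel_measurable p" by (rule cpush_measurable)
    show "(\<lambda>t. 1 / norm (cpush f t s)) \<in> borel_measurable p" by measurable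
  qed
  have "cbound f = (\<lambda>t. max 0 (ln (SUP s\<in>sph. norm (cpush f t s))) + max 0 (ln (SUP s\<in>sph. 1 / norm (cpush f t s))))"
    using cbound_eq by (rule ext)
  then show ?thesis by simp
qed

lemma cbound_nonneg: "0 \<le> cbound f t" by (simp add: cbound_def dom_fun_def)

text \<open>The integrand of the moment condition need not be measurable, but monotonicity of the
  nonnegative integral suffices, as \<open>cbound\<close> is measurable and lies below it almost
  everywhere.\<close>

lemma cbound_integrable: "integrable p (cbound f)"
proof (rule integrableI_nonneg)
  have d: "distr P p (\<lambda>\<omega>. \<omega> 0) = p" by (rule distr_PiM_component) (auto intro: prob_space_axioms)
  have m: "(\<lambda>\<omega>. \<omega> 0) \<in> P \<rightarrow>\<^sub>M p" by measurable
  have "(\<integral>\<^sup>+t. ennreal (cbound f t) \<partial>p) = (\<integral>\<^sup>+\<omega>. ennreal (cbound f (\<omega> 0)) \<partial>P)"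
    by (subst d[symmetric]) (rule nn_integral_distr[OF m], measurable)
  also have "\<dots> \<le> (\<integral>\<^sup>+\<omega>. log_plus (sup_norm_D M X (f \<omega>)) + log_plus (sup_norm_Dinv M X (f \<omega>)) \<partial>P)"
  proof (rule nn_integral_mono_AE)
    show "AE \<omega> in P. ennreal (cbound f (\<omega> 0)) \<le> log_plus (sup_norm_D M X (f \<omega>)) + log_plus (sup_norm_Dinv M X (f \<omega>))"
      using AE_path_coord[OF AE_not_bad, of 0] AE_space
    proof eventually_elim
      case (elim \<omega>)
      have "good (one_step f (\<omega> 0))" by (rule f_good[OF path_at[OF elim(2)] elim(1)])
      from dom_fun_le[OF this] show ?case using elim one_step_eq[OF f_random elim(2)] by (simp add: cbound_def)
    qed
  qed
  also have "\<dots> < \<infinity>" using f unfolding Diff1_loc_def by blast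
  finally show "(\<integral>\<^sup>+t. ennreal (cbound f t) \<partial>p) < \<infinity>" .
qed (auto simp: cbound_nonneg)

lemma cocycle: "random_cocycle p sph (cmap f) (clog f) (cbound f)"
proof
  show "compact sph" by (rule sph_compact)
  show "cmap f t s \<in> sph" if "t \<in> space p" "s \<in> sph" for t s
    using smap_in[OF f_good] that by (auto simp: cmap_def)
  show "continuous_on sph (cmap f t)" if t: "t \<in> space p" for t
  proof (cases "t \<in> bad f")
    case True
    then have "cmap f t = (\<lambda>s. s)" by (auto simp: cmap_def)
    then show ?thesis by (simp add: continuous_on_id)
  next
    case False
    then have "cmap f t = smap (one_step f t)" by (auto simp: cmap_def)
    then show ?thesis using smap_cont[OF f_good[OF t False]] by simp
  qed
  show "continuous_on sph (clog f t)" if t: "t \<in> space p" for t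
  proof (cases "t \<in> bad f")
    case True
    then have "clog f t = (\<lambda>s. 0)" by (auto simp: clog_def)
    then show ?thesis by simp
  next
    case False
    then have "clog f t = slog (one_step f t)" by (auto simp: clog_def)
    then show ?thesis using slog_cont[OF f_good[OF t False]] by simp
  qed
  show "(\<lambda>t. cmap f t s) \<in> borel_measurable p" if s: "s \<in> sph" for s
  proof -
    have [measurable]: "(\<lambda>t. cpush f t s) \<in> borel_measurable p" by (rule cpush_measurable[OF s])
    have [measurable]: "(\<lambda>t. base_map f t (fst s)) \<in> borel_measurable p" by (rule base_map_measurable)
    show ?thesis unfolding cmap_eq[OF s] by measurable
  qed
  show "(\<lambda>t. clog f t s) \<in> borel_measurable p" if s: "s \<in> sph" for s
  proof -
    have [measurable]: "(\<lambda>t. cpush f t s) \<in> borel_measurable p" by (rule cpush_measurable[OF s])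
    show ?thesis unfolding clog_eq[OF s] by measurable
  qed
  show "integrable p (cbound f)" by (rule cbound_integrable)
  show "\<bar>clog f t s\<bar> \<le> cbound f t" if t: "t \<in> space p" and s: "s \<in> sph" for t s
    using slog_bounds(3)[OF f_good[OF t] s] by (auto simp: clog_def cbound_def dom_fun_def)
qed

lemma base_cocycle: "random_cocycle p X (base_map f) (\<lambda>_ _. 0) (\<lambda>_. 0)"
proof
  show "compact X" by (rule X_compact)
  show "base_map f t x \<in> X" if "t \<in> space p" "x \<in> X" for t x
    using good_in[OF f_good] that by (auto simp: base_map_def)
  show "continuous_on X (base_map f t)" if t: "t \<in> space p" for t
  proof (cases "t \<in> bad f")
    case True
    then have "base_map f t = (\<lambda>s. s)" by (auto simp: base_map_def)
    then show ?thesis by (simp add: continuous_on_id)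
  next
    case False
    then have "base_map f t = one_step f t" by (auto simp: base_map_def)
    then show ?thesis using good_cont[OF f_good[OF t False]] by simp
  qed
qed (auto intro: base_map_measurable)

end

end

section \<open>Dependence on the point, and Borel unit vector fields\<close>

context random_cocycle
begin

lemma orbit_cont: "\<omega> \<in> space (path_space p) \<Longrightarrow> continuous_on S (orbit F n \<omega>)"
proof (induction n)
  case 0
  have "orbit F 0 \<omega> = (\<lambda>s. s)" by (rule ext) simp
  then show ?case by (simp add: continuous_on_id)
next
  case (Suc n)
  have "continuous_on S (\<lambda>s. F (\<omega> n) (orbit F n \<omega> s))"
    by (rule continuous_on_compose2[OF F_cont[OF path_in[OF Suc.prems]] Suc.IH[OF Suc.prems]])
      (use orbit_in[OF Suc.prems] in auto)
  then show ?case by simp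
qed

lemma birkhoff_cont: "\<omega> \<in> space (path_space p) \<Longrightarrow> continuous_on S (birkhoff_sum F l n \<omega>)"
proof -
  assume w: "\<omega> \<in> space (path_space p)"
  have "continuous_on S (\<lambda>s. \<Sum>j<n. l (\<omega> j) (orbit F j \<omega> s))"
  proof (rule continuous_on_sum)
    fix j
    show "continuous_on S (\<lambda>s. l (\<omega> j) (orbit F j \<omega> s))"
      by (rule continuous_on_compose2[OF l_cont[OF path_in[OF w]] orbit_cont[OF w]]) (use orbit_in[OF w] in auto)
  qed
  then show ?thesis unfolding birkhoff_sum_def by simp
qed

lemma emeasure_section_path:
  assumes \<nu>: "\<nu> \<in> borel_prob_on S" and A: "A \<in> sets \<nu>"
  shows "(\<integral>\<^sup>+\<omega>. emeasure \<nu> (F (\<omega> 0) -` A \<inter> S) \<partial>path_space p) = (\<integral>\<^sup>+t. emeasure \<nu> (F t -` A \<inter> S) \<partial>p)"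
proof -
  interpret n: prob_space \<nu> using borel_prob_onD(1)[OF \<nu>] .
  have e: "space \<nu> = S" using borel_prob_onD[OF \<nu>] by auto
  note m = emeasure_pushforward(2)[OF \<nu> A]
  have "(\<lambda>t. emeasure \<nu> (Pair t -` ((\<lambda>(t, s). F t s) -` A \<inter> space (p \<Otimes>\<^sub>M \<nu>)))) \<in> borel_measurable p"
    by (rule n.measurable_emeasure_Pair[OF measurable_sets[OF m A]])
  then have g: "(\<lambda>t. emeasure \<nu> (F t -` A \<inter> S)) \<in> borel_measurable p"
    by (rule measurable_cong[THEN iffD1, rotated])
      (auto intro!: arg_cong[where f="emeasure \<nu>"] simp: space_pair_measure e)
  have d: "distr (path_space p) p (\<lambda>\<omega>. \<omega> 0) = p" by (rule distr_PiM_component) (auto intro: prob_space_axioms)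
  have mm: "(\<lambda>\<omega>. \<omega> 0) \<in> path_space p \<rightarrow>\<^sub>M p" by measurable
  have g': "(\<lambda>t. emeasure \<nu> (F t -` A \<inter> S)) \<in> borel_measurable (distr (path_space p) p (\<lambda>\<omega>. \<omega> 0))"
    using g by simp
  show ?thesis using nn_integral_distr[OF mm g'] d by simp
qed

end

context embedded_mfd
begin

text \<open>Each point uses the chart of the first compact piece of the cover that contains it. This
  gives, for every nonzero coordinate vector, a Borel field of unit vectors over \<open>X\<close>,
  with comparison constants uniform over the finitely many pieces.\<close>

lemma measurable_sections:
  obtains ch k1 k2 where "k1 > 0" "k2 > 0" "\<And>x. x \<in> X \<Longrightarrow> ch x \<in> charts_at M x"
    "\<And>x a. x \<in> X \<Longrightarrow> k1 * norm a \<le> norm (emb (ch x) x a)"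
    "\<And>x a. x \<in> X \<Longrightarrow> norm (emb (ch x) x a) \<le> k2 * norm a"
    "\<And>a. a \<noteq> 0 \<Longrightarrow> (\<lambda>x. nemb (ch x) x a) \<in> restrict_space borel X \<rightarrow>\<^sub>M restrict_space borel sph"
proof -
  obtain C c0 K0 where C: "finite C" "C \<subseteq> X" "\<And>i. i \<in> C \<Longrightarrow> c0 i \<in> charts M" "\<And>i. i \<in> C \<Longrightarrow> compact (K0 i)"
    "\<And>i. i \<in> C \<Longrightarrow> K0 i \<subseteq> chart_dom (c0 i) \<inter> X" "X = (\<Union>i\<in>C. K0 (i::'m))"
    by (rule chart_cover, rule that)
  obtain N :: nat and g where g: "C = g ` {i. i < N}" using finite_imp_nat_seg_image_inj_on[OF C(1)] by blast
  define c where "c j = c0 (g j)" for j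
  define K where "K j = K0 (g j)" for j
  have K: "c j \<in> charts M" "compact (K j)" "K j \<subseteq> chart_dom (c j) \<inter> X" if "j < N" for j
    using C(3-5)[of "g j"] that g unfolding c_def K_def by auto
  have cov: "\<exists>j<N. x \<in> K j" if "x \<in> X" for x using C(6) that g unfolding K_def by auto
  define idx where "idx x = (LEAST j. x \<in> K j)" for x
  have idx: "idx x < N" "x \<in> K (idx x)" if x: "x \<in> X" for x
  proof -
    obtain j where j: "j < N" "x \<in> K j" using cov[OF x] by blast
    show "x \<in> K (idx x)" unfolding idx_def using j(2) by (rule LeastI)
    have "idx x \<le> j" unfolding idx_def using j(2) by (rule Least_le)
    then show "idx x < N" using j(1) by simp
  qed
  have bex: "\<exists>q. fst q > 0 \<and> (\<forall>x\<in>K j. \<forall>a. fst q * norm a \<le> norm (emb (c j) x a) \<and> norm (emb (c j) x a) \<le> snd q * norm a)" if j: "j < N" for j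
  proof -
    obtain k1 k2 where "k1 > 0" "\<And>x a. x \<in> K j \<Longrightarrow> k1 * norm a \<le> norm (emb (c j) x a)"
      "\<And>x a. x \<in> K j \<Longrightarrow> norm (emb (c j) x a) \<le> k2 * norm a"
      by (rule emb_bounds[OF K(1)[OF j] K(2)[OF j] K(3)[OF j]], rule that)
    then show ?thesis by (intro exI[of _ "(k1, k2)"]) simp
  qed
  then have "\<forall>j\<in>{..<N}. \<exists>q. fst q > (0::real) \<and> (\<forall>x\<in>K j. \<forall>a. fst q * norm a \<le> norm (emb (c j) x a) \<and> norm (emb (c j) x a) \<le> snd q * norm a)" by blast
  from bchoice[OF this] obtain q where q: "\<And>j. j < N \<Longrightarrow> fst (q j) > (0::real)"
    "\<And>j x a. j < N \<Longrightarrow> x \<in> K j \<Longrightarrow> fst (q j) * norm a \<le> norm (emb (c j) x a)"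
    "\<And>j x a. j < N \<Longrightarrow> x \<in> K j \<Longrightarrow> norm (emb (c j) x a) \<le> snd (q j) * norm a" by auto
  obtain x0 where "x0 \<in> X" using X_ne by blast
  then have N0: "{..<N} \<noteq> {}" using idx(1) by blast
  define k1 where "k1 = Min ((\<lambda>j. fst (q j)) ` {..<N})"
  \<comment> \<open>Inserting 1 makes the upper constant positive.\<close>
  define k2 where "k2 = Max (insert 1 ((\<lambda>j. snd (q j)) ` {..<N}))"
  have k1: "k1 > 0" unfolding k1_def using N0 q(1) by (subst Min_gr_iff) auto
  have k1l: "k1 \<le> fst (q j)" if "j < N" for j unfolding k1_def using that by (intro Min_le) auto
  have k2: "k2 > 0"
  proof -
    have "1 \<le> k2" unfolding k2_def by (intro Max_ge) auto
    then show ?thesis by simp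
  qed
  have k2g: "snd (q j) \<le> k2" if "j < N" for j unfolding k2_def using that by (intro Max_ge) auto
  show ?thesis
  proof (rule that[OF k1 k2, of "\<lambda>x. c (idx x)"])
    fix x assume x: "x \<in> X"
    show "c (idx x) \<in> charts_at M x" using K[OF idx(1)[OF x]] idx(2)[OF x] by (auto simp: chart_at)
    fix a :: 'e
    have "k1 * norm a \<le> fst (q (idx x)) * norm a" by (intro mult_right_mono k1l idx x) simp
    also have "\<dots> \<le> norm (emb (c (idx x)) x a)" by (rule q(2)[OF idx(1)[OF x] idx(2)[OF x]])
    finally show "k1 * norm a \<le> norm (emb (c (idx x)) x a)" .
    have "norm (emb (c (idx x)) x a) \<le> snd (q (idx x)) * norm a" by (rule q(3)[OF idx(1)[OF x] idx(2)[OF x]])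
    also have "\<dots> \<le> k2 * norm a" by (intro mult_right_mono k2g idx x) simp
    finally show "norm (emb (c (idx x)) x a) \<le> k2 * norm a" .
  next
    fix a :: 'e assume a: "a \<noteq> 0"
    obtain z0 where z0: "z0 \<in> sph" using sph_ne by blast
    define E where "E j x = (if x \<in> K j \<and> j < N then nemb (c j) x a else z0)" for j x
    have Em: "E j \<in> borel_measurable borel" for j
    proof (cases "j < N")
      case True
      have "(\<lambda>x. if x \<in> K j then (\<lambda>(x, a). nemb (c j) x a) (x, a) else z0) \<in> borel_measurable borel"
      proof (rule borel_measurable_continuous_on_if)
        show "K j \<in> sets borel" using K(2)[OF True] by (intro borel_closed compact_imp_closed)
        show "continuous_on (K j) (\<lambda>x. (\<lambda>(x, a). nemb (c j) x a) (x, a))"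
          by (rule continuous_on_compose2[OF nemb_cont[OF K(1)[OF True]]])
            (use K(3)[OF True] a in \<open>auto intro!: continuous_intros\<close>)
      qed auto
      moreover have "E j = (\<lambda>x. if x \<in> K j then (\<lambda>(x, a). nemb (c j) x a) (x, a) else z0)"
        using True by (auto simp: E_def)
      ultimately show ?thesis by simp
    next
      case False
      then have "E j = (\<lambda>x. z0)" by (auto simp: E_def)
      then show ?thesis by simp
    qed
    have Es: "E j x \<in> sph" for j x
      using nemb_in[of x "c j" a] K[of j] a z0 unfolding E_def by (auto simp: chart_at)
    have Em': "E j \<in> restrict_space borel X \<rightarrow>\<^sub>M restrict_space borel sph" for j
      using Es by (intro measurable_restrict_space2 measurable_restrict_space1 Em) auto
    have im: "idx \<in> restrict_space borel X \<rightarrow>\<^sub>M count_space UNIV"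
    proof -
      \<comment> \<open>Only the pieces with index below \<open>N\<close> are known to be Borel. The
        extra disjunct makes the predicate measurable for every index and leaves the least index
        over \<open>X\<close> unchanged.\<close>
      have [measurable]: "Measurable.pred (restrict_space borel X) (\<lambda>x. x \<in> K j \<or> N \<le> j)" for j
      proof (cases "j < N")
        case True
        have "K j \<in> sets borel" using K(2)[OF True] by (intro borel_closed compact_imp_closed)
        then have "K j \<inter> X \<in> sets (restrict_space borel X)" by (auto simp: sets_restrict_space)
        moreover have "{x \<in> space (restrict_space borel X). x \<in> K j \<or> N \<le> j} = K j \<inter> X"
          using True by (auto simp: space_restrict_space)
        ultimately show ?thesis unfolding pred_def by simp
      qed simp
      have "(\<lambda>x. LEAST j. x \<in> K j \<or> N \<le> j) \<in> restrict_space borel X \<rightarrow>\<^sub>M count_space UNIV"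
        by measurable
      moreover have "(LEAST j. x \<in> K j \<or> N \<le> j) = idx x" if "x \<in> space (restrict_space borel X)" for x
      proof -
        have x: "x \<in> X" using that by (simp add: space_restrict_space)
        show ?thesis
        proof (rule Least_equality)
          show "x \<in> K (idx x) \<or> N \<le> idx x" using idx(2)[OF x] by simp
          fix j assume j: "x \<in> K j \<or> N \<le> j"
          show "idx x \<le> j"
          proof (cases "x \<in> K j")
            case True then show ?thesis unfolding idx_def by (rule Least_le)
          next
            case False then show ?thesis using j idx(1)[OF x] by simp
          qed
        qed
      qed
      ultimately show ?thesis by (rule measurable_cong[THEN iffD1, rotated])
    qed
    have "(\<lambda>x. E (idx x) x) \<in> restrict_space borel X \<rightarrow>\<^sub>M restrict_space borel sph"
      by (rule measurable_compose_countable[OF Em' im])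
    then show "(\<lambda>x. nemb (c (idx x)) x a) \<in> restrict_space borel X \<rightarrow>\<^sub>M restrict_space borel sph"
      by (rule measurable_cong[THEN iffD1, rotated]) (use idx in \<open>auto simp: E_def space_restrict_space\<close>)
  qed
qed

end

section \<open>The variational formula for the exponent\<close>

text \<open>Along a line in a coordinate direction a linear map is small at no more than one lattice point; so
  lattice vectors detect the norm of a linear map, up to a fraction \<open>1 / K\<close> of them.\<close>

definition lattice_vec :: "('e::euclidean_space \<Rightarrow> nat) \<Rightarrow> 'e" where
  "lattice_vec \<tau> = (\<Sum>i\<in>Basis. real (\<tau> i) *\<^sub>R i)"

definition lattice_box :: "nat \<Rightarrow> ('e::euclidean_space \<Rightarrow> nat) set" where
  "lattice_box K = (\<Pi>\<^sub>E i\<in>Basis. {1..K})"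

lemma finite_lattice_box: "finite (lattice_box K :: ('e::euclidean_space \<Rightarrow> nat) set)"
  unfolding lattice_box_def by (intro finite_PiE) auto

lemma card_lattice_box: "card (lattice_box K :: ('e::euclidean_space \<Rightarrow> nat) set) = K ^ DIM('e)"
  unfolding lattice_box_def by (simp add: card_PiE)

lemma lattice_vec_nonzero:
  assumes "\<tau> \<in> lattice_box K" shows "lattice_vec \<tau> \<noteq> (0::'e::euclidean_space)"
proof
  assume z: "lattice_vec \<tau> = (0::'e)"
  obtain i :: 'e where i: "i \<in> Basis" using nonempty_Basis by blast
  have "lattice_vec \<tau> \<bullet> i = real (\<tau> i)" unfolding lattice_vec_def
    using i by (simp add: inner_sum_left inner_Basis if_distrib[of "(*) _"] sum.delta cong: if_cong)
  then have "\<tau> i = 0" using z by simp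
  moreover have "\<tau> i \<in> {1..K}" using assms i unfolding lattice_box_def by blast
  ultimately show False by simp
qed

lemma norm_lattice_vec:
  assumes "\<tau> \<in> lattice_box K" shows "norm (lattice_vec \<tau> :: 'e::euclidean_space) \<le> real DIM('e) * real K"
proof -
  have "norm (lattice_vec \<tau> :: 'e) \<le> (\<Sum>i\<in>(Basis::'e set). norm (real (\<tau> i) *\<^sub>R i))" unfolding lattice_vec_def by (rule norm_sum)
  also have "\<dots> \<le> (\<Sum>i\<in>(Basis::'e set). real K)"
  proof (rule sum_mono)
    fix i :: 'e assume i: "i \<in> Basis"
    have "\<tau> i \<in> {1..K}" using assms i unfolding lattice_box_def by blast
    then show "norm (real (\<tau> i) *\<^sub>R i) \<le> real K" using i by simp
  qed
  finally show ?thesis by simp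
qed

text \<open>Take the basis vector \<open>i\<close> whose image has the largest norm
  \<open>m\<close>. Two bad vectors that agree off \<open>i\<close> have images differing by less
  than \<open>m / 2 + m / 2\<close>, while a nonzero integer multiple of \<open>B i\<close> has norm
  at least \<open>m\<close>. So the other coordinates determine a bad vector, leaving at most
  \<open>K ^ (DIM('e) - 1)\<close> of them.\<close>

lemma card_bad_lattice_vecs:
  fixes B :: "'e::euclidean_space \<Rightarrow> 'r::euclidean_space"
  assumes B: "linear B"
  shows "real K * real (card {\<tau> \<in> lattice_box K. norm (B (lattice_vec \<tau>)) < Max ((\<lambda>i. norm (B i)) ` Basis) / 2}) \<le> real (card (lattice_box K :: ('e \<Rightarrow> nat) set))"
proof -
  let ?m = "Max ((\<lambda>i. norm (B i)) ` Basis)"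
  let ?bad = "{\<tau> \<in> lattice_box K. norm (B (lattice_vec \<tau>)) < ?m / 2}"
  have "?m \<in> (\<lambda>i. norm (B i)) ` Basis" by (intro Max_in) auto
  then obtain i where "i \<in> Basis" "?m = norm (B i)" by (rule imageE)
  then have i: "i \<in> Basis" "norm (B i) = ?m" by simp_all
  have inj: "inj_on (\<lambda>\<tau>. restrict \<tau> (Basis - {i})) ?bad"
  proof (rule inj_onI)
    fix \<tau> \<tau>' assume t: "\<tau> \<in> ?bad" "\<tau>' \<in> ?bad" and e: "restrict \<tau> (Basis - {i}) = restrict \<tau>' (Basis - {i})"
    have eq: "\<tau> j = \<tau>' j" if "j \<in> Basis" "j \<noteq> i" for j
      using fun_cong[OF e, of j] that by simp
    have "lattice_vec \<tau> - lattice_vec \<tau>' = (\<Sum>j\<in>Basis. (real (\<tau> j) - real (\<tau>' j)) *\<^sub>R j)"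
      unfolding lattice_vec_def by (simp add: sum_subtractf scaleR_diff_left)
    also have "\<dots> = (\<Sum>j\<in>Basis. if j = i then (real (\<tau> i) - real (\<tau>' i)) *\<^sub>R i else 0)"
      using eq by (intro sum.cong) auto
    also have "\<dots> = (real (\<tau> i) - real (\<tau>' i)) *\<^sub>R i" using i(1) by simp
    finally have d: "lattice_vec \<tau> - lattice_vec \<tau>' = (real (\<tau> i) - real (\<tau>' i)) *\<^sub>R i" .
    have "\<bar>real (\<tau> i) - real (\<tau>' i)\<bar> * ?m = norm (B (lattice_vec \<tau> - lattice_vec \<tau>'))"
      unfolding d linear_scale[OF B] using i(2) by simp
    also have "\<dots> \<le> norm (B (lattice_vec \<tau>)) + norm (B (lattice_vec \<tau>'))"
      unfolding linear_diff[OF B] by (rule norm_triangle_ineq4)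
    also have "\<dots> < ?m" using t by simp
    finally have lt: "\<bar>real (\<tau> i) - real (\<tau>' i)\<bar> * ?m < ?m" .
    have m0: "0 \<le> ?m" using i(2) norm_ge_zero by metis
    have "\<tau> i = \<tau>' i"
    proof (rule ccontr)
      assume "\<tau> i \<noteq> \<tau>' i"
      then have "1 \<le> \<bar>real (\<tau> i) - real (\<tau>' i)\<bar>" by linarith
      then have "1 * ?m \<le> \<bar>real (\<tau> i) - real (\<tau>' i)\<bar> * ?m" using m0 by (rule mult_right_mono)
      then show False using lt by linarith
    qed
    then have "\<And>j. j \<in> Basis \<Longrightarrow> \<tau> j = \<tau>' j" using eq by blast
    then show "\<tau> = \<tau>'" using t unfolding lattice_box_def by (intro PiE_ext[of \<tau> Basis _ \<tau>']) auto
  qed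
  have "(\<lambda>\<tau>. restrict \<tau> (Basis - {i})) ` ?bad \<subseteq> (\<Pi>\<^sub>E j\<in>Basis - {i}. {1..K})"
  proof (rule image_subsetI)
    fix \<tau> assume "\<tau> \<in> ?bad"
    then have "\<tau> j \<in> {1..K}" if "j \<in> Basis" for j using that unfolding lattice_box_def by (auto simp: PiE_iff)
    then show "restrict \<tau> (Basis - {i}) \<in> (\<Pi>\<^sub>E j\<in>Basis - {i}. {1..K})" by (simp add: restrict_PiE_iff del: atLeastAtMost_iff)
  qed
  then have "card ?bad \<le> card (\<Pi>\<^sub>E j\<in>Basis - {i}. {1..K})"
    by (rule card_inj_on_le[OF inj]) (rule finite_PiE, simp_all)
  also have "\<dots> = K ^ (DIM('e) - 1)" using i(1) by (simp add: card_PiE)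
  finally have "K * card ?bad \<le> K * K ^ (DIM('e) - 1)" by simp
  also have "\<dots> = K ^ DIM('e)" using DIM_positive[where 'a='e] by (simp add: power_eq_if[of K "DIM('e)"])
  finally have "real (K * card ?bad) \<le> real (K ^ DIM('e))" by (simp only: of_nat_le_iff)
  then show ?thesis unfolding card_lattice_box by simp
qed

text \<open>Plays the part of Fekete's lemma. Every subsequential limit lies below every term, hence
  below every other subsequential limit, so all of them coincide.\<close>

lemma real_limit_from_subsequences:
  fixes u :: "nat \<Rightarrow> real"
  assumes b: "\<And>n. \<bar>u n\<bar> \<le> B"
    and s: "\<And>r l n. strict_mono r \<Longrightarrow> (u \<circ> r) \<longlonglongrightarrow> l \<Longrightarrow> n > 0 \<Longrightarrow> l \<le> u n"
  obtains l where "u \<longlonglongrightarrow> l" "\<And>n. n > 0 \<Longrightarrow> l \<le> u n"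
proof -
  have bd: "bounded (range u)" unfolding bounded_iff using b by auto
  have sub: "\<exists>l r'. strict_mono r' \<and> (u \<circ> r') \<longlonglongrightarrow> l \<and> (\<exists>q. r' = r \<circ> q)" if r: "strict_mono r" for r :: "nat \<Rightarrow> nat"
  proof -
    have "bounded (range (u \<circ> r))" by (rule bounded_subset[OF bd]) auto
    from bounded_imp_convergent_subsequence[OF this] obtain l q where q: "strict_mono q" "((u \<circ> r) \<circ> q) \<longlonglongrightarrow> l" by blast
    then show ?thesis using strict_mono_o[OF r q(1)] by (intro exI[of _ l] exI[of _ "r \<circ> q"]) (auto simp: comp_assoc)
  qed
  obtain l r where r: "strict_mono r" "(u \<circ> r) \<longlonglongrightarrow> l" using sub[OF strict_mono_id] by blast
  have le: "l \<le> u n" if "n > 0" for n by (rule s[OF r that])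
  have "u \<longlonglongrightarrow> l"
  proof (rule ccontr)
    assume "\<not> u \<longlonglongrightarrow> l"
    then obtain e where e: "e > 0" "\<not> eventually (\<lambda>n. dist (u n) l < e) sequentially"
      unfolding tendsto_iff by blast
    obtain q :: "nat \<Rightarrow> nat" where q0: "strict_mono q" "\<forall>n. \<not> dist (u (q n)) l < e"
      using not_eventually_sequentiallyD[OF e(2)] by auto
    note q = q0(1) spec[OF q0(2)]
    obtain l' q' q'' where q': "strict_mono q'" "(u \<circ> q') \<longlonglongrightarrow> l'" "q' = q \<circ> q''" using sub[OF q(1)] by blast
    have "l' \<le> (u \<circ> r) n" if "n \<ge> 1" for n
    proof -
      have "r n > 0" using strict_mono_imp_increasing[OF r(1), of n] that by linarith
      then show ?thesis using s[OF q'(1,2)] by simp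
    qed
    then have "l' \<le> l" by (intro LIMSEQ_le_const[OF r(2)]) blast
    moreover have "l \<le> (u \<circ> q') n" if "n \<ge> 1" for n
    proof -
      have "q' n > 0" using strict_mono_imp_increasing[OF q'(1), of n] that by linarith
      then show ?thesis using le by simp
    qed
    then have "l \<le> l'" by (intro LIMSEQ_le_const[OF q'(2)]) blast
    ultimately have "(u \<circ> q') \<longlonglongrightarrow> l" using q'(2) by simp
    then have "eventually (\<lambda>n. dist ((u \<circ> q') n) l < e) sequentially" using e(1) tendstoD by blast
    then obtain n where "\<forall>m\<ge>n. dist ((u \<circ> q') m) l < e" unfolding eventually_sequentially by blast
    then have "dist ((u \<circ> q') n) l < e" by simp
    then show False using q(2) q'(3) by simp
  qed
  then show ?thesis using that le by blast
qed

context random_embedded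
begin

definition cphi :: "((nat \<Rightarrow> 't) \<Rightarrow> 'm \<Rightarrow> 'm) \<Rightarrow> 'm \<times> 'r \<Rightarrow> real" where
  "cphi f s = (\<integral>t. clog f t s \<partial>p)"

definition proj :: "('m \<times> 'r) measure \<Rightarrow> 'm measure" where
  "proj \<nu> = distr \<nu> (restrict_space borel X) fst"

lemma fst_measurable_sph:
  assumes "\<nu> \<in> borel_prob_on sph" shows "fst \<in> \<nu> \<rightarrow>\<^sub>M restrict_space borel X"
proof (rule measurable_restrict_space2)
  show "fst \<in> space \<nu> \<rightarrow> X" using borel_prob_onD(3)[OF assms] by (auto simp: sph_def)
  show "fst \<in> borel_measurable \<nu>"
    by (rule borel_prob_on_measurable[OF assms]) (simp add: continuous_on_fst continuous_on_id)
qed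

lemma proj_prob: "\<nu> \<in> borel_prob_on sph \<Longrightarrow> proj \<nu> \<in> borel_prob_on X"
  using prob_space.prob_space_distr[OF borel_prob_onD(1) fst_measurable_sph]
  by (auto simp: borel_prob_on_def proj_def)

lemma integral_proj:
  fixes a :: "'m \<Rightarrow> real"
  assumes "\<nu> \<in> borel_prob_on sph" "a \<in> borel_measurable (restrict_space borel X)"
  shows "(\<integral>x. a x \<partial>proj \<nu>) = (\<integral>s. a (fst s) \<partial>\<nu>)"
  unfolding proj_def by (rule integral_distr[OF fst_measurable_sph[OF assms(1)] assms(2)])

lemma fst_comp_cont: "continuous_on X (a :: _ \<Rightarrow> real) \<Longrightarrow> continuous_on sph (\<lambda>s. a (fst s))"
  by (rule continuous_on_compose2[where f=fst]) (auto simp: sph_def intro!: continuous_intros)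

context
  fixes f assumes f: "f \<in> Diff1_loc M p X"
begin

interpretation C: random_cocycle p sph "cmap f" "clog f" "cbound f" by (rule cocycle[OF f])
interpretation B: random_cocycle p X "base_map f" "\<lambda>_ _. 0" "\<lambda>_. 0" by (rule base_cocycle[OF f])

lemma cphi_mean: "C.mean_log = cphi f" unfolding C.mean_log_def cphi_def ..

lemma cphi_cont: "continuous_on sph (cphi f)" using C.mean_log_cont cphi_mean by simp

lemma fst_cmap: "s \<in> sph \<Longrightarrow> fst (cmap f t s) = base_map f t (fst s)"
  using cmap_eq[OF f] by simp

text \<open>The base point of the orbit moves independently of the vector, so functions of the base
  point are carried by the base operator. This is how projections of measures to \<open>X\<close>
  are followed.\<close>

lemma Top_pow_fst:
  "s \<in> sph \<Longrightarrow> (transfer_op p (cmap f) ^^ n) (\<lambda>s. a (fst s)) s = (transfer_op p (base_map f) ^^ n) a (fst s)"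
proof (induction n arbitrary: s)
  case (Suc n)
  have "(transfer_op p (cmap f) ^^ Suc n) (\<lambda>s. a (fst s)) s = (\<integral>t. (transfer_op p (cmap f) ^^ n) (\<lambda>s. a (fst s)) (cmap f t s) \<partial>p)"
    by (rule C.Top_Suc)
  also have "\<dots> = (\<integral>t. (transfer_op p (base_map f) ^^ n) a (base_map f t (fst s)) \<partial>p)"
    using Suc C.F_in fst_cmap by (intro Bochner_Integration.integral_cong) auto
  also have "\<dots> = (transfer_op p (base_map f) ^^ Suc n) a (fst s)" by (rule B.Top_Suc[symmetric])
  finally show ?case .
qed simp

lemma AE_path_eq: "AE \<omega> in P. \<omega> 0 \<notin> bad f \<and> good (f \<omega>) \<and> f \<omega> = base_map f (\<omega> 0)"
  using AE_path_coord[OF AE_not_bad[OF f], of 0] AE_space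
proof eventually_elim
  case (elim \<omega>)
  have 1: "f \<omega> = one_step f (\<omega> 0)" by (rule one_step_eq[OF f_random[OF f] elim(2)])
  have 2: "good (one_step f (\<omega> 0))" by (rule f_good[OF f path_at[OF elim(2)] elim(1)])
  have 3: "base_map f (\<omega> 0) = one_step f (\<omega> 0)" using elim(1) by (auto simp: base_map_def)
  show ?case unfolding 1 3 using elim(1) 2 by blast
qed

lemma stationary_iff:
  assumes \<mu>: "\<mu> \<in> borel_prob_on X"
  shows "stationary P f \<mu> \<longleftrightarrow> fun_stationary p X (base_map f) \<mu>"
proof -
  have e: "space \<mu> = X" "sets \<mu> = sets (restrict_space borel X)" using borel_prob_onD[OF \<mu>] by auto
  have "(\<integral>\<^sup>+\<omega>. emeasure (distr \<mu> \<mu> (f \<omega>)) A \<partial>P) = (\<integral>\<^sup>+t. emeasure \<mu> (base_map f t -` A \<inter> X) \<partial>p)" if A: "A \<in> sets \<mu>" for A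
  proof -
    have "(\<integral>\<^sup>+\<omega>. emeasure (distr \<mu> \<mu> (f \<omega>)) A \<partial>P) = (\<integral>\<^sup>+\<omega>. emeasure \<mu> (base_map f (\<omega> 0) -` A \<inter> X) \<partial>P)"
    proof (rule nn_integral_cong_AE)
      show "AE \<omega> in P. emeasure (distr \<mu> \<mu> (f \<omega>)) A = emeasure \<mu> (base_map f (\<omega> 0) -` A \<inter> X)"
        using AE_path_eq
      proof eventually_elim
        case (elim \<omega>)
        have g: "good (f \<omega>)" using elim by blast
        have "f \<omega> \<in> restrict_space borel X \<rightarrow>\<^sub>M restrict_space borel X"
          using borel_measurable_continuous_on_restrict[OF good_cont[OF g]] good_in[OF g]
          by (intro measurable_restrict_space2) (auto simp: space_restrict_space)
        then have m: "f \<omega> \<in> \<mu> \<rightarrow>\<^sub>M \<mu>" using measurable_cong_sets[OF e(2) e(2)] by simp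
        show ?case unfolding emeasure_distr[OF m A] using elim e by simp
      qed
    qed
    also have "\<dots> = (\<integral>\<^sup>+t. emeasure \<mu> (base_map f t -` A \<inter> X) \<partial>p)" by (rule B.emeasure_section_path[OF \<mu> A])
    finally show ?thesis .
  qed
  then show ?thesis unfolding stationary_def B.stationary_iff_emeasure[OF \<mu>] by simp
qed

lemma stationary_measures_iff: "\<mu> \<in> stationary_measures p X f \<longleftrightarrow> fun_stationary p X (base_map f) \<mu>"
  using stationary_iff unfolding stationary_measures_def fun_stationary_def by blast

lemma proj_stationary:
  assumes \<nu>: "fun_stationary p sph (cmap f) \<nu>" shows "proj \<nu> \<in> stationary_measures p X f"
proof -
  have b: "\<nu> \<in> borel_prob_on sph" using \<nu> unfolding fun_stationary_def by blast
  have "(\<integral>x. transfer_op p (base_map f) a x \<partial>proj \<nu>) = (\<integral>x. a x \<partial>proj \<nu>)" if a: "continuous_on X a" for a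
  proof -
    have "(\<integral>x. transfer_op p (base_map f) a x \<partial>proj \<nu>) = (\<integral>s. transfer_op p (base_map f) a (fst s) \<partial>\<nu>)"
      by (rule integral_proj[OF b borel_measurable_continuous_on_restrict[OF B.Top_cont[OF a]]])
    also have "\<dots> = (\<integral>s. transfer_op p (cmap f) (\<lambda>s. a (fst s)) s \<partial>\<nu>)"
      using Top_pow_fst[of _ 1 a] borel_prob_onD(3)[OF b] by (intro Bochner_Integration.integral_cong) auto
    also have "\<dots> = (\<integral>s. a (fst s) \<partial>\<nu>)" using \<nu> fst_comp_cont[OF a] unfolding fun_stationary_def by blast
    also have "\<dots> = (\<integral>x. a x \<partial>proj \<nu>)" by (rule integral_proj[OF b borel_measurable_continuous_on_restrict[OF a], symmetric])
    finally show ?thesis .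
  qed
  then show ?thesis unfolding stationary_measures_iff fun_stationary_def using proj_prob[OF b] by blast
qed

text \<open>One almost sure event on which the chain rule is valid for all iterates
  simultaneously.\<close>

definition good_path :: "(nat \<Rightarrow> 't) \<Rightarrow> bool" where
  "good_path \<omega> \<longleftrightarrow> \<omega> \<in> space P \<and> (\<forall>n. \<omega> n \<notin> bad f)"

lemma AE_good_path: "AE \<omega> in P. good_path \<omega>"
proof -
  have "AE \<omega> in P. \<forall>n. \<omega> n \<notin> bad f" unfolding AE_all_countable using AE_path_coord[OF AE_not_bad[OF f]] by blast
  then show ?thesis using AE_space by eventually_elim (simp add: good_path_def)
qed

lemma shift_path: "\<omega> \<in> space P \<Longrightarrow> (\<lambda>k. \<omega> (k + n)) \<in> space P"
  by (auto simp: space_PiM PiE_iff)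

text \<open>The derivative of the iterate scales a unit vector by the product of its one-step
  expansions along the orbit on the sphere bundle, and the product is the exponential of a Birkhoff
  sum. One induction proves all claims because the step needs differentiability and invariance of
  \<open>X\<close> at the previous time.\<close>

lemma iterate_props:
  assumes w: "good_path \<omega>" and x: "x \<in> X"
  shows "diff_at M (random_iterate f n \<omega>) x" "random_iterate f n \<omega> x \<in> X"
    "\<And>w. (x, w) \<in> sph \<Longrightarrow> fst (orbit (cmap f) n \<omega> (x, w)) = random_iterate f n \<omega> x \<and>
      push (random_iterate f n \<omega>) x w = exp (birkhoff_sum (cmap f) (clog f) n \<omega> (x, w)) *\<^sub>R snd (orbit (cmap f) n \<omega> (x, w))"
proof -
  have "diff_at M (random_iterate f n \<omega>) x \<and> random_iterate f n \<omega> x \<in> X \<and>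
    (\<forall>w. (x, w) \<in> sph \<longrightarrow> fst (orbit (cmap f) n \<omega> (x, w)) = random_iterate f n \<omega> x \<and>
      push (random_iterate f n \<omega>) x w = exp (birkhoff_sum (cmap f) (clog f) n \<omega> (x, w)) *\<^sub>R snd (orbit (cmap f) n \<omega> (x, w)))"
  proof (induction n)
    case 0
    have "push id x w = w" if "(x, w) \<in> sph" for w
    proof -
      have "w \<in> fibre x" using that unfolding sph_def by auto
      then show ?thesis unfolding push_def using differential_id[OF tvof_props(1)] tvof_props(2) by simp
    qed
    then have "push id x w = exp (birkhoff_sum (cmap f) (clog f) 0 \<omega> (x, w)) *\<^sub>R snd (orbit (cmap f) 0 \<omega> (x, w))"
      if "(x, w) \<in> sph" for w using that by (simp add: birkhoff_sum_def del: id_apply)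
    moreover have "fst (orbit (cmap f) 0 \<omega> (x, w)) = id x" for w by simp
    moreover have "id x \<in> X" using x by simp
    ultimately show ?case unfolding random_iterate.simps using diff_at_id by blast
  next
    case (Suc n)
    let ?it = "random_iterate f n \<omega>" and ?h = "one_step f (\<omega> n)"
    have wP: "\<omega> \<in> space P" "\<omega> n \<notin> bad f" using w unfolding good_path_def by auto
    have h: "good ?h" by (rule f_good[OF f path_at[OF wP(1)] wP(2)])
    have fh: "f (\<lambda>k. \<omega> (k + n)) = ?h" using one_step_eq[OF f_random[OF f] shift_path[OF wP(1), of n]] by simp
    have it: "random_iterate f (Suc n) \<omega> = ?h \<circ> ?it" using fh by simp
    have d: "diff_at M ?it x" "?it x \<in> X" using Suc by auto
    have 1: "diff_at M (?h \<circ> ?it) x" by (rule diff_at_comp[OF d(1) good_diff[OF h]])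
    have 2: "(?h \<circ> ?it) x \<in> X" using good_in[OF h d(2)] by simp
    have "fst (orbit (cmap f) (Suc n) \<omega> (x, w)) = (?h \<circ> ?it) x \<and>
      push (?h \<circ> ?it) x w = exp (birkhoff_sum (cmap f) (clog f) (Suc n) \<omega> (x, w)) *\<^sub>R snd (orbit (cmap f) (Suc n) \<omega> (x, w))"
      if s: "(x, w) \<in> sph" for w
    proof -
      let ?o = "orbit (cmap f) n \<omega> (x, w)" and ?b = "birkhoff_sum (cmap f) (clog f) n \<omega> (x, w)"
      have os: "?o \<in> sph" by (rule C.orbit_in[OF wP(1) s])
      have ih: "fst ?o = ?it x" "push ?it x w = exp ?b *\<^sub>R snd ?o" using Suc s by auto
      have ofib: "snd ?o \<in> fibre (?it x)" using os ih(1) unfolding sph_def by auto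
      have wf: "w \<in> fibre x" using s unfolding sph_def by auto
      have pc: "push (?h \<circ> ?it) x w = push ?h (?it x) (push ?it x w)"
        by (rule push_comp[OF d(1) good_diff[OF h] d(2) wf])
      also have "\<dots> = exp ?b *\<^sub>R push ?h (?it x) (snd ?o)"
        unfolding ih(2) by (rule push_scale[OF good_diff[OF h] d(2) good_in[OF h d(2)] ofib])
      finally have pe: "push (?h \<circ> ?it) x w = exp ?b *\<^sub>R push ?h (?it x) (snd ?o)" .
      let ?q = "push ?h (?it x) (snd ?o)"
      have qp: "norm ?q > 0" using sph_norm_push[OF h os] ih(1) by simp
      have on: "orbit (cmap f) (Suc n) \<omega> (x, w) = (?h (?it x), ?q /\<^sub>R norm ?q)"
        using wP(2) ih(1) by (simp add: cmap_def smap_def case_prod_beta)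
      have bn: "birkhoff_sum (cmap f) (clog f) (Suc n) \<omega> (x, w) = ?b + ln (norm ?q)"
        using wP(2) ih(1) by (simp add: birkhoff_sum_def clog_def slog_def case_prod_beta)
      show ?thesis unfolding on bn pe using qp by (simp add: exp_add)
    qed
    then show ?case unfolding it using 1 2 by blast
  qed
  then show "diff_at M (random_iterate f n \<omega>) x" "random_iterate f n \<omega> x \<in> X"
    "\<And>w. (x, w) \<in> sph \<Longrightarrow> fst (orbit (cmap f) n \<omega> (x, w)) = random_iterate f n \<omega> x \<and>
      push (random_iterate f n \<omega>) x w = exp (birkhoff_sum (cmap f) (clog f) n \<omega> (x, w)) *\<^sub>R snd (orbit (cmap f) n \<omega> (x, w))"
    by blast+
qed

lemma norm_push_iterate:
  assumes w: "good_path \<omega>" and s: "(x, w) \<in> sph"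
  shows "norm (push (random_iterate f n \<omega>) x w) = exp (birkhoff_sum (cmap f) (clog f) n \<omega> (x, w))"
proof -
  have x: "x \<in> X" using s unfolding sph_def by auto
  have "orbit (cmap f) n \<omega> (x, w) \<in> sph" using C.orbit_in s w unfolding good_path_def by blast
  then have "norm (snd (orbit (cmap f) n \<omega> (x, w))) = 1" unfolding sph_def by auto
  then show ?thesis using iterate_props(3)[OF w x s, of n] by simp
qed

definition log_norm :: "nat \<Rightarrow> (nat \<Rightarrow> 't) \<Rightarrow> 'm \<Rightarrow> real" where
  "log_norm n \<omega> x = ln (tangent_onorm M x (random_iterate f n \<omega> x) (differential M (random_iterate f n \<omega>) x))"

lemma fibre_sphere_ne: assumes "x \<in> X" obtains w where "(x, w) \<in> sph"
proof -
  obtain c where c: "c \<in> charts_at M x" using charts_at_ne by blast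
  obtain a :: 'e where "a \<in> Basis" using nonempty_Basis by blast
  then have "a \<noteq> 0" by auto
  then have "nemb c x a \<in> sph" by (rule nemb_in[OF assms c])
  then show ?thesis using that unfolding nemb_def by blast
qed

lemma birkhoff_le_log_norm:
  assumes w: "good_path \<omega>" and s: "(x, w) \<in> sph"
  shows "birkhoff_sum (cmap f) (clog f) n \<omega> (x, w) \<le> log_norm n \<omega> x"
    "0 < tangent_onorm M x (random_iterate f n \<omega> x) (differential M (random_iterate f n \<omega>) x)"
proof -
  have x: "x \<in> X" "w \<in> fibre x" "norm w \<le> 1" using s unfolding sph_def by auto
  have le: "exp (birkhoff_sum (cmap f) (clog f) n \<omega> (x, w)) \<le> tangent_onorm M x (random_iterate f n \<omega> x) (differential M (random_iterate f n \<omega>) x)"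
    using push_le_tangent_onorm[OF iterate_props(1)[OF w x(1)] x(1) iterate_props(2)[OF w x(1)] x(2,3)]
    unfolding norm_push_iterate[OF w s] .
  show p: "0 < tangent_onorm M x (random_iterate f n \<omega> x) (differential M (random_iterate f n \<omega>) x)"
    using le exp_gt_zero less_le_trans by blast
  have "ln (exp (birkhoff_sum (cmap f) (clog f) n \<omega> (x, w))) \<le> log_norm n \<omega> x"
    unfolding log_norm_def using le p by (subst ln_le_cancel_iff) auto
  then show "birkhoff_sum (cmap f) (clog f) n \<omega> (x, w) \<le> log_norm n \<omega> x" by simp
qed

lemma tangent_onorm_iterate_le:
  assumes w: "good_path \<omega>" and x: "x \<in> X" and b: "0 \<le> b"
    "\<And>w. (x, w) \<in> sph \<Longrightarrow> norm (push (random_iterate f n \<omega>) x w) \<le> b"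
  shows "tangent_onorm M x (random_iterate f n \<omega> x) (differential M (random_iterate f n \<omega>) x) \<le> b"
proof (rule tangent_onorm_le[OF iterate_props(1)[OF w x] x iterate_props(2)[OF w x]])
  fix w assume wf: "w \<in> fibre x" "norm w \<le> 1"
  note d = iterate_props(1,2)[OF w x, of n]
  show "norm (push (random_iterate f n \<omega>) x w) \<le> b"
  proof (cases "w = 0")
    case True
    then show ?thesis using push_scale[OF d(1) x d(2) wf(1), of 0] b(1) by simp
  next
    case False
    let ?w = "w /\<^sub>R norm w"
    have s: "(x, ?w) \<in> sph" unfolding sph_def using x wf(1) False subspace_scale[OF fibre_subspace[OF x]] by auto
    have "push (random_iterate f n \<omega>) x w = norm w *\<^sub>R push (random_iterate f n \<omega>) x ?w"
      unfolding push_scale[OF d(1) x d(2) wf(1)] using False by simp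
    then have "norm (push (random_iterate f n \<omega>) x w) = norm w * norm (push (random_iterate f n \<omega>) x ?w)" by simp
    also have "\<dots> \<le> 1 * b" using b(2)[OF s] wf(2) by (intro mult_mono) auto
    finally show ?thesis by simp
  qed
qed

lemma log_norm_le:
  assumes w: "good_path \<omega>" and x: "x \<in> X"
    and b: "\<And>w. (x, w) \<in> sph \<Longrightarrow> birkhoff_sum (cmap f) (clog f) n \<omega> (x, w) \<le> b"
  shows "log_norm n \<omega> x \<le> b"
proof -
  obtain w0 where w0: "(x, w0) \<in> sph" by (rule fibre_sphere_ne[OF x], rule that)
  have "tangent_onorm M x (random_iterate f n \<omega> x) (differential M (random_iterate f n \<omega>) x) \<le> exp b"
    by (rule tangent_onorm_iterate_le[OF w x]) (use b norm_push_iterate[OF w] in auto)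
  then have "log_norm n \<omega> x \<le> ln (exp b)"
    unfolding log_norm_def using birkhoff_le_log_norm(2)[OF w w0, of n] by (subst ln_le_cancel_iff) auto
  then show ?thesis by simp
qed

lemma log_norm_bound:
  assumes w: "good_path \<omega>" and x: "x \<in> X"
  shows "\<bar>log_norm n \<omega> x\<bar> \<le> (\<Sum>j<n. cbound f (\<omega> j))"
proof -
  have wP: "\<omega> \<in> space P" using w unfolding good_path_def by blast
  obtain w0 where w0: "(x, w0) \<in> sph" by (rule fibre_sphere_ne[OF x], rule that)
  have bb: "\<bar>birkhoff_sum (cmap f) (clog f) n \<omega> (x, w)\<bar> \<le> (\<Sum>j<n. cbound f (\<omega> j))" if "(x, w) \<in> sph" for w
    by (rule C.birkhoff_bound[OF wP that])
  have "log_norm n \<omega> x \<le> (\<Sum>j<n. cbound f (\<omega> j))"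
    by (rule log_norm_le[OF w x]) (use bb in force)
  moreover have "- (\<Sum>j<n. cbound f (\<omega> j)) \<le> log_norm n \<omega> x"
    using birkhoff_le_log_norm(1)[OF w w0, of n] bb[OF w0] by linarith
  ultimately show ?thesis by linarith
qed

text \<open>On good paths the logarithm of the operator norm is the supremum of Birkhoff sums over
  the unit vectors at \<open>x\<close>. Letting the coordinate vector run over a countable dense
  set, in Borel chosen charts, gives a jointly measurable function, bounded on all paths and equal
  to the logarithm on good ones.\<close>

lemma log_norm_version:
  obtains V where "(\<lambda>(\<omega>, x). V \<omega> x) \<in> borel_measurable (P \<Otimes>\<^sub>M restrict_space borel X)"
    "\<And>\<omega> x. good_path \<omega> \<Longrightarrow> x \<in> X \<Longrightarrow> V \<omega> x = log_norm n \<omega> x"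
    "\<And>\<omega> x. \<omega> \<in> space P \<Longrightarrow> x \<in> X \<Longrightarrow> \<bar>V \<omega> x\<bar> \<le> (\<Sum>j<n. cbound f (\<omega> j))"
proof -
  obtain ch k1 k2 where ch: "k1 > 0" "k2 > 0" "\<And>x. x \<in> X \<Longrightarrow> ch x \<in> charts_at M x"
    "\<And>x a. x \<in> X \<Longrightarrow> k1 * norm a \<le> norm (emb (ch x) x a)"
    "\<And>x a. x \<in> X \<Longrightarrow> norm (emb (ch x) x a) \<le> k2 * norm a"
    "\<And>a. a \<noteq> 0 \<Longrightarrow> (\<lambda>x. nemb (ch x) x a) \<in> restrict_space borel X \<rightarrow>\<^sub>M restrict_space borel sph"
    by (rule measurable_sections, rule that)
  obtain D :: "'e set" where D: "countable D" "D \<subseteq> -{0}" "\<And>U. open U \<Longrightarrow> U \<inter> -{0} \<noteq> {} \<Longrightarrow> U \<inter> D \<noteq> {}"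
    by (rule countable_dense_subset[of "-{0::'e}"], rule that)
  have "D \<noteq> {}"
  proof -
    obtain a :: 'e where "a \<in> Basis" using nonempty_Basis by blast
    then have "a \<in> -{0}" by auto
    then show ?thesis using D(3)[of UNIV] by blast
  qed
  let ?b = "birkhoff_sum (cmap f) (clog f) n"
  define V where "V \<omega> x = (SUP a\<in>D. ?b \<omega> (nemb (ch x) x a))" for \<omega> x
  have ns: "nemb (ch x) x a \<in> sph" if "x \<in> X" "a \<noteq> 0" for x a by (rule nemb_in[OF that(1) ch(3)[OF that(1)] that(2)])
  have bb: "\<bar>?b \<omega> (nemb (ch x) x a)\<bar> \<le> (\<Sum>j<n. cbound f (\<omega> j))" if "\<omega> \<in> space P" "x \<in> X" "a \<noteq> 0" for \<omega> x a
    by (rule C.birkhoff_bound[OF that(1) ns[OF that(2,3)]])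
  have bd: "bdd_above ((\<lambda>a. ?b \<omega> (nemb (ch x) x a)) ` D)" if "\<omega> \<in> space P" "x \<in> X" for \<omega> x
  proof (rule bdd_aboveI2)
    fix a assume "a \<in> D"
    then have "a \<noteq> 0" using D(2) by blast
    then show "?b \<omega> (nemb (ch x) x a) \<le> (\<Sum>j<n. cbound f (\<omega> j))" using bb[OF that] abs_le_D1 by blast
  qed
  have "(\<lambda>z. SUP a\<in>D. ?b (fst z) (nemb (ch (snd z)) (snd z) a)) \<in> borel_measurable (P \<Otimes>\<^sub>M restrict_space borel X)"
  proof (rule borel_measurable_cSUP[OF D(1)])
    fix a assume a: "a \<in> D"
    have "(\<lambda>z. (fst z, nemb (ch (snd z)) (snd z) a)) \<in> P \<Otimes>\<^sub>M restrict_space borel X \<rightarrow>\<^sub>M P \<Otimes>\<^sub>M restrict_space borel sph"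
      using ch(6)[of a] a D(2) by (intro measurable_Pair measurable_fst measurable_compose[OF measurable_snd]) auto
    from measurable_compose[OF this C.birkhoff_meas[of n]]
    show "(\<lambda>z. ?b (fst z) (nemb (ch (snd z)) (snd z) a)) \<in> borel_measurable (P \<Otimes>\<^sub>M restrict_space borel X)" by simp
  next
    fix z assume "z \<in> space (P \<Otimes>\<^sub>M restrict_space borel X)"
    then show "bdd_above ((\<lambda>a. ?b (fst z) (nemb (ch (snd z)) (snd z) a)) ` D)"
      using bd by (auto simp: space_pair_measure space_restrict_space)
  qed
  then have 1: "(\<lambda>(\<omega>, x). V \<omega> x) \<in> borel_measurable (P \<Otimes>\<^sub>M restrict_space borel X)"
    unfolding V_def by (simp add: case_prod_beta)
  have 2: "V \<omega> x = log_norm n \<omega> x" if w: "good_path \<omega>" and x: "x \<in> X" for \<omega> x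
  proof (rule antisym)
    have wP: "\<omega> \<in> space P" using w unfolding good_path_def by blast
    show "V \<omega> x \<le> log_norm n \<omega> x" unfolding V_def
    proof (rule cSUP_least[OF \<open>D \<noteq> {}\<close>])
      fix a assume "a \<in> D"
      then have "a \<noteq> 0" using D(2) by blast
      then have "nemb (ch x) x a \<in> sph" by (rule ns[OF x])
      then show "?b \<omega> (nemb (ch x) x a) \<le> log_norm n \<omega> x"
        using birkhoff_le_log_norm(1)[OF w] unfolding nemb_def by blast
    qed
    show "log_norm n \<omega> x \<le> V \<omega> x"
    \<comment> \<open>A unit vector with a Birkhoff sum above the countable supremum would, by
      continuity in the coordinate vector, have a competitor in the dense set.\<close>
    proof (rule log_norm_le[OF w x], rule ccontr)
      fix w' assume s: "(x, w') \<in> sph" and n: "\<not> ?b \<omega> (x, w') \<le> V \<omega> x"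
      define g where "g a = ?b \<omega> (nemb (ch x) x a)" for a
      have cM: "ch x \<in> charts M" "x \<in> chart_dom (ch x)" using ch(3)[OF x] by (auto simp: chart_at)
      have "continuous_on (-{0}) (\<lambda>a. (\<lambda>(x, a). nemb (ch x) x a) (x, a))"
      proof -
        have "continuous_on (-{0}) (\<lambda>a. (\<lambda>(y, a). nemb (ch x) y a) (x, a))"
          by (rule continuous_on_compose2[OF nemb_cont[OF cM(1)]]) (use cM x in \<open>auto intro!: continuous_intros\<close>)
        then show ?thesis by simp
      qed
      then have nc: "continuous_on (-{0}) (\<lambda>a. nemb (ch x) x a)" by simp
      have gc: "continuous_on (-{0}) g" unfolding g_def
        by (rule continuous_on_compose2[OF C.birkhoff_cont[OF wP] nc]) (rule image_subsetI, rule ns[OF x], simp)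
      define a0 where "a0 = tvof x w' (ch x)"
      have a0: "(x, w') = nemb (ch x) x a0" "a0 \<noteq> 0" unfolding a0_def using sph_nemb[OF s ch(3)[OF x]] by auto
      have "V \<omega> x < g a0" unfolding g_def a0(1)[symmetric] using n by simp
      then have "\<exists>A. open A \<and> a0 \<in> A \<and> (\<forall>y\<in>-{0}. y \<in> A \<longrightarrow> g y \<in> {V \<omega> x<..})"
        using gc[unfolded continuous_on_topological, rule_format, of a0 "{V \<omega> x<..}"] a0(2) by simp
      then obtain A where A: "open A" "a0 \<in> A" "\<And>y. y \<in> -{0} \<Longrightarrow> y \<in> A \<Longrightarrow> V \<omega> x < g y" by auto
      have "A \<inter> D \<noteq> {}" using D(3)[OF A(1)] A(2) a0(2) by blast
      then obtain d where d: "d \<in> A" "d \<in> D" by blast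
      have "V \<omega> x < g d" using A(3) d D(2) by blast
      moreover have "g d \<le> V \<omega> x" unfolding V_def g_def by (rule cSUP_upper[OF d(2) bd[OF wP x]])
      ultimately show False by simp
    qed
  qed
  have 3: "\<bar>V \<omega> x\<bar> \<le> (\<Sum>j<n. cbound f (\<omega> j))" if w: "\<omega> \<in> space P" and x: "x \<in> X" for \<omega> x
  proof -
    obtain d where d: "d \<in> D" using \<open>D \<noteq> {}\<close> by blast
    have d0: "d \<noteq> 0" using d D(2) by blast
    have "V \<omega> x \<le> (\<Sum>j<n. cbound f (\<omega> j))" unfolding V_def
    proof (rule cSUP_least[OF \<open>D \<noteq> {}\<close>])
      fix a assume "a \<in> D"
      then have "a \<noteq> 0" using D(2) by blast
      then show "?b \<omega> (nemb (ch x) x a) \<le> (\<Sum>j<n. cbound f (\<omega> j))" using bb[OF w x] by fastforce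
    qed
    moreover have "?b \<omega> (nemb (ch x) x d) \<le> V \<omega> x" unfolding V_def by (rule cSUP_upper[OF d bd[OF w x]])
    ultimately show ?thesis using bb[OF w x d0] by linarith
  qed
  show ?thesis by (rule that[OF 1 2 3])
qed

end

context
  fixes f assumes f: "f \<in> Diff1_loc M p X"
begin

interpretation C: random_cocycle p sph "cmap f" "clog f" "cbound f" by (rule cocycle[OF f])
interpretation B: random_cocycle p X "base_map f" "\<lambda>_ _. 0" "\<lambda>_. 0" by (rule base_cocycle[OF f])

definition mean_log_norm :: "nat \<Rightarrow> 'm \<Rightarrow> real" where
  "mean_log_norm n x = (\<integral>\<omega>. log_norm f n \<omega> x \<partial>completion P)"

abbreviation "bsum \<equiv> birkhoff_sum (cmap f) (clog f)"

abbreviation "cmean \<equiv> (\<integral>t. cbound f t \<partial>p)"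

lemma cmean_nonneg: "0 \<le> cmean" by (intro integral_nonneg_AE AE_I2 cbound_nonneg[OF f])

lemma integral_sum_bound: "(\<integral>\<omega>. (\<Sum>j<n. cbound f (\<omega> j)) \<partial>P) = real n * cmean"
  using C.coord_integrable by simp

lemma mean_log_norm_version:
  obtains V where "(\<lambda>(\<omega>, x). V \<omega> x) \<in> borel_measurable (P \<Otimes>\<^sub>M restrict_space borel X)"
    "\<And>\<omega> x. good_path f \<omega> \<Longrightarrow> x \<in> X \<Longrightarrow> V \<omega> x = log_norm f n \<omega> x"
    "\<And>x. x \<in> X \<Longrightarrow> integrable P (\<lambda>\<omega>. V \<omega> x)"
    "\<And>x. x \<in> X \<Longrightarrow> mean_log_norm n x = (\<integral>\<omega>. V \<omega> x \<partial>P)"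
    "\<And>x. x \<in> X \<Longrightarrow> \<bar>\<integral>\<omega>. V \<omega> x \<partial>P\<bar> \<le> real n * cmean"
proof -
  obtain V where V: "(\<lambda>(\<omega>, x). V \<omega> x) \<in> borel_measurable (P \<Otimes>\<^sub>M restrict_space borel X)"
    "\<And>\<omega> x. good_path f \<omega> \<Longrightarrow> x \<in> X \<Longrightarrow> V \<omega> x = log_norm f n \<omega> x"
    "\<And>\<omega> x. \<omega> \<in> space P \<Longrightarrow> x \<in> X \<Longrightarrow> \<bar>V \<omega> x\<bar> \<le> (\<Sum>j<n. cbound f (\<omega> j))"
    by (rule log_norm_version[OF f], rule that)
  have m: "(\<lambda>\<omega>. V \<omega> x) \<in> borel_measurable P" if "x \<in> X" for x
    using B.section_meas[OF that V(1)] by simp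
  have si: "integrable P (\<lambda>\<omega>. \<Sum>j<n. cbound f (\<omega> j))" using C.coord_integrable(1) by simp
  have i: "integrable P (\<lambda>\<omega>. V \<omega> x)" if x: "x \<in> X" for x
  proof (rule Bochner_Integration.integrable_bound[OF si m[OF x]])
    show "AE \<omega> in P. norm (V \<omega> x) \<le> norm (\<Sum>j<n. cbound f (\<omega> j))"
      using V(3) x by (intro AE_I2) (simp, meson abs_ge_self order_trans)
  qed
  have e: "mean_log_norm n x = (\<integral>\<omega>. V \<omega> x \<partial>P)" if x: "x \<in> X" for x
    unfolding mean_log_norm_def
  proof (rule integral_completion_AE_eq[OF m[OF x]])
    show "AE \<omega> in P. log_norm f n \<omega> x = V \<omega> x"
      using AE_good_path[OF f] by eventually_elim (use V(2) x in simp)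
  qed
  have b: "\<bar>\<integral>\<omega>. V \<omega> x \<partial>P\<bar> \<le> real n * cmean" if x: "x \<in> X" for x
  proof -
    have "\<bar>\<integral>\<omega>. V \<omega> x \<partial>P\<bar> \<le> (\<integral>\<omega>. \<bar>V \<omega> x\<bar> \<partial>P)" by (rule integral_abs_bound)
    also have "\<dots> \<le> (\<integral>\<omega>. (\<Sum>j<n. cbound f (\<omega> j)) \<partial>P)"
      using V(3) x by (intro integral_mono integrable_abs i si) auto
    finally show ?thesis unfolding integral_sum_bound .
  qed
  show ?thesis by (rule that[OF V(1,2) i e b])
qed

lemma mean_log_norm_measurable: "mean_log_norm n \<in> borel_measurable (restrict_space borel X)"
proof -
  obtain V where V: "(\<lambda>(\<omega>, x). V \<omega> x) \<in> borel_measurable (P \<Otimes>\<^sub>M restrict_space borel X)"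
    "\<And>\<omega> x. good_path f \<omega> \<Longrightarrow> x \<in> X \<Longrightarrow> V \<omega> x = log_norm f n \<omega> x"
    "\<And>x. x \<in> X \<Longrightarrow> integrable P (\<lambda>\<omega>. V \<omega> x)"
    "\<And>x. x \<in> X \<Longrightarrow> mean_log_norm n x = (\<integral>\<omega>. V \<omega> x \<partial>P)"
    "\<And>x. x \<in> X \<Longrightarrow> \<bar>\<integral>\<omega>. V \<omega> x \<partial>P\<bar> \<le> real n * cmean"
    by (rule mean_log_norm_version[of n], rule that)
  have "(\<lambda>(x, \<omega>). V \<omega> x) \<in> borel_measurable (restrict_space borel X \<Otimes>\<^sub>M P)"
    using measurable_pair_swap[OF V(1)] by (simp add: case_prod_beta)
  then have "(\<lambda>x. \<integral>\<omega>. V \<omega> x \<partial>P) \<in> borel_measurable (restrict_space borel X)"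
    by (rule sigma_finite_measure.borel_measurable_lebesgue_integral[OF prob_space_imp_sigma_finite[OF P_prob]])
  then show ?thesis
    by (rule measurable_cong[THEN iffD1, rotated]) (simp add: V(4) space_restrict_space)
qed

lemma mean_log_norm_bound: "x \<in> X \<Longrightarrow> \<bar>mean_log_norm n x\<bar> \<le> real n * cmean"
  by (rule mean_log_norm_version[of n]) simp

lemma mean_bsum_le:
  assumes s: "s \<in> sph" shows "(\<integral>\<omega>. bsum n \<omega> s \<partial>P) \<le> mean_log_norm n (fst s)"
proof -
  obtain x w where sx: "s = (x, w)" "x \<in> X" using s unfolding sph_def by auto
  obtain V where V: "(\<lambda>(\<omega>, x). V \<omega> x) \<in> borel_measurable (P \<Otimes>\<^sub>M restrict_space borel X)"
    "\<And>\<omega> x. good_path f \<omega> \<Longrightarrow> x \<in> X \<Longrightarrow> V \<omega> x = log_norm f n \<omega> x"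
    "\<And>x. x \<in> X \<Longrightarrow> integrable P (\<lambda>\<omega>. V \<omega> x)"
    "\<And>x. x \<in> X \<Longrightarrow> mean_log_norm n x = (\<integral>\<omega>. V \<omega> x \<partial>P)"
    "\<And>x. x \<in> X \<Longrightarrow> \<bar>\<integral>\<omega>. V \<omega> x \<partial>P\<bar> \<le> real n * cmean"
    by (rule mean_log_norm_version[of n], rule that)
  have "(\<integral>\<omega>. bsum n \<omega> s \<partial>P) \<le> (\<integral>\<omega>. V \<omega> x \<partial>P)"
  proof (rule integral_mono_AE[OF C.birkhoff_integrable[OF s] V(3)[OF sx(2)]])
    show "AE \<omega> in P. bsum n \<omega> s \<le> V \<omega> x"
      using AE_good_path[OF f]
    proof eventually_elim
      case (elim \<omega>)
      show ?case using birkhoff_le_log_norm(1)[OF f elim, of x w n] s sx V(2)[OF elim sx(2)] by simp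
    qed
  qed
  then show ?thesis using V(4) sx by simp
qed

text \<open>On a good path, a vector that detects the norm has a Birkhoff sum within a constant of
  the logarithmic norm. A bad one loses at most twice the sum of the bounds \<open>cbound\<close>,
  since both quantities are bounded by that sum in absolute value. Bad vectors make up at most
  \<open>1 / K\<close> of the box, and the integral over paths gives the claim.\<close>

lemma lattice_lower_bound:
  assumes ch: "k1 > 0" "k2 > 0" "\<And>x. x \<in> X \<Longrightarrow> ch x \<in> charts_at M x"
    "\<And>x a. x \<in> X \<Longrightarrow> k1 * norm a \<le> norm (emb (ch x) x a)"
    "\<And>x a. x \<in> X \<Longrightarrow> norm (emb (ch x) x a) \<le> k2 * norm a"
    and K: "K > 0" and x: "x \<in> X"
  shows "mean_log_norm n x - 2 / real K * (real n * cmean) - max 0 (ln (2 * k2 * real DIM('e) * real DIM('e) * real K / k1))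
    \<le> (\<Sum>\<tau>\<in>lattice_box K. \<integral>\<omega>. bsum n \<omega> (nemb (ch x) x (lattice_vec \<tau>)) \<partial>P) / real (card (lattice_box K :: ('e \<Rightarrow> nat) set))"
proof -
  let ?c = "ch x" and ?box = "lattice_box K :: ('e \<Rightarrow> nat) set"
  \<comment> \<open>Worst ratio between the operator norm and the expansion of a detecting lattice
    vector. The operator norm is at most \<open>DIM('e) * m / k1\<close>, the image of the vector
    has norm at least \<open>m / 2\<close>, and the embedded vector has norm at most
    \<open>k2 * DIM('e) * K\<close>.\<close>
  define c0 where "c0 = 2 * k2 * real DIM('e) * real DIM('e) * real K / k1"
  define C0 where "C0 = max 0 (ln c0)"
  have dpos: "real DIM('e) > 0" by simp
  have c0: "c0 > 0" unfolding c0_def using ch(1,2) K by simp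
  have ca: "?c \<in> charts_at M x" by (rule ch(3)[OF x])
  have bcard: "real (card ?box) > 0" unfolding card_lattice_box using K by simp
  have sph\<tau>: "nemb ?c x (lattice_vec \<tau>) \<in> sph" if "\<tau> \<in> ?box" for \<tau>
    by (rule nemb_in[OF x ca lattice_vec_nonzero[OF that]])
  obtain V where V: "(\<lambda>(\<omega>, x). V \<omega> x) \<in> borel_measurable (P \<Otimes>\<^sub>M restrict_space borel X)"
    "\<And>\<omega> x. good_path f \<omega> \<Longrightarrow> x \<in> X \<Longrightarrow> V \<omega> x = log_norm f n \<omega> x"
    "\<And>x. x \<in> X \<Longrightarrow> integrable P (\<lambda>\<omega>. V \<omega> x)"
    "\<And>x. x \<in> X \<Longrightarrow> mean_log_norm n x = (\<integral>\<omega>. V \<omega> x \<partial>P)"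
    "\<And>x. x \<in> X \<Longrightarrow> \<bar>\<integral>\<omega>. V \<omega> x \<partial>P\<bar> \<le> real n * cmean"
    by (rule mean_log_norm_version[of n], rule that)
  let ?b = "\<lambda>\<omega>. \<Sum>j<n. cbound f (\<omega> j)"
  have pt: "V \<omega> x - 2 / real K * ?b \<omega> - C0 \<le> (\<Sum>\<tau>\<in>?box. bsum n \<omega> (nemb ?c x (lattice_vec \<tau>))) / real (card ?box)"
    if w: "good_path f \<omega>" for \<omega>
  proof -
    have wP: "\<omega> \<in> space P" using w unfolding good_path_def[OF f] by blast
    let ?it = "random_iterate f n \<omega>" and ?ln = "log_norm f n \<omega> x"
    let ?T = "tangent_onorm M x (?it x) (differential M ?it x)"
    note d = iterate_props(1,2)[OF f w x, of n]
    obtain c' where c': "c' \<in> charts_at M (?it x)" using charts_at_ne by blast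
    define A where "A a = push ?it x (emb ?c x a)" for a
    have Ae: "A = (\<lambda>a. emb c' (?it x) (local_deriv ?c c' ?it x a))"
      unfolding A_def by (rule ext) (rule push_emb[OF d(1) x ca c'])
    have Al: "linear A" unfolding Ae
      using linear_compose[OF local_deriv_linear[OF d(1) ca c'] emb_linear[OF d(2) c']] by (simp add: comp_def)
    define m where "m = Max ((\<lambda>i. norm (A i)) ` Basis)"
    have mi: "norm (A i) \<le> m" if "i \<in> Basis" for i unfolding m_def using that by (intro Max_ge) auto
    have m0: "0 \<le> m"
    proof -
      obtain i :: 'e where i: "i \<in> Basis" using nonempty_Basis by blast
      show ?thesis using mi[OF i] norm_ge_zero[of "A i"] by linarith
    qed
    \<comment> \<open>Coordinates of a unit vector are at most \<open>1 / k1\<close> in absolute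
      value; expanding in the basis bounds its image by the images of the basis vectors.\<close>
    have Tle: "?T \<le> real DIM('e) * m / k1"
    proof (rule tangent_onorm_iterate_le[OF f w x])
      show "0 \<le> real DIM('e) * m / k1" using m0 ch(1) by simp
      fix w' assume s: "(x, w') \<in> sph"
      then have w': "w' \<in> fibre x" "norm w' = 1" unfolding sph_def by auto
      define a where "a = tvof x w' ?c"
      have ea: "emb ?c x a = w'" unfolding a_def by (rule emb_coord[OF ca w'(1)])
      have na: "norm a \<le> 1 / k1" using ch(4)[OF x, of a] ea w'(2) ch(1) by (simp add: field_simps)
      have "push ?it x w' = A (\<Sum>i\<in>Basis. (a \<bullet> i) *\<^sub>R i)" unfolding euclidean_representation A_def ea ..
      also have "\<dots> = (\<Sum>i\<in>Basis. (a \<bullet> i) *\<^sub>R A i)" unfolding linear_sum[OF Al] linear_scale[OF Al] ..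
      finally have pe: "push ?it x w' = (\<Sum>i\<in>Basis. (a \<bullet> i) *\<^sub>R A i)" .
      have "norm (push ?it x w') \<le> (\<Sum>i\<in>(Basis::'e set). norm ((a \<bullet> i) *\<^sub>R A i))"
        unfolding pe by (rule norm_sum)
      also have "\<dots> \<le> (\<Sum>i\<in>(Basis::'e set). (1 / k1) * m)"
      proof (rule sum_mono)
        fix i :: 'e assume i: "i \<in> Basis"
        have "\<bar>a \<bullet> i\<bar> \<le> 1 / k1" using Basis_le_norm[OF i, of a] na by linarith
        then have "\<bar>a \<bullet> i\<bar> * norm (A i) \<le> (1 / k1) * m" using mi[OF i] ch(1) by (intro mult_mono) auto
        then show "norm ((a \<bullet> i) *\<^sub>R A i) \<le> (1 / k1) * m" by simp
      qed
      finally show "norm (push ?it x w') \<le> real DIM('e) * m / k1" by simp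
    qed
    obtain w0 where w0: "(x, w0) \<in> sph" by (rule fibre_sphere_ne[OF f x], rule that)
    have Tpos: "?T > 0" by (rule birkhoff_le_log_norm(2)[OF f w w0])
    have mpos: "m > 0"
    proof (rule ccontr)
      assume "\<not> m > 0" then have "m = 0" using m0 by simp
      then show False using Tle Tpos by simp
    qed
    define bad' where "bad' = {\<tau> \<in> ?box. norm (A (lattice_vec \<tau>)) < m / 2}"
    have bc: "real K * real (card bad') \<le> real (card ?box)"
      unfolding bad'_def m_def by (rule card_bad_lattice_vecs[OF Al])
    have b0: "0 \<le> ?b \<omega>" by (intro sum_nonneg cbound_nonneg[OF f])
    have lower: "?ln - C0 - (if \<tau> \<in> bad' then 2 * ?b \<omega> else 0) \<le> bsum n \<omega> (nemb ?c x (lattice_vec \<tau>))" if t: "\<tau> \<in> ?box" for \<tau>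
    proof (cases "\<tau> \<in> bad'")
      case True
      have "?ln \<le> ?b \<omega>" using log_norm_bound[OF f w x, of n] by linarith
      moreover have "- ?b \<omega> \<le> bsum n \<omega> (nemb ?c x (lattice_vec \<tau>))"
        using C.birkhoff_bound[OF wP sph\<tau>[OF t], of n] by linarith
      moreover have "0 \<le> C0" unfolding C0_def by simp
      ultimately show ?thesis using True by simp
    next
      case False
      let ?v = "lattice_vec \<tau> :: 'e"
      let ?e = "norm (emb ?c x ?v)"
      have v0: "?v \<noteq> 0" by (rule lattice_vec_nonzero[OF t])
      have e0: "?e > 0" using emb_zero_iff[OF x ca] v0 by simp
      have "?e \<le> k2 * norm ?v" by (rule ch(5)[OF x])
      also have "\<dots> \<le> k2 * (real DIM('e) * real K)" using norm_lattice_vec[OF t] ch(2) by (intro mult_left_mono) auto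
      finally have el: "?e \<le> k2 * (real DIM('e) * real K)" .
      have "A ?v /\<^sub>R ?e = push ?it x (emb ?c x ?v /\<^sub>R ?e)"
        unfolding A_def by (rule push_scale[OF d(1) x d(2) emb_in[OF ca], symmetric])
      moreover have "norm (push ?it x (emb ?c x ?v /\<^sub>R ?e)) = exp (bsum n \<omega> (nemb ?c x ?v))"
        unfolding nemb_def using sph\<tau>[OF t] unfolding nemb_def by (rule norm_push_iterate[OF f w])
      moreover have "norm (A ?v /\<^sub>R ?e) = norm (A ?v) / ?e" by (simp add: divide_inverse mult.commute)
      ultimately have ex: "exp (bsum n \<omega> (nemb ?c x ?v)) = norm (A ?v) / ?e" by simp
      have "?T / c0 \<le> (real DIM('e) * m / k1) / c0" using Tle c0 by (intro divide_right_mono) auto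
      also have "\<dots> = (m / 2) / (k2 * (real DIM('e) * real K))"
        unfolding c0_def using ch(1,2) K by (simp add: field_simps)
      also have "\<dots> \<le> norm (A ?v) / ?e"
        using False t m0 e0 el unfolding bad'_def by (intro frac_le) auto
      finally have "?T / c0 \<le> exp (bsum n \<omega> (nemb ?c x ?v))" unfolding ex .
      then have "ln (?T / c0) \<le> ln (exp (bsum n \<omega> (nemb ?c x ?v)))"
        using Tpos c0 by (subst ln_le_cancel_iff) auto
      then have "ln ?T - ln c0 \<le> bsum n \<omega> (nemb ?c x ?v)" using Tpos c0 by (simp add: ln_div)
      moreover have "ln c0 \<le> C0" unfolding C0_def by simp
      ultimately show ?thesis using False unfolding log_norm_def[OF f] by simp
    qed
    have "real (card ?box) * (?ln - C0 - 2 / real K * ?b \<omega>) \<le> real (card ?box) * (?ln - C0) - real (card bad') * (2 * ?b \<omega>)"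
    proof -
      have "real (card bad') \<le> real (card ?box) / real K" using bc K by (simp add: field_simps)
      then have "real (card bad') * (2 * ?b \<omega>) \<le> real (card ?box) / real K * (2 * ?b \<omega>)"
        using b0 by (intro mult_right_mono) auto
      then show ?thesis by (simp add: right_diff_distrib)
    qed
    also have "\<dots> = (\<Sum>\<tau>\<in>?box. ?ln - C0 - (if \<tau> \<in> bad' then 2 * ?b \<omega> else 0))"
    proof -
      have "(\<Sum>\<tau>\<in>?box. if \<tau> \<in> bad' then 2 * ?b \<omega> else 0) = (\<Sum>\<tau>\<in>bad'. 2 * ?b \<omega>)"
        by (rule sum.mono_neutral_cong_right) (auto simp: bad'_def finite_lattice_box)
      then show ?thesis by (simp add: sum_subtractf right_diff_distrib)
    qed
    also have "\<dots> \<le> (\<Sum>\<tau>\<in>?box. bsum n \<omega> (nemb ?c x (lattice_vec \<tau>)))" by (rule sum_mono) (rule lower)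
    finally have "?ln - C0 - 2 / real K * ?b \<omega> \<le> (\<Sum>\<tau>\<in>?box. bsum n \<omega> (nemb ?c x (lattice_vec \<tau>))) / real (card ?box)"
      using bcard by (simp add: pos_le_divide_eq mult.commute)
    then show ?thesis using V(2)[OF w x] by simp
  qed
  have si: "integrable P ?b" using C.coord_integrable(1) by simp
  have bi: "integrable P (\<lambda>\<omega>. bsum n \<omega> (nemb ?c x (lattice_vec \<tau>)))" if "\<tau> \<in> ?box" for \<tau>
    by (rule C.birkhoff_integrable[OF sph\<tau>[OF that]])
  have "(\<integral>\<omega>. V \<omega> x - 2 / real K * ?b \<omega> - C0 \<partial>P) \<le> (\<integral>\<omega>. (\<Sum>\<tau>\<in>?box. bsum n \<omega> (nemb ?c x (lattice_vec \<tau>))) / real (card ?box) \<partial>P)"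
  proof (rule integral_mono_AE)
    show "integrable P (\<lambda>\<omega>. V \<omega> x - 2 / real K * ?b \<omega> - C0)" using V(3)[OF x] si by simp
    show "integrable P (\<lambda>\<omega>. (\<Sum>\<tau>\<in>?box. bsum n \<omega> (nemb ?c x (lattice_vec \<tau>))) / real (card ?box))"
      using bi by (intro integrable_divide_zero Bochner_Integration.integrable_sum) auto
    show "AE \<omega> in P. V \<omega> x - 2 / real K * ?b \<omega> - C0 \<le> (\<Sum>\<tau>\<in>?box. bsum n \<omega> (nemb ?c x (lattice_vec \<tau>))) / real (card ?box)"
      using AE_good_path[OF f] by eventually_elim (rule pt)
  qed
  moreover have "(\<integral>\<omega>. V \<omega> x - 2 / real K * ?b \<omega> - C0 \<partial>P) = mean_log_norm n x - 2 / real K * (real n * cmean) - C0"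
  proof -
    have "(\<integral>\<omega>. V \<omega> x - 2 / real K * ?b \<omega> - C0 \<partial>P) = (\<integral>\<omega>. V \<omega> x \<partial>P) - 2 / real K * (\<integral>\<omega>. ?b \<omega> \<partial>P) - C0"
      using V(3)[OF x] si by (simp add: prob_space.prob_space[OF P_prob])
    then show ?thesis unfolding integral_sum_bound V(4)[OF x] .
  qed
  moreover have "(\<integral>\<omega>. (\<Sum>\<tau>\<in>?box. bsum n \<omega> (nemb ?c x (lattice_vec \<tau>))) / real (card ?box) \<partial>P)
      = (\<Sum>\<tau>\<in>?box. \<integral>\<omega>. bsum n \<omega> (nemb ?c x (lattice_vec \<tau>)) \<partial>P) / real (card ?box)"
  proof -
    have "(\<integral>\<omega>. (\<Sum>\<tau>\<in>?box. bsum n \<omega> (nemb ?c x (lattice_vec \<tau>))) \<partial>P) = (\<Sum>\<tau>\<in>?box. \<integral>\<omega>. bsum n \<omega> (nemb ?c x (lattice_vec \<tau>)) \<partial>P)"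
      by (rule Bochner_Integration.integral_sum) (rule bi)
    then show ?thesis by simp
  qed
  ultimately show ?thesis unfolding C0_def c0_def by (simp only:)
qed

lemma mean_log_norm_integrable:
  assumes \<mu>: "\<mu> \<in> borel_prob_on X" shows "integrable \<mu> (mean_log_norm n)"
proof -
  interpret m: prob_space \<mu> using borel_prob_onD(1)[OF \<mu>] .
  have "mean_log_norm n \<in> borel_measurable \<mu>"
    using mean_log_norm_measurable measurable_cong_sets[OF borel_prob_onD(2)[OF \<mu>] refl] by auto
  then show ?thesis using mean_log_norm_bound borel_prob_onD(3)[OF \<mu>]
    by (intro m.integrable_const_bound[of _ "real n * cmean"]) auto
qed

text \<open>Stationarity makes \<open>n\<close> times the integral of \<open>cphi f\<close> the
  integral of the expected Birkhoff sum of length \<open>n\<close>, and a single vector expands by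
  at most the operator norm.\<close>

lemma stationary_integral_le:
  assumes \<nu>: "fun_stationary p sph (cmap f) \<nu>"
  shows "real n * (\<integral>s. cphi f s \<partial>\<nu>) \<le> (\<integral>x. mean_log_norm n x \<partial>proj \<nu>)"
proof -
  have b: "\<nu> \<in> borel_prob_on sph" using \<nu> unfolding fun_stationary_def by blast
  have c: "continuous_on sph (cphi f)" by (rule cphi_cont[OF f])
  have i: "integrable \<nu> ((transfer_op p (cmap f) ^^ j) (cphi f))" for j
    by (rule borel_prob_on_integrable[OF sph_compact b C.Top_pow_cont[OF c]])
  have "real n * (\<integral>s. cphi f s \<partial>\<nu>) = (\<Sum>j<n. \<integral>s. (transfer_op p (cmap f) ^^ j) (cphi f) s \<partial>\<nu>)"
    using C.stationary_pow[OF \<nu> c] by simp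
  also have "\<dots> = (\<integral>s. (\<Sum>j<n. (transfer_op p (cmap f) ^^ j) (cphi f) s) \<partial>\<nu>)"
    using i by simp
  also have "\<dots> \<le> (\<integral>s. mean_log_norm n (fst s) \<partial>\<nu>)"
  proof (rule integral_mono)
    show "integrable \<nu> (\<lambda>s. \<Sum>j<n. (transfer_op p (cmap f) ^^ j) (cphi f) s)" using i by simp
    show "integrable \<nu> (\<lambda>s. mean_log_norm n (fst s))"
      using integrable_distr[OF fst_measurable_sph[OF b]] mean_log_norm_integrable[OF proj_prob[OF b]]
      unfolding proj_def by blast
    fix s assume "s \<in> space \<nu>"
    then have s: "s \<in> sph" using borel_prob_onD(3)[OF b] by simp
    show "(\<Sum>j<n. (transfer_op p (cmap f) ^^ j) (cphi f) s) \<le> mean_log_norm n (fst s)"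
      using mean_bsum_le[OF s, of n] C.integral_birkhoff[OF s, of n] cphi_mean[OF f] by simp
  qed
  also have "\<dots> = (\<integral>x. mean_log_norm n x \<partial>proj \<nu>)" by (rule integral_proj[OF b mean_log_norm_measurable, symmetric])
  finally show ?thesis .
qed

text \<open>The Cesaro averages start from the mean of the images of \<open>\<mu>\<close> under the
  Borel vector fields of the lattice box. Their integrals of \<open>cphi f\<close> inherit the
  lattice lower bound: its constant vanishes after division by time, and its loss proportional to
  time is made at most \<open>e\<close> by the size of the box.\<close>

lemma stationary_lift_approx:
  assumes \<mu>: "\<mu> \<in> stationary_measures p X f" and e: "e > 0" and r0: "strict_mono (r0 :: nat \<Rightarrow> nat)" "\<And>k. r0 k > 0"
    and l: "(\<lambda>k. (\<integral>x. mean_log_norm (r0 k) x \<partial>\<mu>) / real (r0 k)) \<longlonglongrightarrow> l"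
  obtains \<xi> where "fun_stationary p sph (cmap f) \<xi>" "proj \<xi> = \<mu>" "l - e \<le> (\<integral>s. cphi f s \<partial>\<xi>)"
proof -
  have \<mu>b: "\<mu> \<in> borel_prob_on X" using \<mu> unfolding stationary_measures_def by blast
  have \<mu>s: "fun_stationary p X (base_map f) \<mu>" using \<mu> stationary_measures_iff[OF f] by blast
  interpret m: prob_space \<mu> using borel_prob_onD(1)[OF \<mu>b] .
  have \<mu>sets: "sets \<mu> = sets (restrict_space borel X)" "space \<mu> = X" using borel_prob_onD[OF \<mu>b] by auto
  obtain ch k1 k2 where ch: "k1 > 0" "k2 > 0" "\<And>x. x \<in> X \<Longrightarrow> ch x \<in> charts_at M x"
    "\<And>x a. x \<in> X \<Longrightarrow> k1 * norm a \<le> norm (emb (ch x) x a)"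
    "\<And>x a. x \<in> X \<Longrightarrow> norm (emb (ch x) x a) \<le> k2 * norm a"
    "\<And>a. a \<noteq> 0 \<Longrightarrow> (\<lambda>x. nemb (ch x) x a) \<in> restrict_space borel X \<rightarrow>\<^sub>M restrict_space borel sph"
    by (rule measurable_sections, rule that)
  \<comment> \<open>The box size must make the loss per unit time \<open>2 * cmean / K\<close> at
    most \<open>e\<close>; the successor makes it positive even when \<open>cmean\<close> is
    0.\<close>
  obtain K0 :: nat where K0: "2 * cmean / e < real K0" using reals_Archimedean2 by blast
  define K where "K = Suc K0"
  have K: "K > 0" unfolding K_def by simp
  have Ke: "2 / real K * cmean \<le> e"
  proof -
    have "2 * cmean / e \<le> real K" using K0 unfolding K_def by simp
    then show ?thesis using e K by (simp add: field_simps)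
  qed
  let ?box = "lattice_box K :: ('e \<Rightarrow> nat) set"
  define C0 where "C0 = max 0 (ln (2 * k2 * real DIM('e) * real DIM('e) * real K / k1))"
  have bne: "?box \<noteq> {}"
  proof -
    have "card ?box > 0" unfolding card_lattice_box using K by simp
    then show ?thesis by auto
  qed
  have Z: "(\<lambda>x. nemb (ch x) x (lattice_vec \<tau>)) \<in> \<mu> \<rightarrow>\<^sub>M restrict_space borel sph" if "\<tau> \<in> ?box" for \<tau>
    using ch(6)[OF lattice_vec_nonzero[OF that]] measurable_cong_sets[OF \<mu>sets(1) refl] by auto
  obtain m0 where m0: "m0 \<in> borel_prob_on sph" "\<And>h :: _ \<Rightarrow> real. continuous_on sph h \<Longrightarrow>
      (\<integral>s. h s \<partial>m0) = (\<Sum>\<tau>\<in>?box. \<integral>x. h (nemb (ch x) x (lattice_vec \<tau>)) \<partial>\<mu>) / real (card ?box)"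
    by (rule average_of_images[OF m.prob_space_axioms finite_lattice_box bne sph_compact Z], assumption, rule that)
  have sph\<tau>: "nemb (ch x) x (lattice_vec \<tau>) \<in> sph" if "\<tau> \<in> ?box" "x \<in> X" for \<tau> x
    by (rule nemb_in[OF that(2) ch(3)[OF that(2)] lattice_vec_nonzero[OF that(1)]])
  have cc: "continuous_on sph (cphi f)" by (rule cphi_cont[OF f])
  let ?T = "transfer_op p (cmap f)"
  \<comment> \<open>The expected Birkhoff sum is the sum of iterated operators applied to
    \<open>cphi f\<close>, a continuous function of the starting point; hence \<open>m0\<close> may
    be tested on it.\<close>
  have low: "(\<integral>x. mean_log_norm n x \<partial>\<mu>) - 2 / real K * (real n * cmean) - C0 \<le> (\<Sum>j<n. \<integral>s. (?T ^^ j) (cphi f) s \<partial>m0)" for n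
  proof -
    define h where "h s = (\<Sum>j<n. (?T ^^ j) (cphi f) s)" for s
    have hc: "continuous_on sph h" unfolding h_def by (intro continuous_on_sum C.Top_pow_cont[OF cc])
    have hb: "h s = (\<integral>\<omega>. bsum n \<omega> s \<partial>P)" if "s \<in> sph" for s
      unfolding h_def using C.integral_birkhoff[OF that, of n] cphi_mean[OF f] by simp
    obtain B where B: "\<And>s. s \<in> sph \<Longrightarrow> \<bar>h s\<bar> \<le> B" using continuous_on_compact_bdd[OF sph_compact hc] by metis
    have hi: "integrable \<mu> (\<lambda>x. h (nemb (ch x) x (lattice_vec \<tau>)))" if t: "\<tau> \<in> ?box" for \<tau>
    proof (rule m.integrable_const_bound[of _ B])
      show "(\<lambda>x. h (nemb (ch x) x (lattice_vec \<tau>))) \<in> borel_measurable \<mu>"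
        using measurable_compose[OF Z[OF t] borel_measurable_continuous_on_restrict[OF hc]] .
      show "AE x in \<mu>. norm (h (nemb (ch x) x (lattice_vec \<tau>))) \<le> B"
      proof (rule AE_I2)
        fix x assume "x \<in> space \<mu>"
        then have "x \<in> X" using \<mu>sets by simp
        from B[OF sph\<tau>[OF t this]] show "norm (h (nemb (ch x) x (lattice_vec \<tau>))) \<le> B" by simp
      qed
    qed
    have "(\<integral>x. mean_log_norm n x \<partial>\<mu>) - 2 / real K * (real n * cmean) - C0 = (\<integral>x. mean_log_norm n x - 2 / real K * (real n * cmean) - C0 \<partial>\<mu>)"
      using mean_log_norm_integrable[OF \<mu>b, of n] by (simp add: m.prob_space)
    also have "\<dots> \<le> (\<integral>x. (\<Sum>\<tau>\<in>?box. h (nemb (ch x) x (lattice_vec \<tau>))) / real (card ?box) \<partial>\<mu>)"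
    proof (rule integral_mono)
      show "integrable \<mu> (\<lambda>x. mean_log_norm n x - 2 / real K * (real n * cmean) - C0)"
        using mean_log_norm_integrable[OF \<mu>b, of n] by simp
      show "integrable \<mu> (\<lambda>x. (\<Sum>\<tau>\<in>?box. h (nemb (ch x) x (lattice_vec \<tau>))) / real (card ?box))"
        using hi by (intro integrable_divide_zero Bochner_Integration.integrable_sum) auto
      fix x assume "x \<in> space \<mu>" then have x: "x \<in> X" using \<mu>sets by simp
      have "(\<Sum>\<tau>\<in>?box. h (nemb (ch x) x (lattice_vec \<tau>))) = (\<Sum>\<tau>\<in>?box. \<integral>\<omega>. bsum n \<omega> (nemb (ch x) x (lattice_vec \<tau>)) \<partial>P)"
        by (rule sum.cong[OF refl]) (rule hb[OF sph\<tau>[OF _ x]])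
      then show "mean_log_norm n x - 2 / real K * (real n * cmean) - C0 \<le> (\<Sum>\<tau>\<in>?box. h (nemb (ch x) x (lattice_vec \<tau>))) / real (card ?box)"
        using lattice_lower_bound[OF ch(1-5) K x, of n] unfolding C0_def by simp
    qed
    also have "\<dots> = (\<Sum>\<tau>\<in>?box. \<integral>x. h (nemb (ch x) x (lattice_vec \<tau>)) \<partial>\<mu>) / real (card ?box)"
    proof -
      have "(\<integral>x. (\<Sum>\<tau>\<in>?box. h (nemb (ch x) x (lattice_vec \<tau>))) \<partial>\<mu>) = (\<Sum>\<tau>\<in>?box. \<integral>x. h (nemb (ch x) x (lattice_vec \<tau>)) \<partial>\<mu>)"
        by (rule Bochner_Integration.integral_sum) (rule hi)
      then show ?thesis by simp
    qed
    also have "\<dots> = (\<integral>s. h s \<partial>m0)" by (rule m0(2)[OF hc, symmetric])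
    also have "\<dots> = (\<Sum>j<n. \<integral>s. (?T ^^ j) (cphi f) s \<partial>m0)"
      unfolding h_def using borel_prob_on_integrable[OF sph_compact m0(1) C.Top_pow_cont[OF cc]] by simp
    finally show ?thesis .
  qed
  obtain r \<xi> where r: "strict_mono (r::nat \<Rightarrow> nat)" "fun_stationary p sph (cmap f) \<xi>"
    "\<And>h. continuous_on sph h \<Longrightarrow> (\<lambda>k. (\<Sum>j<r0 (r k). \<integral>s. (?T ^^ j) h s \<partial>m0) / real (r0 (r k))) \<longlonglongrightarrow> (\<integral>s. h s \<partial>\<xi>)"
    by (rule C.cesaro_limit_stationary[OF m0(1) r0], rule that)
  have \<xi>b: "\<xi> \<in> borel_prob_on sph" using r(2) unfolding fun_stationary_def by blast
  have Ninf: "filterlim (\<lambda>k. real (r0 (r k))) at_top sequentially"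
    using filterlim_compose[OF filterlim_real_sequentially filterlim_subseq[OF strict_mono_o[OF r0(1) r(1)]]]
    by (simp add: comp_def)
  \<comment> \<open>Each vector field is a section, so \<open>m0\<close> projects to
    \<open>\<mu>\<close>; stationarity of \<open>\<mu>\<close> keeps this true along the averages,
    and weak limits preserve it.\<close>
  have pr: "proj \<xi> = \<mu>"
  proof (rule borel_prob_eqI[OF X_compact proj_prob[OF \<xi>b] \<mu>b])
    fix a :: "'m \<Rightarrow> real" assume a: "continuous_on X a"
    have ac: "continuous_on sph (\<lambda>s. a (fst s))" by (rule fst_comp_cont[OF a])
    have "(\<integral>s. (?T ^^ j) (\<lambda>s. a (fst s)) s \<partial>m0) = (\<integral>x. a x \<partial>\<mu>)" for j
    proof -
      have "(\<integral>s. (?T ^^ j) (\<lambda>s. a (fst s)) s \<partial>m0) = (\<Sum>\<tau>\<in>?box. \<integral>x. (?T ^^ j) (\<lambda>s. a (fst s)) (nemb (ch x) x (lattice_vec \<tau>)) \<partial>\<mu>) / real (card ?box)"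
        by (rule m0(2)[OF C.Top_pow_cont[OF ac]])
      also have "(\<Sum>\<tau>\<in>?box. \<integral>x. (?T ^^ j) (\<lambda>s. a (fst s)) (nemb (ch x) x (lattice_vec \<tau>)) \<partial>\<mu>) = (\<Sum>\<tau>\<in>?box. \<integral>x. a x \<partial>\<mu>)"
      proof (rule sum.cong[OF refl])
        fix \<tau> assume t: "\<tau> \<in> ?box"
        have "(\<integral>x. (?T ^^ j) (\<lambda>s. a (fst s)) (nemb (ch x) x (lattice_vec \<tau>)) \<partial>\<mu>) = (\<integral>x. (transfer_op p (base_map f) ^^ j) a x \<partial>\<mu>)"
        proof (rule Bochner_Integration.integral_cong[OF refl])
          fix x assume "x \<in> space \<mu>" then have x: "x \<in> X" using \<mu>sets by simp
          show "(?T ^^ j) (\<lambda>s. a (fst s)) (nemb (ch x) x (lattice_vec \<tau>)) = (transfer_op p (base_map f) ^^ j) a x"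
            using Top_pow_fst[OF f sph\<tau>[OF t x], of j a] by (simp add: nemb_def)
        qed
        also have "\<dots> = (\<integral>x. a x \<partial>\<mu>)" by (rule B.stationary_pow[OF \<mu>s a])
        finally show "(\<integral>x. (?T ^^ j) (\<lambda>s. a (fst s)) (nemb (ch x) x (lattice_vec \<tau>)) \<partial>\<mu>) = (\<integral>x. a x \<partial>\<mu>)" .
      qed
      moreover have "card ?box \<noteq> 0" unfolding card_lattice_box using K by simp
      ultimately show ?thesis by simp
    qed
    then have "(\<lambda>k. (\<Sum>j<r0 (r k). \<integral>s. (?T ^^ j) (\<lambda>s. a (fst s)) s \<partial>m0) / real (r0 (r k))) = (\<lambda>k. \<integral>x. a x \<partial>\<mu>)"
      using r0(2) by (intro ext) (simp add: less_imp_neq[symmetric])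
    then have "(\<integral>s. a (fst s) \<partial>\<xi>) = (\<integral>x. a x \<partial>\<mu>)" using r(3)[OF ac] by (simp add: LIMSEQ_const_iff)
    then show "(\<integral>x. a x \<partial>proj \<xi>) = (\<integral>x. a x \<partial>\<mu>)"
      using integral_proj[OF \<xi>b borel_measurable_continuous_on_restrict[OF a]] by simp
  qed
  have "l - 2 / real K * cmean \<le> (\<integral>s. cphi f s \<partial>\<xi>)"
  proof (rule LIMSEQ_le)
    have "(\<lambda>k. (\<integral>x. mean_log_norm (r0 (r k)) x \<partial>\<mu>) / real (r0 (r k))) \<longlonglongrightarrow> l"
      using LIMSEQ_subseq_LIMSEQ[OF l r(1)] by (simp add: comp_def)
    moreover have "(\<lambda>k. C0 / real (r0 (r k))) \<longlonglongrightarrow> 0" by (rule real_tendsto_divide_at_top[OF tendsto_const Ninf])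
    ultimately have "(\<lambda>k. (\<integral>x. mean_log_norm (r0 (r k)) x \<partial>\<mu>) / real (r0 (r k)) - 2 / real K * cmean - C0 / real (r0 (r k))) \<longlonglongrightarrow> l - 2 / real K * cmean - 0"
      by (intro tendsto_diff tendsto_const)
    then show "(\<lambda>k. (\<integral>x. mean_log_norm (r0 (r k)) x \<partial>\<mu>) / real (r0 (r k)) - 2 / real K * cmean - C0 / real (r0 (r k))) \<longlonglongrightarrow> l - 2 / real K * cmean"
      by simp
    show "(\<lambda>k. (\<Sum>j<r0 (r k). \<integral>s. (?T ^^ j) (cphi f) s \<partial>m0) / real (r0 (r k))) \<longlonglongrightarrow> (\<integral>s. cphi f s \<partial>\<xi>)" by (rule r(3)[OF cc])
    show "\<exists>N. \<forall>n\<ge>N. (\<integral>x. mean_log_norm (r0 (r n)) x \<partial>\<mu>) / real (r0 (r n)) - 2 / real K * cmean - C0 / real (r0 (r n))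
        \<le> (\<Sum>j<r0 (r n). \<integral>s. (?T ^^ j) (cphi f) s \<partial>m0) / real (r0 (r n))"
    proof (intro exI[of _ 0] allI impI)
      fix n
      have q: "real (r0 (r n)) > 0" using r0(2) by simp
      have "(\<integral>x. mean_log_norm (r0 (r n)) x \<partial>\<mu>) / real (r0 (r n)) - 2 / real K * cmean - C0 / real (r0 (r n)) =
        ((\<integral>x. mean_log_norm (r0 (r n)) x \<partial>\<mu>) - 2 / real K * (real (r0 (r n)) * cmean) - C0) / real (r0 (r n))"
        using q by (simp add: diff_divide_distrib)
      also have "\<dots> \<le> (\<Sum>j<r0 (r n). \<integral>s. (?T ^^ j) (cphi f) s \<partial>m0) / real (r0 (r n))"
        using low[of "r0 (r n)"] q by (intro divide_right_mono) auto
      finally show "(\<integral>x. mean_log_norm (r0 (r n)) x \<partial>\<mu>) / real (r0 (r n)) - 2 / real K * cmean - C0 / real (r0 (r n))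
        \<le> (\<Sum>j<r0 (r n). \<integral>s. (?T ^^ j) (cphi f) s \<partial>m0) / real (r0 (r n))" .
    qed
  qed
  then have "l - e \<le> (\<integral>s. cphi f s \<partial>\<xi>)" using Ke by linarith
  then show ?thesis using that r(2) pr by blast
qed

text \<open>For the averaged logarithmic norms \<open>u n\<close>, every subsequential limit is, up
  to \<open>e\<close>, at most the integral of \<open>cphi f\<close> over some stationary lift, and
  such an integral is at most every \<open>u n\<close> with \<open>n > 0\<close>. So the sequence
  converges and its limit, the exponent, has both properties.\<close>

lemma lyapunov_variational:
  assumes \<mu>: "\<mu> \<in> stationary_measures p X f"
  shows "\<And>\<nu>. fun_stationary p sph (cmap f) \<nu> \<Longrightarrow> proj \<nu> = \<mu> \<Longrightarrow> (\<integral>s. cphi f s \<partial>\<nu>) \<le> lyapunov M p \<mu> f"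
    and "\<And>e. e > 0 \<Longrightarrow> \<exists>\<xi>. fun_stationary p sph (cmap f) \<xi> \<and> proj \<xi> = \<mu> \<and> lyapunov M p \<mu> f - e \<le> (\<integral>s. cphi f s \<partial>\<xi>)"
proof -
  have \<mu>b: "\<mu> \<in> borel_prob_on X" using \<mu> unfolding stationary_measures_def by blast
  interpret m: prob_space \<mu> using borel_prob_onD(1)[OF \<mu>b] .
  define u where "u n = (\<integral>x. mean_log_norm n x \<partial>\<mu>) / real n" for n
  have ub: "\<bar>u n\<bar> \<le> cmean" for n
  proof (cases "n = 0")
    case False
    have "\<bar>\<integral>x. mean_log_norm n x \<partial>\<mu>\<bar> \<le> (\<integral>x. \<bar>mean_log_norm n x\<bar> \<partial>\<mu>)" by (rule integral_abs_bound)
    also have "\<dots> \<le> (\<integral>x. real n * cmean \<partial>\<mu>)"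
      using mean_log_norm_integrable[OF \<mu>b, of n] mean_log_norm_bound borel_prob_onD(3)[OF \<mu>b]
      by (intro integral_mono integrable_abs) auto
    finally have "\<bar>\<integral>x. mean_log_norm n x \<partial>\<mu>\<bar> \<le> real n * cmean" by (simp add: m.prob_space)
    then show ?thesis unfolding u_def using False by (simp add: field_simps)
  qed (simp add: u_def cmean_nonneg)
  have uge: "(\<integral>s. cphi f s \<partial>\<nu>) \<le> u n" if "fun_stationary p sph (cmap f) \<nu>" "proj \<nu> = \<mu>" "n > 0" for \<nu> n
    using stationary_integral_le[OF that(1), of n] that(2,3) unfolding u_def by (simp add: field_simps)
  have sub: "l \<le> u n" if r: "strict_mono r" "(u \<circ> r) \<longlonglongrightarrow> l" "n > 0" for r l n
  proof (rule field_le_epsilon)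
    fix e :: real assume e: "e > 0"
    \<comment> \<open>A strictly increasing sequence may begin at time 0, where no average exists;
      dropping the first index removes this case.\<close>
    have r': "strict_mono (\<lambda>k. r (Suc k))" "\<And>k. r (Suc k) > 0"
      using r(1) strict_mono_imp_increasing[OF r(1)] by (auto simp: strict_mono_def intro: less_le_trans[of 0 "Suc _"])
    have l': "(\<lambda>k. (\<integral>x. mean_log_norm (r (Suc k)) x \<partial>\<mu>) / real (r (Suc k))) \<longlonglongrightarrow> l"
      using LIMSEQ_Suc[OF r(2)] by (simp add: u_def comp_def)
    obtain \<xi> where x: "fun_stationary p sph (cmap f) \<xi>" "proj \<xi> = \<mu>" "l - e \<le> (\<integral>s. cphi f s \<partial>\<xi>)"
      by (rule stationary_lift_approx[OF \<mu> e r' l'], rule that)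
    show "l \<le> u n + e" using uge[OF x(1,2) r(3)] x(3) by linarith
  qed
  obtain l where l: "u \<longlonglongrightarrow> l" "\<And>n. n > 0 \<Longrightarrow> l \<le> u n" by (rule real_limit_from_subsequences[OF ub sub], assumption, assumption, assumption, rule that)
  have "lyapunov M p \<mu> f = lim u"
    unfolding lyapunov_def u_def mean_log_norm_def log_norm_def[OF f] by (simp add: divide_inverse mult.commute)
  then have lyap: "lyapunov M p \<mu> f = l" using limI[OF l(1)] by simp
  show "(\<integral>s. cphi f s \<partial>\<nu>) \<le> lyapunov M p \<mu> f" if "fun_stationary p sph (cmap f) \<nu>" "proj \<nu> = \<mu>" for \<nu>
    unfolding lyap by (rule LIMSEQ_le_const[OF l(1)]) (use uge[OF that] in \<open>auto intro!: exI[of _ 1]\<close>)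
  show "\<exists>\<xi>. fun_stationary p sph (cmap f) \<xi> \<and> proj \<xi> = \<mu> \<and> lyapunov M p \<mu> f - e \<le> (\<integral>s. cphi f s \<partial>\<xi>)" if e: "e > 0" for e
  proof -
    have s: "strict_mono Suc" by (simp add: strict_mono_def)
    have l': "(\<lambda>k. (\<integral>x. mean_log_norm (Suc k) x \<partial>\<mu>) / real (Suc k)) \<longlonglongrightarrow> l"
      using LIMSEQ_Suc[OF l(1)] by (simp add: u_def)
    obtain \<xi> where "fun_stationary p sph (cmap f) \<xi>" "proj \<xi> = \<mu>" "l - e \<le> (\<integral>s. cphi f s \<partial>\<xi>)"
      by (rule stationary_lift_approx[OF \<mu> e s _ l'], simp, rule that)
    then show ?thesis unfolding lyap by blast
  qed
qed

text \<open>The averages start from a Dirac mass, written as the image of \<open>p\<close> under a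
  constant map. Its projection makes the supremum in \<open>top_lyapunov\<close> range over a
  nonempty set.\<close>

lemma stationary_exists: "\<exists>\<xi>. fun_stationary p sph (cmap f) \<xi>"
proof -
  obtain s where s: "s \<in> sph" using sph_ne by blast
  define m where "m = distr p (restrict_space borel sph) (\<lambda>_. s)"
  have "(\<lambda>_. s) \<in> p \<rightarrow>\<^sub>M restrict_space borel sph" using s by (simp add: space_restrict_space)
  then have m: "m \<in> borel_prob_on sph" unfolding m_def borel_prob_on_def using prob_space_distr by simp
  have "strict_mono Suc" by (simp add: strict_mono_def)
  then obtain r \<xi> where "fun_stationary p sph (cmap f) \<xi>"
    by (rule C.cesaro_limit_stationary[OF m]) (simp, rule that)
  then show ?thesis by blast
qed

text \<open>A bound independent of the stationary measure, so that the supremum defining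
  \<open>top_lyapunov\<close> is a genuine one.\<close>

lemma lyapunov_bounded:
  assumes \<mu>: "\<mu> \<in> stationary_measures p X f" shows "lyapunov M p \<mu> f \<le> cmean"
proof (rule field_le_epsilon)
  fix e :: real assume "e > 0"
  then obtain \<xi> where x: "fun_stationary p sph (cmap f) \<xi>" "proj \<xi> = \<mu>" "lyapunov M p \<mu> f - e \<le> (\<integral>s. cphi f s \<partial>\<xi>)"
    using lyapunov_variational(2)[OF \<mu>] by blast
  have b: "\<xi> \<in> borel_prob_on sph" using x(1) unfolding fun_stationary_def by blast
  interpret x: prob_space \<xi> using borel_prob_onD(1)[OF b] .
  have "(\<integral>s. cphi f s \<partial>\<xi>) \<le> (\<integral>s. cmean \<partial>\<xi>)"
  proof (rule integral_mono)
    show "integrable \<xi> (cphi f)" by (rule borel_prob_on_integrable[OF sph_compact b cphi_cont[OF f]])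
    fix s assume "s \<in> space \<xi>"
    then have s: "s \<in> sph" using borel_prob_onD(3)[OF b] by simp
    have "integrable p (\<lambda>t. clog f t s)"
      by (rule Bochner_Integration.integrable_bound[OF C.b_int C.l_meas[OF s]])
        (use C.l_bound[OF _ s] in \<open>auto intro!: AE_I2 intro: order_trans[OF _ abs_ge_self]\<close>)
    then show "cphi f s \<le> cmean" unfolding cphi_def
      using C.l_bound[OF _ s] by (intro integral_mono C.b_int) (auto dest: abs_le_D1)
  qed simp
  then show "lyapunov M p \<mu> f \<le> cmean + e" using x(3) by (simp add: x.prob_space)
qed

end

end

section \<open>Perturbation\<close>

context random_embedded
begin

definition cinv :: "((nat \<Rightarrow> 't) \<Rightarrow> 'm \<Rightarrow> 'm) \<Rightarrow> 't \<Rightarrow> real" where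
  "cinv f t = (SUP s\<in>sph. 1 / norm (cpush f t s))"

definition cdiff :: "((nat \<Rightarrow> 't) \<Rightarrow> 'm \<Rightarrow> 'm) \<Rightarrow> ((nat \<Rightarrow> 't) \<Rightarrow> 'm \<Rightarrow> 'm) \<Rightarrow> 't \<Rightarrow> real" where
  "cdiff f g t = (SUP s\<in>sph. norm (cpush f t s - cpush g t s))"

text \<open>One integrable weight for both error estimates: it is at least 1, so its tail bounds the
  probability of a large inverse derivative, and it dominates the logarithm
  \<open>ln (1 + cinv f t)\<close> that \<open>slog_close\<close> leaves on that tail.\<close>

definition cweight :: "((nat \<Rightarrow> 't) \<Rightarrow> 'm \<Rightarrow> 'm) \<Rightarrow> 't \<Rightarrow> real" where
  "cweight f t = 1 + ln (1 + cinv f t)"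

definition step_dist :: "((nat \<Rightarrow> 't) \<Rightarrow> 'm \<Rightarrow> 'm) \<Rightarrow> ((nat \<Rightarrow> 't) \<Rightarrow> 'm \<Rightarrow> 'm) \<Rightarrow> 't \<Rightarrow> ennreal" where
  "step_dist f g t = dC0 M X (one_step f t) (one_step g t) + sup_diff_D M X \<iota> (one_step f t) (one_step g t) +
     sup_diff_Dinv M X \<iota> (one_step f t) (one_step g t)"

lemma cinv_good: "t \<notin> bad f \<Longrightarrow> cinv f t = Linv (one_step f t)"
  by (simp add: cinv_def Linv_def cpush_def)

lemma cdiff_good: "t \<notin> bad f \<Longrightarrow> t \<notin> bad g \<Longrightarrow> cdiff f g t = ediff (one_step f t) (one_step g t)"
  by (simp add: cdiff_def ediff_def cpush_def)

lemma cinv_measurable: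
  assumes f: "f \<in> Diff1_loc M p X" shows "cinv f \<in> borel_measurable p"
  unfolding cinv_def[abs_def]
proof (rule SUP_measurable[OF sph_compact sph_ne])
  fix t assume t: "t \<in> space p"
  show "continuous_on sph (\<lambda>s. 1 / norm (cpush f t s))"
    using cpush_pos[OF f t] by (intro continuous_intros cpush_cont[OF f t]) force+
next
  fix s assume "s \<in> sph"
  then have [measurable]: "(\<lambda>t. cpush f t s) \<in> borel_measurable p" by (rule cpush_measurable[OF f])
  show "(\<lambda>t. 1 / norm (cpush f t s)) \<in> borel_measurable p" by measurable
qed

lemma cdiff_measurable:
  assumes f: "f \<in> Diff1_loc M p X" and g: "g \<in> Diff1_loc M p X" shows "cdiff f g \<in> borel_measurable p"
  unfolding cdiff_def[abs_def]
proof (rule SUP_measurable[OF sph_compact sph_ne])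
  fix t assume t: "t \<in> space p"
  show "continuous_on sph (\<lambda>s. norm (cpush f t s - cpush g t s))"
    by (intro continuous_intros cpush_cont[OF f t] cpush_cont[OF g t])
next
  fix s assume s: "s \<in> sph"
  have [measurable]: "(\<lambda>t. cpush f t s) \<in> borel_measurable p" "(\<lambda>t. cpush g t s) \<in> borel_measurable p"
    by (rule cpush_measurable[OF f s], rule cpush_measurable[OF g s])
  show "(\<lambda>t. norm (cpush f t s - cpush g t s)) \<in> borel_measurable p" by measurable
qed

lemma cinv_pos:
  assumes f: "f \<in> Diff1_loc M p X" and t: "t \<in> space p" shows "0 < cinv f t"
proof (cases "t \<in> bad f")
  case True
  have "(SUP s\<in>sph. 1 / norm (cpush f t s)) = (SUP s\<in>sph. (1::real))"
    using True by (intro SUP_cong refl) (auto simp: cpush_def sph_def)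
  then show ?thesis using sph_ne by (simp add: cinv_def)
next
  case False
  then show ?thesis using Linv_pos[OF f_good[OF f t False]] by (simp add: cinv_good)
qed

lemma cdiff_nonneg:
  assumes f: "f \<in> Diff1_loc M p X" and g: "g \<in> Diff1_loc M p X" and t: "t \<in> space p" shows "0 \<le> cdiff f g t"
proof -
  obtain s where s: "s \<in> sph" using sph_ne by blast
  have bd: "bdd_above ((\<lambda>s. norm (cpush f t s - cpush g t s)) ` sph)"
    by (intro bdd_sph continuous_intros cpush_cont[OF f t] cpush_cont[OF g t])
  have "norm (cpush f t s - cpush g t s) \<le> cdiff f g t" unfolding cdiff_def by (rule cSUP_upper[OF s bd])
  then show ?thesis using norm_ge_zero order_trans by blast
qed

lemma cweight_le:
  assumes f: "f \<in> Diff1_loc M p X" and t: "t \<in> space p"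
  shows "1 \<le> cweight f t" "cweight f t \<le> 1 + ln 2 + cbound f t"
proof -
  have c: "0 < cinv f t" by (rule cinv_pos[OF f t])
  show "1 \<le> cweight f t" unfolding cweight_def using c by simp
  have cb: "max 0 (ln (cinv f t)) \<le> cbound f t" unfolding cbound_eq[OF f] cinv_def by simp
  have "ln (1 + cinv f t) \<le> ln 2 + max 0 (ln (cinv f t))"
  proof (cases "cinv f t \<le> 1")
    case True
    then have "ln (1 + cinv f t) \<le> ln 2" using c by (subst ln_le_cancel_iff) auto
    then show ?thesis by simp
  next
    case False
    then have "ln (1 + cinv f t) \<le> ln (2 * cinv f t)" using c by (subst ln_le_cancel_iff) auto
    also have "\<dots> = ln 2 + ln (cinv f t)" using c by (simp add: ln_mult)
    finally show ?thesis by simp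
  qed
  then show "cweight f t \<le> 1 + ln 2 + cbound f t" unfolding cweight_def using cb by linarith
qed

lemma cweight_measurable:
  assumes f: "f \<in> Diff1_loc M p X" shows "cweight f \<in> borel_measurable p"
proof -
  have [measurable]: "cinv f \<in> borel_measurable p" by (rule cinv_measurable[OF f])
  show ?thesis unfolding cweight_def[abs_def] by measurable
qed

text \<open>\<open>cinv f t\<close> is finite for each parameter, so the truncated weights tend to 0
  pointwise and are dominated by \<open>1 + ln 2 + cbound f t\<close>, which the moment condition
  makes integrable.\<close>

lemma cweight_tail:
  assumes f: "f \<in> Diff1_loc M p X" and e: "e > 0"
  obtains R where "R \<ge> 1" "integrable p (\<lambda>t. cweight f t * indicator {t. R < cinv f t} t)"
    "(\<integral>t. cweight f t * indicator {t. R < cinv f t} t \<partial>p) \<le> e"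
proof -
  have [measurable]: "cweight f \<in> borel_measurable p" "cinv f \<in> borel_measurable p"
    by (rule cweight_measurable[OF f], rule cinv_measurable[OF f])
  have wi: "integrable p (\<lambda>t. 1 + ln 2 + cbound f t)" using cbound_integrable[OF f] by simp
  have bd: "norm (cweight f t * indicator {t. real n < cinv f t} t) \<le> 1 + ln 2 + cbound f t" if "t \<in> space p" for t n
    using cweight_le[OF f that] cbound_nonneg[OF f, of t] by (auto simp: indicator_def)
  have int: "integrable p (\<lambda>t. cweight f t * indicator {t. real n < cinv f t} t)" for n
    by (rule Bochner_Integration.integrable_bound[OF wi]) (use bd in \<open>auto intro!: AE_I2 intro: order_trans[OF _ abs_ge_self]\<close>)
  have "(\<lambda>n. \<integral>t. cweight f t * indicator {t. real n < cinv f t} t \<partial>p) \<longlonglongrightarrow> (\<integral>t. 0 \<partial>p)"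
  proof (rule integral_dominated_convergence[where w="\<lambda>t. 1 + ln 2 + cbound f t"])
    show "AE t in p. (\<lambda>n. cweight f t * indicator {t. real n < cinv f t} t) \<longlonglongrightarrow> 0"
    proof (rule AE_I2)
      fix t
      obtain N where N: "cinv f t < real N" using reals_Archimedean2 by blast
      have "eventually (\<lambda>n. cweight f t * indicator {t. real n < cinv f t} t = 0) sequentially"
        using eventually_ge_at_top[of N]
      proof eventually_elim
        case (elim n)
        then have "real N \<le> real n" by simp
        then have "\<not> real n < cinv f t" using N by linarith
        then show ?case by simp
      qed
      then show "(\<lambda>n. cweight f t * indicator {t. real n < cinv f t} t) \<longlonglongrightarrow> 0" by (rule tendsto_eventually)
    qed
    show "integrable p (\<lambda>t. 1 + ln 2 + cbound f t)" by (rule wi)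
    show "AE t in p. norm (cweight f t * indicator {t. real n < cinv f t} t) \<le> 1 + ln 2 + cbound f t" for n
      using bd by (intro AE_I2) blast
    show "(\<lambda>t. cweight f t * indicator {t. real n < cinv f t} t) \<in> borel_measurable p" for n using int by blast
  qed simp
  then have "(\<lambda>n. \<integral>t. cweight f t * indicator {t. real n < cinv f t} t \<partial>p) \<longlonglongrightarrow> 0" by simp
  from order_tendstoD(2)[OF this e] eventually_ge_at_top[of 1]
  have "eventually (\<lambda>n. (\<integral>t. cweight f t * indicator {t. real n < cinv f t} t \<partial>p) < e \<and> 1 \<le> n) sequentially"
    by eventually_elim simp
  then obtain n where "\<forall>m\<ge>n. (\<integral>t. cweight f t * indicator {t. real m < cinv f t} t \<partial>p) < e \<and> 1 \<le> m"
    unfolding eventually_sequentially by blast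
  then have n: "(\<integral>t. cweight f t * indicator {t. real n < cinv f t} t \<partial>p) < e" "1 \<le> n" by auto
  show ?thesis by (rule that[of "real n", OF _ int]) (use n in auto)
qed

text \<open>The integrand of \<open>d\<^sub>C\<^sub>1\<close> need not be measurable. The integral of a nonmeasurable function is the
  supremum over its measurable minorants, so only lower bounds on the distance can be used.\<close>

lemma nn_integral_le_dC1:
  assumes f: "f \<in> Diff1_loc M p X" and g: "g \<in> Diff1_loc M p X"
    and u: "u \<in> borel_measurable p" "\<And>t. t \<in> space p \<Longrightarrow> t \<notin> bad f \<Longrightarrow> t \<notin> bad g \<Longrightarrow> ennreal (u t) \<le> step_dist f g t"
  shows "(\<integral>\<^sup>+t. ennreal (u t) \<partial>p) \<le> dC1 M p X \<iota> f g"
proof -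
  have d: "distr P p (\<lambda>\<omega>. \<omega> 0) = p" by (rule distr_PiM_component) (auto intro: prob_space_axioms)
  have m: "(\<lambda>\<omega>. \<omega> 0) \<in> P \<rightarrow>\<^sub>M p" by measurable
  have um: "(\<lambda>t. ennreal (u t)) \<in> borel_measurable (distr P p (\<lambda>\<omega>. \<omega> 0))" using u(1) by simp
  have "(\<integral>\<^sup>+t. ennreal (u t) \<partial>p) = (\<integral>\<^sup>+\<omega>. ennreal (u (\<omega> 0)) \<partial>P)"
    using nn_integral_distr[OF m um] d by simp
  also have "\<dots> \<le> dC1 M p X \<iota> f g" unfolding dC1_def
  proof (rule nn_integral_mono_AE)
    show "AE \<omega> in P. ennreal (u (\<omega> 0)) \<le> dC0 M X (f \<omega>) (g \<omega>) + sup_diff_D M X \<iota> (f \<omega>) (g \<omega>) + sup_diff_Dinv M X \<iota> (f \<omega>) (g \<omega>)"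
      using AE_path_coord[OF AE_not_bad[OF f], of 0] AE_path_coord[OF AE_not_bad[OF g], of 0] AE_space
    proof eventually_elim
      case (elim \<omega>)
      show ?case using u(2)[OF path_at[OF elim(3)] elim(1,2)]
        unfolding step_dist_def one_step_eq[OF f_random[OF f] elim(3)] one_step_eq[OF f_random[OF g] elim(3)] .
    qed
  qed
  finally show ?thesis .
qed

lemma integral_le_dC1:
  assumes f: "f \<in> Diff1_loc M p X" and g: "g \<in> Diff1_loc M p X"
    and u: "u \<in> borel_measurable p" "\<And>t. t \<in> space p \<Longrightarrow> t \<notin> bad f \<Longrightarrow> t \<notin> bad g \<Longrightarrow> ennreal (u t) \<le> step_dist f g t"
    and u0: "\<And>t. t \<in> space p \<Longrightarrow> 0 \<le> u t" and d: "dC1 M p X \<iota> f g < ennreal \<delta>"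
  shows "integrable p u" "(\<integral>t. u t \<partial>p) \<le> \<delta>"
proof -
  have le: "(\<integral>\<^sup>+t. ennreal (u t) \<partial>p) < ennreal \<delta>" using nn_integral_le_dC1[OF f g u] d by (rule le_less_trans)
  show i: "integrable p u"
  proof (rule integrableI_nonneg[OF u(1)])
    show "AE x in p. 0 \<le> u x" using u0 by (rule AE_I2)
    show "(\<integral>\<^sup>+t. ennreal (u t) \<partial>p) < \<infinity>" using less_trans[OF le ennreal_less_top] by simp
  qed
  have "ennreal (\<integral>t. u t \<partial>p) = (\<integral>\<^sup>+t. ennreal (u t) \<partial>p)"
    by (rule nn_integral_eq_integral[symmetric, OF i]) (use u0 in \<open>auto intro!: AE_I2\<close>)
  then have "ennreal (\<integral>t. u t \<partial>p) < ennreal \<delta>" using le by simp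
  moreover have "\<delta> > 0"
  proof (rule ccontr)
    assume "\<not> \<delta> > 0" then have "ennreal \<delta> = 0" by (simp add: ennreal_neg)
    then show False using le by simp
  qed
  ultimately show "(\<integral>t. u t \<partial>p) \<le> \<delta>" by (meson ennreal_less_iff less_imp_le linorder_not_less ennreal_leI)
qed

text \<open>Where the inverse derivative of \<open>f\<close> is at most \<open>R\<close>, the images
  under \<open>h\<close> can differ by more than \<open>e / 2\<close> only if the one-step distance
  is at least some \<open>\<delta>1\<close>; this has small probability by Markov's inequality. On
  the rest the difference is at most \<open>2 * B\<close>, against a small tail. The starting point
  \<open>s\<close> never enters the exceptional set, so the estimate is uniform.\<close>

lemma transfer_op_close:
  assumes f: "f \<in> Diff1_loc M p X" and h: "continuous_on sph h" and e: "e > 0"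
  obtains \<delta> where "\<delta> > 0" "\<And>g s. g \<in> Diff1_loc M p X \<Longrightarrow> dC1 M p X \<iota> f g < ennreal \<delta> \<Longrightarrow> s \<in> sph \<Longrightarrow>
    \<bar>transfer_op p (cmap g) h s - transfer_op p (cmap f) h s\<bar> \<le> e"
proof -
  interpret Cf: random_cocycle p sph "cmap f" "clog f" "cbound f" by (rule cocycle[OF f])
  obtain B where B: "0 \<le> B" "\<And>s. s \<in> sph \<Longrightarrow> \<bar>h s\<bar> \<le> B" using continuous_on_compact_bdd[OF sph_compact h] by metis
  \<comment> \<open>Two exceptional events, each costing at most \<open>2 * B * \<eta>\<close>, must
    together stay below \<open>e / 2\<close>; the added 1 covers \<open>B = 0\<close>.\<close>
  define \<eta> where "\<eta> = e / (8 * (B + 1))"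
  have \<eta>: "\<eta> > 0" unfolding \<eta>_def using e B(1) by simp
  have B\<eta>: "2 * B * \<eta> \<le> e / 4"
  proof -
    have "2 * B * \<eta> = (e / 4) * (B / (B + 1))" unfolding \<eta>_def using B(1) by (simp add: field_simps)
    also have "\<dots> \<le> (e / 4) * 1" using B(1) e by (intro mult_left_mono) auto
    finally show ?thesis by simp
  qed
  obtain R where R: "R \<ge> 1" "integrable p (\<lambda>t. cweight f t * indicator {t. R < cinv f t} t)"
    "(\<integral>t. cweight f t * indicator {t. R < cinv f t} t \<partial>p) \<le> \<eta>"
    by (rule cweight_tail[OF f \<eta>], rule that)
  have e2: "e / 2 > 0" "R > 0" using e R(1) by auto
  obtain \<delta>1 where \<delta>1: "\<delta>1 > 0" "\<And>f g s. good f \<Longrightarrow> good g \<Longrightarrow> Linv f \<le> R \<Longrightarrow> dC0 M X f g < ennreal \<delta>1 \<Longrightarrow>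
     ediff f g < \<delta>1 \<Longrightarrow> s \<in> sph \<Longrightarrow> \<bar>h (smap f s) - h (smap g s)\<bar> \<le> e / 2"
    by (rule smap_close[OF h e2], rule that)
  \<comment> \<open>Markov's inequality: if the distance integrates to at most
    \<open>\<delta>1 * \<eta>\<close>, then an event on which it is at least
    \<open>\<delta>1\<close> has probability at most \<open>\<eta>\<close>.\<close>
  define \<delta> where "\<delta> = \<delta>1 * \<eta>"
  have \<delta>: "\<delta> > 0" unfolding \<delta>_def using \<delta>1(1) \<eta> by simp
  have main: "\<bar>transfer_op p (cmap g) h s - transfer_op p (cmap f) h s\<bar> \<le> e"
    if g: "g \<in> Diff1_loc M p X" and d: "dC1 M p X \<iota> f g < ennreal \<delta>" and s: "s \<in> sph" for g s
  proof -
    interpret Cg: random_cocycle p sph "cmap g" "clog g" "cbound g" by (rule cocycle[OF g])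
    obtain D where D: "countable D" "D \<subseteq> sph" "\<And>U. open U \<Longrightarrow> U \<inter> sph \<noteq> {} \<Longrightarrow> U \<inter> D \<noteq> {}"
      by (rule countable_dense_subset[of sph], rule that)
    have [measurable]: "cweight f \<in> borel_measurable p" "cinv f \<in> borel_measurable p" "bad f \<in> sets p" "bad g \<in> sets p"
      by (rule cweight_measurable[OF f], rule cinv_measurable[OF f], rule bad_meas[OF f], rule bad_meas[OF g])
    define v where "v t s = \<bar>h (cmap g t s) - h (cmap f t s)\<bar>" for t s
    have vm: "(\<lambda>t. v t s) \<in> borel_measurable p" if "s \<in> sph" for s
    proof -
      have [measurable]: "(\<lambda>t. h (cmap g t s)) \<in> borel_measurable p" "(\<lambda>t. h (cmap f t s)) \<in> borel_measurable p"
        by (rule Cg.compose_cont_meas[OF h that], rule Cf.compose_cont_meas[OF h that])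
      show ?thesis unfolding v_def by measurable
    qed
    have vB: "v t s \<le> 2 * B" if "t \<in> space p" "s \<in> sph" for t s
      using B(2)[OF Cg.F_in[OF that]] B(2)[OF Cf.F_in[OF that]] unfolding v_def by linarith
    \<comment> \<open>The parameters for which some point of the bundle is moved too far. A
      countable dense set detects this by continuity and keeps the event measurable.\<close>
    define E where "E = (\<Union>d\<in>D. {t \<in> space p. v t d > e / 2})"
    have Em[measurable]: "E \<in> sets p" unfolding E_def
    proof (rule sets.countable_UN''[OF D(1)])
      fix d assume "d \<in> D"
      then have [measurable]: "(\<lambda>t. v t d) \<in> borel_measurable p" using vm D(2) by blast
      show "{t \<in> space p. v t d > e / 2} \<in> sets p" by measurable
    qed
    have vE: "v t s \<le> e / 2" if t: "t \<in> space p" "t \<notin> E" and s: "s \<in> sph" for t s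
    proof (rule ccontr)
      assume n: "\<not> v t s \<le> e / 2"
      have hc: "continuous_on sph (\<lambda>s. h (F s))" if "continuous_on sph F" "\<And>s. s \<in> sph \<Longrightarrow> F s \<in> sph" for F
        by (rule continuous_on_compose2[OF h that(1)]) (use that(2) in auto)
      have vc: "continuous_on sph (v t)" unfolding v_def
        by (intro continuous_intros hc Cg.F_cont[OF t(1)] Cf.F_cont[OF t(1)] Cg.F_in[OF t(1)] Cf.F_in[OF t(1)])
      have "\<exists>A. open A \<and> s \<in> A \<and> (\<forall>y\<in>sph. y \<in> A \<longrightarrow> v t y \<in> {e/2<..})"
        using vc[unfolded continuous_on_topological, rule_format, OF s, of "{e/2<..}"] n by simp
      then obtain A where A: "open A" "s \<in> A" "\<And>y. y \<in> sph \<Longrightarrow> y \<in> A \<Longrightarrow> e/2 < v t y" by auto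
      have "A \<inter> D \<noteq> {}" using D(3)[OF A(1)] A(2) s by blast
      then obtain d where "d \<in> A" "d \<in> D" by blast
      then have "t \<in> E" unfolding E_def using A(3) D(2) t(1) by blast
      then show False using t(2) by simp
    qed
    define G where "G = {t \<in> space p. t \<in> E \<and> t \<notin> bad f \<and> t \<notin> bad g \<and> cinv f t \<le> R}"
    have Gm[measurable]: "G \<in> sets p" unfolding G_def by measurable
    have Gd: "ennreal (\<delta>1 * indicator G t) \<le> step_dist f g t" if t: "t \<in> space p" "t \<notin> bad f" "t \<notin> bad g" for t
    proof (cases "t \<in> G")
      case True
      then obtain d where d: "d \<in> D" "v t d > e / 2" unfolding G_def E_def by blast
      have ds: "d \<in> sph" using d(1) D(2) by blast
      let ?f = "one_step f t" and ?g = "one_step g t"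
      have gd: "good ?f" "good ?g" using f_good[OF f t(1,2)] f_good[OF g t(1,3)] by auto
      have L: "Linv ?f \<le> R" using True cinv_good[OF t(2)] unfolding G_def by simp
      have "v t d = \<bar>h (smap ?f d) - h (smap ?g d)\<bar>" unfolding v_def using t by (simp add: cmap_def)
      then have "\<not> (dC0 M X ?f ?g < ennreal \<delta>1 \<and> ediff ?f ?g < \<delta>1)"
        using \<delta>1(2)[OF gd L _ _ ds] d(2) by (auto simp: not_le)
      then have "ennreal \<delta>1 \<le> dC0 M X ?f ?g \<or> ennreal \<delta>1 \<le> sup_diff_D M X \<iota> ?f ?g"
      proof -
        have "ennreal \<delta>1 \<le> sup_diff_D M X \<iota> ?f ?g" if "\<delta>1 \<le> ediff ?f ?g"
          using ennreal_leI[OF that] ediff_le_sup_diff_D[OF gd] by (rule order_trans)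
        then show ?thesis using \<open>\<not> (dC0 M X ?f ?g < ennreal \<delta>1 \<and> ediff ?f ?g < \<delta>1)\<close> by (auto simp: not_less)
      qed
      moreover have "dC0 M X ?f ?g \<le> step_dist f g t" "sup_diff_D M X \<iota> ?f ?g \<le> step_dist f g t"
        unfolding step_dist_def by (auto intro: add_increasing add_increasing2)
      ultimately show ?thesis using True order_trans by auto
    qed simp
    have Gi: "(\<integral>t. \<delta>1 * indicator G t \<partial>p) \<le> \<delta>"
      by (rule integral_le_dC1(2)[OF f g _ Gd _ d]) (use \<delta>1(1) in auto)
    have pG: "prob G \<le> \<eta>"
    proof -
      have "\<delta>1 * prob G \<le> \<delta>1 * \<eta>" using Gi unfolding \<delta>_def by simp
      then show ?thesis using \<delta>1(1) by simp
    qed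
    \<comment> \<open>Almost every parameter in \<open>E\<close> lies in \<open>G\<close> or in the
      tail, and on the tail the weight is at least 1, so the bracket is at least 1 there.\<close>
    have ptw: "AE t in p. v t s \<le> e / 2 + 2 * B * (indicator G t + cweight f t * indicator {t. R < cinv f t} t)"
      using AE_not_bad[OF f] AE_not_bad[OF g] AE_space
    proof eventually_elim
      case (elim t)
      have w: "1 \<le> cweight f t" by (rule cweight_le(1)[OF f elim(3)])
      show ?case
      proof (cases "t \<in> E")
        case False
        have "0 \<le> 2 * B * (indicator G t + cweight f t * indicator {t. R < cinv f t} t)"
          using B(1) w by (intro mult_nonneg_nonneg add_nonneg_nonneg) auto
        then show ?thesis using vE[OF elim(3) False s] by linarith
      next
        case True
        have "1 \<le> indicator G t + cweight f t * indicator {t. R < cinv f t} t"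
          using True elim w unfolding G_def by (auto simp: indicator_def)
        then have "2 * B * 1 \<le> 2 * B * (indicator G t + cweight f t * indicator {t. R < cinv f t} t)"
          using B(1) by (intro mult_left_mono) auto
        then show ?thesis using vB[OF elim(3) s] e by linarith
      qed
    qed
    have hi: "integrable p (\<lambda>t. h (cmap g t s))" "integrable p (\<lambda>t. h (cmap f t s))"
      using Cg.compose_cont_meas[OF h s] Cf.compose_cont_meas[OF h s] B(2)[OF Cg.F_in[OF _ s]] B(2)[OF Cf.F_in[OF _ s]]
      by (auto intro!: integrable_const_bound[of _ B])
    have Gint: "integrable p (indicator G :: _ \<Rightarrow> real)" by (simp add: less_top[symmetric])
    have "\<bar>transfer_op p (cmap g) h s - transfer_op p (cmap f) h s\<bar> = \<bar>\<integral>t. h (cmap g t s) - h (cmap f t s) \<partial>p\<bar>"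
      unfolding transfer_op_def using hi by simp
    also have "\<dots> \<le> (\<integral>t. v t s \<partial>p)" unfolding v_def by (rule integral_abs_bound)
    also have "\<dots> \<le> (\<integral>t. e / 2 + 2 * B * (indicator G t + cweight f t * indicator {t. R < cinv f t} t) \<partial>p)"
    proof (rule integral_mono_AE[OF _ _ ptw])
      show "integrable p (\<lambda>t. v t s)" unfolding v_def using hi by simp
      show "integrable p (\<lambda>t. e / 2 + 2 * B * (indicator G t + cweight f t * indicator {t. R < cinv f t} t))"
        using R(2) Gint by simp
    qed
    also have "\<dots> = e / 2 + 2 * B * (prob G + (\<integral>t. cweight f t * indicator {t. R < cinv f t} t \<partial>p))"
    proof -
      have "(\<integral>t. e / 2 + 2 * B * (indicator G t + cweight f t * indicator {t. R < cinv f t} t) \<partial>p) =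
        (\<integral>t. e / 2 \<partial>p) + 2 * B * ((\<integral>t. indicator G t \<partial>p) + (\<integral>t. cweight f t * indicator {t. R < cinv f t} t \<partial>p))"
        using R(2) Gint by (subst Bochner_Integration.integral_add) auto
      then show ?thesis by (simp add: prob_space)
    qed
    also have "\<dots> \<le> e / 2 + 2 * B * (\<eta> + \<eta>)"
      using pG R(3) B(1) by (intro add_left_mono mult_left_mono add_mono) auto
    also have "\<dots> \<le> e" using B\<eta> by (simp add: distrib_left)
    finally show ?thesis .
  qed
  show ?thesis by (rule that[OF \<delta> main])
qed

text \<open>The logarithmic term of \<open>slog_close\<close> is treated in two ranges: linearly
  where the inverse derivative is at most \<open>R\<close>, and by splitting the logarithm of a
  product beyond it. The linear terms are controlled by the distance, the remaining logarithm by the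
  weight.\<close>

lemma cphi_close:
  assumes f: "f \<in> Diff1_loc M p X" and e: "e > 0"
  obtains \<delta> where "\<delta> > 0" "\<And>g s. g \<in> Diff1_loc M p X \<Longrightarrow> dC1 M p X \<iota> f g < ennreal \<delta> \<Longrightarrow> s \<in> sph \<Longrightarrow> \<bar>cphi g s - cphi f s\<bar> \<le> e"
proof -
  interpret Cf: random_cocycle p sph "cmap f" "clog f" "cbound f" by (rule cocycle[OF f])
  have e2: "e / 2 > 0" using e by simp
  obtain R where R: "R \<ge> 1" "integrable p (\<lambda>t. cweight f t * indicator {t. R < cinv f t} t)"
    "(\<integral>t. cweight f t * indicator {t. R < cinv f t} t \<partial>p) \<le> e / 2"
    by (rule cweight_tail[OF f e2], rule that)
  \<comment> \<open>Makes the linear error \<open>(R + 2) * \<delta>\<close> equal to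
    \<open>e / 2\<close>; the tail uses the other half.\<close>
  define \<delta> where "\<delta> = e / (2 * (R + 2))"
  have \<delta>: "\<delta> > 0" unfolding \<delta>_def using e R(1) by simp
  have main: "\<bar>cphi g s - cphi f s\<bar> \<le> e"
    if g: "g \<in> Diff1_loc M p X" and d: "dC1 M p X \<iota> f g < ennreal \<delta>" and s: "s \<in> sph" for g s
  proof -
    interpret Cg: random_cocycle p sph "cmap g" "clog g" "cbound g" by (rule cocycle[OF g])
    have [measurable]: "cinv f \<in> borel_measurable p" "cinv g \<in> borel_measurable p" "cdiff f g \<in> borel_measurable p"
      by (rule cinv_measurable[OF f], rule cinv_measurable[OF g], rule cdiff_measurable[OF f g])
    \<comment> \<open>A measurable minorant of the one-step distance that contains both terms of
      \<open>slog_close\<close> that depend on \<open>g\<close>.\<close>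
    define u where "u t = cdiff f g t + max 0 (cinv g t - cinv f t)" for t
    have um: "u \<in> borel_measurable p" unfolding u_def[abs_def] by measurable
    have u0: "0 \<le> u t" if "t \<in> space p" for t unfolding u_def using cdiff_nonneg[OF f g that] by simp
    have ud: "ennreal (u t) \<le> step_dist f g t" if t: "t \<in> space p" "t \<notin> bad f" "t \<notin> bad g" for t
    proof -
      let ?f = "one_step f t" and ?g = "one_step g t"
      have gd: "good ?f" "good ?g" using f_good[OF f t(1,2)] f_good[OF g t(1,3)] by auto
      have "ennreal (u t) = ennreal (ediff ?f ?g) + ennreal (max 0 (Linv ?g - Linv ?f))"
        unfolding u_def cdiff_good[OF t(2,3)] cinv_good[OF t(2)] cinv_good[OF t(3)]
        by (rule ennreal_plus) (use ediff_nonneg[OF gd] in auto)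
      also have "\<dots> \<le> sup_diff_D M X \<iota> ?f ?g + sup_diff_Dinv M X \<iota> ?f ?g"
        by (intro add_mono ediff_le_sup_diff_D Linv_le_sup_diff_Dinv gd)
      also have "\<dots> \<le> step_dist f g t" unfolding step_dist_def by (simp add: add.assoc add_increasing)
      finally show ?thesis .
    qed
    have ui: "integrable p u" "(\<integral>t. u t \<partial>p) \<le> \<delta>" by (rule integral_le_dC1[OF f g um ud u0 d], assumption+)+
    have li: "integrable p (\<lambda>t. clog g t s)" "integrable p (\<lambda>t. clog f t s)"
    proof -
      show "integrable p (\<lambda>t. clog g t s)"
        by (rule Bochner_Integration.integrable_bound[OF Cg.b_int Cg.l_meas[OF s]])
          (use Cg.l_bound[OF _ s] in \<open>auto intro!: AE_I2 intro: order_trans[OF _ abs_ge_self]\<close>)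
      show "integrable p (\<lambda>t. clog f t s)"
        by (rule Bochner_Integration.integrable_bound[OF Cf.b_int Cf.l_meas[OF s]])
          (use Cf.l_bound[OF _ s] in \<open>auto intro!: AE_I2 intro: order_trans[OF _ abs_ge_self]\<close>)
    qed
    have ptw: "AE t in p. \<bar>clog g t s - clog f t s\<bar> \<le> (R + 2) * u t + cweight f t * indicator {t. R < cinv f t} t"
      using AE_not_bad[OF f] AE_not_bad[OF g] AE_space
    proof eventually_elim
      case (elim t)
      let ?f = "one_step f t" and ?g = "one_step g t"
      have gd: "good ?f" "good ?g" using f_good[OF f elim(3,1)] f_good[OF g elim(3,2)] by auto
      let ?e = "ediff ?f ?g" and ?e' = "max 0 (Linv ?g - Linv ?f)" and ?L = "Linv ?f"
      have e0: "0 \<le> ?e" by (rule ediff_nonneg[OF gd])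
      have L0: "0 < ?L" by (rule Linv_pos[OF gd(1)])
      have ue: "u t = ?e + ?e'" unfolding u_def cdiff_good[OF elim(1,2)] cinv_good[OF elim(1)] cinv_good[OF elim(2)] ..
      have cl: "\<bar>clog g t s - clog f t s\<bar> \<le> ln (1 + ?e * ?L) + ?e + ?e'"
        using slog_close[OF gd s] elim by (simp add: clog_def)
      have ln_le: "ln (1 + ?e * ?L) \<le> (R + 1) * ?e + cweight f t * indicator {t. R < cinv f t} t"
      proof (cases "R < cinv f t")
        case False
        then have LR: "?L \<le> R" using cinv_good[OF elim(1)] by simp
        have "ln (1 + ?e * ?L) \<le> ?e * ?L" using e0 L0 by (intro ln_add_one_self_le_self) simp
        also have "\<dots> \<le> ?e * R" using LR e0 by (rule mult_left_mono)
        also have "\<dots> \<le> (R + 1) * ?e" using e0 by (simp add: algebra_simps)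
        finally show ?thesis using False by simp
      next
        case True
        \<comment> \<open>Separates the perturbation from the large factor, so that
          \<open>?L\<close> survives only in \<open>ln (1 + ?L)\<close>, a part of the
          weight.\<close>
        have "1 + ?e * ?L \<le> (1 + ?e) * (1 + ?L)" using e0 L0 by (simp add: algebra_simps)
        then have "ln (1 + ?e * ?L) \<le> ln ((1 + ?e) * (1 + ?L))"
          using e0 L0 by (subst ln_le_cancel_iff) (auto intro!: add_pos_nonneg mult_pos_pos)
        also have "\<dots> = ln (1 + ?e) + ln (1 + ?L)" using e0 L0 by (intro ln_mult_pos) auto
        also have "\<dots> \<le> ?e + ln (1 + ?L)" using e0 by (intro add_right_mono ln_add_one_self_le_self)
        also have "\<dots> \<le> (R + 1) * ?e + cweight f t"
          using e0 R(1) unfolding cweight_def cinv_good[OF elim(1)] by (simp add: algebra_simps)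
        finally show ?thesis using True by simp
      qed
      have "0 \<le> (R + 1) * ?e'" using R(1) by simp
      then show ?case using cl ln_le unfolding ue by (simp add: algebra_simps)
    qed
    have "\<bar>cphi g s - cphi f s\<bar> = \<bar>\<integral>t. clog g t s - clog f t s \<partial>p\<bar>"
      unfolding cphi_def using li by simp
    also have "\<dots> \<le> (\<integral>t. \<bar>clog g t s - clog f t s\<bar> \<partial>p)" by (rule integral_abs_bound)
    also have "\<dots> \<le> (\<integral>t. (R + 2) * u t + cweight f t * indicator {t. R < cinv f t} t \<partial>p)"
      by (rule integral_mono_AE[OF _ _ ptw]) (use li ui R in auto)
    also have "\<dots> = (R + 2) * (\<integral>t. u t \<partial>p) + (\<integral>t. cweight f t * indicator {t. R < cinv f t} t \<partial>p)"
      using ui(1) R(2) by simp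
    also have "\<dots> \<le> (R + 2) * \<delta> + e / 2" using ui(2) R by (intro add_mono mult_left_mono) auto
    also have "\<dots> = e" unfolding \<delta>_def using R(1) by (simp add: field_simps)
    finally show ?thesis .
  qed
  show ?thesis by (rule that[OF \<delta> main])
qed

text \<open>One subsequence serves all test functions and also the varying integrands, because both
  the operators and the functions \<open>cphi\<close> converge uniformly on the sphere bundle.
  Projections are left free, so that a fixed base measure and a varying one can both be
  treated.\<close>

lemma stationary_lift_limit:
  assumes f: "f \<in> Diff1_loc M p X" and g: "\<And>k. g k \<in> Diff1_loc M p X"
    and d: "\<And>k. dC1 M p X \<iota> f (g k) < ennreal (1 / real (Suc k))"
    and st: "\<And>k. fun_stationary p sph (cmap (g k)) (\<nu> k)"
  obtains r \<xi> where "strict_mono (r :: nat \<Rightarrow> nat)" "fun_stationary p sph (cmap f) \<xi>"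
    "(\<lambda>k. \<integral>s. cphi (g (r k)) s \<partial>\<nu> (r k)) \<longlonglongrightarrow> (\<integral>s. cphi f s \<partial>\<xi>)"
    "\<And>h::_ \<Rightarrow> real. continuous_on sph h \<Longrightarrow> (\<lambda>k. \<integral>s. h s \<partial>\<nu> (r k)) \<longlonglongrightarrow> (\<integral>s. h s \<partial>\<xi>)"
proof -
  have small: "eventually (\<lambda>k. dC1 M p X \<iota> f (g k) < ennreal \<delta>) sequentially" if "\<delta> > 0" for \<delta> :: real
  proof -
    have "eventually (\<lambda>k. 1 / real (Suc k) < \<delta>) sequentially"
      using order_tendstoD(2)[OF LIMSEQ_Suc[OF lim_1_over_n] that] by simp
    then show ?thesis
    proof eventually_elim
      case (elim k)
      then show ?case using d[of k] ennreal_leI[of "1 / real (Suc k)" \<delta>] by (meson less_imp_le less_le_trans)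
    qed
  qed
  have cT: "continuous_on sph (transfer_op p (cmap q) h)" if "q \<in> Diff1_loc M p X" "continuous_on sph h" for q h
    using random_cocycle.Top_cont[OF cocycle[OF that(1)] that(2)] .
  have uT: "eventually (\<lambda>k. \<forall>s\<in>sph. \<bar>transfer_op p (cmap (g k)) h s - transfer_op p (cmap f) h s\<bar> \<le> e) sequentially"
    if h: "continuous_on sph h" and e: "e > 0" for h e
  proof -
    obtain \<delta> where \<delta>: "\<delta> > 0" "\<And>g s. g \<in> Diff1_loc M p X \<Longrightarrow> dC1 M p X \<iota> f g < ennreal \<delta> \<Longrightarrow> s \<in> sph \<Longrightarrow>
      \<bar>transfer_op p (cmap g) h s - transfer_op p (cmap f) h s\<bar> \<le> e"
      by (rule transfer_op_close[OF f h e], rule that)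
    show ?thesis using small[OF \<delta>(1)] by eventually_elim (use \<delta>(2)[OF g] in blast)
  qed
  obtain r \<xi> where r: "strict_mono (r::nat \<Rightarrow> nat)" "fun_stationary p sph (cmap f) \<xi>"
    "\<And>h::_ \<Rightarrow> real. continuous_on sph h \<Longrightarrow> (\<lambda>k. \<integral>x. h x \<partial>\<nu> (r k)) \<longlonglongrightarrow> (\<integral>x. h x \<partial>\<xi>)"
    by (rule fun_stationary_limit[OF sph_compact st cT[OF g] cT[OF f] uT], assumption+, rule that)
  have b: "\<nu> k \<in> borel_prob_on sph" for k using st unfolding fun_stationary_def by blast
  have cl: "(\<lambda>k. \<integral>s. cphi (g (r k)) s \<partial>\<nu> (r k)) \<longlonglongrightarrow> (\<integral>s. cphi f s \<partial>\<xi>)"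
  proof (rule integral_uniform_limit[OF sph_compact b cphi_cont[OF g] cphi_cont[OF f] _ r(3)[OF cphi_cont[OF f]]])
    fix e :: real assume e: "e > 0"
    obtain \<delta> where \<delta>: "\<delta> > 0" "\<And>g s. g \<in> Diff1_loc M p X \<Longrightarrow> dC1 M p X \<iota> f g < ennreal \<delta> \<Longrightarrow> s \<in> sph \<Longrightarrow> \<bar>cphi g s - cphi f s\<bar> \<le> e"
      by (rule cphi_close[OF f e], rule that)
    have "eventually (\<lambda>k. \<forall>s\<in>sph. \<bar>cphi (g k) s - cphi f s\<bar> \<le> e) sequentially"
      using small[OF \<delta>(1)] by eventually_elim (use \<delta>(2)[OF g] in blast)
    then show "eventually (\<lambda>k. \<forall>s\<in>sph. \<bar>cphi (g (r k)) s - cphi f s\<bar> \<le> e) sequentially"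
      by (rule eventually_subseq[OF r(1)])
  qed
  show ?thesis by (rule that[OF r(1,2) cl r(3)])
qed

end

section \<open>The projectivized tangent bundle\<close>

context atlas_manifold
begin

lemma tvec_scale_in:
  assumes "v \<in> tangent_space M x" shows "(\<lambda>c. r *\<^sub>R v c) \<in> tangent_space M x"
  using tvec_lin_in[OF assms assms, of r 0] by simp

lemma differential_scale:
  assumes h: "diff_at M h x" and v: "v \<in> tangent_space M x"
  shows "differential M h x (\<lambda>c. r *\<^sub>R v c) = (\<lambda>c. r *\<^sub>R differential M h x v c)"
proof -
  obtain c c' where c: "c \<in> charts_at M x" "c' \<in> charts_at M (h x)" using charts_at_ne by blast
  have "differential M h x (\<lambda>c. r *\<^sub>R v c) = coord_tvec M c' (h x) (r *\<^sub>R local_deriv c c' h x (v c))"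
    unfolding differential_eq[OF h tvec_scale_in[OF v] c] linear_scale[OF local_deriv_linear[OF h c]] ..
  also have "\<dots> = (\<lambda>d. r *\<^sub>R coord_tvec M c' (h x) (local_deriv c c' h x (v c)) d)"
    using coord_tvec_lin[OF c(2), of r "local_deriv c c' h x (v c)" 0 0] by simp
  finally show ?thesis unfolding differential_eq[OF h v c] .
qed

end

lemma proj_class_scale:
  assumes "r \<noteq> 0" shows "proj_class (\<lambda>c. r *\<^sub>R v c) = proj_class v"
proof (intro equalityI subsetI)
  fix u assume "u \<in> proj_class (\<lambda>c. r *\<^sub>R v c)"
  then obtain k where "u = (\<lambda>c. k *\<^sub>R (r *\<^sub>R v c))" unfolding proj_class_def by blast
  then have "u = (\<lambda>c. (k * r) *\<^sub>R v c)" by simp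
  then show "u \<in> proj_class v" unfolding proj_class_def by blast
next
  fix u assume "u \<in> proj_class v"
  then obtain k where "u = (\<lambda>c. k *\<^sub>R v c)" unfolding proj_class_def by blast
  then have "u = (\<lambda>c. (k / r) *\<^sub>R (r *\<^sub>R v c))" using assms by simp
  then show "u \<in> proj_class (\<lambda>c. r *\<^sub>R v c)" unfolding proj_class_def by blast
qed

context embedded_mfd
begin

definition to_proj :: "'m \<times> 'r \<Rightarrow> 'm \<times> ('m, 'e) tvec set" where
  "to_proj = (\<lambda>(x, w). (x, proj_class (tvof x w)))"

lemma tvof_scale:
  assumes x: "x \<in> X" and w: "w \<in> fibre x" shows "tvof x (r *\<^sub>R w) = (\<lambda>c. r *\<^sub>R tvof x w c)"
proof -
  note v = tvof_props[OF w]
  have "\<iota> x (\<lambda>c. r *\<^sub>R tvof x w c) = r *\<^sub>R w"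
    using iota_lin[OF x v(1) v(1), of r 0] v(2) by simp
  then show ?thesis using tvof_iota[OF x tvec_scale_in[OF v(1)], of r] by simp
qed

lemma to_proj_image: "to_proj ` sph = proj_bundle M X"
proof (intro equalityI subsetI)
  fix z assume "z \<in> to_proj ` sph"
  then obtain x w where z: "z = (x, proj_class (tvof x w))" "x \<in> X" "w \<in> fibre x" "norm w = 1"
    unfolding to_proj_def sph_def by auto
  have "tnorm M x (tvof x w) = 1" using iota_norm[OF z(2) tvof_props(1)[OF z(3)]] tvof_props(2)[OF z(3)] z(4) by simp
  then show "z \<in> proj_bundle M X" unfolding proj_bundle_def using z tvof_props(1)[OF z(3)] by blast
next
  fix z assume "z \<in> proj_bundle M X"
  then obtain x v where z: "z = (x, proj_class v)" "x \<in> X" "v \<in> tangent_space M x" "tnorm M x v = 1"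
    unfolding proj_bundle_def by blast
  have "(x, \<iota> x v) \<in> sph" unfolding sph_def fibre_def using z iota_norm[OF z(2,3)] by auto
  moreover have "to_proj (x, \<iota> x v) = z" unfolding to_proj_def using z tvof_iota[OF z(2,3)] by simp
  ultimately show "z \<in> to_proj ` sph" by blast
qed

lemma to_proj_in: "s \<in> sph \<Longrightarrow> to_proj s \<in> proj_bundle M X"
  using to_proj_image by blast

lemma to_proj_nemb:
  assumes x: "x \<in> X" and c: "c \<in> charts_at M x" and a: "a \<noteq> 0"
  shows "to_proj (nemb c x a) = (x, proj_class (coord_tvec M c x a))"
proof -
  have n: "inverse (norm (emb c x a)) \<noteq> 0" using emb_zero_iff[OF x c] a by simp
  show ?thesis unfolding nemb_def to_proj_def
    using tvof_scale[OF x emb_in[OF c], of "inverse (norm (emb c x a))" a] proj_class_scale[OF n] tvof_emb[OF x c] by simp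
qed

text \<open>The topology on lines is given by chart coordinates, while measures live on unit
  vectors. Over a chart, reading coordinates and normalizing the embedded vector are continuous in
  the two directions and respect lines, so \<open>to_proj\<close> is a quotient map.\<close>

lemma proj_bundle_open_iff:
  assumes W: "W \<subseteq> proj_bundle M X"
  shows "proj_bundle_open M X W \<longleftrightarrow> openin (top_of_set sph) (sph \<inter> to_proj -` W)"
proof
  assume o: "proj_bundle_open M X W"
  have "openin (top_of_set sph) (sph \<inter> (chart_dom c \<times> UNIV) \<inter> to_proj -` W)" if c: "c \<in> charts M" for c
  proof -
    let ?D = "(chart_dom c \<inter> X) \<times> (-{0::'e})" and ?S = "sph \<inter> (chart_dom c \<times> UNIV)"
    define Wc where "Wc = {(x, a). x \<in> chart_dom c \<inter> X \<and> a \<noteq> 0 \<and> (x, proj_class (coord_tvec M c x a)) \<in> W}"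
    have Wo: "openin (top_of_set ?D) Wc" using o c unfolding proj_bundle_open_def Wc_def by blast
    define k where "k z = (fst z, tvof (fst z) (snd z) c)" for z
    have kc: "continuous_on ?S k"
    proof -
      have "?S \<subseteq> {(x, w) \<in> tbundle. x \<in> chart_dom c}" using sph_bundle by auto
      then have "continuous_on ?S (\<lambda>z. tvof (fst z) (snd z) c)"
        using continuous_on_subset[OF coord_cont[OF c]] by (auto simp: case_prod_beta)
      then show ?thesis unfolding k_def by (intro continuous_intros)
    qed
    have kD: "k ` ?S \<subseteq> ?D"
    proof (rule image_subsetI)
      fix z assume z: "z \<in> ?S"
      obtain x w where zx: "z = (x, w)" by (cases z)
      have "c \<in> charts_at M x" "x \<in> X" "x \<in> chart_dom c" using z zx c unfolding sph_def by (auto simp: chart_at)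
      then show "k z \<in> ?D" using sph_nemb(2)[of x w c] z zx unfolding k_def by auto
    qed
    have "openin (top_of_set ?S) (?S \<inter> k -` Wc)"
      by (rule continuous_openin_preimage[OF kc _ Wo]) (use kD in auto)
    moreover have "?S \<inter> k -` Wc = ?S \<inter> to_proj -` W"
    proof -
      have "k z \<in> Wc \<longleftrightarrow> to_proj z \<in> W" if z: "z \<in> ?S" for z
      proof -
        obtain x w where zx: "z = (x, w)" by (cases z)
        have x: "c \<in> charts_at M x" "x \<in> X" "x \<in> chart_dom c" "w \<in> fibre x" using z zx c unfolding sph_def by (auto simp: chart_at)
        have n: "tvof x w c \<noteq> 0" using sph_nemb(2)[OF _ x(1)] z zx by blast
        have "coord_tvec M c x (tvof x w c) = tvof x w" by (rule tvec_eq_coord[OF x(1) tvof_props(1)[OF x(4)], symmetric])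
        then show ?thesis using x n unfolding zx k_def Wc_def to_proj_def by simp
      qed
      then show ?thesis by blast
    qed
    moreover have "openin (top_of_set sph) ?S"
      using open_Times[OF chart_props(1)[OF c] open_UNIV] by (rule openin_open_Int)
    ultimately show ?thesis using openin_trans by metis
  qed
  then have "openin (top_of_set sph) (\<Union>c\<in>charts M. sph \<inter> (chart_dom c \<times> UNIV) \<inter> to_proj -` W)"
    by (intro openin_Union) blast
  moreover have "(\<Union>c\<in>charts M. sph \<inter> (chart_dom c \<times> UNIV) \<inter> to_proj -` W) = sph \<inter> to_proj -` W"
  proof (intro equalityI subsetI)
    fix z assume z: "z \<in> sph \<inter> to_proj -` W"
    obtain c where "c \<in> charts_at M (fst z)" using charts_at_ne by blast
    then have "c \<in> charts M" "fst z \<in> chart_dom c" by (auto simp: chart_at)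
    then show "z \<in> (\<Union>c\<in>charts M. sph \<inter> (chart_dom c \<times> UNIV) \<inter> to_proj -` W)" using z by (auto simp: mem_Times_iff)
  qed blast
  ultimately show "openin (top_of_set sph) (sph \<inter> to_proj -` W)" by simp
next
  assume o: "openin (top_of_set sph) (sph \<inter> to_proj -` W)"
  show "proj_bundle_open M X W" unfolding proj_bundle_open_def
  proof (intro conjI ballI W)
    fix c assume c: "c \<in> charts M"
    let ?D = "(chart_dom c \<inter> X) \<times> (-{0::'e})"
    have nD: "(\<lambda>(x, a). nemb c x a) ` ?D \<subseteq> sph"
    proof (rule image_subsetI)
      fix z assume "z \<in> ?D"
      then obtain x a where z: "z = (x, a)" "x \<in> chart_dom c" "x \<in> X" "a \<noteq> 0" by auto
      have "c \<in> charts_at M x" using z c by (simp add: chart_at)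
      from nemb_in[OF z(3) this z(4)] show "(\<lambda>(x, a). nemb c x a) z \<in> sph" unfolding z(1) prod.case .
    qed
    have "openin (top_of_set ?D) (?D \<inter> (\<lambda>(x, a). nemb c x a) -` (sph \<inter> to_proj -` W))"
      by (rule continuous_openin_preimage[OF nemb_cont[OF c] _ o]) (use nD in auto)
    moreover have "?D \<inter> (\<lambda>(x, a). nemb c x a) -` (sph \<inter> to_proj -` W)
      = {(x, a). x \<in> chart_dom c \<inter> X \<and> a \<noteq> 0 \<and> (x, proj_class (coord_tvec M c x a)) \<in> W}"
    proof -
      have "(nemb c x a \<in> sph \<and> to_proj (nemb c x a) \<in> W) \<longleftrightarrow> (x, proj_class (coord_tvec M c x a)) \<in> W"
        if "x \<in> chart_dom c" "x \<in> X" "a \<noteq> 0" for x a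
        using nemb_in[of x c a] to_proj_nemb[of x c a] that c by (simp add: chart_at)
      then have "z \<in> ?D \<inter> (\<lambda>(x, a). nemb c x a) -` (sph \<inter> to_proj -` W) \<longleftrightarrow>
          z \<in> {(x, a). x \<in> chart_dom c \<inter> X \<and> a \<noteq> 0 \<and> (x, proj_class (coord_tvec M c x a)) \<in> W}" for z
        by (cases z) (simp add: conj_ac cong: conj_cong)
      then show ?thesis by (rule set_eqI)
    qed
    ultimately show "openin (top_of_set ?D) {(x, a). x \<in> chart_dom c \<inter> X \<and> a \<noteq> 0 \<and> (x, proj_class (coord_tvec M c x a)) \<in> W}" by simp
  qed
qed

lemma proj_bundle_borel_space: "space (proj_bundle_borel M X) = proj_bundle M X"
  unfolding proj_bundle_borel_def by (simp add: space_measure_of_conv)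

lemma proj_bundle_borel_sets:
  "sets (proj_bundle_borel M X) = sigma_sets (proj_bundle M X) {W. proj_bundle_open M X W}"
  unfolding proj_bundle_borel_def by (rule sets_measure_of) (auto simp: proj_bundle_open_def)

lemma openin_sph_sets: "openin (top_of_set sph) A \<Longrightarrow> A \<in> sets (restrict_space borel sph)"
  unfolding openin_open by (auto simp: sets_restrict_space)

lemma to_proj_measurable: "to_proj \<in> restrict_space borel sph \<rightarrow>\<^sub>M proj_bundle_borel M X"
  unfolding proj_bundle_borel_def
proof (rule measurable_measure_of)
  show "{W. proj_bundle_open M X W} \<subseteq> Pow (proj_bundle M X)" by (auto simp: proj_bundle_open_def)
  show "to_proj \<in> space (restrict_space borel sph) \<rightarrow> proj_bundle M X"
    using to_proj_image by (auto simp: space_restrict_space)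
  fix W assume W: "W \<in> {W. proj_bundle_open M X W}"
  then have "openin (top_of_set sph) (sph \<inter> to_proj -` W)"
    using proj_bundle_open_iff unfolding proj_bundle_open_def by blast
  then have "sph \<inter> to_proj -` W \<in> sets (restrict_space borel sph)" by (rule openin_sph_sets)
  then show "to_proj -` W \<inter> space (restrict_space borel sph) \<in> sets (restrict_space borel sph)"
    by (simp add: space_restrict_space Int_commute)
qed

lemma proj_bundle_open_set:
  assumes W: "W \<subseteq> proj_bundle M X" and o: "openin (top_of_set sph) (sph \<inter> to_proj -` W)"
  shows "W \<in> sets (proj_bundle_borel M X)"
  unfolding proj_bundle_borel_sets using proj_bundle_open_iff[OF W] o by (intro sigma_sets.Basic) simp

lemma proj_map_to_proj:
  assumes h: "good h" and s: "s \<in> sph" shows "proj_map M h (to_proj s) = to_proj (smap h s)"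
proof -
  obtain x w where sx: "s = (x, w)" "x \<in> X" "w \<in> fibre x" "norm w = 1" using s unfolding sph_def by auto
  note d = good_diff[OF h, of x]
  have tv: "tvof x w \<in> tangent_space M x" by (rule tvof_props(1)[OF sx(3)])
  have hx: "h x \<in> X" by (rule good_in[OF h sx(2)])
  have im: "differential M h x ` proj_class (tvof x w) = proj_class (differential M h x (tvof x w))"
    unfolding proj_class_def image_image using differential_scale[OF d tv] by simp
  have pf: "push h x w \<in> fibre (h x)" by (rule push_in[OF d sx(3)])
  have tp: "tvof (h x) (push h x w) = differential M h x (tvof x w)"
    unfolding push_def by (rule tvof_iota[OF hx differential_in[OF d tv]])
  have n: "inverse (norm (push h x w)) \<noteq> 0" using sph_norm_push[OF h s] sx by simp
  have "proj_class (tvof (h x) (push h x w /\<^sub>R norm (push h x w))) = proj_class (differential M h x (tvof x w))"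
    unfolding tvof_scale[OF hx pf] tp by (rule proj_class_scale[OF n])
  then show ?thesis unfolding sx to_proj_def smap_def proj_map_def using im by simp
qed

text \<open>Preimages of open sets are computed upstairs, where the normalized derivative map is
  continuous, and transferred by the quotient property.\<close>

lemma proj_map_measurable:
  assumes h: "good h" shows "proj_map M h \<in> proj_bundle_borel M X \<rightarrow>\<^sub>M proj_bundle_borel M X"
proof -
  have "proj_map M h \<in> proj_bundle_borel M X \<rightarrow>\<^sub>M sigma (proj_bundle M X) {W. proj_bundle_open M X W}"
  proof (rule measurable_measure_of)
    show "{W. proj_bundle_open M X W} \<subseteq> Pow (proj_bundle M X)" by (auto simp: proj_bundle_open_def)
    show "proj_map M h \<in> space (proj_bundle_borel M X) \<rightarrow> proj_bundle M X"
    proof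
      fix z assume "z \<in> space (proj_bundle_borel M X)"
      then obtain s where s: "s \<in> sph" "z = to_proj s" using to_proj_image proj_bundle_borel_space by blast
      then show "proj_map M h z \<in> proj_bundle M X"
        using proj_map_to_proj[OF h s(1)] smap_in[OF h s(1)] to_proj_image by auto
    qed
    fix W assume W: "W \<in> {W. proj_bundle_open M X W}"
    then have o: "openin (top_of_set sph) (sph \<inter> to_proj -` W)"
      using proj_bundle_open_iff unfolding proj_bundle_open_def by blast
    have "openin (top_of_set sph) (sph \<inter> smap h -` (sph \<inter> to_proj -` W))"
      by (rule continuous_openin_preimage[OF smap_cont[OF h] _ o]) (use smap_in[OF h] in auto)
    moreover have "sph \<inter> smap h -` (sph \<inter> to_proj -` W) = sph \<inter> to_proj -` (proj_map M h -` W \<inter> proj_bundle M X)"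
    proof -
      have "smap h s \<in> sph \<inter> to_proj -` W \<longleftrightarrow> to_proj s \<in> proj_map M h -` W \<inter> proj_bundle M X" if s: "s \<in> sph" for s
        using proj_map_to_proj[OF h s] smap_in[OF h s] to_proj_in[OF s] by simp
      then show ?thesis by blast
    qed
    ultimately show "proj_map M h -` W \<inter> space (proj_bundle_borel M X) \<in> sets (proj_bundle_borel M X)"
      unfolding proj_bundle_borel_space by (intro proj_bundle_open_set) auto
  qed
  then show ?thesis unfolding proj_bundle_borel_def .
qed

end

context random_embedded
begin

text \<open>The unit vector selected from a line differs from the given one by a factor
  \<open>r\<close> of absolute value 1, which the norm does not see.\<close>

lemma phi_to_proj:
  assumes f: "f \<in> Diff1_loc M p X" and s: "s \<in> sph" shows "phi M p f (to_proj s) = cphi f s"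
proof -
  interpret C: random_cocycle p sph "cmap f" "clog f" "cbound f" by (rule cocycle[OF f])
  obtain x w where sx: "s = (x, w)" "x \<in> X" "w \<in> fibre x" "norm w = 1" using s unfolding sph_def by auto
  let ?Q = "\<lambda>v. v \<in> proj_class (tvof x w) \<and> tnorm M x v = 1"
  define v where "v = (SOME v. ?Q v)"
  have t1: "tnorm M x (tvof x w) = 1" using iota_norm[OF sx(2) tvof_props(1)[OF sx(3)]] tvof_props(2)[OF sx(3)] sx(4) by simp
  have "(\<lambda>c. 1 *\<^sub>R tvof x w c) \<in> proj_class (tvof x w)" unfolding proj_class_def by blast
  then have "?Q (tvof x w)" using t1 by simp
  then have v: "v \<in> proj_class (tvof x w)" "tnorm M x v = 1" unfolding v_def using someI[of ?Q] by blast+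
  obtain r where r: "v = (\<lambda>c. r *\<^sub>R tvof x w c)" using v(1) unfolding proj_class_def by blast
  have vr: "v = tvof x (r *\<^sub>R w)" unfolding r by (rule tvof_scale[OF sx(2,3), symmetric])
  have rf: "r *\<^sub>R w \<in> fibre x" by (rule subspace_scale[OF fibre_subspace[OF sx(2)] sx(3)])
  have "norm (r *\<^sub>R w) = 1" using v(2) iota_norm[OF sx(2) tvof_props(1)[OF rf]] tvof_props(2)[OF rf] vr by simp
  then have ra: "\<bar>r\<bar> = 1" using sx(4) by simp
  have d: "distr P p (\<lambda>\<omega>. \<omega> 0) = p" by (rule distr_PiM_component) (auto intro: prob_space_axioms)
  have m: "(\<lambda>\<omega>. \<omega> 0) \<in> P \<rightarrow>\<^sub>M p" by measurable
  have "phi M p f (to_proj s) = (\<integral>\<omega>. ln (tnorm M (f \<omega> x) (differential M (f \<omega>) x v)) \<partial>completion P)"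
    unfolding sx to_proj_def phi_def v_def by (simp add: Let_def)
  also have "\<dots> = (\<integral>\<omega>. clog f (\<omega> 0) s \<partial>P)"
  proof (rule integral_completion_AE_eq)
    show "(\<lambda>\<omega>. clog f (\<omega> 0) s) \<in> borel_measurable P" by (rule measurable_compose[OF m C.l_meas[OF s]])
    show "AE \<omega> in P. ln (tnorm M (f \<omega> x) (differential M (f \<omega>) x v)) = clog f (\<omega> 0) s"
      using AE_path_coord[OF AE_not_bad[OF f], of 0] AE_space
    proof eventually_elim
      case (elim \<omega>)
      have e: "f \<omega> = one_step f (\<omega> 0)" by (rule one_step_eq[OF f_random[OF f] elim(2)])
      have g: "good (one_step f (\<omega> 0))" by (rule f_good[OF f path_at[OF elim(2)] elim(1)])
      note dd = good_diff[OF g, of x] and gx = good_in[OF g sx(2)]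
      have "tnorm M (one_step f (\<omega> 0) x) (differential M (one_step f (\<omega> 0)) x v) = norm (push (one_step f (\<omega> 0)) x (r *\<^sub>R w))"
        unfolding vr by (rule tnorm_push(1)[OF dd sx(2) gx rf])
      also have "\<dots> = norm (push (one_step f (\<omega> 0)) x w)" unfolding push_scale[OF dd sx(2) gx sx(3)] using ra by simp
      finally show ?case unfolding e using elim(1) sx by (simp add: clog_def slog_def)
    qed
  qed
  also have "\<dots> = (\<integral>t. clog f t s \<partial>p)" using integral_distr[OF m C.l_meas[OF s]] d by simp
  finally show ?thesis unfolding cphi_def .
qed

lemma phi_measurable:
  assumes f: "f \<in> Diff1_loc M p X" shows "phi M p f \<in> borel_measurable (proj_bundle_borel M X)"
proof (rule borel_measurableI)
  fix U :: "real set" assume U: "open U"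
  have "openin (top_of_set sph) (sph \<inter> cphi f -` U)"
    using cphi_cont[OF f] U by (rule continuous_openin_preimage_gen)
  moreover have "sph \<inter> cphi f -` U = sph \<inter> to_proj -` (phi M p f -` U \<inter> proj_bundle M X)"
  proof -
    have "cphi f s \<in> U \<longleftrightarrow> to_proj s \<in> phi M p f -` U \<inter> proj_bundle M X" if s: "s \<in> sph" for s
      using phi_to_proj[OF f s] to_proj_in[OF s] by simp
    then show ?thesis by blast
  qed
  ultimately show "phi M p f -` U \<inter> space (proj_bundle_borel M X) \<in> sets (proj_bundle_borel M X)"
    unfolding proj_bundle_borel_space by (intro proj_bundle_open_set) auto
qed

text \<open>For almost every path \<open>to_proj\<close> intertwines the action on unit vectors with
  the action on lines and leaves base points fixed, so it carries stationarity, the projection and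
  the integral of \<open>phi\<close> along.\<close>

lemma stationary_lift_of_sph:
  assumes f: "f \<in> Diff1_loc M p X" and \<nu>: "fun_stationary p sph (cmap f) \<nu>" and \<mu>: "proj \<nu> = \<mu>" and \<mu>b: "\<mu> \<in> borel_prob_on X"
  shows "distr \<nu> (proj_bundle_borel M X) to_proj \<in> stationary_lifts M p X \<mu> f"
    "(\<integral>z. phi M p f z \<partial>distr \<nu> (proj_bundle_borel M X) to_proj) = (\<integral>s. cphi f s \<partial>\<nu>)"
proof -
  interpret C: random_cocycle p sph "cmap f" "clog f" "cbound f" by (rule cocycle[OF f])
  let ?B = "proj_bundle_borel M X"
  let ?n = "distr \<nu> ?B to_proj"
  have b: "\<nu> \<in> borel_prob_on sph" using \<nu> unfolding fun_stationary_def by blast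
  have sp: "space \<nu> = sph" "sets \<nu> = sets (restrict_space borel sph)" using borel_prob_onD[OF b] by auto
  have qm: "to_proj \<in> \<nu> \<rightarrow>\<^sub>M ?B" using to_proj_measurable measurable_cong_sets[OF sp(2) refl] by auto
  show "(\<integral>z. phi M p f z \<partial>?n) = (\<integral>s. cphi f s \<partial>\<nu>)"
  proof -
    have "(\<integral>z. phi M p f z \<partial>?n) = (\<integral>s. phi M p f (to_proj s) \<partial>\<nu>)" by (rule integral_distr[OF qm phi_measurable[OF f]])
    also have "\<dots> = (\<integral>s. cphi f s \<partial>\<nu>)"
      using phi_to_proj[OF f] sp(1) by (intro Bochner_Integration.integral_cong) auto
    finally show ?thesis .
  qed
  have \<mu>s: "sets \<mu> = sets (restrict_space borel X)" "space \<mu> = X" using borel_prob_onD[OF \<mu>b] by auto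
  have fm: "fst \<in> ?B \<rightarrow>\<^sub>M restrict_space borel X"
  proof (rule measurable_restrict_space2)
    show "fst \<in> space ?B \<rightarrow> X" unfolding proj_bundle_borel_space by (auto simp: proj_bundle_def)
    show "fst \<in> borel_measurable ?B"
    proof (rule borel_measurableI)
      fix V :: "'m set" assume V: "open V"
      have "openin (top_of_set sph) (sph \<inter> (V \<times> UNIV))"
        using open_Times[OF V open_UNIV] by (rule openin_open_Int)
      moreover have "sph \<inter> (V \<times> UNIV) = sph \<inter> to_proj -` (fst -` V \<inter> proj_bundle M X)"
        using to_proj_image by (auto simp: to_proj_def)
      ultimately show "fst -` V \<inter> space ?B \<in> sets ?B"
        unfolding proj_bundle_borel_space by (intro proj_bundle_open_set) auto
    qed
  qed
  have "distr ?n \<mu> fst = distr ?n (restrict_space borel X) fst" by (rule distr_cong) (auto simp: \<mu>s)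
  also have "\<dots> = distr \<nu> (restrict_space borel X) (fst \<circ> to_proj)" by (rule distr_distr[OF fm qm])
  also have "fst \<circ> to_proj = (fst :: 'm \<times> 'r \<Rightarrow> 'm)" by (auto simp: to_proj_def)
  finally have pr: "distr ?n \<mu> fst = \<mu>" using \<mu> unfolding proj_def by simp
  have st: "stationary P (\<lambda>\<omega>. proj_map M (f \<omega>)) ?n" unfolding stationary_def
  proof
    fix A assume "A \<in> sets ?n"
    then have A: "A \<in> sets ?B" by simp
    define A' where "A' = to_proj -` A \<inter> sph"
    have A': "A' \<in> sets \<nu>" using measurable_sets[OF qm A] sp unfolding A'_def by simp
    have "(\<integral>\<^sup>+\<omega>. emeasure (distr ?n ?n (proj_map M (f \<omega>))) A \<partial>P) = (\<integral>\<^sup>+\<omega>. emeasure \<nu> (cmap f (\<omega> 0) -` A' \<inter> sph) \<partial>P)"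
    proof (rule nn_integral_cong_AE)
      show "AE \<omega> in P. emeasure (distr ?n ?n (proj_map M (f \<omega>))) A = emeasure \<nu> (cmap f (\<omega> 0) -` A' \<inter> sph)"
        using AE_path_coord[OF AE_not_bad[OF f], of 0] AE_space
      proof eventually_elim
        case (elim \<omega>)
        have e: "f \<omega> = one_step f (\<omega> 0)" by (rule one_step_eq[OF f_random[OF f] elim(2)])
        have g: "good (f \<omega>)" unfolding e by (rule f_good[OF f path_at[OF elim(2)] elim(1)])
        have pm: "proj_map M (f \<omega>) \<in> ?B \<rightarrow>\<^sub>M ?B" by (rule proj_map_measurable[OF g])
        then have pm': "proj_map M (f \<omega>) \<in> ?n \<rightarrow>\<^sub>M ?n" by simp
        have "emeasure (distr ?n ?n (proj_map M (f \<omega>))) A = emeasure ?n (proj_map M (f \<omega>) -` A \<inter> space ?B)"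
          using A by (subst emeasure_distr[OF pm']) auto
        also have "\<dots> = emeasure \<nu> (to_proj -` (proj_map M (f \<omega>) -` A \<inter> space ?B) \<inter> sph)"
          using emeasure_distr[OF qm measurable_sets[OF pm A]] sp(1) by simp
        also have "to_proj -` (proj_map M (f \<omega>) -` A \<inter> space ?B) \<inter> sph = cmap f (\<omega> 0) -` A' \<inter> sph"
        proof -
          have cm: "cmap f (\<omega> 0) s = smap (f \<omega>) s" for s using elim(1) by (simp add: cmap_def e)
          have "to_proj s \<in> proj_map M (f \<omega>) -` A \<inter> proj_bundle M X \<longleftrightarrow> smap (f \<omega>) s \<in> to_proj -` A \<inter> sph" if s: "s \<in> sph" for s
            using proj_map_to_proj[OF g s] smap_in[OF g s] to_proj_in[OF s] by simp
          then show ?thesis unfolding A'_def proj_bundle_borel_space vimage_def cm by blast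
        qed
        finally show ?case .
      qed
    qed
    also have "\<dots> = (\<integral>\<^sup>+t. emeasure \<nu> (cmap f t -` A' \<inter> sph) \<partial>p)" by (rule C.emeasure_section_path[OF b A'])
    also have "\<dots> = emeasure \<nu> A'" using C.stationary_iff_emeasure[OF b] \<nu> A' by simp
    also have "\<dots> = emeasure ?n A" unfolding A'_def using emeasure_distr[OF qm A] sp(1) by simp
    finally show "emeasure ?n A = (\<integral>\<^sup>+\<omega>. emeasure (distr ?n ?n (proj_map M (f \<omega>))) A \<partial>P)" by simp
  qed
  have "prob_space ?n" by (rule prob_space.prob_space_distr[OF borel_prob_onD(1)[OF b] qm])
  then show "?n \<in> stationary_lifts M p X \<mu> f" unfolding stationary_lifts_def using st pr by simp
qed

text \<open>The passage from the hypothesis, which speaks of measures on lines, to the measures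
  constructed on the sphere bundle.\<close>

lemma quasi_irreducible_integral:
  assumes f: "f \<in> Diff1_loc M p X" and q: "quasi_irreducible M p X f \<mu>"
    and \<nu>: "fun_stationary p sph (cmap f) \<nu>" and \<mu>: "proj \<nu> = \<mu>"
  shows "(\<integral>s. cphi f s \<partial>\<nu>) = lyapunov M p \<mu> f"
proof -
  have \<mu>b: "\<mu> \<in> borel_prob_on X" using q unfolding quasi_irreducible_def stationary_measures_def by blast
  note l = stationary_lift_of_sph[OF f \<nu> \<mu> \<mu>b]
  have "(\<integral>z. phi M p f z \<partial>distr \<nu> (proj_bundle_borel M X) to_proj) = lyapunov M p \<mu> f"
    using q l(1) unfolding quasi_irreducible_def by blast
  then show ?thesis using l(2) by simp
qed

section \<open>Continuity of the exponents\<close>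

lemma not_continuous_at_sequence:
  assumes "\<not> continuous_at_wrt (dC1 M p X \<iota>) S \<Phi> f"
  obtains e g where "e > 0" "\<And>k. g k \<in> S" "\<And>k. dC1 M p X \<iota> f (g k) < ennreal (1 / real (Suc k))" "\<And>k. e \<le> \<bar>\<Phi> (g k) - \<Phi> f\<bar>"
proof -
  obtain e where e: "e > 0" "\<And>\<delta>. \<delta> > 0 \<Longrightarrow> \<exists>g\<in>S. dC1 M p X \<iota> f g < ennreal \<delta> \<and> e \<le> \<bar>\<Phi> g - \<Phi> f\<bar>"
    using assms unfolding continuous_at_wrt_def not_all not_ex not_imp by (meson not_less)
  have "\<forall>k. \<exists>g. g \<in> S \<and> dC1 M p X \<iota> f g < ennreal (1 / real (Suc k)) \<and> e \<le> \<bar>\<Phi> g - \<Phi> f\<bar>"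
  proof
    fix k
    have "1 / real (Suc k) > 0" by simp
    from e(2)[OF this] show "\<exists>g. g \<in> S \<and> dC1 M p X \<iota> f g < ennreal (1 / real (Suc k)) \<and> e \<le> \<bar>\<Phi> g - \<Phi> f\<bar>" by blast
  qed
  from choice[OF this] obtain g where g: "\<forall>k. g k \<in> S \<and> dC1 M p X \<iota> f (g k) < ennreal (1 / real (Suc k)) \<and> e \<le> \<bar>\<Phi> (g k) - \<Phi> f\<bar>" ..
  show ?thesis
  proof (rule that[OF e(1)])
    show "g k \<in> S" for k using g by blast
    show "dC1 M p X \<iota> f (g k) < ennreal (1 / real (Suc k))" for k using g by blast
    show "e \<le> \<bar>\<Phi> (g k) - \<Phi> f\<bar>" for k using g by blast
  qed
qed

text \<open>Both semicontinuities come at once: for an almost optimal lift the integral for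
  \<open>g k\<close> is within \<open>e / 3\<close> of the exponent of \<open>g k\<close>, and along
  a subsequence it tends to the integral of a lift for \<open>f\<close>, which can only be the
  exponent of \<open>f\<close>. So some exponent of \<open>g k\<close> is closer than
  \<open>e\<close> to that of \<open>f\<close>.\<close>

lemma lyapunov_continuous:
  assumes f: "f \<in> Diff1_loc_stat M p X \<mu>" and q: "quasi_irreducible M p X f \<mu>"
  shows "continuous_at_wrt (dC1 M p X \<iota>) (Diff1_loc_stat M p X \<mu>) (lyapunov M p \<mu>) f"
proof (rule ccontr)
  assume n: "\<not> ?thesis"
  obtain e g where g: "e > 0" "\<And>k. g k \<in> Diff1_loc_stat M p X \<mu>"
    "\<And>k. dC1 M p X \<iota> f (g k) < ennreal (1 / real (Suc k))" "\<And>k. e \<le> \<bar>lyapunov M p \<mu> (g k) - lyapunov M p \<mu> f\<bar>"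
    by (rule not_continuous_at_sequence[OF n], rule that)
  have fd: "f \<in> Diff1_loc M p X" using f unfolding Diff1_loc_stat_def by blast
  have gd: "g k \<in> Diff1_loc M p X" "\<mu> \<in> stationary_measures p X (g k)" for k using g(2)[of k] unfolding Diff1_loc_stat_def by auto
  have e3: "e / 3 > 0" using g(1) by simp
  have "\<forall>k. \<exists>\<nu>. fun_stationary p sph (cmap (g k)) \<nu> \<and> proj \<nu> = \<mu> \<and> lyapunov M p \<mu> (g k) - e / 3 \<le> (\<integral>s. cphi (g k) s \<partial>\<nu>)"
    using lyapunov_variational(2)[OF gd e3] by blast
  from choice[OF this] obtain \<nu> where "\<forall>k. fun_stationary p sph (cmap (g k)) (\<nu> k) \<and> proj (\<nu> k) = \<mu> \<and> lyapunov M p \<mu> (g k) - e / 3 \<le> (\<integral>s. cphi (g k) s \<partial>\<nu> k)" ..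
  then have \<nu>: "\<And>k. fun_stationary p sph (cmap (g k)) (\<nu> k)" "\<And>k. proj (\<nu> k) = \<mu>"
    "\<And>k. lyapunov M p \<mu> (g k) - e / 3 \<le> (\<integral>s. cphi (g k) s \<partial>\<nu> k)" by blast+
  have up: "(\<integral>s. cphi (g k) s \<partial>\<nu> k) \<le> lyapunov M p \<mu> (g k)" for k by (rule lyapunov_variational(1)[OF gd \<nu>(1,2)])
  obtain r \<xi> where r: "strict_mono (r :: nat \<Rightarrow> nat)" "fun_stationary p sph (cmap f) \<xi>"
    "(\<lambda>k. \<integral>s. cphi (g (r k)) s \<partial>\<nu> (r k)) \<longlonglongrightarrow> (\<integral>s. cphi f s \<partial>\<xi>)"
    "\<And>h::_ \<Rightarrow> real. continuous_on sph h \<Longrightarrow> (\<lambda>k. \<integral>s. h s \<partial>\<nu> (r k)) \<longlonglongrightarrow> (\<integral>s. h s \<partial>\<xi>)"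
    by (rule stationary_lift_limit[OF fd gd(1) g(3) \<nu>(1)], rule that)
  have \<mu>b: "\<mu> \<in> borel_prob_on X" using gd(2)[of 0] unfolding stationary_measures_def by blast
  have \<xi>b: "\<xi> \<in> borel_prob_on sph" using r(2) unfolding fun_stationary_def by blast
  have \<nu>b: "\<nu> k \<in> borel_prob_on sph" for k using \<nu>(1)[of k] unfolding fun_stationary_def by blast
  \<comment> \<open>The measure \<open>\<mu>\<close> is stationary for every perturbation, all
    chosen lifts project to it, and weak limits preserve the projection; so quasi-irreducibility of
    \<open>\<mu>\<close> applies to the limit.\<close>
  have "proj \<xi> = \<mu>"
  proof (rule borel_prob_eqI[OF X_compact proj_prob[OF \<xi>b] \<mu>b])
    fix a :: "'m \<Rightarrow> real" assume a: "continuous_on X a"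
    note am = borel_measurable_continuous_on_restrict[OF a]
    have "(\<lambda>k. \<integral>s. a (fst s) \<partial>\<nu> (r k)) = (\<lambda>k. \<integral>x. a x \<partial>\<mu>)"
      using integral_proj[OF \<nu>b am] \<nu>(2) by simp
    then have "(\<integral>s. a (fst s) \<partial>\<xi>) = (\<integral>x. a x \<partial>\<mu>)"
      using r(4)[OF fst_comp_cont[OF a]] by (simp add: LIMSEQ_const_iff)
    then show "(\<integral>x. a x \<partial>proj \<xi>) = (\<integral>x. a x \<partial>\<mu>)" using integral_proj[OF \<xi>b am] by simp
  qed
  from quasi_irreducible_integral[OF fd q r(2) this]
  have "(\<lambda>k. \<integral>s. cphi (g (r k)) s \<partial>\<nu> (r k)) \<longlonglongrightarrow> lyapunov M p \<mu> f" using r(3) by simp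
  from tendstoD[OF this e3] obtain k where "dist (\<integral>s. cphi (g (r k)) s \<partial>\<nu> (r k)) (lyapunov M p \<mu> f) < e / 3"
    unfolding eventually_sequentially by blast
  then show False using \<nu>(3)[of "r k"] up[of "r k"] g(4)[of "r k"] g(1) unfolding dist_real_def by linarith
qed

text \<open>The stationary measures of the perturbations vary, so the limit projects to some
  stationary measure of \<open>f\<close> that is not prescribed. Maximality gives every such measure
  the same value, the top exponent of \<open>f\<close>.\<close>

lemma top_lyapunov_continuous:
  assumes f: "f \<in> Diff1_loc M p X" and q: "maximal_quasi_irreducible M p X f"
  shows "continuous_at_wrt (dC1 M p X \<iota>) (Diff1_loc M p X) (top_lyapunov M p X) f"
proof (rule ccontr)
  assume n: "\<not> ?thesis"
  obtain e g where g: "e > 0" "\<And>k. g k \<in> Diff1_loc M p X"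
    "\<And>k. dC1 M p X \<iota> f (g k) < ennreal (1 / real (Suc k))" "\<And>k. e \<le> \<bar>top_lyapunov M p X (g k) - top_lyapunov M p X f\<bar>"
    by (rule not_continuous_at_sequence[OF n], rule that)
  have e3: "e / 3 > 0" using g(1) by simp
  \<comment> \<open>One third of \<open>e\<close> is spent on a nearly optimal stationary measure,
    one on a nearly optimal lift of it; the last third is left for the limit.\<close>
  have "\<exists>\<nu>. fun_stationary p sph (cmap h) \<nu> \<and> top_lyapunov M p X h - 2 * (e / 3) \<le> (\<integral>s. cphi h s \<partial>\<nu>) \<and> (\<integral>s. cphi h s \<partial>\<nu>) \<le> top_lyapunov M p X h"
    if h: "h \<in> Diff1_loc M p X" for h
  proof -
    let ?I = "stationary_measures p X h"
    obtain \<nu>0 where "fun_stationary p sph (cmap h) \<nu>0" using stationary_exists[OF h] by blast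
    then have ne: "?I \<noteq> {}" using proj_stationary[OF h] by blast
    have bd: "bdd_above ((\<lambda>\<eta>. lyapunov M p \<eta> h) ` ?I)" using lyapunov_bounded[OF h] by (rule bdd_aboveI2)
    have "top_lyapunov M p X h - e / 3 < (SUP \<eta>\<in>?I. lyapunov M p \<eta> h)" unfolding top_lyapunov_def using e3 by simp
    then obtain \<eta> where \<eta>: "\<eta> \<in> ?I" "top_lyapunov M p X h - e / 3 < lyapunov M p \<eta> h" using less_cSUP_iff[OF ne bd] by blast
    obtain \<nu> where n: "fun_stationary p sph (cmap h) \<nu>" "proj \<nu> = \<eta>" "lyapunov M p \<eta> h - e / 3 \<le> (\<integral>s. cphi h s \<partial>\<nu>)"
      using lyapunov_variational(2)[OF h \<eta>(1) e3] by blast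
    have "(\<integral>s. cphi h s \<partial>\<nu>) \<le> lyapunov M p \<eta> h" by (rule lyapunov_variational(1)[OF h \<eta>(1) n(1,2)])
    also have "\<dots> \<le> top_lyapunov M p X h" unfolding top_lyapunov_def by (rule cSUP_upper[OF \<eta>(1) bd])
    finally have "(\<integral>s. cphi h s \<partial>\<nu>) \<le> top_lyapunov M p X h" .
    moreover have "top_lyapunov M p X h - 2 * (e / 3) \<le> (\<integral>s. cphi h s \<partial>\<nu>)" using \<eta>(2) n(3) by linarith
    ultimately show ?thesis using n(1) by blast
  qed
  then have "\<forall>k. \<exists>\<nu>. fun_stationary p sph (cmap (g k)) \<nu> \<and> top_lyapunov M p X (g k) - 2 * (e / 3) \<le> (\<integral>s. cphi (g k) s \<partial>\<nu>)
     \<and> (\<integral>s. cphi (g k) s \<partial>\<nu>) \<le> top_lyapunov M p X (g k)" using g(2) by blast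
  from choice[OF this] obtain \<nu> where "\<forall>k. fun_stationary p sph (cmap (g k)) (\<nu> k) \<and> top_lyapunov M p X (g k) - 2 * (e / 3) \<le> (\<integral>s. cphi (g k) s \<partial>\<nu> k)
     \<and> (\<integral>s. cphi (g k) s \<partial>\<nu> k) \<le> top_lyapunov M p X (g k)" ..
  then have \<nu>: "\<And>k. fun_stationary p sph (cmap (g k)) (\<nu> k)" "\<And>k. top_lyapunov M p X (g k) - 2 * (e / 3) \<le> (\<integral>s. cphi (g k) s \<partial>\<nu> k)"
     "\<And>k. (\<integral>s. cphi (g k) s \<partial>\<nu> k) \<le> top_lyapunov M p X (g k)" by blast+
  obtain r \<xi> where r: "strict_mono (r :: nat \<Rightarrow> nat)" "fun_stationary p sph (cmap f) \<xi>"
    "(\<lambda>k. \<integral>s. cphi (g (r k)) s \<partial>\<nu> (r k)) \<longlonglongrightarrow> (\<integral>s. cphi f s \<partial>\<xi>)"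
    "\<And>h::_ \<Rightarrow> real. continuous_on sph h \<Longrightarrow> (\<lambda>k. \<integral>s. h s \<partial>\<nu> (r k)) \<longlonglongrightarrow> (\<integral>s. h s \<partial>\<xi>)"
    by (rule stationary_lift_limit[OF f g(2,3) \<nu>(1)], rule that)
  have \<eta>: "proj \<xi> \<in> stationary_measures p X f" by (rule proj_stationary[OF f r(2)])
  have qi: "quasi_irreducible M p X f (proj \<xi>)" "lyapunov M p (proj \<xi>) f = top_lyapunov M p X f"
    using q \<eta> unfolding maximal_quasi_irreducible_def by blast+
  have "(\<integral>s. cphi f s \<partial>\<xi>) = top_lyapunov M p X f"
    using quasi_irreducible_integral[OF f qi(1) r(2) refl] qi(2) by simp
  then have "(\<lambda>k. \<integral>s. cphi (g (r k)) s \<partial>\<nu> (r k)) \<longlonglongrightarrow> top_lyapunov M p X f" using r(3) by simp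
  from tendstoD[OF this e3] obtain k where "dist (\<integral>s. cphi (g (r k)) s \<partial>\<nu> (r k)) (top_lyapunov M p X f) < e / 3"
    unfolding eventually_sequentially by blast
  then show False using \<nu>(2,3)[of "r k"] g(4)[of "r k"] g(1) unfolding dist_real_def by linarith
qed

end

lemma borel_prob_on_empty: "borel_prob_on {} = ({} :: 'm::topological_space measure set)"
proof -
  have False if m: "\<mu> \<in> borel_prob_on ({} :: 'm set)" for \<mu>
    using prob_space.not_empty[OF borel_prob_onD(1)[OF m]] borel_prob_onD(3)[OF m] by simp
  then show ?thesis by blast
qed

theorem theorem3:
  fixes M :: "('m::{t2_space,second_countable_topology}, 'e::euclidean_space) riemannian"
    and p :: "'t measure"
    and X :: "'m set"
    and \<iota> :: "'m \<Rightarrow> ('m, 'e) tvec \<Rightarrow> 'r::euclidean_space"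
  assumes "riemannian_manifold M"
    and "prob_space p"
    and "compact X"
    and "tangent_embedding M X \<iota>"
  shows "(\<forall>\<mu>\<in>borel_prob_on X. \<forall>f\<in>Diff1_loc_stat M p X \<mu>. quasi_irreducible M p X f \<mu> \<longrightarrow>
            continuous_at_wrt (dC1 M p X \<iota>) (Diff1_loc_stat M p X \<mu>) (lyapunov M p \<mu>) f) \<and>
         (\<forall>f\<in>Diff1_loc M p X. maximal_quasi_irreducible M p X f \<longrightarrow>
            continuous_at_wrt (dC1 M p X \<iota>) (Diff1_loc M p X) (top_lyapunov M p X) f)"
proof (cases "X = {}")
  case True
  \<comment> \<open>Over the empty set there are no stationary measures, and the supremum of the
    empty set of reals is one fixed value for all random maps, so the difference cancels.\<close>
  have t: "top_lyapunov M p X g - top_lyapunov M p X f = 0" for f g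
    unfolding top_lyapunov_def stationary_measures_def True borel_prob_on_empty by simp
  have "continuous_at_wrt (dC1 M p X \<iota>) (Diff1_loc M p X) (top_lyapunov M p X) f" for f
    unfolding continuous_at_wrt_def t by (intro allI impI exI[of _ 1] conjI ballI) simp_all
  then show ?thesis using borel_prob_on_empty True by auto
next
  case False
  interpret prob_space p by fact
  interpret random_embedded M X \<iota> p
    by unfold_locales (use assms False in auto)
  show ?thesis using lyapunov_continuous top_lyapunov_continuous by blast
qed

end
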